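(* Let $K_1, K_2$ be two infinite compact Hausdorff spaces. Then $C(K_1)\hat{\otimes} C(K_2)$ has the Dunford-Pettis Property if and only if both $K_1$ and $K_2$ are scattered.
   Context: $C(K)$ denotes the Banach space (sup norm) of continuous scalar-valued functions on a compact Hausdorff space $K$, the scalar field $\mathbb{K}$ being $\mathbb{R}$ or $\mathbb{C}$. $E_1\hat{\otimes}E_2$ denotes the (completed) projective tensor product of the Banach spaces $E_1,E_2$. All operators are linear and continuous. An operator between Banach spaces is weakly compact if it maps bounded sets to relatively weakly compact sets, and completely continuous if it maps weakly convergent sequences to norm convergent sequences. A Banach space $E$ has the Dunford-Pettis Property (DPP) if, for every Banach space $F$, every weakly compact operator from $E$ into $F$ is completely continuous. A topological space is scattered if every nonempty subset has an isolated point in its relative topology. *)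

theory Defs
  imports "HOL-Analysis.Analysis" "HOL-Library.Poly_Mapping"
begin

section \<open>Normed spaces with explicit carrier\<close>

text \<open>
  The Dunford-Pettis property quantifies over all Banach spaces \<open>F\<close>, and the scalar field may be
  the reals or the complex numbers. Type classes offer neither, so normed spaces are records over a
  scalar type \<open>'k\<close>, used below for \<open>'k = real\<close> and \<open>'k = complex\<close>.
\<close>

record ('k, 'e) nspace =
  vs_carrier :: "'e set"
  vs_add :: "'e \<Rightarrow> 'e \<Rightarrow> 'e"
  vs_zero :: "'e"
  vs_scale :: "'k \<Rightarrow> 'e \<Rightarrow> 'e"
  vs_norm :: "'e \<Rightarrow> real"

definition vs_diff :: "('k::real_normed_field, 'e) nspace \<Rightarrow> 'e \<Rightarrow> 'e \<Rightarrow> 'e" where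
  "vs_diff V x y = vs_add V x (vs_scale V (-1) y)"

text \<open>The locale \<^locale>\<open>Metric_space\<close> wants a function that is nonnegative and symmetric
  everywhere, hence the value 0 outside the carrier.\<close>

definition vs_dist :: "('k::real_normed_field, 'e) nspace \<Rightarrow> 'e \<Rightarrow> 'e \<Rightarrow> real" where
  "vs_dist V x y =
     (if x \<in> vs_carrier V \<and> y \<in> vs_carrier V then vs_norm V (vs_diff V x y) else 0)"

locale normed_space =
  fixes V :: "('k::real_normed_field, 'e) nspace"
  assumes zero_closed: "vs_zero V \<in> vs_carrier V"
    and add_closed: "\<lbrakk>x \<in> vs_carrier V; y \<in> vs_carrier V\<rbrakk> \<Longrightarrow> vs_add V x y \<in> vs_carrier V"
    and scale_closed: "x \<in> vs_carrier V \<Longrightarrow> vs_scale V c x \<in> vs_carrier V"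
    and add_assoc: "\<lbrakk>x \<in> vs_carrier V; y \<in> vs_carrier V; z \<in> vs_carrier V\<rbrakk>
      \<Longrightarrow> vs_add V (vs_add V x y) z = vs_add V x (vs_add V y z)"
    and add_commute: "\<lbrakk>x \<in> vs_carrier V; y \<in> vs_carrier V\<rbrakk> \<Longrightarrow> vs_add V x y = vs_add V y x"
    and add_zero: "x \<in> vs_carrier V \<Longrightarrow> vs_add V x (vs_zero V) = x"
    and diff_self: "x \<in> vs_carrier V \<Longrightarrow> vs_diff V x x = vs_zero V"
    and scale_one: "x \<in> vs_carrier V \<Longrightarrow> vs_scale V 1 x = x"
    and scale_scale: "x \<in> vs_carrier V \<Longrightarrow> vs_scale V a (vs_scale V b x) = vs_scale V (a * b) x"
    and scale_left_distrib: "x \<in> vs_carrier V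
      \<Longrightarrow> vs_scale V (a + b) x = vs_add V (vs_scale V a x) (vs_scale V b x)"
    and scale_right_distrib: "\<lbrakk>x \<in> vs_carrier V; y \<in> vs_carrier V\<rbrakk>
      \<Longrightarrow> vs_scale V a (vs_add V x y) = vs_add V (vs_scale V a x) (vs_scale V a y)"
    and norm_nonneg: "x \<in> vs_carrier V \<Longrightarrow> 0 \<le> vs_norm V x"
    and norm_eq_zero: "x \<in> vs_carrier V \<Longrightarrow> vs_norm V x = 0 \<longleftrightarrow> x = vs_zero V"
    and norm_scale: "x \<in> vs_carrier V \<Longrightarrow> vs_norm V (vs_scale V a x) = norm a * vs_norm V x"
    and norm_triangle: "\<lbrakk>x \<in> vs_carrier V; y \<in> vs_carrier V\<rbrakk>
      \<Longrightarrow> vs_norm V (vs_add V x y) \<le> vs_norm V x + vs_norm V y"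

definition banach_space :: "('k::real_normed_field, 'e) nspace \<Rightarrow> bool" where
  "banach_space V \<longleftrightarrow> normed_space V \<and> Metric_space.mcomplete (vs_carrier V) (vs_dist V)"

definition norm_topology :: "('k::real_normed_field, 'e) nspace \<Rightarrow> 'e topology" where
  "norm_topology V = Metric_space.mtopology (vs_carrier V) (vs_dist V)"

definition scalar_space :: "('k::real_normed_field, 'k) nspace" where
  "scalar_space = \<lparr>vs_carrier = UNIV, vs_add = (+), vs_zero = 0, vs_scale = (*), vs_norm = norm\<rparr>"


section \<open>Operators, weak topology and the Dunford-Pettis property\<close>

definition operators ::
    "('k::real_normed_field, 'e) nspace \<Rightarrow> ('k, 'f) nspace \<Rightarrow> ('e \<Rightarrow> 'f) set" where
  "operators V W = {T. T ` vs_carrier V \<subseteq> vs_carrier W \<and>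
     (\<forall>x\<in>vs_carrier V. \<forall>y\<in>vs_carrier V. T (vs_add V x y) = vs_add W (T x) (T y)) \<and>
     (\<forall>c. \<forall>x\<in>vs_carrier V. T (vs_scale V c x) = vs_scale W c (T x)) \<and>
     continuous_map (norm_topology V) (norm_topology W) T}"

definition weak_topology :: "('k::real_normed_field, 'e) nspace \<Rightarrow> 'e topology" where
  "weak_topology V = topology_generated_by
     {{x \<in> vs_carrier V. \<phi> x \<in> U} | \<phi> U. \<phi> \<in> operators V scalar_space \<and> open U}"

definition norm_bounded :: "('k::real_normed_field, 'e) nspace \<Rightarrow> 'e set \<Rightarrow> bool" where
  "norm_bounded V B \<longleftrightarrow> B \<subseteq> vs_carrier V \<and> (\<exists>C. \<forall>x\<in>B. vs_norm V x \<le> C)"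

definition weakly_compact_operator ::
    "('k::real_normed_field, 'e) nspace \<Rightarrow> ('k, 'f) nspace \<Rightarrow> ('e \<Rightarrow> 'f) \<Rightarrow> bool" where
  "weakly_compact_operator V W T \<longleftrightarrow> T \<in> operators V W \<and>
     (\<forall>B. norm_bounded V B \<longrightarrow> compactin (weak_topology W) (weak_topology W closure_of (T ` B)))"

definition completely_continuous_operator ::
    "('k::real_normed_field, 'e) nspace \<Rightarrow> ('k, 'f) nspace \<Rightarrow> ('e \<Rightarrow> 'f) \<Rightarrow> bool" where
  "completely_continuous_operator V W T \<longleftrightarrow> T \<in> operators V W \<and>
     (\<forall>s. range s \<subseteq> vs_carrier V \<and> (\<exists>l. limitin (weak_topology V) s l sequentially) \<longrightarrow>
        (\<exists>m. limitin (norm_topology W) (T \<circ> s) m sequentially))"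

text \<open>
  HOL cannot quantify over types inside a formula, so \<open>F\<close> ranges over the Banach spaces whose
  carrier lies in \<open>'e + 'u\<close>, where \<open>'e\<close> is the element type of \<open>E\<close> and \<open>'u\<close> is a parameter. Leaving
  \<open>'u\<close> arbitrary in a theorem covers a Banach space \<open>F\<close> on any type. For a Banach space \<open>E\<close> the
  truth value does not depend on \<open>'u\<close>: an operator \<open>T\<close> on \<open>E\<close> may be corestricted to the closure of
  its range without changing weak compactness or complete continuity, and this closure has at most
  the cardinality of \<open>E\<close>, hence is isometric to a Banach space carried by a subset of \<open>'e\<close>.
\<close>

definition dunford_pettis_property ::
    "'u itself \<Rightarrow> ('k::real_normed_field, 'e) nspace \<Rightarrow> bool" where
  "dunford_pettis_property (_ :: 'u itself) E \<longleftrightarrow>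
     (\<forall>(F :: ('k, 'e + 'u) nspace) T. banach_space F \<and> weakly_compact_operator E F T
        \<longrightarrow> completely_continuous_operator E F T)"


section \<open>Spaces of continuous functions, scattered spaces\<close>

text \<open>The norm is the intended one when \<open>K\<close> is compact and nonempty.\<close>

definition C_space :: "'a topology \<Rightarrow> ('k::real_normed_field, 'a \<Rightarrow> 'k) nspace" where
  "C_space K = \<lparr>
     vs_carrier = {f \<in> extensional (topspace K). continuous_map K euclidean f},
     vs_add = (\<lambda>f g. \<lambda>x\<in>topspace K. f x + g x),
     vs_zero = (\<lambda>x\<in>topspace K. 0),
     vs_scale = (\<lambda>c f. \<lambda>x\<in>topspace K. c * f x),
     vs_norm = (\<lambda>f. SUP x\<in>topspace K. norm (f x))\<rparr>"

definition scattered_space :: "'a topology \<Rightarrow> bool" where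
  "scattered_space K \<longleftrightarrow>
     (\<forall>S. S \<subseteq> topspace K \<and> S \<noteq> {} \<longrightarrow> (\<exists>x\<in>S. openin (subtopology K S) {x}))"


section \<open>The completed projective tensor product\<close>

text \<open>
  The free vector space on a set of pairs consists of the finitely supported functions
  \<^typ>\<open>('e \<times> 'f) \<Rightarrow>\<^sub>0 'k\<close>. The algebraic tensor product is its quotient by the span of the
  bilinearity relations, so that its elements are cosets, and \<open>x \<otimes> y\<close> is the coset of
  \<open>Poly_Mapping.single (x, y) 1\<close>.
\<close>

definition free_scale :: "'k::field \<Rightarrow> ('b \<Rightarrow>\<^sub>0 'k) \<Rightarrow> ('b \<Rightarrow>\<^sub>0 'k)" where
  "free_scale c = Poly_Mapping.map (\<lambda>a. c * a)"

lemma lookup_free_scale: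
  "Poly_Mapping.lookup (free_scale c u) p = c * Poly_Mapping.lookup u p"
  unfolding free_scale_def by transfer (auto simp: when_def)

lemma vector_space_free_scale:
  "vector_space (free_scale :: 'k::field \<Rightarrow> ('b \<Rightarrow>\<^sub>0 'k) \<Rightarrow> ('b \<Rightarrow>\<^sub>0 'k))"
  by unfold_locales
    (auto intro!: poly_mapping_eqI simp: lookup_free_scale lookup_add algebra_simps)

definition free_carrier ::
    "('k::real_normed_field, 'e) nspace \<Rightarrow> ('k, 'f) nspace \<Rightarrow> (('e \<times> 'f) \<Rightarrow>\<^sub>0 'k) set" where
  "free_carrier V W = {u. Poly_Mapping.keys u \<subseteq> vs_carrier V \<times> vs_carrier W}"

definition bilinear_relations ::
    "('k::real_normed_field, 'e) nspace \<Rightarrow> ('k, 'f) nspace \<Rightarrow> (('e \<times> 'f) \<Rightarrow>\<^sub>0 'k) set" where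
  "bilinear_relations V W =
     {Poly_Mapping.single (vs_add V x x', y) 1
        - Poly_Mapping.single (x, y) 1 - Poly_Mapping.single (x', y) 1 | x x' y.
        x \<in> vs_carrier V \<and> x' \<in> vs_carrier V \<and> y \<in> vs_carrier W} \<union>
     {Poly_Mapping.single (x, vs_add W y y') 1
        - Poly_Mapping.single (x, y) 1 - Poly_Mapping.single (x, y') 1 | x y y'.
        x \<in> vs_carrier V \<and> y \<in> vs_carrier W \<and> y' \<in> vs_carrier W} \<union>
     {Poly_Mapping.single (vs_scale V c x, y) 1 - Poly_Mapping.single (x, y) c | c x y.
        x \<in> vs_carrier V \<and> y \<in> vs_carrier W} \<union>
     {Poly_Mapping.single (x, vs_scale W c y) 1 - Poly_Mapping.single (x, y) c | c x y.
        x \<in> vs_carrier V \<and> y \<in> vs_carrier W}"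

definition tensor_rel ::
    "('k::real_normed_field, 'e) nspace \<Rightarrow> ('k, 'f) nspace \<Rightarrow> (('e \<times> 'f) \<Rightarrow>\<^sub>0 'k) rel" where
  "tensor_rel V W = {(u, v). u \<in> free_carrier V W \<and> v \<in> free_carrier V W \<and>
     u - v \<in> module.span free_scale (bilinear_relations V W)}"

text \<open>The projective norm of a coset is the infimum of \<open>\<Sum>\<^sub>i \<parallel>x\<^sub>i\<parallel> \<parallel>y\<^sub>i\<parallel>\<close> over its
  representations \<open>\<Sum>\<^sub>i x\<^sub>i \<otimes> y\<^sub>i\<close>.\<close>

definition projective_norm :: "('k::real_normed_field, 'e) nspace \<Rightarrow> ('k, 'f) nspace \<Rightarrow>
    (('e \<times> 'f) \<Rightarrow>\<^sub>0 'k) set \<Rightarrow> real" where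
  "projective_norm V W A =
     Inf {(\<Sum>i<n. vs_norm V (x i) * vs_norm W (y i)) | (n::nat) x y.
       (\<forall>i<n. x i \<in> vs_carrier V \<and> y i \<in> vs_carrier W) \<and>
       (\<Sum>i<n. Poly_Mapping.single (x i, y i) 1) \<in> A}"

definition algebraic_tensor :: "('k::real_normed_field, 'e) nspace \<Rightarrow> ('k, 'f) nspace \<Rightarrow>
    ('k, (('e \<times> 'f) \<Rightarrow>\<^sub>0 'k) set) nspace" where
  "algebraic_tensor V W = \<lparr>
     vs_carrier = free_carrier V W // tensor_rel V W,
     vs_add = (\<lambda>A B. \<Union>u\<in>A. \<Union>v\<in>B. tensor_rel V W `` {u + v}),
     vs_zero = tensor_rel V W `` {0},
     vs_scale = (\<lambda>c A. \<Union>u\<in>A. tensor_rel V W `` {free_scale c u}),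
     vs_norm = projective_norm V W\<rparr>"

text \<open>Completion by Cauchy sequences modulo null sequences.\<close>

definition cauchy_seqs :: "('k::real_normed_field, 'e) nspace \<Rightarrow> (nat \<Rightarrow> 'e) set" where
  "cauchy_seqs V = {s. Metric_space.MCauchy (vs_carrier V) (vs_dist V) s}"

definition null_rel :: "('k::real_normed_field, 'e) nspace \<Rightarrow> (nat \<Rightarrow> 'e) rel" where
  "null_rel V = {(s, t). s \<in> cauchy_seqs V \<and> t \<in> cauchy_seqs V \<and>
     (\<lambda>n. vs_dist V (s n) (t n)) \<longlonglongrightarrow> 0}"

definition completion_space ::
    "('k::real_normed_field, 'e) nspace \<Rightarrow> ('k, (nat \<Rightarrow> 'e) set) nspace" where
  "completion_space V = \<lparr>
     vs_carrier = cauchy_seqs V // null_rel V,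
     vs_add = (\<lambda>A B. \<Union>s\<in>A. \<Union>t\<in>B. null_rel V `` {\<lambda>n. vs_add V (s n) (t n)}),
     vs_zero = null_rel V `` {\<lambda>n. vs_zero V},
     vs_scale = (\<lambda>c A. \<Union>s\<in>A. null_rel V `` {\<lambda>n. vs_scale V c (s n)}),
     vs_norm = (\<lambda>A. THE r. \<forall>s\<in>A. (\<lambda>n. vs_norm V (s n)) \<longlonglongrightarrow> r)\<rparr>"

definition projective_tensor :: "('k::real_normed_field, 'e) nspace \<Rightarrow> ('k, 'f) nspace \<Rightarrow>
    ('k, (nat \<Rightarrow> (('e \<times> 'f) \<Rightarrow>\<^sub>0 'k) set) set) nspace" where
  "projective_tensor V W = completion_space (algebraic_tensor V W)"

end

(* Scattered spaces give the property. If T is weakly compact on the tensor product, then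
   N(f, g) = |T (f \<otimes> g)| tends to 0 along tensors f_n \<otimes> g_n in the unit ball if both factors run
   through disjoint functions, or one does and the other is fixed: averaging over signs shows that
   the f_n \<otimes> g_n then form a weakly unconditionally Cauchy series. On scattered spaces this forces N
   to be small if one factor vanishes on a suitable finite set. Hence T is, up to epsilon
   times the norm, controlled by finitely many functionals extending \<delta>_s \<otimes> \<delta>_t, and so maps
   weakly null sequences to norm null ones.

   Conversely, let K1 be non-scattered. A crowded subset carries an independent sequence x_n of
   functions into [-1, 1], which has biorthogonal functionals \<phi>_n satisfying Bessel's inequality. On the
   infinite space K2 there are disjoint bumps y_n with y_n(t_n) = 1. The map f \<otimes> g \<mapsto> (\<phi>_n(f) g(t_n))_n
   into l2 is weakly compact and does not vanish along x_n \<otimes> y_n, but this sequence is weakly null: a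
   Riesz product shows that a bounded bilinear form cannot stay away from 0 on it.

   Both scalar fields are treated at once: they are real normed fields that are Euclidean spaces. *)
theory Submission imports Defs begin

text \<open>The dual of C(K) is never described by measures. Functionals are produced by
  Hahn-Banach, by the universal property of the tensor product, and by limits along one fixed
  ultrafilter, which replace weak-star compactness. An element of the completed product is never
  decomposed in the main argument: estimates on it come from norming functionals or are transferred
  from elementary tensors by \<open>seminorm_bound\<close>.

  The obstacle in the positive direction is that disjoint f_n paired with arbitrary g_n in the unit
  ball need not give an unconditional series; the counterexample of the negative direction is of
  this kind. So T (f_n \<otimes> g_n) \<rightarrow> 0 has to be deduced from scatteredness of the
  second space, and only this makes the tail estimate in the first variable uniform in the second.

  In the negative direction the x_n are independent, not disjoint, so a sum of n terms \<plusminus>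
  a x_l may have sup norm n a. The product of the 1 \<plusminus> i a x_l has modulus at most (1 +
  a^2)^(n/2), which stays bounded for a = 1 / sqrt n. That is why a product replaces the plain
  average over signs.\<close>

section \<open>Elementary calculus in normed spaces with a carrier\<close>

context normed_space
begin

lemma scale_zero_left [simp]: "x \<in> vs_carrier V \<Longrightarrow> vs_scale V 0 x = vs_zero V"
  using scale_left_distrib[of x 1 "-1"] diff_self[of x] by (simp add: vs_diff_def scale_one)

lemma scale_zero_right [simp]: "vs_scale V c (vs_zero V) = vs_zero V"
  using scale_scale[of "vs_zero V" c 0] zero_closed by simp

lemma norm_zero [simp]: "vs_norm V (vs_zero V) = 0"
  by (simp add: norm_eq_zero zero_closed)

lemma add_neg: "x \<in> vs_carrier V \<Longrightarrow> vs_add V x (vs_scale V (-1) x) = vs_zero V"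
  using diff_self by (simp add: vs_diff_def)

lemma zero_add: "x \<in> vs_carrier V \<Longrightarrow> vs_add V (vs_zero V) x = x"
  using add_commute add_zero zero_closed by metis

lemma add_left_commute:
  "\<lbrakk>x \<in> vs_carrier V; y \<in> vs_carrier V; z \<in> vs_carrier V\<rbrakk>
    \<Longrightarrow> vs_add V x (vs_add V y z) = vs_add V y (vs_add V x z)"
  by (metis add_assoc add_commute)

lemma diff_closed: "\<lbrakk>x \<in> vs_carrier V; y \<in> vs_carrier V\<rbrakk> \<Longrightarrow> vs_diff V x y \<in> vs_carrier V"
  by (simp add: vs_diff_def add_closed scale_closed)

lemmas closed = zero_closed add_closed scale_closed diff_closed

lemmas add_ac = add_assoc add_commute add_left_commute

lemma diff_zero [simp]: "x \<in> vs_carrier V \<Longrightarrow> vs_diff V x (vs_zero V) = x"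
  by (simp add: vs_diff_def add_zero)

lemma diff_add_cancel: "\<lbrakk>x \<in> vs_carrier V; y \<in> vs_carrier V\<rbrakk> \<Longrightarrow> vs_add V (vs_diff V x y) y = x"
  unfolding vs_diff_def using add_assoc[of x "vs_scale V (-1) y" y] add_commute[of y "vs_scale V (-1) y"] add_neg[of y]
  by (metis add_zero scale_closed)

lemma diff_eq_zero: "\<lbrakk>x \<in> vs_carrier V; y \<in> vs_carrier V\<rbrakk> \<Longrightarrow> vs_diff V x y = vs_zero V \<longleftrightarrow> x = y"
  using diff_add_cancel[of x y] diff_self zero_add by metis

lemma scale_diff: "\<lbrakk>x \<in> vs_carrier V; y \<in> vs_carrier V\<rbrakk>
    \<Longrightarrow> vs_scale V c (vs_diff V x y) = vs_diff V (vs_scale V c x) (vs_scale V c y)"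
  by (simp add: vs_diff_def scale_right_distrib scale_scale scale_closed)

lemma diff_add_diff:
  assumes "x \<in> vs_carrier V" "y \<in> vs_carrier V" "x' \<in> vs_carrier V" "y' \<in> vs_carrier V"
  shows "vs_diff V (vs_add V x y) (vs_add V x' y') = vs_add V (vs_diff V x x') (vs_diff V y y')"
  using assms by (simp add: vs_diff_def scale_right_distrib scale_closed add_closed add_ac)

lemma diff_swap: "\<lbrakk>x \<in> vs_carrier V; y \<in> vs_carrier V\<rbrakk> \<Longrightarrow> vs_diff V y x = vs_scale V (-1) (vs_diff V x y)"
  by (simp add: vs_diff_def scale_right_distrib scale_scale scale_closed scale_one add_commute)

lemma diff_diff_add:
  assumes "x \<in> vs_carrier V" "y \<in> vs_carrier V" "z \<in> vs_carrier V"
  shows "vs_add V (vs_diff V x y) (vs_diff V y z) = vs_diff V x z"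
proof -
  have "vs_add V (vs_diff V x y) (vs_diff V y z)
      = vs_add V (vs_add V (vs_diff V x y) y) (vs_scale V (-1) z)"
    using assms by (simp add: vs_diff_def[of V y z] add_assoc closed)
  then show ?thesis
    using assms by (simp add: diff_add_cancel vs_diff_def[of V x z])
qed

lemma norm_minus: "x \<in> vs_carrier V \<Longrightarrow> vs_norm V (vs_scale V (-1) x) = vs_norm V x"
  by (simp add: norm_scale)

lemma norm_diff_commute: "\<lbrakk>x \<in> vs_carrier V; y \<in> vs_carrier V\<rbrakk> \<Longrightarrow> vs_norm V (vs_diff V x y) = vs_norm V (vs_diff V y x)"
  using diff_swap[of x y] norm_minus closed by metis

lemma norm_le_diff: "\<lbrakk>x \<in> vs_carrier V; y \<in> vs_carrier V\<rbrakk> \<Longrightarrow> vs_norm V x \<le> vs_norm V (vs_diff V x y) + vs_norm V y"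
  using norm_triangle[of "vs_diff V x y" y] by (simp add: diff_add_cancel closed)

lemma norm_triangle_diff:
  "\<lbrakk>x \<in> vs_carrier V; y \<in> vs_carrier V\<rbrakk> \<Longrightarrow> \<bar>vs_norm V x - vs_norm V y\<bar> \<le> vs_norm V (vs_diff V x y)"
  using norm_le_diff[of x y] norm_le_diff[of y x] norm_diff_commute[of x y] by linarith

lemma Metric_space: "Metric_space (vs_carrier V) (vs_dist V)"
proof
  show "0 \<le> vs_dist V x y" for x y
    by (simp add: vs_dist_def norm_nonneg closed)
  show "vs_dist V x y = vs_dist V y x" for x y
    by (simp add: vs_dist_def norm_diff_commute)
  show "vs_dist V x y = 0 \<longleftrightarrow> x = y" if "x \<in> vs_carrier V" "y \<in> vs_carrier V" for x y
    using that by (simp add: vs_dist_def norm_eq_zero closed diff_eq_zero)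
  show "vs_dist V x z \<le> vs_dist V x y + vs_dist V y z"
    if "x \<in> vs_carrier V" "y \<in> vs_carrier V" "z \<in> vs_carrier V" for x y z
    using that norm_triangle[of "vs_diff V x y" "vs_diff V y z"]
    by (simp add: vs_dist_def diff_diff_add closed)
qed

lemma dist_eq: "\<lbrakk>x \<in> vs_carrier V; y \<in> vs_carrier V\<rbrakk> \<Longrightarrow> vs_dist V x y = vs_norm V (vs_diff V x y)"
  by (simp add: vs_dist_def)

lemma limitin_norm:
  assumes "range s \<subseteq> vs_carrier V"
  shows "limitin (norm_topology V) s l sequentially
    \<longleftrightarrow> l \<in> vs_carrier V \<and> (\<lambda>n. vs_norm V (vs_diff V (s n) l)) \<longlonglongrightarrow> 0"
proof -
  have s: "s n \<in> vs_carrier V" for n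
    using assms by auto
  show ?thesis
    unfolding norm_topology_def Metric_space.limitin_metric[OF Metric_space]
    by (auto simp: s dist_eq tendsto_iff norm_nonneg closed)
qed

lemma mcomplete_iff:
  "Metric_space.mcomplete (vs_carrier V) (vs_dist V) \<longleftrightarrow>
    (\<forall>s. range s \<subseteq> vs_carrier V \<and>
      (\<forall>e>0. \<exists>N. \<forall>m\<ge>N. \<forall>n\<ge>N. vs_norm V (vs_diff V (s m) (s n)) < e) \<longrightarrow>
      (\<exists>l\<in>vs_carrier V. (\<lambda>n. vs_norm V (vs_diff V (s n) l)) \<longlonglongrightarrow> 0))"
proof -
  have cauchy: "Metric_space.MCauchy (vs_carrier V) (vs_dist V) s \<longleftrightarrow> range s \<subseteq> vs_carrier V \<and>
      (\<forall>e>0. \<exists>N. \<forall>m\<ge>N. \<forall>n\<ge>N. vs_norm V (vs_diff V (s m) (s n)) < e)" for s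
    unfolding Metric_space.MCauchy_def[OF Metric_space]
    by (auto simp: vs_dist_def image_subset_iff)
  show ?thesis
    unfolding Metric_space.mcomplete_def[OF Metric_space] cauchy
    by (intro all_cong1 imp_cong refl) (auto simp: limitin_norm[unfolded norm_topology_def] Bex_def)
qed

end

section \<open>Bounded operators, functionals and weak convergence\<close>

lemma scalar_space_simps [simp]:
  "vs_carrier scalar_space = UNIV" "vs_add scalar_space = (+)" "vs_zero scalar_space = 0"
  "vs_scale scalar_space = (*)" "vs_norm scalar_space = norm" "vs_diff scalar_space x y = x - y"
  by (simp_all add: scalar_space_def vs_diff_def)

lemma normed_space_scalar: "normed_space (scalar_space :: ('k::real_normed_field, 'k) nspace)"
  by unfold_locales (auto simp: algebra_simps norm_mult norm_triangle_ineq)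

lemma operators_bound:
  assumes V: "normed_space V" and W: "normed_space W" and T: "T \<in> operators V W"
  shows "\<exists>C>0. \<forall>x\<in>vs_carrier V. vs_norm W (T x) \<le> C * vs_norm V x"
proof -
  interpret V: normed_space V by fact
  interpret W: normed_space W by fact
  have lin: "T x \<in> vs_carrier W" "T (vs_scale V c x) = vs_scale W c (T x)" if "x \<in> vs_carrier V" for x c
    using T that by (auto simp: operators_def)
  have T0: "T (vs_zero V) = vs_zero W"
    using lin[of "vs_zero V"] V.closed V.scale_zero_right W.scale_zero_left by metis
  have "continuous_map (norm_topology V) (norm_topology W) T"
    using T by (simp add: operators_def)
  then obtain d where d: "d > 0" "\<And>x. x \<in> vs_carrier V \<Longrightarrow> vs_dist V (vs_zero V) x < d \<Longrightarrow> vs_dist W (T (vs_zero V)) (T x) < 1"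
    unfolding norm_topology_def Metric_space.metric_continuous_map[OF V.Metric_space W.Metric_space]
    using V.closed(1) zero_less_one by metis
  have d': "vs_norm W (T x) < 1" if "x \<in> vs_carrier V" "vs_norm V x < d" for x
  proof -
    have "vs_dist V (vs_zero V) x < d"
      using that by (simp add: V.dist_eq V.closed V.norm_diff_commute[of "vs_zero V"])
    then show ?thesis
      using d(2)[OF that(1)] that lin[of x] T0 by (simp add: W.dist_eq W.closed W.norm_diff_commute[of "vs_zero W"])
  qed
  show ?thesis
  proof (intro exI conjI ballI)
    show "2 / d > 0" using d by simp
    fix x assume x: "x \<in> vs_carrier V"
    show "vs_norm W (T x) \<le> 2 / d * vs_norm V x"
    proof (cases "vs_norm V x = 0")
      case True
      then show ?thesis using x T0 V.norm_eq_zero by auto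
    next
      case False
      then have n: "vs_norm V x > 0" using V.norm_nonneg[OF x] by simp
      \<comment> \<open>Scaling by \<open>c\<close> brings \<open>x\<close> to norm d/2, strictly
        inside the ball on which continuity at zero keeps \<open>T\<close> below 1. This is the
        origin of the constant 2/d.\<close>
      define c :: 'a where "c = of_real (d / (2 * vs_norm V x))"
      have c: "norm c = d / (2 * vs_norm V x)"
        using n d unfolding c_def norm_of_real by simp
      have "vs_norm V (vs_scale V c x) < d"
        using x d n by (simp add: V.norm_scale c)
      then have "norm c * vs_norm W (T x) < 1"
        using d'[of "vs_scale V c x"] x lin by (simp add: V.closed W.norm_scale)
      then show ?thesis using n d by (simp add: c field_simps)
    qed
  qed
qed

lemma operatorsI:
  assumes V: "normed_space V" and W: "normed_space W"
    and "\<And>x. x \<in> vs_carrier V \<Longrightarrow> T x \<in> vs_carrier W"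
    and "\<And>x y. \<lbrakk>x \<in> vs_carrier V; y \<in> vs_carrier V\<rbrakk> \<Longrightarrow> T (vs_add V x y) = vs_add W (T x) (T y)"
    and "\<And>c x. x \<in> vs_carrier V \<Longrightarrow> T (vs_scale V c x) = vs_scale W c (T x)"
    and bound: "\<And>x. x \<in> vs_carrier V \<Longrightarrow> vs_norm W (T x) \<le> C * vs_norm V x"
  shows "T \<in> operators V W"
proof -
  interpret V: normed_space V by fact
  interpret W: normed_space W by fact
  have diff: "T (vs_diff V x y) = vs_diff W (T x) (T y)" if "x \<in> vs_carrier V" "y \<in> vs_carrier V" for x y
    using that assms by (simp add: vs_diff_def V.closed)
  have "continuous_map (norm_topology V) (norm_topology W) T"
    unfolding norm_topology_def Metric_space.metric_continuous_map[OF V.Metric_space W.Metric_space]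
  proof (intro conjI ballI allI impI)
    show "T ` vs_carrier V \<subseteq> vs_carrier W" using assms by auto
    fix a and e :: real assume a: "a \<in> vs_carrier V" and e: "e > 0"
    \<comment> \<open>The hypothesis says nothing about the sign of \<open>C\<close>, so
      \<bar>C\<bar> + 1 is used as a positive Lipschitz constant.\<close>
    have "vs_dist W (T a) (T x) < e" if x: "x \<in> vs_carrier V" and "vs_dist V a x < e / (\<bar>C\<bar> + 1)" for x
    proof -
      have *: "vs_norm V (vs_diff V a x) < e / (\<bar>C\<bar> + 1)" using that a by (simp add: V.dist_eq)
      have "vs_dist W (T a) (T x) = vs_norm W (T (vs_diff V a x))"
        using a x assms by (simp add: W.dist_eq diff)
      also have "\<dots> \<le> C * vs_norm V (vs_diff V a x)" using bound a x by (simp add: V.closed)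
      also have "\<dots> \<le> (\<bar>C\<bar> + 1) * vs_norm V (vs_diff V a x)"
        by (rule mult_right_mono) (use a x in \<open>auto simp: V.norm_nonneg V.closed\<close>)
      also have "\<dots> < e" using * by (simp add: field_simps)
      finally show ?thesis .
    qed
    then show "\<exists>\<delta>>0. \<forall>x. x \<in> vs_carrier V \<and> vs_dist V a x < \<delta> \<longrightarrow> vs_dist W (T a) (T x) < e"
      using e by (intro exI[of _ "e / (\<bar>C\<bar> + 1)"]) auto
  qed
  then show ?thesis using assms by (auto simp: operators_def)
qed

lemma operators_simps:
  assumes "T \<in> operators V W" "x \<in> vs_carrier V"
  shows "T x \<in> vs_carrier W" "y \<in> vs_carrier V \<Longrightarrow> T (vs_add V x y) = vs_add W (T x) (T y)"
    "T (vs_scale V c x) = vs_scale W c (T x)"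
  using assms by (auto simp: operators_def)

lemma operators_diff:
  assumes "T \<in> operators V W" "normed_space V" "x \<in> vs_carrier V" "y \<in> vs_carrier V"
  shows "T (vs_diff V x y) = vs_diff W (T x) (T y)"
  using assms by (simp add: vs_diff_def operators_simps normed_space.scale_closed)

lemma topspace_weak: "topspace (weak_topology V) = vs_carrier V" if "normed_space V"
proof -
  have "(\<lambda>x. 0) \<in> operators V scalar_space"
    by (rule operatorsI[of _ _ _ 0]) (use that in \<open>auto simp: normed_space_scalar\<close>)
  then have "vs_carrier V \<subseteq> \<Union>{{x \<in> vs_carrier V. \<phi> x \<in> U} | \<phi> U. \<phi> \<in> operators V scalar_space \<and> open U}"
    by (intro subsetI UnionI[of "{x \<in> vs_carrier V. 0 \<in> (UNIV :: 'a set)}"]) auto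
  then show ?thesis
    unfolding weak_topology_def topology_generated_by_topspace by auto
qed

text \<open>An arbitrary filter is allowed because the lemma serves both ordinary sequences and
  limits along an ultrafilter. The converse is an induction over the generation of the open set:
  functionals handle the generating sets, and for a union it suffices to stay in the one member that
  contains the limit.\<close>

lemma limitin_weak_iff:
  fixes V :: "('k::real_normed_field, 'e) nspace"
  assumes V: "normed_space V" and s: "\<And>i. s i \<in> vs_carrier V"
  shows "limitin (weak_topology V) s l F
    \<longleftrightarrow> l \<in> vs_carrier V \<and> (\<forall>\<phi>\<in>operators V scalar_space. ((\<lambda>i. \<phi> (s i)) \<longlongrightarrow> \<phi> l) F)"
    (is "?L \<longleftrightarrow> ?R")
proof
  assume L: ?L
  have l: "l \<in> vs_carrier V"
    using L topspace_weak[OF V] by (auto simp: limitin_def)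
  have "((\<lambda>i. \<phi> (s i)) \<longlongrightarrow> \<phi> l) F" if \<phi>: "\<phi> \<in> operators V scalar_space" for \<phi>
  proof (rule topological_tendstoI)
    fix U assume U: "open U" "\<phi> l \<in> U"
    have "openin (weak_topology V) {x \<in> vs_carrier V. \<phi> x \<in> U}"
      unfolding weak_topology_def by (rule topology_generated_by_Basis) (use \<phi> U in auto)
    then have "eventually (\<lambda>i. s i \<in> {x \<in> vs_carrier V. \<phi> x \<in> U}) F"
      using L l U unfolding limitin_def by blast
    then show "eventually (\<lambda>i. \<phi> (s i) \<in> U) F"
      by (auto elim: eventually_mono)
  qed
  then show ?R using l by blast
next
  assume R: ?R
  have "eventually (\<lambda>i. s i \<in> W) F" if W: "openin (weak_topology V) W" "l \<in> W" for W
  proof -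
    have "generate_topology_on {{x \<in> vs_carrier V. \<phi> x \<in> U} | \<phi> U. \<phi> \<in> operators V scalar_space \<and> open U} W"
      using W unfolding weak_topology_def by (simp add: openin_topology_generated_by)
    then show ?thesis using W(2)
    proof (induction rule: generate_topology_on.induct)
      case (Basis W)
      then obtain \<phi> U where *: "\<phi> \<in> operators V scalar_space" "open U" "W = {x \<in> vs_carrier V. \<phi> x \<in> U}"
        by auto
      then have "eventually (\<lambda>i. \<phi> (s i) \<in> U) F"
        using R Basis by (auto dest: topological_tendstoD)
      then show ?case using * s by (auto elim: eventually_mono)
    next
      case (UN K)
      then obtain k where k: "k \<in> K" "l \<in> k" by auto
      then have "eventually (\<lambda>i. s i \<in> k) F" by (rule UN.IH)
      then show ?case by (rule eventually_mono) (use k in blast)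
    qed (auto intro: eventually_conj)
  qed
  then show ?L using R topspace_weak[OF V] by (auto simp: limitin_def)
qed

section \<open>Functionals\<close>

text \<open>The conjugate of \<open>a\<close>; at \<open>a = 0\<close> division by zero gives the right value \<open>0\<close>.\<close>

definition sconj :: "'k::{real_normed_field, euclidean_space} \<Rightarrow> 'k" where
  "sconj a = of_real ((norm a)\<^sup>2) / a"

text \<open>The norm is multiplicative, so multiplication by \<open>a\<close> is a multiple of an
  isometry, and polarization carries this over to the inner product. This replaces a case
  distinction between real and complex scalars.\<close>

lemma inner_mult_mult:
  fixes a x y :: "'k::{real_normed_field, euclidean_space}"
  shows "inner (a * x) (a * y) = (norm a)\<^sup>2 * inner x y"
  by (simp add: dot_norm norm_mult power_mult_distrib right_diff_distrib flip: distrib_left)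

text \<open>Multiplication by \<open>sconj a\<close> is the adjoint of multiplication by
  \<open>a\<close>. This determines \<open>sconj\<close> and yields its algebraic rules through
  \<open>sconj_eqI\<close>.\<close>

lemma inner_sconj:
  fixes a x y :: "'k::{real_normed_field, euclidean_space}"
  shows "inner (a * x) y = inner x (sconj a * y)"
proof (cases "a = 0")
  case False
  then have "inner (a * x) y = inner (a * x) (a * (y / a))" by simp
  also have "\<dots> = inner x ((norm a)\<^sup>2 *\<^sub>R (y / a))" by (simp only: inner_mult_mult inner_scaleR_right)
  finally show ?thesis by (simp add: sconj_def scaleR_conv_of_real)
qed (simp add: sconj_def)

lemma sconj_eqI:
  fixes b :: "'k::{real_normed_field, euclidean_space}"
  assumes "\<And>x. inner (a * x) 1 = inner x b"
  shows "sconj a = b"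
  using assms inner_sconj[of a _ 1] vector_eq_ldot[of "sconj a" b] by simp

lemma sconj_add: "sconj (a + b) = sconj a + sconj b"
  by (rule sconj_eqI) (simp add: distrib_right inner_add_left inner_add_right inner_sconj)

lemma sconj_scaleR: "sconj (c *\<^sub>R a) = c *\<^sub>R sconj a"
  by (rule sconj_eqI) (simp add: inner_sconj)

lemma sconj_mult: "sconj (a * b) = sconj a * sconj b"
  by (simp add: sconj_def norm_mult power_mult_distrib)

lemma norm_sconj [simp]: "norm (sconj a) = norm a"
  by (simp add: sconj_def norm_divide norm_mult power2_eq_square)

lemma sconj_sconj [simp]: "sconj (sconj a) = a"
  by (cases "a = 0") (auto simp: sconj_def norm_divide norm_mult power2_eq_square)

section \<open>Hahn-Banach by minimal sublinear functionals\<close>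

text \<open>The value 0 off the carrier makes the pointwise order antisymmetric on these functions,
  as Zorn's lemma requires. Domination by the norm is built in, since it also gives the lower bound
  for infima of chains. Homogeneity is asked for as an inequality, which survives infima
  directly.\<close>

definition sublinear :: "('k::real_normed_field, 'e) nspace \<Rightarrow> ('e \<Rightarrow> real) \<Rightarrow> bool" where
  "sublinear V q \<longleftrightarrow>
    (\<forall>x\<in>vs_carrier V. \<forall>y\<in>vs_carrier V. q (vs_add V x y) \<le> q x + q y) \<and>
    (\<forall>x\<in>vs_carrier V. \<forall>c>0. q (vs_scale V (of_real c) x) \<le> c * q x) \<and>
    (\<forall>x\<in>vs_carrier V. q x \<le> vs_norm V x) \<and> (\<forall>x. x \<notin> vs_carrier V \<longrightarrow> q x = 0)"

context normed_space
begin

lemma sublinear_zero: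
  assumes "sublinear V q" shows "q (vs_zero V) = 0"
proof -
  have "q (vs_scale V (of_real 2) (vs_zero V)) \<le> 2 * q (vs_zero V)" "q (vs_zero V) \<le> vs_norm V (vs_zero V)"
    using assms zero_closed unfolding sublinear_def by (metis zero_less_numeral, metis)
  then show ?thesis by simp
qed

lemma sublinear_neg:
  assumes "sublinear V q" "x \<in> vs_carrier V" shows "- q (vs_scale V (-1) x) \<le> q x"
proof -
  have "q (vs_add V x (vs_scale V (-1) x)) \<le> q x + q (vs_scale V (-1) x)"
    using assms scale_closed unfolding sublinear_def by metis
  then show ?thesis using assms by (simp add: add_neg sublinear_zero)
qed

lemma sublinear_le: "sublinear V q \<Longrightarrow> x \<in> vs_carrier V \<Longrightarrow> q x \<le> vs_norm V x"
  by (simp add: sublinear_def)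

lemma sublinear_ge: "sublinear V q \<Longrightarrow> x \<in> vs_carrier V \<Longrightarrow> - vs_norm V x \<le> q x"
  using sublinear_neg[of q x] sublinear_le[of q "vs_scale V (-1) x"] norm_minus[of x] scale_closed[of x "-1"] by simp

lemma sublinear_scale:
  assumes q: "sublinear V q" and x: "x \<in> vs_carrier V" and c: "c \<ge> 0"
  shows "q (vs_scale V (of_real c) x) = c * q x"
proof (cases "c = 0")
  case True
  then show ?thesis using assms by (simp add: sublinear_zero)
next
  case False
  then have c: "c > 0" using c by simp
  have "q (vs_scale V (of_real (1 / c)) (vs_scale V (of_real c) x)) \<le> 1 / c * q (vs_scale V (of_real c) x)"
    using q x c scale_closed unfolding sublinear_def by (metis zero_less_divide_1_iff)
  moreover have "of_real (1 / c) * of_real c = (1 :: 'k)"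
    using c by simp
  then have "vs_scale V (of_real (1 / c)) (vs_scale V (of_real c) x) = x"
    using x by (simp only: scale_scale scale_one)
  ultimately have "c * q x \<le> q (vs_scale V (of_real c) x)" using c by (simp add: field_simps)
  then show ?thesis using q x c unfolding sublinear_def by (meson order_antisym)
qed

text \<open>Subadditivity bounds the infimum below by - q (-x), so it is finite. At x = -y and t = 1
  the second claim gives p (-y) \<le> - q y: the shift pushes a functional towards linearity along
  \<open>y\<close>.\<close>

lemma sublinear_shift:
  assumes q: "sublinear V q" and y: "y \<in> vs_carrier V"
  defines "p \<equiv> \<lambda>x. if x \<in> vs_carrier V
    then INF t\<in>{0..}. q (vs_add V x (vs_scale V (of_real t) y)) - t * q y else 0"
  shows "sublinear V p" "\<And>x t. x \<in> vs_carrier V \<Longrightarrow> t \<ge> 0 \<Longrightarrow> p x \<le> q (vs_add V x (vs_scale V (of_real t) y)) - t * q y"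
proof -
  have lb: "- q (vs_scale V (-1) x) \<le> q (vs_add V x (vs_scale V (of_real t) y)) - t * q y"
    if x: "x \<in> vs_carrier V" and t: "t \<ge> 0" for x t
  proof -
    have "vs_add V (vs_scale V (-1) x) (vs_add V x (vs_scale V (of_real t) y)) = vs_scale V (of_real t) y"
      using x y add_assoc[of "vs_scale V (-1) x" x "vs_scale V (of_real t) y"]
      by (simp add: closed add_commute[of "vs_scale V (-1) x" x] add_neg zero_add)
    then have "q (vs_scale V (of_real t) y) \<le> q (vs_scale V (-1) x) + q (vs_add V x (vs_scale V (of_real t) y))"
      using q x y closed unfolding sublinear_def by metis
    then show ?thesis using sublinear_scale[OF q y t] by simp
  qed
  show upper: "p x \<le> q (vs_add V x (vs_scale V (of_real t) y)) - t * q y" if x: "x \<in> vs_carrier V" and t: "t \<ge> 0" for x t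
    unfolding p_def using x t lb[OF x] by (auto intro!: cINF_lower bdd_belowI2)
  have greatest: "b \<le> p x"
    if "x \<in> vs_carrier V" "\<And>t. t \<ge> 0 \<Longrightarrow> b \<le> q (vs_add V x (vs_scale V (of_real t) y)) - t * q y" for b x
    unfolding p_def using that by (auto intro!: cINF_greatest)
  have add: "p (vs_add V x x') \<le> p x + p x'" if x: "x \<in> vs_carrier V" "x' \<in> vs_carrier V" for x x'
  proof -
    have main: "p (vs_add V x x') \<le> (q (vs_add V x (vs_scale V (of_real t) y)) - t * q y)
         + (q (vs_add V x' (vs_scale V (of_real t') y)) - t' * q y)" if "t \<ge> 0" "t' \<ge> 0" for t t'
    proof -
      have "vs_add V (vs_add V x x') (vs_scale V (of_real (t + t')) y)
          = vs_add V (vs_add V x (vs_scale V (of_real t) y)) (vs_add V x' (vs_scale V (of_real t') y))"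
        using x y by (simp add: scale_left_distrib closed add_ac)
      then have "q (vs_add V (vs_add V x x') (vs_scale V (of_real (t + t')) y))
          \<le> q (vs_add V x (vs_scale V (of_real t) y)) + q (vs_add V x' (vs_scale V (of_real t') y))"
        using q x y closed unfolding sublinear_def by metis
      then show ?thesis
        using upper[of "vs_add V x x'" "t + t'"] that x by (simp add: closed algebra_simps)
    qed
    have "p (vs_add V x x') - (q (vs_add V x' (vs_scale V (of_real t') y)) - t' * q y) \<le> p x" if "t' \<ge> 0" for t'
      by (rule greatest) (use x main that in \<open>auto simp: algebra_simps\<close>)
    then have "p (vs_add V x x') - p x \<le> p x'"
      by (intro greatest) (use x in \<open>auto simp: algebra_simps\<close>)
    then show ?thesis by simp
  qed
  have scale: "p (vs_scale V (of_real c) x) \<le> c * p x" if x: "x \<in> vs_carrier V" and c: "c > 0" for x c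
  proof -
    have "p (vs_scale V (of_real c) x) / c \<le> p x"
    proof (rule greatest[OF x])
      fix t :: real assume t: "t \<ge> 0"
      have "vs_add V (vs_scale V (of_real c) x) (vs_scale V (of_real (c * t)) y)
          = vs_scale V (of_real c) (vs_add V x (vs_scale V (of_real t) y))"
        using x y by (simp add: scale_right_distrib scale_scale closed)
      then have "p (vs_scale V (of_real c) x) \<le> q (vs_scale V (of_real c) (vs_add V x (vs_scale V (of_real t) y))) - c * t * q y"
        using upper[of "vs_scale V (of_real c) x" "c * t"] x t c by (simp add: closed)
      also have "\<dots> = c * (q (vs_add V x (vs_scale V (of_real t) y)) - t * q y)"
        using sublinear_scale[OF q, of "vs_add V x (vs_scale V (of_real t) y)" c] x y c by (simp add: closed algebra_simps)
      finally show "p (vs_scale V (of_real c) x) / c \<le> q (vs_add V x (vs_scale V (of_real t) y)) - t * q y"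
        using c by (simp add: field_simps)
    qed
    then show ?thesis using c by (simp add: field_simps)
  qed
  have "p x \<le> vs_norm V x" if "x \<in> vs_carrier V" for x
  proof -
    have "q x \<le> vs_norm V x" using q that by (simp add: sublinear_def)
    then show ?thesis using upper[of x 0] that y by (simp add: add_zero)
  qed
  with add scale show "sublinear V p" unfolding sublinear_def p_def by auto
qed

text \<open>A minimal sublinear functional is additive: shifting it as in \<open>sublinear_shift\<close> cannot decrease it.\<close>

lemma minimal_sublinear:
  assumes p: "sublinear V p"
  obtains q where "sublinear V q" "\<And>x. q x \<le> p x" "\<And>q'. sublinear V q' \<Longrightarrow> (\<And>x. q' x \<le> q x) \<Longrightarrow> q' = q"
proof -
  define A where "A = {q. sublinear V q \<and> (\<forall>x. q x \<le> p x)}"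
  \<comment> \<open>The order is reversed, so the maximal element found by Zorn's lemma is a minimal
    functional, and upper bounds of chains are pointwise infima.\<close>
  define P where "P = (\<lambda>q q' :: 'e \<Rightarrow> real. \<forall>x. q' x \<le> q x)"
  have "\<exists>m\<in>A. \<forall>a\<in>A. P m a \<longrightarrow> a = m"
  proof (rule predicate_Zorn)
    show "partial_order_on A (relation_of P A)"
      unfolding partial_order_on_def preorder_on_def refl_on_def trans_def antisym_def relation_of_def P_def
      by (auto intro: order_trans intro!: ext order_antisym)
    fix C assume "C \<in> Chains (relation_of P A)"
    then have CA: "C \<subseteq> A" and lin: "\<And>a b. a \<in> C \<Longrightarrow> b \<in> C \<Longrightarrow> P a b \<or> P b a"
      unfolding Chains_def relation_of_def by auto
    show "\<exists>u\<in>A. \<forall>a\<in>C. P a u"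
    proof (cases "C = {}")
      case True
      then show ?thesis using p by (auto simp: A_def)
    next
      case False
      define u where "u = (\<lambda>x. INF q\<in>C. q x)"
      have bdd: "bdd_below ((\<lambda>q. q x) ` C)" for x
      proof (cases "x \<in> vs_carrier V")
        case True
        then show ?thesis using CA sublinear_ge by (intro bdd_belowI2[of _ "- vs_norm V x"]) (auto simp: A_def)
      next
        case False
        then show ?thesis using CA by (intro bdd_belowI2[of _ 0]) (auto simp: A_def sublinear_def)
      qed
      have ul: "u x \<le> q x" if "q \<in> C" for q x
        unfolding u_def by (rule cINF_lower) (use bdd that in auto)
      have ug: "b \<le> u x" if "\<And>q. q \<in> C \<Longrightarrow> b \<le> q x" for b x
        unfolding u_def by (rule cINF_greatest) (use False that in auto)
      obtain q0 where q0: "q0 \<in> C" using False by auto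
      have "u (vs_add V x y) \<le> u x + u y" if x: "x \<in> vs_carrier V" "y \<in> vs_carrier V" for x y
      proof -
        have main: "u (vs_add V x y) \<le> q1 x + q2 y" if q12: "q1 \<in> C" "q2 \<in> C" for q1 q2
        proof -
          \<comment> \<open>Of two members of a chain one lies below the other; this single
            \<open>q\<close> bounds both summands and has its own subadditivity.\<close>
          obtain q where q: "q \<in> C" "q x \<le> q1 x" "q y \<le> q2 y"
            using lin[OF q12] q12 unfolding P_def by (metis order_refl)
          then have "q (vs_add V x y) \<le> q x + q y" using CA x by (auto simp: A_def sublinear_def)
          then show ?thesis using ul[OF q(1), of "vs_add V x y"] q by linarith
        qed
        have "u (vs_add V x y) - q2 y \<le> u x" if "q2 \<in> C" for q2
          by (rule ug) (use main that in \<open>auto simp: algebra_simps\<close>)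
        then have "u (vs_add V x y) - u x \<le> u y"
          by (intro ug) (auto simp: algebra_simps)
        then show ?thesis by simp
      qed
      moreover have "u (vs_scale V (of_real c) x) \<le> c * u x" if x: "x \<in> vs_carrier V" and c: "c > 0" for x c
      proof -
        have "u (vs_scale V (of_real c) x) / c \<le> u x"
        proof (rule ug)
          fix q assume q: "q \<in> C"
          have "q (vs_scale V (of_real c) x) \<le> c * q x" using q CA x c by (auto simp: A_def sublinear_def)
          then show "u (vs_scale V (of_real c) x) / c \<le> q x"
            using ul[OF q, of "vs_scale V (of_real c) x"] c by (simp add: field_simps)
        qed
        then show ?thesis using c by (simp add: field_simps)
      qed
      moreover have "u x \<le> vs_norm V x" if "x \<in> vs_carrier V" for x
        using ul[OF q0, of x] q0 CA that by (force simp: A_def sublinear_def)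
      moreover have "u x = 0" if "x \<notin> vs_carrier V" for x
        unfolding u_def using CA that False by (subst INF_cong[OF refl, of _ _ "\<lambda>_. 0"]) (auto simp: A_def sublinear_def)
      ultimately have "sublinear V u" unfolding sublinear_def by blast
      moreover have "u x \<le> p x" for x
        by (rule order_trans[OF ul[OF q0]]) (use q0 CA in \<open>auto simp: A_def\<close>)
      ultimately show ?thesis using ul by (auto simp: A_def P_def)
    qed
  qed
  then obtain m where *: "m \<in> A" "\<forall>a\<in>A. P m a \<longrightarrow> a = m" by blast
  then have m: "sublinear V m" "\<And>x. m x \<le> p x" by (auto simp: A_def)
  have min: "a = m" if "sublinear V a" "\<forall>x. a x \<le> p x" "\<forall>x. a x \<le> m x" for a
    using that bspec[OF *(2), of a] by (simp add: A_def P_def)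
  show thesis
  proof (rule that[of m])
    show "sublinear V m" by (rule m(1))
    show "m x \<le> p x" for x by (rule m(2))
    fix q' assume q': "sublinear V q'" "\<And>x. q' x \<le> m x"
    have "\<forall>x. q' x \<le> p x"
      using order_trans[OF q'(2) m(2)] by blast
    then show "q' = m" using min q' by blast
  qed
qed

text \<open>No functional is extended from a subspace. The norm is shifted along \<open>x0\<close>,
  so everything below the shift is at most - norm x0 at the vector -x0; a minimal functional below
  it is additive, and its value at \<open>x0\<close> is therefore at least the norm.\<close>

lemma real_norming_functional:
  assumes x0: "x0 \<in> vs_carrier V"
  obtains f :: "'e \<Rightarrow> real" where
    "\<And>x y. \<lbrakk>x \<in> vs_carrier V; y \<in> vs_carrier V\<rbrakk> \<Longrightarrow> f (vs_add V x y) = f x + f y"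
    "\<And>c x. x \<in> vs_carrier V \<Longrightarrow> f (vs_scale V (of_real c) x) = c * f x"
    "\<And>x. x \<in> vs_carrier V \<Longrightarrow> f x \<le> vs_norm V x" "f x0 \<ge> vs_norm V x0"
proof -
  define n where "n = (\<lambda>x. if x \<in> vs_carrier V then vs_norm V x else 0)"
  have n: "sublinear V n"
    unfolding sublinear_def n_def by (auto simp: closed norm_triangle norm_scale)
  obtain p where p: "sublinear V p"
    "\<And>x t. x \<in> vs_carrier V \<Longrightarrow> t \<ge> 0 \<Longrightarrow> p x \<le> n (vs_add V x (vs_scale V (of_real t) x0)) - t * n x0"
    using sublinear_shift[OF n x0] by blast
  obtain f where f: "sublinear V f" "\<And>x. f x \<le> p x"
    and min: "\<And>q'. sublinear V q' \<Longrightarrow> (\<And>x. q' x \<le> f x) \<Longrightarrow> q' = f"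
    using minimal_sublinear[OF p(1)] by blast
  have add: "f (vs_add V x y) = f x + f y" if x: "x \<in> vs_carrier V" and y: "y \<in> vs_carrier V" for x y
  proof -
    obtain g where g: "sublinear V g"
      "\<And>x t. x \<in> vs_carrier V \<Longrightarrow> t \<ge> 0 \<Longrightarrow> g x \<le> f (vs_add V x (vs_scale V (of_real t) y)) - t * f y"
      using sublinear_shift[OF f(1) y] by blast
    have "g x \<le> f x" for x
      using g(2)[of x 0] y g(1) f(1) by (cases "x \<in> vs_carrier V") (auto simp: add_zero sublinear_def)
    then have "g = f" using min g(1) by blast
    then have "f x \<le> f (vs_add V x y) - f y"
      using g(2)[OF x, of 1] y by (simp add: scale_one)
    moreover have "f (vs_add V x y) \<le> f x + f y" using f(1) x y by (simp add: sublinear_def)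
    ultimately show ?thesis by simp
  qed
  have neg: "f (vs_scale V (-1) x) = - f x" if "x \<in> vs_carrier V" for x
    using add[of x "vs_scale V (-1) x"] that by (simp add: closed add_neg sublinear_zero[OF f(1)])
  have scale: "f (vs_scale V (of_real c) x) = c * f x" if x: "x \<in> vs_carrier V" for c x
  proof (cases "c \<ge> 0")
    case True
    then show ?thesis using sublinear_scale f(1) x by blast
  next
    case False
    have "vs_scale V (of_real c) x = vs_scale V (-1) (vs_scale V (of_real (- c)) x)"
      using x by (simp add: scale_scale)
    then show ?thesis using neg[of "vs_scale V (of_real (- c)) x"] sublinear_scale[OF f(1) x, of "- c"] False x
      by (simp add: closed)
  qed
  have "f (vs_scale V (-1) x0) \<le> p (vs_scale V (-1) x0)" by (rule f)
  also have "vs_add V (vs_scale V (-1) x0) x0 = vs_zero V"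
    using x0 by (metis add_commute add_neg scale_closed)
  then have "p (vs_scale V (-1) x0) \<le> - vs_norm V x0"
    using p(2)[of "vs_scale V (-1) x0" 1] x0 by (simp add: closed scale_one n_def)
  finally have "f x0 \<ge> vs_norm V x0" using neg x0 by simp
  moreover have "f x \<le> vs_norm V x" if "x \<in> vs_carrier V" for x
    using f(1) that by (simp add: sublinear_def)
  ultimately show thesis using add scale by (intro that[of f])
qed

end

abbreviation dual :: "('k::real_normed_field, 'e) nspace \<Rightarrow> ('e \<Rightarrow> 'k) set" where
  "dual V \<equiv> operators V scalar_space"

text \<open>The scalar functional is recovered from its real part: \<phi> x is the scalar whose
  inner product with every \<open>c\<close> is f (sconj c \<cdot> x). For complex scalars this is
  the familiar f x - i f (i x); for real scalars it is f itself.\<close>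

theorem norming_functional:
  fixes V :: "('k::{real_normed_field, euclidean_space}, 'e) nspace"
  assumes V: "normed_space V" and x0: "x0 \<in> vs_carrier V"
  obtains \<phi> where "\<phi> \<in> dual V" "\<And>x. x \<in> vs_carrier V \<Longrightarrow> norm (\<phi> x) \<le> vs_norm V x"
    "norm (\<phi> x0) = vs_norm V x0"
proof -
  interpret normed_space V by fact
  obtain f :: "'e \<Rightarrow> real" where
    add: "\<And>x y. \<lbrakk>x \<in> vs_carrier V; y \<in> vs_carrier V\<rbrakk> \<Longrightarrow> f (vs_add V x y) = f x + f y" and
    scale: "\<And>c x. x \<in> vs_carrier V \<Longrightarrow> f (vs_scale V (of_real c) x) = c * f x" and
    le: "\<And>x. x \<in> vs_carrier V \<Longrightarrow> f x \<le> vs_norm V x" and f0: "f x0 \<ge> vs_norm V x0"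
    using real_norming_functional[OF x0] by blast
  define \<phi> where "\<phi> x = (\<Sum>b\<in>Basis. f (vs_scale V (sconj b) x) *\<^sub>R b)" for x
  have inner: "inner (\<phi> x) c = f (vs_scale V (sconj c) x)" if x: "x \<in> vs_carrier V" for x c
  proof -
    have lin: "linear (\<lambda>c. f (vs_scale V (sconj c) x))"
    proof
      show "f (vs_scale V (sconj (a + b)) x) = f (vs_scale V (sconj a) x) + f (vs_scale V (sconj b) x)" for a b
        using x by (simp add: sconj_add scale_left_distrib add closed)
      show "f (vs_scale V (sconj (r *\<^sub>R b)) x) = r *\<^sub>R f (vs_scale V (sconj b) x)" for r b
      proof -
        have "vs_scale V (sconj (r *\<^sub>R b)) x = vs_scale V (of_real r) (vs_scale V (sconj b) x)"
          using x by (simp only: sconj_scaleR scaleR_conv_of_real[of r "sconj b"] scale_scale)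
        then show ?thesis using x by (simp add: scale closed)
      qed
    qed
    have "f (vs_scale V (sconj c) x) = f (vs_scale V (sconj (\<Sum>b\<in>Basis. inner c b *\<^sub>R b)) x)"
      by (simp add: euclidean_representation)
    also have "\<dots> = (\<Sum>b\<in>Basis. inner c b * f (vs_scale V (sconj b) x))"
      using linear_sum[OF lin, of "\<lambda>b. inner c b *\<^sub>R b" Basis] linear_scale[OF lin] by simp
    also have "\<dots> = inner (\<phi> x) c"
      by (simp add: \<phi>_def inner_sum_left inner_commute[of c] mult.commute)
    finally show ?thesis by simp
  qed
  have bound: "norm (\<phi> x) \<le> vs_norm V x" if x: "x \<in> vs_carrier V" for x
  proof -
    \<comment> \<open>Testing with c = \<phi> x plays the role of rotating \<phi> x onto the
      positive axis, and avoids any loss of a constant in the passage from f to \<phi>.\<close>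
    have "(norm (\<phi> x))\<^sup>2 = f (vs_scale V (sconj (\<phi> x)) x)"
      by (simp add: power2_norm_eq_inner inner[OF x])
    also have "\<dots> \<le> norm (\<phi> x) * vs_norm V x"
      using le[of "vs_scale V (sconj (\<phi> x)) x"] x by (simp add: closed norm_scale)
    finally show ?thesis
      using norm_nonneg[OF x] by (cases "\<phi> x = 0") (auto simp: power2_eq_square)
  qed
  have dual: "\<phi> \<in> dual V"
  proof (rule operatorsI[of _ _ _ 1])
    show "\<phi> (vs_add V x y) = vs_add scalar_space (\<phi> x) (\<phi> y)"
      if "x \<in> vs_carrier V" "y \<in> vs_carrier V" for x y
      using that by (simp add: \<phi>_def scale_right_distrib add closed scaleR_left_distrib sum.distrib)
    show "\<phi> (vs_scale V c x) = vs_scale scalar_space c (\<phi> x)" if x: "x \<in> vs_carrier V" for c x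
    proof -
      have "inner (\<phi> (vs_scale V c x)) b = inner (c * \<phi> x) b" for b
        using x by (simp add: inner closed scale_scale inner_sconj sconj_mult mult.commute)
      then have "\<phi> (vs_scale V c x) = c * \<phi> x"
        using vector_eq_rdot by blast
      then show ?thesis by simp
    qed
  qed (simp_all add: V normed_space_scalar bound)
  have "sconj (1::'k) = 1" by (simp add: sconj_def)
  then have "vs_norm V x0 \<le> inner (\<phi> x0) 1"
    using inner[OF x0, of 1] f0 x0 by (simp add: scale_one)
  then have "vs_norm V x0 \<le> norm (\<phi> x0)"
    using norm_cauchy_schwarz[of "\<phi> x0" 1] by simp
  then have "norm (\<phi> x0) = vs_norm V x0" using bound[OF x0] by simp
  show thesis
    by (rule that[of \<phi>]) (fact dual, erule bound, fact)
qed

lemma dual_add: "\<phi> \<in> dual V \<Longrightarrow> x \<in> vs_carrier V \<Longrightarrow> y \<in> vs_carrier V \<Longrightarrow> \<phi> (vs_add V x y) = \<phi> x + \<phi> y"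
  using operators_simps(2)[of \<phi> V scalar_space x y] by simp

lemma dual_scale: "\<phi> \<in> dual V \<Longrightarrow> x \<in> vs_carrier V \<Longrightarrow> \<phi> (vs_scale V c x) = c * \<phi> x"
  using operators_simps(3)[of \<phi> V scalar_space x c] by simp

lemma dual_diff: "normed_space V \<Longrightarrow> \<phi> \<in> dual V \<Longrightarrow> x \<in> vs_carrier V \<Longrightarrow> y \<in> vs_carrier V \<Longrightarrow> \<phi> (vs_diff V x y) = \<phi> x - \<phi> y"
  using operators_diff[of \<phi> V scalar_space x y] by simp

lemma dual_bound:
  assumes "normed_space V" "\<phi> \<in> dual V"
  shows "\<exists>C>0. \<forall>x\<in>vs_carrier V. norm (\<phi> x) \<le> C * vs_norm V x"
  using operators_bound[OF assms(1) normed_space_scalar assms(2)] by simp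

lemma dualI:
  assumes "normed_space V"
    and "\<And>x y. \<lbrakk>x \<in> vs_carrier V; y \<in> vs_carrier V\<rbrakk> \<Longrightarrow> \<phi> (vs_add V x y) = \<phi> x + \<phi> y"
    and "\<And>c x. x \<in> vs_carrier V \<Longrightarrow> \<phi> (vs_scale V c x) = c * \<phi> x"
    and "\<And>x. x \<in> vs_carrier V \<Longrightarrow> norm (\<phi> x) \<le> C * vs_norm V x"
  shows "\<phi> \<in> dual V"
proof (rule operatorsI[OF assms(1) normed_space_scalar])
  show "\<phi> (vs_add V x y) = vs_add scalar_space (\<phi> x) (\<phi> y)"
    if "x \<in> vs_carrier V" "y \<in> vs_carrier V" for x y
    using assms(2)[OF that] by simp
  show "\<phi> (vs_scale V c x) = vs_scale scalar_space c (\<phi> x)" if "x \<in> vs_carrier V" for x c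
    using assms(3)[OF that] by simp
  show "vs_norm scalar_space (\<phi> x) \<le> C * vs_norm V x" if "x \<in> vs_carrier V" for x
    using assms(4)[OF that] by simp
qed simp

section \<open>Limits along an ultrafilter\<close>

text \<open>A minimal proper filter below \<open>sequentially\<close> is an ultrafilter: if P does
  not hold eventually, restricting the filter to the complement of P leaves it proper, so by
  minimality nothing changes and the complement holds eventually.\<close>

lemma ex_free_ultrafilter:
  "\<exists>U :: nat filter. U \<noteq> bot \<and> U \<le> sequentially \<and> (\<forall>P. eventually P U \<or> eventually (\<lambda>n. \<not> P n) U)"
proof -
  define A where "A = {F :: nat filter. F \<noteq> bot \<and> F \<le> sequentially}"
  define R where "R = (\<lambda>F G :: nat filter. G \<le> F)"
  have "\<exists>m\<in>A. \<forall>a\<in>A. R m a \<longrightarrow> a = m"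
  proof (rule predicate_Zorn)
    show "partial_order_on A (relation_of R A)"
      unfolding partial_order_on_def preorder_on_def refl_on_def trans_def antisym_def relation_of_def R_def
      by auto
    fix C assume "C \<in> Chains (relation_of R A)"
    then have CA: "C \<subseteq> A" and lin: "\<And>a b. a \<in> C \<Longrightarrow> b \<in> C \<Longrightarrow> a \<le> b \<or> b \<le> a"
      unfolding Chains_def relation_of_def R_def by auto
    show "\<exists>u\<in>A. \<forall>a\<in>C. R a u"
    proof (cases "C = {}")
      case True
      then show ?thesis by (intro bexI[of _ sequentially]) (auto simp: A_def)
    next
      case False
      have "\<not> eventually (\<lambda>_. False) (Inf C)"
        by (subst eventually_Inf_base)
          (use False CA lin in \<open>auto simp: A_def trivial_limit_def intro: inf_greatest\<close>)
      then have "Inf C \<noteq> bot" by (simp add: trivial_limit_def)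
      moreover have "Inf C \<le> sequentially"
        using False CA by (auto simp: A_def intro: Inf_lower2)
      ultimately show ?thesis
        by (intro bexI[of _ "Inf C"]) (auto simp: A_def R_def intro: Inf_lower)
    qed
  qed
  then obtain U where U: "U \<in> A" "\<forall>F\<in>A. F \<le> U \<longrightarrow> F = U"
    unfolding R_def by blast
  have "eventually (\<lambda>n. \<not> P n) U" if P: "\<not> eventually P U" for P
  proof -
    let ?F = "inf U (principal {n. \<not> P n})"
    have "?F \<noteq> bot"
      using P by (simp add: trivial_limit_def eventually_inf_principal)
    then have "?F \<in> A" using U(1) by (auto simp: A_def intro: le_infI1)
    then have "?F = U" using bspec[OF U(2)] by simp
    moreover have "eventually (\<lambda>n. \<not> P n) ?F"
      by (simp add: eventually_inf_principal)
    ultimately show ?thesis by metis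
  qed
  then show ?thesis using U(1) by (auto simp: A_def)
qed

text \<open>Fixing one ultrafilter gives all bounded scalar sequences a limit at the same time.
  Pointwise limits of functionals are then linear automatically, with no passage to subsequences,
  which could fail as the spaces need not be separable.\<close>

definition \<U> :: "nat filter" where
  "\<U> = (SOME U. U \<noteq> bot \<and> U \<le> sequentially \<and> (\<forall>P. eventually P U \<or> eventually (\<lambda>n. \<not> P n) U))"

lemma \<U>_nontrivial [simp]: "\<U> \<noteq> bot"
  and \<U>_le_sequentially: "\<U> \<le> sequentially"
  and \<U>_ultra: "eventually P \<U> \<or> eventually (\<lambda>n. \<not> P n) \<U>"
  using someI_ex[OF ex_free_ultrafilter] unfolding \<U>_def by auto

lemma tendsto_\<U>: "X \<longlonglongrightarrow> l \<Longrightarrow> (X \<longlongrightarrow> l) \<U>"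
  using \<U>_le_sequentially by (rule tendsto_mono)

lemma eventually_\<U>: "eventually P sequentially \<Longrightarrow> eventually P \<U>"
  using \<U>_le_sequentially by (simp add: filter_leD)

text \<open>A point that is not a limit has a neighbourhood that the sequence avoids eventually
  along \<open>\<U>\<close>, by the ultrafilter property. Finitely many such neighbourhoods would
  cover \<open>K\<close>, and the sequence would avoid all of them.\<close>

lemma compactin_\<U>_limit:
  assumes K: "compactin X K" and s: "\<And>n. s n \<in> K"
  shows "\<exists>l\<in>K. limitin X s l \<U>"
proof (rule ccontr)
  assume no: "\<not> ?thesis"
  have KX: "K \<subseteq> topspace X" using K by (simp add: compactin_def)
  have "\<exists>W. openin X W \<and> l \<in> W \<and> eventually (\<lambda>n. s n \<notin> W) \<U>" if l: "l \<in> K" for l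
  proof -
    obtain W where "openin X W" "l \<in> W" "\<not> eventually (\<lambda>n. s n \<in> W) \<U>"
      using no l KX unfolding limitin_def by blast
    then show ?thesis using \<U>_ultra[of "\<lambda>n. s n \<in> W"] by blast
  qed
  then obtain W where W: "\<And>l. l \<in> K \<Longrightarrow> openin X (W l)" "\<And>l. l \<in> K \<Longrightarrow> l \<in> W l"
    "\<And>l. l \<in> K \<Longrightarrow> eventually (\<lambda>n. s n \<notin> W l) \<U>"
    by metis
  have "\<exists>\<F>. finite \<F> \<and> \<F> \<subseteq> W ` K \<and> K \<subseteq> \<Union>\<F>"
    by (rule compactinD[OF K]) (use W(1,2) in auto)
  then obtain \<F> where \<F>: "finite \<F>" "\<F> \<subseteq> W ` K" "K \<subseteq> \<Union>\<F>" by blast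
  obtain L where L: "L \<subseteq> K" "finite L" "\<F> = W ` L"
    using finite_subset_image[OF \<F>(1,2)] by blast
  then have L: "finite L" "L \<subseteq> K" "K \<subseteq> (\<Union>l\<in>L. W l)"
    using \<F>(3) by auto
  have "eventually (\<lambda>n. \<forall>l\<in>L. s n \<notin> W l) \<U>"
    using L W(3) by (intro eventually_ball_finite) auto
  then have "eventually (\<lambda>n. False) \<U>"
    by (rule eventually_mono) (use L(3) s in blast)
  then show False by simp
qed

lemma \<U>_convergent:
  fixes X :: "nat \<Rightarrow> 'a::euclidean_space"
  assumes "\<And>n. norm (X n) \<le> C"
  shows "(X \<longlongrightarrow> Lim \<U> X) \<U>"
proof -
  have "compactin euclidean (cball 0 C :: 'a set)" by simp
  then obtain l where "limitin euclidean X l \<U>"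
    using compactin_\<U>_limit[of euclidean "cball 0 C" X] assms by auto
  then show ?thesis using tendsto_Lim[OF \<U>_nontrivial, of X l] by simp
qed

text \<open>Stands in for the Banach-Alaoglu theorem: a bounded sequence of functionals has a
  weak-star limit along \<open>\<U>\<close>, with the same bound.\<close>

lemma dual_Lim_\<U>:
  fixes V :: "('k::{real_normed_field, euclidean_space}, 'e) nspace"
  assumes V: "normed_space V" and h: "\<And>n. h n \<in> dual V"
    and le: "\<And>n x. x \<in> vs_carrier V \<Longrightarrow> norm (h n x) \<le> C * vs_norm V x"
  shows "(\<lambda>x. Lim \<U> (\<lambda>n. h n x)) \<in> dual V"
    and "\<And>x. x \<in> vs_carrier V \<Longrightarrow> ((\<lambda>n. h n x) \<longlongrightarrow> Lim \<U> (\<lambda>n. h n x)) \<U>"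
    and "\<And>x. x \<in> vs_carrier V \<Longrightarrow> norm (Lim \<U> (\<lambda>n. h n x)) \<le> C * vs_norm V x"
proof -
  interpret normed_space V by fact
  show lim: "((\<lambda>n. h n x) \<longlongrightarrow> Lim \<U> (\<lambda>n. h n x)) \<U>" if "x \<in> vs_carrier V" for x
    by (rule \<U>_convergent) (rule le[OF that])
  show bound: "norm (Lim \<U> (\<lambda>n. h n x)) \<le> C * vs_norm V x" if "x \<in> vs_carrier V" for x
    by (rule tendsto_upperbound[OF tendsto_norm[OF lim[OF that]]]) (use le[OF that] in auto)
  show "(\<lambda>x. Lim \<U> (\<lambda>n. h n x)) \<in> dual V"
  proof (rule dualI[OF V])
    fix x y assume x: "x \<in> vs_carrier V" and y: "y \<in> vs_carrier V"
    have "((\<lambda>n. h n (vs_add V x y)) \<longlongrightarrow> Lim \<U> (\<lambda>n. h n x) + Lim \<U> (\<lambda>n. h n y)) \<U>"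
      using tendsto_add[OF lim[OF x] lim[OF y]] by (simp add: dual_add[OF h x y])
    then show "Lim \<U> (\<lambda>n. h n (vs_add V x y)) = Lim \<U> (\<lambda>n. h n x) + Lim \<U> (\<lambda>n. h n y)"
      by (rule tendsto_Lim[OF \<U>_nontrivial])
  next
    fix c x assume x: "x \<in> vs_carrier V"
    have "((\<lambda>n. h n (vs_scale V c x)) \<longlongrightarrow> c * Lim \<U> (\<lambda>n. h n x)) \<U>"
      using tendsto_mult_left[OF lim[OF x]] by (simp add: dual_scale[OF h x])
    then show "Lim \<U> (\<lambda>n. h n (vs_scale V c x)) = c * Lim \<U> (\<lambda>n. h n x)"
      by (rule tendsto_Lim[OF \<U>_nontrivial])
  next
    show "norm (Lim \<U> (\<lambda>n. h n x)) \<le> C * vs_norm V x" if "x \<in> vs_carrier V" for x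
      using that by (rule bound)
  qed
qed

section \<open>Weakly bounded sequences\<close>

text \<open>A gliding hump: \<open>\<psi> (Suc k) = \<psi> k \<plusminus> 3\<^sup>-\<^sup>k u\<^sub>k\<close>, where \<open>u\<^sub>k\<close> norms the \<open>k\<close>-th vector and the sign
  keeps \<open>\<psi> (Suc k)\<close> large on it.\<close>

theorem weakly_bounded_imp_bounded:
  fixes V :: "('k::{real_normed_field, euclidean_space}, 'e) nspace"
  assumes V: "normed_space V" and z: "\<And>n. z n \<in> vs_carrier V"
    and weak: "\<And>\<phi>. \<phi> \<in> dual V \<Longrightarrow> \<exists>C. \<forall>n. norm (\<phi> (z n)) \<le> C"
  shows "\<exists>C. \<forall>n. vs_norm V (z n) \<le> C"
proof (rule ccontr)
  interpret normed_space V by fact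
  assume "\<not> ?thesis"
  then have "\<forall>k. \<exists>n. 4 ^ k < vs_norm V (z n)"
    by (meson not_le)
  then obtain r where r: "\<And>k::nat. 4 ^ k < vs_norm V (z (r k))" by metis
  define y where "y k = z (r k)" for k
  have y: "y k \<in> vs_carrier V" for k using z by (simp add: y_def)
  have "\<exists>\<phi>. \<phi> \<in> dual V \<and> (\<forall>x\<in>vs_carrier V. norm (\<phi> x) \<le> vs_norm V x) \<and> norm (\<phi> (y k)) = vs_norm V (y k)" for k
    by (rule norming_functional[OF V y[of k]]) blast
  then obtain u where u: "\<And>k. u k \<in> dual V" "\<And>k x. x \<in> vs_carrier V \<Longrightarrow> norm (u k x) \<le> vs_norm V x"
    "\<And>k. norm (u k (y k)) = vs_norm V (y k)"
    by metis
  define sg where "sg p k = (if norm (p (y k) + (1/3)^k *\<^sub>R u k (y k)) \<ge> (1/3)^k * vs_norm V (y k) then 1 else -1 :: real)"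
    for p :: "'e \<Rightarrow> 'k" and k :: nat
  define \<psi> where "\<psi> = rec_nat (\<lambda>_. 0) (\<lambda>k p x. p x + (sg p k * (1/3)^k) *\<^sub>R u k x)"
  have \<psi>_0: "\<psi> 0 = (\<lambda>_. 0)" and \<psi>_Suc: "\<psi> (Suc k) = (\<lambda>x. \<psi> k x + (sg (\<psi> k) k * (1/3)^k) *\<^sub>R u k x)" for k
    by (simp_all add: \<psi>_def)
  define t where "t k x = (sg (\<psi> k) k * (1/3)^k) *\<^sub>R u k x" for k x
  have \<psi>_sum: "\<psi> k x = (\<Sum>i<k. t i x)" for k x
    by (induction k) (auto simp: \<psi>_0 \<psi>_Suc t_def)
  have sg: "\<bar>sg p k\<bar> = 1" for p k by (simp add: sg_def)
  have t_le: "norm (t k x) \<le> (1/3)^k * vs_norm V x" if "x \<in> vs_carrier V" for k x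
    using u(2)[OF that, of k] by (simp add: t_def abs_mult sg mult_left_mono)
  have geo: "summable (\<lambda>k. (1/3)^k * c)" "suminf (\<lambda>k. (1/3)^(k + n) * c) = (1/3)^n * (3/2) * c" for c :: real and n
  proof -
    show "summable (\<lambda>k. (1/3)^k * c)" by (intro summable_mult2 summable_geometric) simp
    have "suminf (\<lambda>k. (1/3)^(k + n) * c) = suminf (\<lambda>k. (1/3)^k * ((1/3)^n * c))"
      by (simp add: power_add mult.assoc)
    also have "\<dots> = suminf (\<lambda>k. (1/3)^k) * ((1/3)^n * c)"
      by (rule suminf_mult2[symmetric]) (simp add: summable_geometric)
    also have "suminf (\<lambda>k. (1/3::real)^k) = 3/2" by (subst suminf_geometric) auto
    finally show "suminf (\<lambda>k. (1/3)^(k + n) * c) = (1/3)^n * (3/2) * c" by simp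
  qed
  have t_sum: "summable (\<lambda>k. t k x)" "summable (\<lambda>k. norm (t k x))" if "x \<in> vs_carrier V" for x
  proof -
    show *: "summable (\<lambda>k. norm (t k x))"
      by (rule summable_comparison_test'[OF geo(1)[of "vs_norm V x"]]) (use t_le[OF that] in simp)
    show "summable (\<lambda>k. t k x)" using * by (rule summable_norm_cancel)
  qed
  define \<phi> where "\<phi> x = suminf (\<lambda>k. t k x)" for x
  have \<phi>: "\<phi> \<in> dual V"
  proof (rule dualI[OF V])
    fix x y assume x: "x \<in> vs_carrier V" and y: "y \<in> vs_carrier V"
    have "t k (vs_add V x y) = t k x + t k y" for k
      by (simp add: t_def dual_add[OF u(1) x y] scaleR_right_distrib)
    then show "\<phi> (vs_add V x y) = \<phi> x + \<phi> y"
      using suminf_add[OF t_sum(1)[OF x] t_sum(1)[OF y]] by (simp add: \<phi>_def)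
  next
    fix c x assume x: "x \<in> vs_carrier V"
    have "t k (vs_scale V c x) = c * t k x" for k
      by (simp add: t_def dual_scale[OF u(1) x])
    then show "\<phi> (vs_scale V c x) = c * \<phi> x"
      using suminf_mult[OF t_sum(1)[OF x]] by (simp add: \<phi>_def)
  next
    fix x assume x: "x \<in> vs_carrier V"
    have "norm (\<phi> x) \<le> suminf (\<lambda>k. norm (t k x))"
      unfolding \<phi>_def by (rule summable_norm[OF t_sum(2)[OF x]])
    also have "\<dots> \<le> suminf (\<lambda>k. (1/3)^k * vs_norm V x)"
      by (rule suminf_le[OF t_le[OF x] t_sum(2)[OF x] geo(1)])
    also have "\<dots> = 3/2 * vs_norm V x" using geo(2)[of 0 "vs_norm V x"] by simp
    finally show "norm (\<phi> x) \<le> 3/2 * vs_norm V x" .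
  qed
  have hump: "norm (\<psi> (Suc k) (y k)) \<ge> (1/3)^k * vs_norm V (y k)" for k
  proof (cases "norm (\<psi> k (y k) + (1/3)^k *\<^sub>R u k (y k)) \<ge> (1/3)^k * vs_norm V (y k)")
    case True
    then show ?thesis by (simp add: \<psi>_Suc sg_def)
  next
    case False
    \<comment> \<open>Twice a vector is the difference of its two translates by the same amount, so
      one of the two signs keeps at least the norm of the added term. If the sign + fails, the sign
      - succeeds.\<close>
    have "2 * ((1/3)^k * vs_norm V (y k)) = norm (2 *\<^sub>R ((1/3)^k *\<^sub>R u k (y k)))"
      by (simp add: u(3))
    also have "2 *\<^sub>R ((1/3)^k *\<^sub>R u k (y k))
        = (\<psi> k (y k) + (1/3)^k *\<^sub>R u k (y k)) - (\<psi> k (y k) - (1/3)^k *\<^sub>R u k (y k))"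
      unfolding scaleR_2 by simp
    also have "norm \<dots> \<le> norm (\<psi> k (y k) + (1/3)^k *\<^sub>R u k (y k)) + norm (\<psi> k (y k) - (1/3)^k *\<^sub>R u k (y k))"
      by (rule norm_triangle_ineq4)
    finally show ?thesis using False by (simp add: \<psi>_Suc sg_def)
  qed
  \<comment> \<open>With ratio 1/3 the terms after the k-th amount to at most half of the k-th
    bound, so half of the hump survives. As the k-th vector has norm above 4^k, at least (4/3)^k / 2
    is left, which is unbounded.\<close>
  have big: "norm (\<phi> (y k)) \<ge> (4/3)^k / 2" for k
  proof -
    have "\<phi> (y k) = suminf (\<lambda>j. t (j + Suc k) (y k)) + \<psi> (Suc k) (y k)"
      unfolding \<phi>_def \<psi>_sum by (rule suminf_split_initial_segment[OF t_sum(1)[OF y]])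
    then have *: "norm (\<psi> (Suc k) (y k)) \<le> norm (\<phi> (y k)) + norm (suminf (\<lambda>j. t (j + Suc k) (y k)))"
      by (metis add_diff_cancel_left' norm_triangle_ineq4)
    have "norm (suminf (\<lambda>j. t (j + Suc k) (y k))) \<le> suminf (\<lambda>j. norm (t (j + Suc k) (y k)))"
      by (intro summable_norm summable_ignore_initial_segment t_sum y)
    also have "\<dots> \<le> suminf (\<lambda>j. (1/3)^(j + Suc k) * vs_norm V (y k))"
      by (rule suminf_le[OF t_le[OF y] summable_ignore_initial_segment[OF t_sum(2)[OF y]]
            summable_ignore_initial_segment[OF geo(1)]])
    also have "\<dots> = (1/3)^k * vs_norm V (y k) / 2" by (subst geo(2)) simp
    finally have "norm (\<phi> (y k)) \<ge> (1/3)^k * vs_norm V (y k) / 2"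
      using hump[of k] * by linarith
    moreover have "(1/3)^k * 4^k \<le> (1/3)^k * vs_norm V (y k)"
      using r[of k] by (intro mult_left_mono) (auto simp: y_def)
    moreover have "(1/3)^k * 4^k = (4/3::real)^k" by (simp add: power_divide)
    ultimately show ?thesis by linarith
  qed
  obtain C where C: "\<And>n. norm (\<phi> (z n)) \<le> C" using weak[OF \<phi>] by blast
  obtain k where "2 * C < (4/3)^k" using real_arch_pow[of "4/3" "2 * C"] by auto
  then show False using big[of k] C[of "r k"] by (simp add: y_def)
qed

section \<open>Weakly unconditionally Cauchy series\<close>

primrec vsum :: "('k, 'e) nspace \<Rightarrow> (nat \<Rightarrow> 'e) \<Rightarrow> nat \<Rightarrow> 'e" where
  "vsum V s 0 = vs_zero V"
| "vsum V s (Suc n) = vs_add V (vsum V s n) (s n)"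

lemma vsum_closed: "normed_space V \<Longrightarrow> (\<And>i. s i \<in> vs_carrier V) \<Longrightarrow> vsum V s n \<in> vs_carrier V"
  by (induction n) (auto simp: normed_space.closed)

lemma dual_vsum:
  assumes V: "normed_space V" and "\<phi> \<in> dual V" "\<And>i. s i \<in> vs_carrier V"
  shows "\<phi> (vsum V s n) = (\<Sum>i<n. \<phi> (s i))"
proof (induction n)
  case 0
  have "\<phi> (vs_scale V 0 (vs_zero V)) = 0 * \<phi> (vs_zero V)"
    using assms by (intro dual_scale) (auto simp: normed_space.closed)
  then show ?case using V by (simp add: normed_space.scale_zero_right)
next
  case (Suc n)
  have "\<phi> (vsum V s (Suc n)) = \<phi> (vsum V s n) + \<phi> (s n)"
    using dual_add[of \<phi> V "vsum V s n" "s n"] assms by (simp add: vsum_closed)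
  then show ?case using Suc by simp
qed

lemma dual_comp:
  assumes V: "normed_space V" and W: "normed_space W" and T: "T \<in> operators V W" and \<phi>: "\<phi> \<in> dual W"
  shows "(\<lambda>x. \<phi> (T x)) \<in> dual V"
proof -
  obtain C where C: "C > 0" "\<And>x. x \<in> vs_carrier V \<Longrightarrow> vs_norm W (T x) \<le> C * vs_norm V x"
    using operators_bound[OF V W T] by blast
  obtain D where D: "D > 0" "\<And>x. x \<in> vs_carrier W \<Longrightarrow> norm (\<phi> x) \<le> D * vs_norm W x"
    using dual_bound[OF W \<phi>] by blast
  show ?thesis
  proof (rule dualI[OF V])
    fix x y assume x: "x \<in> vs_carrier V" and y: "y \<in> vs_carrier V"
    note * = operators_simps(1,2)[OF T x] operators_simps(1)[OF T y] y
    show "\<phi> (T (vs_add V x y)) = \<phi> (T x) + \<phi> (T y)"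
      unfolding *(2)[OF y] by (rule dual_add[OF \<phi>]) (rule *)+
  next
    fix c x assume x: "x \<in> vs_carrier V"
    show "\<phi> (T (vs_scale V c x)) = c * \<phi> (T x)"
      unfolding operators_simps(3)[OF T x] by (rule dual_scale[OF \<phi> operators_simps(1)[OF T x]])
  next
    fix x assume x: "x \<in> vs_carrier V"
    have "norm (\<phi> (T x)) \<le> D * vs_norm W (T x)" by (rule D(2)[OF operators_simps(1)[OF T x]])
    also have "\<dots> \<le> D * (C * vs_norm V x)" using C(2)[OF x] D(1) by (intro mult_left_mono) auto
    finally show "norm (\<phi> (T x)) \<le> D * C * vs_norm V x" by simp
  qed
qed

text \<open>A new index meets only finitely many conditions, each true eventually along
  \<open>\<U>\<close>, hence all true at once somewhere. In \<open>R k i j\<close> the number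
  \<open>k\<close> is the position of the new index \<open>j\<close>, so that tolerances can shrink
  along the subsequence.\<close>

lemma ultrafilter_subsequence:
  assumes Q: "eventually Q \<U>" and R: "\<And>k i. eventually (R k i) \<U>"
  shows "\<exists>r :: nat \<Rightarrow> nat. strict_mono r \<and> (\<forall>k. Q (r k)) \<and> (\<forall>k. \<forall>l<k. R k (r l) (r k))"
proof -
  have "\<exists>f. \<forall>k. Q (f k) \<and> (\<forall>l<k. f l < f k \<and> R k (f l) (f k))"
  proof (rule dependent_wellorder_choice)
    fix r :: nat and f g :: "nat \<Rightarrow> nat" and x :: nat
    assume "\<And>y. y < x \<Longrightarrow> f y = g y"
    then show "(Q r \<and> (\<forall>l<x. f l < r \<and> R x (f l) r)) = (Q r \<and> (\<forall>l<x. g l < r \<and> R x (g l) r))" by auto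
  next
    fix k :: nat and f :: "nat \<Rightarrow> nat"
    have "eventually (\<lambda>j. Q j \<and> (\<forall>l\<in>{..<k}. f l < j \<and> R k (f l) j)) \<U>"
      by (intro eventually_conj Q eventually_ball_finite ballI R eventually_\<U> eventually_gt_at_top) simp
    then obtain j where "Q j \<and> (\<forall>l\<in>{..<k}. f l < j \<and> R k (f l) j)"
      using eventually_happens[of _ \<U>] by auto
    then show "\<exists>r. Q r \<and> (\<forall>l<k. f l < r \<and> R k (f l) r)" by auto
  qed
  then obtain f where f: "\<And>k. Q (f k)" "\<And>k l. l < k \<Longrightarrow> f l < f k \<and> R k (f l) (f k)" by blast
  show ?thesis
    by (rule exI[of _ f]) (use f in \<open>auto simp: strict_mono_def\<close>)
qed

text \<open>Coefficients that align the phases turn the sums into sums of norms, so \<open>a\<close>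
  is even absolutely summable.\<close>

lemma bounded_signed_sums_imp_null:
  fixes a :: "nat \<Rightarrow> 'k::real_normed_field"
  assumes "\<And>c n. (\<And>l. norm (c l) \<le> 1) \<Longrightarrow> norm (\<Sum>l<n. c l * a l) \<le> C"
  shows "a \<longlonglongrightarrow> 0"
proof -
  define c where "c l = (if a l = 0 then 0 else of_real (norm (a l)) / a l)" for l
  have c: "norm (c l) \<le> 1" "c l * a l = of_real (norm (a l))" for l
    by (auto simp: c_def norm_divide)
  have "(\<Sum>l<n. norm (a l)) \<le> C" for n
  proof -
    have "norm (\<Sum>l<n. c l * a l) = norm (of_real (\<Sum>l<n. norm (a l)) :: 'k)" by (simp add: c(2))
    also have "\<dots> = (\<Sum>l<n. norm (a l))" unfolding norm_of_real by (simp add: sum_nonneg)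
    finally show ?thesis using assms[of c n] c(1) by simp
  qed
  then have "summable (\<lambda>l. norm (a l))"
    by (intro bounded_imp_summable[of _ C]) (use lessThan_Suc_atMost in \<open>metis norm_ge_zero\<close>)+
  then show ?thesis using summable_LIMSEQ_zero tendsto_norm_zero_iff by blast
qed

lemma not_tendsto_zero_subsequence:
  fixes a :: "nat \<Rightarrow> real"
  assumes "\<not> a \<longlonglongrightarrow> 0" and pos: "\<And>n. a n \<ge> 0"
  shows "\<exists>d>0. \<exists>r :: nat \<Rightarrow> nat. strict_mono r \<and> (\<forall>n. a (r n) \<ge> d)"
proof -
  obtain d where d: "d > 0" "\<not> eventually (\<lambda>n. a n < d) sequentially"
    using assms(1) unfolding tendsto_iff by (auto simp: abs_of_nonneg[OF pos])
  have inf: "infinite {n. a n \<ge> d}"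
  proof
    assume "finite {n. a n \<ge> d}"
    then have "eventually (\<lambda>n. \<not> a n \<ge> d) cofinite" by (simp add: eventually_cofinite)
    then have "eventually (\<lambda>n. a n < d) sequentially" by (simp add: cofinite_eq_sequentially not_le)
    then show False using d(2) by blast
  qed
  show ?thesis
    using d(1) strict_mono_enumerate[OF inf] enumerate_in_set[OF inf] by blast
qed

text \<open>If not, norming functionals \<open>h\<^sub>i\<close> of \<open>T x\<^sub>i\<close>, minus their limit along the ultrafilter, have
  almost diagonal values on a subsequence. The two iterated limits of these functionals on the
  partial sums then differ, although relative weak compactness forces them to agree.\<close>

theorem weakly_compact_operator_wuc:
  fixes V :: "('k::{real_normed_field, euclidean_space}, 'e) nspace"
  assumes V: "normed_space V" and W: "normed_space W" and wc: "weakly_compact_operator V W T"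
    and x: "\<And>n. x n \<in> vs_carrier V"
    and bnd: "\<And>r c n. strict_mono r \<Longrightarrow> (\<And>l. norm (c l) \<le> 1)
      \<Longrightarrow> vs_norm V (vsum V (\<lambda>l. vs_scale V (c l) (x (r l))) n) \<le> C"
  shows "(\<lambda>n. vs_norm W (T (x n))) \<longlonglongrightarrow> 0"
proof (rule ccontr)
  interpret V: normed_space V by fact
  interpret W: normed_space W by fact
  have T: "T \<in> operators V W" using wc by (simp add: weakly_compact_operator_def)
  have TW: "T v \<in> vs_carrier W" if "v \<in> vs_carrier V" for v using operators_simps(1)[OF T that] .
  assume neg: "\<not> ?thesis"
  obtain d and \<rho> :: "nat \<Rightarrow> nat" where d: "d > 0" and \<rho>: "strict_mono \<rho>" and big: "\<And>n. d \<le> vs_norm W (T (x (\<rho> n)))"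
    using not_tendsto_zero_subsequence[OF neg W.norm_nonneg[OF TW[OF x]]] by blast
  define y where "y n = x (\<rho> n)" for n
  have y: "y n \<in> vs_carrier V" "T (y n) \<in> vs_carrier W" for n using x TW by (simp_all add: y_def)
  have bnd_y: "vs_norm V (vsum V (\<lambda>l. vs_scale V (c l) (y (r l))) n) \<le> C"
    if "strict_mono r" "\<And>l. norm (c l) \<le> 1" for r c n
    using bnd[OF strict_mono_o[OF \<rho> that(1)], of c n] that by (simp add: y_def o_def)
  have null: "(\<lambda>n. \<phi> (T (y n))) \<longlonglongrightarrow> 0" if \<phi>: "\<phi> \<in> dual W" for \<phi>
  proof -
    obtain D where D: "D > 0" "\<forall>v\<in>vs_carrier V. norm (\<phi> (T v)) \<le> D * vs_norm V v"
      using dual_bound[OF V dual_comp[OF V W T \<phi>]] by blast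
    show ?thesis
    proof (rule bounded_signed_sums_imp_null)
      fix c :: "nat \<Rightarrow> 'k" and n assume c: "\<And>l. norm (c l) \<le> 1"
      let ?s = "vsum V (\<lambda>l. vs_scale V (c l) (y l)) n"
      have "\<phi> (T ?s) = (\<Sum>l<n. \<phi> (T (vs_scale V (c l) (y l))))"
        by (rule dual_vsum[OF V dual_comp[OF V W T \<phi>]]) (simp add: y V.closed)
      also have "\<dots> = (\<Sum>l<n. c l * \<phi> (T (y l)))"
        by (intro sum.cong refl dual_scale[OF dual_comp[OF V W T \<phi>] y(1)])
      finally have "norm (\<Sum>l<n. c l * \<phi> (T (y l))) \<le> D * vs_norm V ?s"
        using bspec[OF D(2), of ?s] vsum_closed[OF V, of "\<lambda>l. vs_scale V (c l) (y l)" n] y V.closed by simp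
      also have "\<dots> \<le> D * C"
        using bnd_y[of id c n] c D(1) by (intro mult_left_mono) (auto simp: strict_mono_def)
      finally show "norm (\<Sum>l<n. c l * \<phi> (T (y l))) \<le> D * C" .
    qed
  qed
  have "\<exists>\<phi>. \<phi> \<in> dual W \<and> (\<forall>w\<in>vs_carrier W. norm (\<phi> w) \<le> vs_norm W w) \<and> norm (\<phi> (T (y n))) = vs_norm W (T (y n))" for n
    by (rule norming_functional[OF W y(2)[of n]]) blast
  then obtain h where h: "\<And>n. h n \<in> dual W" "\<And>n w. w \<in> vs_carrier W \<Longrightarrow> norm (h n w) \<le> 1 * vs_norm W w"
    "\<And>n. norm (h n (T (y n))) = vs_norm W (T (y n))"
    by (metis mult_1)
  define h0 where "h0 = (\<lambda>w. Lim \<U> (\<lambda>n. h n w))"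
  have h0: "h0 \<in> dual W"
    "\<And>w. w \<in> vs_carrier W \<Longrightarrow> ((\<lambda>n. h n w) \<longlongrightarrow> h0 w) \<U>"
    "\<And>w. w \<in> vs_carrier W \<Longrightarrow> norm (h0 w) \<le> 1 * vs_norm W w"
    unfolding h0_def by (rule dual_Lim_\<U>[OF W h(1,2)]; assumption)+
  \<comment> \<open>Subtracting the weak-star limit makes the functionals small at each fixed
    vector. On the diagonal little is lost, because \<open>h0\<close> tends to 0 along the vectors T
    (y n) by \<open>null\<close>.\<close>
  define g where "g n w = h n w - h0 w" for n w
  have g_lim: "((\<lambda>n. g n w) \<longlongrightarrow> 0) \<U>" if "w \<in> vs_carrier W" for w
    using h0(2)[OF that] unfolding g_def by (rule LIM_zero)
  have g_bound: "norm (g n w) \<le> 2 * vs_norm W w" if "w \<in> vs_carrier W" for n w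
    using norm_triangle_ineq4[of "h n w" "h0 w"] h(2)[OF that, of n] h0(3)[OF that] by (simp add: g_def)
  have g: "g n \<in> dual W" for n
  proof (rule dualI[OF W])
    show "norm (g n w) \<le> 2 * vs_norm W w" if "w \<in> vs_carrier W" for w using that by (rule g_bound)
    show "g n (vs_add W v w) = g n v + g n w" if "v \<in> vs_carrier W" "w \<in> vs_carrier W" for v w
      by (simp add: g_def dual_add[OF h(1) that] dual_add[OF h0(1) that])
    show "g n (vs_scale W c w) = c * g n w" if "w \<in> vs_carrier W" for c w
      by (simp add: g_def dual_scale[OF h(1) that] dual_scale[OF h0(1) that] right_diff_distrib)
  qed
  define Q where "Q j \<longleftrightarrow> norm (h0 (T (y j))) < d / 2" for j
  \<comment> \<open>The row entries before the diagonal, k of them, are each below d / (8 (k + 1)),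
    so they sum to at most d/8. The entries after it are dominated by d/16 times powers of 1/2,
    again at most d/8. The diagonal entry is at least d/2, so d/4 remains in
    \<open>lower\<close>.\<close>
  define R where "R k i j \<longleftrightarrow> norm (g j (T (y i))) < d / (8 * (real k + 1)) \<and>
    norm (g i (T (y j))) < d / 16 * (1/2) ^ k" for k i j
  have "\<exists>r. strict_mono r \<and> (\<forall>k. Q (r k)) \<and> (\<forall>k. \<forall>l<k. R k (r l) (r k))"
  proof (rule ultrafilter_subsequence[of Q R])
    show "eventually Q \<U>" unfolding Q_def
      using order_tendstoD(2)[OF tendsto_norm[OF tendsto_\<U>[OF null[OF h0(1)]]], of "d/2"] d by simp
    show "eventually (R k i) \<U>" for k i
      unfolding R_def
    proof (rule eventually_conj)
      show "\<forall>\<^sub>F j in \<U>. norm (g j (T (y i))) < d / (8 * (real k + 1))"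
        using order_tendstoD(2)[OF tendsto_norm[OF g_lim[OF y(2)]], of "d / (8 * (real k + 1))" i] d by simp
      show "\<forall>\<^sub>F j in \<U>. norm (g i (T (y j))) < d / 16 * (1 / 2) ^ k"
        using order_tendstoD(2)[OF tendsto_norm[OF tendsto_\<U>[OF null[OF g]]], of "d / 16 * (1 / 2) ^ k" i] d by simp
    qed
  qed
  then obtain r where r: "strict_mono r" "\<And>k. Q (r k)" "\<And>k l. l < k \<Longrightarrow> R k (r l) (r k)"
    by blast
  define X where "X m = vsum V (\<lambda>l. y (r l)) m" for m
  have X: "X m \<in> vs_carrier V" for m unfolding X_def by (rule vsum_closed[OF V y(1)])
  have X_bound: "vs_norm V (X m) \<le> C" for m
    using bnd_y[OF r(1), of "\<lambda>_. 1" m] y by (simp add: X_def V.scale_one)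
  have gX: "\<phi> (T (X m)) = (\<Sum>i<m. \<phi> (T (y (r i))))" if "\<phi> \<in> dual W" for \<phi> m
    using dual_vsum[OF V dual_comp[OF V W T that], of "\<lambda>l. y (r l)" m] y(1) by (simp add: X_def)
  \<comment> \<open>The partial sums with all coefficients 1 are bounded, so their images have a
    weak limit \<open>l\<close> along \<open>\<U>\<close>. For fixed k, letting m run gives |g (r k)
    l| \<ge> d/4, one of the two iterated limits.\<close>
  let ?K = "weak_topology W closure_of (T ` range X)"
  have "norm_bounded V (range X)"
    using X X_bound unfolding norm_bounded_def by blast
  then have "compactin (weak_topology W) ?K"
    using wc unfolding weakly_compact_operator_def by blast
  moreover have "T (X m) \<in> ?K" for m
    by (rule subsetD[OF closure_of_subset]) (use X TW in \<open>auto simp: topspace_weak[OF W]\<close>)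
  ultimately have "\<exists>l\<in>?K. limitin (weak_topology W) (\<lambda>m. T (X m)) l \<U>"
    by (rule compactin_\<U>_limit)
  then obtain l where "limitin (weak_topology W) (\<lambda>m. T (X m)) l \<U>" by blast
  then have l: "l \<in> vs_carrier W" "\<And>\<phi>. \<phi> \<in> dual W \<Longrightarrow> ((\<lambda>m. \<phi> (T (X m))) \<longlongrightarrow> \<phi> l) \<U>"
    using limitin_weak_iff[of W "\<lambda>m. T (X m)" l \<U>, OF W TW[OF X]] by auto
  have lower: "norm (g (r k) (T (X m))) \<ge> d / 4" if "k < m" for k m
  proof -
    have main: "norm (g (r k) (T (y (r k)))) \<ge> d / 2"
    proof -
      have "d \<le> norm (h (r k) (T (y (r k))))" using h(3) big by (simp add: y_def)
      also have "h (r k) (T (y (r k))) = g (r k) (T (y (r k))) + h0 (T (y (r k)))" by (simp add: g_def)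
      also have "norm \<dots> \<le> norm (g (r k) (T (y (r k)))) + norm (h0 (T (y (r k))))" by (rule norm_triangle_ineq)
      finally show ?thesis using r(2)[of k] by (simp add: Q_def)
    qed
    have lo: "norm (\<Sum>i<k. g (r k) (T (y (r i)))) \<le> d / 8"
    proof -
      have "norm (\<Sum>i<k. g (r k) (T (y (r i)))) \<le> (\<Sum>i<k. d / (8 * (real k + 1)))"
        by (rule sum_norm_le) (use r(3) in \<open>auto simp: R_def less_imp_le\<close>)
      also have "\<dots> \<le> d / 8" using d by (simp add: field_simps)
      finally show ?thesis .
    qed
    have hi: "norm (\<Sum>i\<in>{Suc k..<m}. g (r k) (T (y (r i)))) \<le> d / 8"
    proof -
      have "norm (\<Sum>i\<in>{Suc k..<m}. g (r k) (T (y (r i)))) \<le> (\<Sum>i\<in>{Suc k..<m}. d / 16 * (1/2) ^ i)"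
        by (rule sum_norm_le) (use r(3) in \<open>auto simp: R_def less_imp_le\<close>)
      also have "\<dots> \<le> (\<Sum>i<m. d / 16 * (1/2) ^ i)"
        by (rule sum_mono2) (use d in auto)
      also have "\<dots> = d / 16 * (\<Sum>i<m. (1/2) ^ i)" by (simp only: sum_distrib_left)
      also have "\<dots> \<le> d / 16 * 2"
        using d by (intro mult_left_mono) (auto simp: sum_gp_strict)
      also have "\<dots> = d / 8" by simp
      finally show ?thesis .
    qed
    have "{..<m} = {..<k} \<union> insert k {Suc k..<m}" using that by auto
    then have "g (r k) (T (X m)) = (\<Sum>i\<in>{..<k} \<union> insert k {Suc k..<m}. g (r k) (T (y (r i))))"
      by (simp add: gX[OF g])
    also have "\<dots> = (\<Sum>i<k. g (r k) (T (y (r i)))) +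
        (g (r k) (T (y (r k))) + (\<Sum>i\<in>{Suc k..<m}. g (r k) (T (y (r i)))))"
      by (subst sum.union_disjoint) auto
    finally have eq: "g (r k) (T (y (r k))) = g (r k) (T (X m)) - (\<Sum>i<k. g (r k) (T (y (r i))))
        - (\<Sum>i\<in>{Suc k..<m}. g (r k) (T (y (r i))))" by simp
    have "norm (g (r k) (T (y (r k)))) \<le> norm (g (r k) (T (X m))) +
        norm (\<Sum>i<k. g (r k) (T (y (r i)))) + norm (\<Sum>i\<in>{Suc k..<m}. g (r k) (T (y (r i))))"
      unfolding eq by (rule order_trans[OF norm_triangle_ineq4 add_right_mono[OF norm_triangle_ineq4]])
    then show ?thesis using main lo hi by linarith
  qed
  have lower_l: "norm (g (r k) l) \<ge> d / 4" for k
  proof (rule tendsto_lowerbound[OF tendsto_norm[OF l(2)[OF g]]])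
    show "\<forall>\<^sub>F m in \<U>. d / 4 \<le> norm (g (r k) (T (X m)))"
      by (rule eventually_mono[OF eventually_\<U>[OF eventually_gt_at_top[of k]]]) (rule lower)
  qed simp
  \<comment> \<open>The other order of limits: for a fixed vector T (y (r i)) the functionals g (r
    k) tend to 0 in k, so their limit \<gamma> kills every partial sum and hence, by weak
    convergence, also \<open>l\<close>.\<close>
  define \<gamma> where "\<gamma> = (\<lambda>w. Lim \<U> (\<lambda>k. g (r k) w))"
  have \<gamma>: "\<gamma> \<in> dual W" "\<And>w. w \<in> vs_carrier W \<Longrightarrow> ((\<lambda>k. g (r k) w) \<longlongrightarrow> \<gamma> w) \<U>"
    unfolding \<gamma>_def by (rule dual_Lim_\<U>[where h = "\<lambda>k. g (r k)", OF W g g_bound]; assumption)+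
  have "\<gamma> (T (y (r i))) = 0" for i
  proof -
    have "(\<lambda>k. d / 8 * inverse (real (Suc k))) \<longlonglongrightarrow> d / 8 * 0"
      by (intro tendsto_mult_left LIMSEQ_inverse_real_of_nat)
    then have "(\<lambda>k. d / (8 * (real k + 1))) \<longlonglongrightarrow> 0"
      by (simp add: field_simps)
    then have "(\<lambda>k. g (r k) (T (y (r i)))) \<longlonglongrightarrow> 0"
    proof (rule Lim_null_comparison[rotated])
      show "\<forall>\<^sub>F k in sequentially. norm (g (r k) (T (y (r i)))) \<le> d / (8 * (real k + 1))"
        by (rule eventually_mono[OF eventually_gt_at_top[of i]]) (use r(3) in \<open>auto simp: R_def less_imp_le\<close>)
    qed
    then show ?thesis
      unfolding \<gamma>_def by (intro tendsto_Lim \<U>_nontrivial tendsto_\<U>)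
  qed
  then have "\<gamma> (T (X m)) = 0" for m by (simp add: gX[OF \<gamma>(1)])
  then have "\<gamma> l = 0"
    using l(2)[OF \<gamma>(1)] tendsto_unique[OF \<U>_nontrivial, of "\<lambda>_. 0" "\<gamma> l" 0] by simp
  moreover have "norm (\<gamma> l) \<ge> d / 4"
    by (rule tendsto_lowerbound[OF tendsto_norm[OF \<gamma>(2)[OF l(1)]]]) (use lower_l in auto)
  ultimately show False using d by simp
qed

section \<open>The completion\<close>

definition cclass :: "('k::real_normed_field, 'e) nspace \<Rightarrow> (nat \<Rightarrow> 'e) \<Rightarrow> (nat \<Rightarrow> 'e) set" where
  "cclass V s = null_rel V `` {s}"

text \<open>One notion covers both extended functionals and the norm: \<open>vs_norm\<close> of the
  completion is exactly this expression for the norm of \<open>V\<close>.\<close>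

definition completion_ext :: "('e \<Rightarrow> 'b::banach) \<Rightarrow> (nat \<Rightarrow> 'e) set \<Rightarrow> 'b" where
  "completion_ext f z = (THE r. \<forall>s\<in>z. (\<lambda>n. f (s n)) \<longlonglongrightarrow> r)"

context normed_space
begin

lemma cauchy_seqs_iff:
  "s \<in> cauchy_seqs V \<longleftrightarrow> (\<forall>n. s n \<in> vs_carrier V) \<and>
    (\<forall>e>0. \<exists>N. \<forall>m\<ge>N. \<forall>n\<ge>N. vs_norm V (vs_diff V (s m) (s n)) < e)"
  unfolding cauchy_seqs_def mem_Collect_eq Metric_space.MCauchy_def[OF Metric_space]
  by (auto simp: vs_dist_def image_subset_iff)

lemma cauchy_seqs_closed: "s \<in> cauchy_seqs V \<Longrightarrow> s n \<in> vs_carrier V"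
  by (simp add: cauchy_seqs_iff)

lemma cauchy_seqsI:
  assumes t: "\<And>n. t n \<in> vs_carrier V" and s: "s \<in> cauchy_seqs V"
    and le: "\<And>m n. vs_norm V (vs_diff V (t m) (t n)) \<le> C * vs_norm V (vs_diff V (s m) (s n))"
  shows "t \<in> cauchy_seqs V"
  unfolding cauchy_seqs_iff
proof (intro conjI allI impI)
  fix e :: real assume e: "e > 0"
  obtain N where N: "\<And>m n. m \<ge> N \<Longrightarrow> n \<ge> N \<Longrightarrow> vs_norm V (vs_diff V (s m) (s n)) < e / (\<bar>C\<bar> + 1)"
    using s e unfolding cauchy_seqs_iff by (meson abs_ge_zero add_nonneg_pos divide_pos_pos zero_less_one)
  have "vs_norm V (vs_diff V (t m) (t n)) < e" if "m \<ge> N" "n \<ge> N" for m n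
  proof -
    have "vs_norm V (vs_diff V (t m) (t n)) \<le> C * vs_norm V (vs_diff V (s m) (s n))" by (rule le)
    also have "\<dots> \<le> (\<bar>C\<bar> + 1) * vs_norm V (vs_diff V (s m) (s n))"
      by (intro mult_right_mono norm_nonneg closed cauchy_seqs_closed s) simp
    also have "\<dots> < e" using N[OF that] by (simp add: field_simps)
    finally show ?thesis .
  qed
  then show "\<exists>N. \<forall>m\<ge>N. \<forall>n\<ge>N. vs_norm V (vs_diff V (t m) (t n)) < e" by blast
qed (rule t)

lemma cauchy_seqs_const: "v \<in> vs_carrier V \<Longrightarrow> (\<lambda>_. v) \<in> cauchy_seqs V"
  by (simp add: cauchy_seqs_iff diff_self)

lemma cauchy_seqs_scale: "s \<in> cauchy_seqs V \<Longrightarrow> (\<lambda>n. vs_scale V c (s n)) \<in> cauchy_seqs V"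
  by (rule cauchy_seqsI[of _ s "norm c"]) (auto simp: closed cauchy_seqs_closed norm_scale simp flip: scale_diff)

lemma cauchy_seqs_add:
  assumes s: "s \<in> cauchy_seqs V" and t: "t \<in> cauchy_seqs V"
  shows "(\<lambda>n. vs_add V (s n) (t n)) \<in> cauchy_seqs V"
  unfolding cauchy_seqs_iff
proof (intro conjI allI impI)
  note c = cauchy_seqs_closed[OF s] cauchy_seqs_closed[OF t]
  show "vs_add V (s n) (t n) \<in> vs_carrier V" for n using c by (simp add: closed)
  fix e :: real assume e: "e > 0"
  obtain M where M: "\<And>m n. m \<ge> M \<Longrightarrow> n \<ge> M \<Longrightarrow> vs_norm V (vs_diff V (s m) (s n)) < e / 2"
    using s e unfolding cauchy_seqs_iff by (meson half_gt_zero)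
  obtain N where N: "\<And>m n. m \<ge> N \<Longrightarrow> n \<ge> N \<Longrightarrow> vs_norm V (vs_diff V (t m) (t n)) < e / 2"
    using t e unfolding cauchy_seqs_iff by (meson half_gt_zero)
  have "vs_norm V (vs_diff V (vs_add V (s m) (t m)) (vs_add V (s n) (t n))) < e"
    if "m \<ge> max M N" "n \<ge> max M N" for m n
    using M[of m n] N[of m n] that norm_triangle[of "vs_diff V (s m) (s n)" "vs_diff V (t m) (t n)"] c
    by (simp add: diff_add_diff closed)
  then show "\<exists>K. \<forall>m\<ge>K. \<forall>n\<ge>K. vs_norm V (vs_diff V (vs_add V (s m) (t m)) (vs_add V (s n) (t n))) < e"
    by blast
qed

lemma null_rel_iff:
  "(s, t) \<in> null_rel V \<longleftrightarrow> s \<in> cauchy_seqs V \<and> t \<in> cauchy_seqs V \<and>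
    (\<lambda>n. vs_norm V (vs_diff V (s n) (t n))) \<longlonglongrightarrow> 0"
  by (auto simp: null_rel_def dist_eq cauchy_seqs_closed)

lemma null_relI:
  assumes "s \<in> cauchy_seqs V" "t \<in> cauchy_seqs V" "f \<longlonglongrightarrow> 0"
    "\<And>n. vs_norm V (vs_diff V (s n) (t n)) \<le> f n"
  shows "(s, t) \<in> null_rel V"
  unfolding null_rel_iff
  using assms by (auto intro!: Lim_null_comparison[OF _ assms(3)] simp: norm_nonneg closed cauchy_seqs_closed)

lemma equiv_null_rel: "equiv (cauchy_seqs V) (null_rel V)"
proof (rule equivI)
  show "null_rel V \<subseteq> cauchy_seqs V \<times> cauchy_seqs V" by (auto simp: null_rel_iff)
  show "refl_on (cauchy_seqs V) (null_rel V)"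
    by (auto simp: refl_on_def null_rel_iff diff_self cauchy_seqs_closed)
  show "sym (null_rel V)"
    by (auto simp: sym_def null_rel_iff norm_diff_commute cauchy_seqs_closed)
  show "trans (null_rel V)"
  proof (rule transI)
    fix s t u assume st: "(s, t) \<in> null_rel V" and tu: "(t, u) \<in> null_rel V"
    then have c: "s n \<in> vs_carrier V" "t n \<in> vs_carrier V" "u n \<in> vs_carrier V" for n
      by (auto simp: null_rel_iff cauchy_seqs_closed)
    have "(\<lambda>n. vs_norm V (vs_diff V (s n) (t n)) + vs_norm V (vs_diff V (t n) (u n))) \<longlonglongrightarrow> 0 + 0"
      using st tu unfolding null_rel_iff by (intro tendsto_add) auto
    moreover have "vs_norm V (vs_diff V (s n) (u n)) \<le> vs_norm V (vs_diff V (s n) (t n)) + vs_norm V (vs_diff V (t n) (u n))" for n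
      using norm_triangle[of "vs_diff V (s n) (t n)" "vs_diff V (t n) (u n)"] c by (simp add: diff_diff_add closed)
    ultimately show "(s, u) \<in> null_rel V"
      using st tu by (intro null_relI) (auto simp: null_rel_iff)
  qed
qed

lemma cclass_eq:
  "s \<in> cauchy_seqs V \<Longrightarrow> t \<in> cauchy_seqs V \<Longrightarrow>
    cclass V s = cclass V t \<longleftrightarrow> (\<lambda>n. vs_norm V (vs_diff V (s n) (t n))) \<longlonglongrightarrow> 0"
  unfolding cclass_def by (simp add: eq_equiv_class_iff[OF equiv_null_rel] null_rel_iff)

lemma completion_carrier: "vs_carrier (completion_space V) = cclass V ` cauchy_seqs V"
  by (auto simp: completion_space_def cclass_def quotient_def)

lemma completion_zero: "vs_zero (completion_space V) = cclass V (\<lambda>_. vs_zero V)"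
  by (simp add: completion_space_def cclass_def)

lemma completion_add:
  assumes "s \<in> cauchy_seqs V" "t \<in> cauchy_seqs V"
  shows "vs_add (completion_space V) (cclass V s) (cclass V t) = cclass V (\<lambda>n. vs_add V (s n) (t n))"
proof -
  have "congruent2 (null_rel V) (null_rel V) (\<lambda>s t. null_rel V `` {\<lambda>n. vs_add V (s n) (t n)})"
  proof (rule congruent2I')
    fix s s' t t' assume s: "(s, s') \<in> null_rel V" and t: "(t, t') \<in> null_rel V"
    have c: "s n \<in> vs_carrier V" "s' n \<in> vs_carrier V" "t n \<in> vs_carrier V" "t' n \<in> vs_carrier V" for n
      using s t by (auto simp: null_rel_iff cauchy_seqs_closed)
    have "(\<lambda>n. vs_norm V (vs_diff V (s n) (s' n)) + vs_norm V (vs_diff V (t n) (t' n))) \<longlonglongrightarrow> 0 + 0"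
      using s t unfolding null_rel_iff by (intro tendsto_add) auto
    moreover have "vs_norm V (vs_diff V (vs_add V (s n) (t n)) (vs_add V (s' n) (t' n)))
        \<le> vs_norm V (vs_diff V (s n) (s' n)) + vs_norm V (vs_diff V (t n) (t' n))" for n
      using norm_triangle[of "vs_diff V (s n) (s' n)" "vs_diff V (t n) (t' n)"] c by (simp add: diff_add_diff closed)
    ultimately have "((\<lambda>n. vs_add V (s n) (t n)), (\<lambda>n. vs_add V (s' n) (t' n))) \<in> null_rel V"
      using s t by (intro null_relI) (auto simp: null_rel_iff cauchy_seqs_add)
    then show "null_rel V `` {\<lambda>n. vs_add V (s n) (t n)} = null_rel V `` {\<lambda>n. vs_add V (s' n) (t' n)}"
      by (rule equiv_class_eq[OF equiv_null_rel])
  qed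
  from UN_equiv_class2[OF equiv_null_rel equiv_null_rel this assms]
  show ?thesis by (simp add: completion_space_def cclass_def)
qed

lemma completion_scale:
  assumes "s \<in> cauchy_seqs V"
  shows "vs_scale (completion_space V) c (cclass V s) = cclass V (\<lambda>n. vs_scale V c (s n))"
proof -
  have "congruent (null_rel V) (\<lambda>s. null_rel V `` {\<lambda>n. vs_scale V c (s n)})"
  proof (rule congruentI)
    fix s t assume s: "(s, t) \<in> null_rel V"
    have c: "s n \<in> vs_carrier V" "t n \<in> vs_carrier V" for n
      using s by (auto simp: null_rel_iff cauchy_seqs_closed)
    have "(\<lambda>n. norm c * vs_norm V (vs_diff V (s n) (t n))) \<longlonglongrightarrow> norm c * 0"
      using s unfolding null_rel_iff by (intro tendsto_mult_left) auto
    then have "((\<lambda>n. vs_scale V c (s n)), (\<lambda>n. vs_scale V c (t n))) \<in> null_rel V"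
      using s c by (intro null_relI)
        (auto simp: null_rel_iff closed cauchy_seqs_scale norm_scale simp flip: scale_diff)
    then show "null_rel V `` {\<lambda>n. vs_scale V c (s n)} = null_rel V `` {\<lambda>n. vs_scale V c (t n)}"
      by (rule equiv_class_eq[OF equiv_null_rel])
  qed
  from UN_equiv_class[OF equiv_null_rel this assms]
  show ?thesis by (simp add: completion_space_def cclass_def)
qed

text \<open>A Lipschitz function sends Cauchy sequences to Cauchy sequences and equivalent ones to
  sequences with vanishing difference, so the description by \<open>THE\<close> denotes a genuine
  limit common to all representatives.\<close>

lemma completion_ext:
  fixes f :: "'e \<Rightarrow> 'b::banach"
  assumes s: "s \<in> cauchy_seqs V"
    and f: "\<And>x y. x \<in> vs_carrier V \<Longrightarrow> y \<in> vs_carrier V \<Longrightarrow> norm (f x - f y) \<le> C * vs_norm V (vs_diff V x y)"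
  shows "(\<lambda>n. f (s n)) \<longlonglongrightarrow> completion_ext f (cclass V s)"
proof -
  have "Cauchy (\<lambda>n. f (s n))"
    unfolding Cauchy_iff
  proof (intro allI impI)
    fix e :: real assume e: "e > 0"
    obtain N where N: "\<And>m n. m \<ge> N \<Longrightarrow> n \<ge> N \<Longrightarrow> vs_norm V (vs_diff V (s m) (s n)) < e / (\<bar>C\<bar> + 1)"
      using s e unfolding cauchy_seqs_iff by (meson abs_ge_zero add_nonneg_pos divide_pos_pos zero_less_one)
    have "norm (f (s m) - f (s n)) < e" if "m \<ge> N" "n \<ge> N" for m n
    proof -
      have "norm (f (s m) - f (s n)) \<le> C * vs_norm V (vs_diff V (s m) (s n))"
        by (intro f cauchy_seqs_closed s)
      also have "\<dots> \<le> (\<bar>C\<bar> + 1) * vs_norm V (vs_diff V (s m) (s n))"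
        by (intro mult_right_mono norm_nonneg closed cauchy_seqs_closed s) simp
      also have "\<dots> < e" using N[OF that] by (simp add: field_simps)
      finally show ?thesis .
    qed
    then show "\<exists>M. \<forall>m\<ge>M. \<forall>n\<ge>M. norm (f (s m) - f (s n)) < e" by blast
  qed
  then obtain r where r: "(\<lambda>n. f (s n)) \<longlonglongrightarrow> r"
    using Cauchy_convergent_iff convergent_def by blast
  have all: "(\<lambda>n. f (t n)) \<longlonglongrightarrow> r" if "t \<in> cclass V s" for t
  proof -
    have st: "(s, t) \<in> null_rel V" using that by (simp add: cclass_def)
    then have t: "t \<in> cauchy_seqs V" by (simp add: null_rel_iff)
    have "(\<lambda>n. C * vs_norm V (vs_diff V (s n) (t n))) \<longlonglongrightarrow> C * 0"
      using st unfolding null_rel_iff by (intro tendsto_mult_left) auto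
    then have lim: "(\<lambda>n. C * vs_norm V (vs_diff V (s n) (t n))) \<longlonglongrightarrow> 0" by simp
    have "(\<lambda>n. f (s n) - f (t n)) \<longlonglongrightarrow> 0"
      by (rule Lim_null_comparison[OF _ lim])
        (intro always_eventually allI f cauchy_seqs_closed[OF s] cauchy_seqs_closed[OF t])
    from tendsto_diff[OF r this] show ?thesis by simp
  qed
  have "s \<in> cclass V s"
    using s by (simp add: cclass_def null_rel_iff diff_self cauchy_seqs_closed)
  then have "completion_ext f (cclass V s) = r"
    unfolding completion_ext_def using all LIMSEQ_unique by (intro the_equality) blast+
  then show ?thesis using r by simp
qed

lemma completion_norm:
  assumes "s \<in> cauchy_seqs V"
  shows "(\<lambda>n. vs_norm V (s n)) \<longlonglongrightarrow> vs_norm (completion_space V) (cclass V s)"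
proof -
  have "vs_norm (completion_space V) = completion_ext (vs_norm V)"
    by (simp add: completion_space_def completion_ext_def fun_eq_iff)
  moreover have "(\<lambda>n. vs_norm V (s n)) \<longlonglongrightarrow> completion_ext (vs_norm V) (cclass V s)"
    by (rule completion_ext[OF assms, of _ 1]) (simp add: norm_triangle_diff)
  ultimately show ?thesis by simp
qed

lemma completion_diff:
  assumes "s \<in> cauchy_seqs V" "t \<in> cauchy_seqs V"
  shows "vs_diff (completion_space V) (cclass V s) (cclass V t) = cclass V (\<lambda>n. vs_diff V (s n) (t n))"
  using assms by (simp add: vs_diff_def completion_scale completion_add cauchy_seqs_scale)

lemma normed_space_completion: "normed_space (completion_space V)"
proof
  note [simp] = completion_carrier completion_zero completion_add completion_scale completion_diff
    cauchy_seqs_add cauchy_seqs_scale cauchy_seqs_const closed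
  let ?X = "completion_space V"
  show "vs_zero ?X \<in> vs_carrier ?X" by (auto intro: cauchy_seqs_const)
  show "vs_add ?X x y \<in> vs_carrier ?X" if "x \<in> vs_carrier ?X" "y \<in> vs_carrier ?X" for x y
    using that by auto
  show "vs_scale ?X c x \<in> vs_carrier ?X" if "x \<in> vs_carrier ?X" for x c
    using that by auto
  show "vs_add ?X (vs_add ?X x y) z = vs_add ?X x (vs_add ?X y z)"
    if "x \<in> vs_carrier ?X" "y \<in> vs_carrier ?X" "z \<in> vs_carrier ?X" for x y z
    using that by (auto simp: add_assoc cauchy_seqs_closed)
  show "vs_add ?X x y = vs_add ?X y x" if "x \<in> vs_carrier ?X" "y \<in> vs_carrier ?X" for x y
    using that by (auto simp: add_commute cauchy_seqs_closed)
  show "vs_add ?X x (vs_zero ?X) = x" if "x \<in> vs_carrier ?X" for x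
    using that by (auto simp: add_zero cauchy_seqs_closed)
  show "vs_diff ?X x x = vs_zero ?X" if "x \<in> vs_carrier ?X" for x
    using that by (auto simp: diff_self cauchy_seqs_closed)
  show "vs_scale ?X 1 x = x" if "x \<in> vs_carrier ?X" for x
    using that by (auto simp: scale_one cauchy_seqs_closed)
  show "vs_scale ?X a (vs_scale ?X b x) = vs_scale ?X (a * b) x" if "x \<in> vs_carrier ?X" for x a b
    using that by (auto simp: scale_scale cauchy_seqs_closed)
  show "vs_scale ?X (a + b) x = vs_add ?X (vs_scale ?X a x) (vs_scale ?X b x)" if "x \<in> vs_carrier ?X" for x a b
    using that by (auto simp: scale_left_distrib cauchy_seqs_closed)
  show "vs_scale ?X a (vs_add ?X x y) = vs_add ?X (vs_scale ?X a x) (vs_scale ?X a y)"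
    if "x \<in> vs_carrier ?X" "y \<in> vs_carrier ?X" for x y a
    using that by (auto simp: scale_right_distrib cauchy_seqs_closed)
  show "0 \<le> vs_norm ?X x" if x: "x \<in> vs_carrier ?X" for x
  proof -
    obtain s where s: "s \<in> cauchy_seqs V" "x = cclass V s" using x by auto
    show ?thesis unfolding s(2)
      by (rule LIMSEQ_le_const[OF completion_norm[OF s(1)]]) (simp add: norm_nonneg cauchy_seqs_closed s)
  qed
  show "vs_norm ?X x = 0 \<longleftrightarrow> x = vs_zero ?X" if x: "x \<in> vs_carrier ?X" for x
  proof -
    obtain s where s: "s \<in> cauchy_seqs V" "x = cclass V s" using x by auto
    have "vs_norm ?X x = 0 \<longleftrightarrow> (\<lambda>n. vs_norm V (s n)) \<longlonglongrightarrow> 0"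
      using completion_norm[OF s(1)] LIMSEQ_unique unfolding s(2) by metis
    then show ?thesis using s by (simp add: cclass_eq cauchy_seqs_closed)
  qed
  show "vs_norm ?X (vs_scale ?X a x) = norm a * vs_norm ?X x" if x: "x \<in> vs_carrier ?X" for x a
  proof -
    obtain s where s: "s \<in> cauchy_seqs V" "x = cclass V s" using x by auto
    have "(\<lambda>n. vs_norm V (vs_scale V a (s n))) \<longlonglongrightarrow> norm a * vs_norm ?X x"
      using tendsto_mult_left[OF completion_norm[OF s(1)]] s by (simp add: norm_scale cauchy_seqs_closed)
    moreover have "(\<lambda>n. vs_norm V (vs_scale V a (s n))) \<longlonglongrightarrow> vs_norm ?X (vs_scale ?X a x)"
      using completion_norm[OF cauchy_seqs_scale[OF s(1)]] s by simp
    ultimately show ?thesis using LIMSEQ_unique by blast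
  qed
  show "vs_norm ?X (vs_add ?X x y) \<le> vs_norm ?X x + vs_norm ?X y" if x: "x \<in> vs_carrier ?X" "y \<in> vs_carrier ?X" for x y
  proof -
    obtain s where s: "s \<in> cauchy_seqs V" "x = cclass V s" using x by auto
    obtain t where t: "t \<in> cauchy_seqs V" "y = cclass V t" using x by auto
    have "(\<lambda>n. vs_norm V (vs_add V (s n) (t n))) \<longlonglongrightarrow> vs_norm ?X (vs_add ?X x y)"
      using completion_norm[OF cauchy_seqs_add[OF s(1) t(1)]] s t by simp
    moreover have "(\<lambda>n. vs_norm V (s n) + vs_norm V (t n)) \<longlonglongrightarrow> vs_norm ?X x + vs_norm ?X y"
      using tendsto_add[OF completion_norm[OF s(1)] completion_norm[OF t(1)]] s t by simp
    ultimately show ?thesis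
      by (rule LIMSEQ_le) (use s t in \<open>auto simp: norm_triangle cauchy_seqs_closed\<close>)
  qed
qed

definition embed :: "'e \<Rightarrow> (nat \<Rightarrow> 'e) set" where "embed v = cclass V (\<lambda>_. v)"

lemma embed:
  assumes v: "v \<in> vs_carrier V"
  shows "embed v \<in> vs_carrier (completion_space V)"
    and "vs_norm (completion_space V) (embed v) = vs_norm V v"
    and "vs_scale (completion_space V) c (embed v) = embed (vs_scale V c v)"
    and "w \<in> vs_carrier V \<Longrightarrow> vs_add (completion_space V) (embed v) (embed w) = embed (vs_add V v w)"
proof -
  show "embed v \<in> vs_carrier (completion_space V)"
    using v by (simp add: embed_def completion_carrier cauchy_seqs_const)
  show "vs_norm (completion_space V) (embed v) = vs_norm V v"
    using completion_norm[OF cauchy_seqs_const[OF v]] by (simp add: embed_def LIMSEQ_const_iff)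
  show "vs_scale (completion_space V) c (embed v) = embed (vs_scale V c v)"
    using v by (simp add: embed_def completion_scale cauchy_seqs_const)
  show "w \<in> vs_carrier V \<Longrightarrow> vs_add (completion_space V) (embed v) (embed w) = embed (vs_add V v w)"
    using v by (simp add: embed_def completion_add cauchy_seqs_const)
qed

lemma embed_dense:
  assumes z: "z \<in> vs_carrier (completion_space V)" and e: "e > 0"
  shows "\<exists>v\<in>vs_carrier V. vs_norm (completion_space V) (vs_diff (completion_space V) z (embed v)) < e"
proof -
  obtain s where s: "s \<in> cauchy_seqs V" "z = cclass V s" using z by (auto simp: completion_carrier)
  obtain N where N: "\<And>m n. m \<ge> N \<Longrightarrow> n \<ge> N \<Longrightarrow> vs_norm V (vs_diff V (s m) (s n)) < e / 2"
    using s e unfolding cauchy_seqs_iff by (meson half_gt_zero)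
  have c: "(\<lambda>_. s N) \<in> cauchy_seqs V" using s by (intro cauchy_seqs_const cauchy_seqs_closed)
  have "(\<lambda>n. vs_diff V (s n) (s N)) \<in> cauchy_seqs V"
    using cauchy_seqs_add[OF s(1) cauchy_seqs_scale[OF c]] by (simp add: vs_diff_def)
  then have "(\<lambda>n. vs_norm V (vs_diff V (s n) (s N))) \<longlonglongrightarrow>
      vs_norm (completion_space V) (vs_diff (completion_space V) z (embed (s N)))"
    unfolding s(2) embed_def completion_diff[OF s(1) c] by (rule completion_norm)
  then have "vs_norm (completion_space V) (vs_diff (completion_space V) z (embed (s N))) \<le> e / 2"
    by (rule LIMSEQ_le_const2) (use N in \<open>auto intro!: exI[of _ N] less_imp_le\<close>)
  then show ?thesis using e s by (intro bexI[of _ "s N"]) (auto simp: cauchy_seqs_closed)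
qed

end

lemma dual_extend_completion:
  fixes V :: "('k::{real_normed_field, euclidean_space}, 'e) nspace"
  assumes V: "normed_space V" and \<phi>: "\<phi> \<in> dual V"
  shows "\<exists>\<Phi>\<in>dual (completion_space V). \<forall>v\<in>vs_carrier V. \<Phi> (normed_space.embed V v) = \<phi> v"
proof -
  interpret normed_space V by fact
  let ?X = "completion_space V" and ?\<Phi> = "completion_ext \<phi>"
  obtain C where C: "C > 0" "\<forall>x\<in>vs_carrier V. norm (\<phi> x) \<le> C * vs_norm V x"
    using dual_bound[OF V \<phi>] by blast
  have lip: "norm (\<phi> x - \<phi> y) \<le> C * vs_norm V (vs_diff V x y)" if "x \<in> vs_carrier V" "y \<in> vs_carrier V" for x y
    using bspec[OF C(2), of "vs_diff V x y"] that by (simp add: dual_diff[OF V \<phi> that] closed)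
  have lim: "(\<lambda>n. \<phi> (s n)) \<longlonglongrightarrow> ?\<Phi> (cclass V s)" if "s \<in> cauchy_seqs V" for s
    by (rule completion_ext[OF that lip])
  have "?\<Phi> \<in> dual ?X"
  proof (rule dualI[OF normed_space_completion])
    fix x y assume "x \<in> vs_carrier ?X" "y \<in> vs_carrier ?X"
    then obtain s t where s: "s \<in> cauchy_seqs V" "x = cclass V s" and t: "t \<in> cauchy_seqs V" "y = cclass V t"
      by (auto simp: completion_carrier)
    have "(\<lambda>n. \<phi> (vs_add V (s n) (t n))) \<longlonglongrightarrow> ?\<Phi> x + ?\<Phi> y"
      using tendsto_add[OF lim[OF s(1)] lim[OF t(1)]] s t
      by (simp add: dual_add[OF \<phi> cauchy_seqs_closed cauchy_seqs_closed])
    moreover have "(\<lambda>n. \<phi> (vs_add V (s n) (t n))) \<longlonglongrightarrow> ?\<Phi> (vs_add ?X x y)"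
      using lim[OF cauchy_seqs_add[OF s(1) t(1)]] s t by (simp add: completion_add)
    ultimately show "?\<Phi> (vs_add ?X x y) = ?\<Phi> x + ?\<Phi> y" using LIMSEQ_unique by blast
  next
    fix c x assume "x \<in> vs_carrier ?X"
    then obtain s where s: "s \<in> cauchy_seqs V" "x = cclass V s"
      by (auto simp: completion_carrier)
    have "(\<lambda>n. \<phi> (vs_scale V c (s n))) \<longlonglongrightarrow> c * ?\<Phi> x"
      using tendsto_mult_left[OF lim[OF s(1)]] s by (simp add: dual_scale[OF \<phi> cauchy_seqs_closed])
    moreover have "(\<lambda>n. \<phi> (vs_scale V c (s n))) \<longlonglongrightarrow> ?\<Phi> (vs_scale ?X c x)"
      using lim[OF cauchy_seqs_scale[OF s(1)]] s by (simp add: completion_scale)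
    ultimately show "?\<Phi> (vs_scale ?X c x) = c * ?\<Phi> x" using LIMSEQ_unique by blast
  next
    fix x assume "x \<in> vs_carrier ?X"
    then obtain s where s: "s \<in> cauchy_seqs V" "x = cclass V s"
      by (auto simp: completion_carrier)
    show "norm (?\<Phi> x) \<le> C * vs_norm ?X x" unfolding s(2)
      by (rule LIMSEQ_le[OF tendsto_norm[OF lim[OF s(1)]] tendsto_mult_left[OF completion_norm[OF s(1)]]])
        (use C(2) s in \<open>auto simp: cauchy_seqs_closed\<close>)
  qed
  moreover have "?\<Phi> (embed v) = \<phi> v" if "v \<in> vs_carrier V" for v
    using lim[OF cauchy_seqs_const[OF that]] by (simp add: embed_def LIMSEQ_const_iff)
  ultimately show ?thesis by blast
qed

section \<open>The projective tensor product\<close>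

interpretation free: vector_space "free_scale :: 'k::field \<Rightarrow> ('b \<Rightarrow>\<^sub>0 'k) \<Rightarrow> ('b \<Rightarrow>\<^sub>0 'k)"
  by (rule vector_space_free_scale)

lemma free_scale_single: "free_scale c (Poly_Mapping.single p a) = Poly_Mapping.single p (c * a)"
  by (rule poly_mapping_eqI) (simp add: lookup_free_scale lookup_single when_def)

text \<open>The algebraic tensor as a list of elementary tensors. A list lets the same pair occur
  several times and makes addition a concatenation; scalar coefficients have to be absorbed into the
  pairs.\<close>

definition tsum :: "('e \<times> 'f) list \<Rightarrow> (('e \<times> 'f) \<Rightarrow>\<^sub>0 'k::field)" where
  "tsum xs = sum_list (map (\<lambda>p. Poly_Mapping.single p 1) xs)"

lemma tsum_simps [simp]:
  "tsum [] = 0" "tsum (p # xs) = Poly_Mapping.single p 1 + tsum xs" "tsum (xs @ ys) = tsum xs + tsum ys"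
  by (simp_all add: tsum_def)

definition bform :: "('e \<Rightarrow> 'f \<Rightarrow> 'k) \<Rightarrow> (('e \<times> 'f) \<Rightarrow>\<^sub>0 'k::field) \<Rightarrow> 'k" where
  "bform b u = (\<Sum>p\<in>Poly_Mapping.keys u. Poly_Mapping.lookup u p * b (fst p) (snd p))"

lemma bform_superset:
  assumes "finite A" "Poly_Mapping.keys u \<subseteq> A"
  shows "bform b u = (\<Sum>p\<in>A. Poly_Mapping.lookup u p * b (fst p) (snd p))"
  unfolding bform_def by (rule sum.mono_neutral_left) (use assms in \<open>auto simp: in_keys_iff\<close>)

lemma bform_add: "bform b (u + v) = bform b u + bform b v"
proof -
  let ?A = "Poly_Mapping.keys u \<union> Poly_Mapping.keys v"
  have "Poly_Mapping.keys (u + v) \<subseteq> ?A" by (rule Poly_Mapping.keys_add)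
  then show ?thesis
    by (simp add: bform_superset[of ?A] lookup_add distrib_right sum.distrib)
qed

lemma bform_scale: "bform b (free_scale c u) = c * bform b u"
proof -
  have "Poly_Mapping.keys (free_scale c u) \<subseteq> Poly_Mapping.keys u"
    by (auto simp: in_keys_iff lookup_free_scale)
  then show ?thesis
    by (simp add: bform_superset[of "Poly_Mapping.keys u"] lookup_free_scale sum_distrib_left mult.assoc)
qed

lemma bform_single [simp]: "bform b (Poly_Mapping.single p c) = c * b (fst p) (snd p)"
  by (subst bform_superset[of "{p}"]) (auto simp: lookup_single)

lemma bform_zero [simp]: "bform b 0 = 0" by (simp add: bform_def)

lemma bform_diff: "bform b (u - v) = bform b u - bform b v"
  using bform_add[of b "u - v" v] by simp

lemma bform_tsum: "bform b (tsum xs) = (\<Sum>p\<leftarrow>xs. b (fst p) (snd p))"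
  by (induction xs) (auto simp: bform_add)

locale tensor_product = V: normed_space V + W: normed_space W
  for V :: "('k::{real_normed_field, euclidean_space}, 'e) nspace" and W :: "('k, 'f) nspace"
begin

abbreviation S :: "(('e \<times> 'f) \<Rightarrow>\<^sub>0 'k) set" where "S \<equiv> free.span (bilinear_relations V W)"

abbreviation A :: "('k, (('e \<times> 'f) \<Rightarrow>\<^sub>0 'k) set) nspace" where "A \<equiv> algebraic_tensor V W"

abbreviation pairs :: "('e \<times> 'f) set" where "pairs \<equiv> vs_carrier V \<times> vs_carrier W"

abbreviation sg :: "'e \<Rightarrow> 'f \<Rightarrow> 'k \<Rightarrow> (('e \<times> 'f) \<Rightarrow>\<^sub>0 'k)" where "sg x y \<equiv> Poly_Mapping.single (x, y)"

lemma rel_add_left: "x \<in> vs_carrier V \<Longrightarrow> x' \<in> vs_carrier V \<Longrightarrow> y \<in> vs_carrier W \<Longrightarrow>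
    sg (vs_add V x x') y 1 - sg x y 1 - sg x' y 1 \<in> S"
  by (rule free.span_base) (unfold bilinear_relations_def, blast)

lemma rel_add_right: "x \<in> vs_carrier V \<Longrightarrow> y \<in> vs_carrier W \<Longrightarrow> y' \<in> vs_carrier W \<Longrightarrow>
    sg x (vs_add W y y') 1 - sg x y 1 - sg x y' 1 \<in> S"
  by (rule free.span_base) (unfold bilinear_relations_def, blast)

lemma rel_scale_left: "x \<in> vs_carrier V \<Longrightarrow> y \<in> vs_carrier W \<Longrightarrow> sg (vs_scale V c x) y 1 - sg x y c \<in> S"
  by (rule free.span_base) (unfold bilinear_relations_def, blast)

lemma rel_scale_right: "x \<in> vs_carrier V \<Longrightarrow> y \<in> vs_carrier W \<Longrightarrow> sg x (vs_scale W c y) 1 - sg x y c \<in> S"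
  by (rule free.span_base) (unfold bilinear_relations_def, blast)

lemma span_trans: "u - v \<in> S \<Longrightarrow> v - w \<in> S \<Longrightarrow> u - w \<in> S"
  using free.span_add[of "u - v" _ "v - w"] by simp

lemma span_sym: "u - v \<in> S \<Longrightarrow> v - u \<in> S"
  using free.span_neg[of "u - v"] by simp

text \<open>The linear extension of a bilinear map vanishes on each of the four kinds of relations,
  and its kernel is a subspace. So its value on a coset does not depend on the
  representative.\<close>

lemma bform_span:
  assumes "\<And>x x' y. \<lbrakk>x \<in> vs_carrier V; x' \<in> vs_carrier V; y \<in> vs_carrier W\<rbrakk> \<Longrightarrow> b (vs_add V x x') y = b x y + b x' y"
    and "\<And>x y y'. \<lbrakk>x \<in> vs_carrier V; y \<in> vs_carrier W; y' \<in> vs_carrier W\<rbrakk> \<Longrightarrow> b x (vs_add W y y') = b x y + b x y'"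
    and "\<And>c x y. \<lbrakk>x \<in> vs_carrier V; y \<in> vs_carrier W\<rbrakk> \<Longrightarrow> b (vs_scale V c x) y = c * b x y"
    and "\<And>c x y. \<lbrakk>x \<in> vs_carrier V; y \<in> vs_carrier W\<rbrakk> \<Longrightarrow> b x (vs_scale W c y) = c * b x y"
    and u: "u \<in> S"
  shows "bform b u = 0"
proof -
  have "bilinear_relations V W \<subseteq> {u. bform b u = 0}"
    unfolding bilinear_relations_def by (auto simp: bform_diff assms(1-4))
  moreover have "free.subspace {u. bform b u = 0}"
    unfolding free.subspace_def by (auto simp: bform_add bform_scale)
  ultimately show ?thesis using free.span_minimal[of "bilinear_relations V W" "{u. bform b u = 0}"] u by blast
qed

subsection \<open>Separation\<close>

lemma dual_separates:
  assumes "y \<in> vs_carrier W" "y' \<in> vs_carrier W" and eq: "\<And>\<psi>. \<psi> \<in> dual W \<Longrightarrow> \<psi> y = \<psi> y'"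
  shows "y = y'"
proof -
  have "\<exists>\<psi>\<in>dual W. norm (\<psi> (vs_diff W y y')) = vs_norm W (vs_diff W y y')"
    by (rule norming_functional[OF W.normed_space_axioms W.diff_closed[OF assms(1,2)]]) blast
  then obtain \<psi> where \<psi>: "\<psi> \<in> dual W" "norm (\<psi> (vs_diff W y y')) = vs_norm W (vs_diff W y y')" by blast
  then have "vs_norm W (vs_diff W y y') = 0"
    using dual_diff[OF W.normed_space_axioms \<psi>(1) assms(1,2)] eq[OF \<psi>(1)] by simp
  then show ?thesis using assms W.norm_eq_zero W.diff_eq_zero W.diff_closed by simp
qed

text \<open>Elimination: if \<open>\<phi>\<^sub>0 x \<noteq> 0\<close>, the hypothesis expresses \<open>y\<close> through the remaining right factors,
  so that \<open>x \<otimes> y\<close> can be absorbed into the left factors of the remaining terms.\<close>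

lemma tsum_in_span:
  assumes "set xs \<subseteq> pairs"
    and "\<And>\<phi> \<psi>. \<phi> \<in> dual V \<Longrightarrow> \<psi> \<in> dual W \<Longrightarrow> (\<Sum>p\<leftarrow>xs. \<phi> (fst p) * \<psi> (snd p)) = 0"
  shows "tsum xs \<in> S"
  using assms
proof (induction "length xs" arbitrary: xs rule: less_induct)
  case less
  show ?case
  proof (cases xs)
    case Nil
    then show ?thesis by (simp add: free.span_zero)
  next
    case (Cons p ys)
    obtain x y where p: "p = (x, y)" by fastforce
    have x: "x \<in> vs_carrier V" and y: "y \<in> vs_carrier W" and ys: "set ys \<subseteq> pairs"
      using less.prems(1) by (auto simp: Cons p)
    have zero: "\<phi> x * \<psi> y + (\<Sum>p\<leftarrow>ys. \<phi> (fst p) * \<psi> (snd p)) = 0" if "\<phi> \<in> dual V" "\<psi> \<in> dual W" for \<phi> \<psi>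
      using less.prems(2)[OF that] by (simp add: Cons p)
    show ?thesis
    proof (cases "x = vs_zero V")
      case True
      have "sg x y 1 \<in> S"
        using rel_scale_left[OF x y, of 0] x by (simp add: True)
      moreover have "tsum ys \<in> S"
      proof (rule less.hyps)
        show "(\<Sum>p\<leftarrow>ys. \<phi> (fst p) * \<psi> (snd p)) = 0" if "\<phi> \<in> dual V" "\<psi> \<in> dual W" for \<phi> \<psi>
          using zero[OF that] dual_scale[OF that(1) x, of 0] x by (simp add: True)
      qed (use ys in \<open>auto simp: Cons\<close>)
      ultimately show ?thesis by (simp add: Cons p free.span_add)
    next
      case False
      have "\<exists>\<phi>\<in>dual V. norm (\<phi> x) = vs_norm V x"
        by (rule norming_functional[OF V.normed_space_axioms x]) blast
      then obtain \<phi>0 where \<phi>0: "\<phi>0 \<in> dual V" "\<phi>0 x \<noteq> 0"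
        using False V.norm_eq_zero[OF x] by force
      define c where "c p = \<phi>0 (fst p) / \<phi>0 x" for p :: "'e \<times> 'f"
      define y' where "y' = foldr (\<lambda>p. vs_add W (vs_scale W (- c p) (snd p))) ys (vs_zero W)"
      \<comment> \<open>Read with \<open>c\<close>, the hypothesis for \<phi>0 says that
        \<open>y\<close> equals minus the sum of c p \<cdot> snd p. \<open>y'\<close> is that
        combination, built over an arbitrary list so that its values under functionals and the
        congruence of x \<otimes> y' can be proved by induction.\<close>
      have y'_gen: "foldr (\<lambda>p. vs_add W (vs_scale W (- c p) (snd p))) zs (vs_zero W) \<in> vs_carrier W \<and>
          (\<forall>\<psi>\<in>dual W. \<psi> (foldr (\<lambda>p. vs_add W (vs_scale W (- c p) (snd p))) zs (vs_zero W)) = - (\<Sum>p\<leftarrow>zs. c p * \<psi> (snd p))) \<and>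
          sg x (foldr (\<lambda>p. vs_add W (vs_scale W (- c p) (snd p))) zs (vs_zero W)) 1 + (\<Sum>p\<leftarrow>zs. sg x (snd p) (c p)) \<in> S"
        if "set zs \<subseteq> pairs" for zs
        using that
      proof (induction zs)
        case Nil
        have "\<psi> (vs_zero W) = 0" if "\<psi> \<in> dual W" for \<psi>
          using dual_scale[OF that W.zero_closed, of 0] by simp
        moreover have "sg x (vs_zero W) 1 \<in> S"
          using rel_scale_right[OF x W.zero_closed, of 0] by simp
        ultimately show ?case by (simp add: W.closed)
      next
        case (Cons q zs)
        let ?f = "foldr (\<lambda>p. vs_add W (vs_scale W (- c p) (snd p))) zs (vs_zero W)"
        have q: "snd q \<in> vs_carrier W" and IH: "?f \<in> vs_carrier W"
          "\<And>\<psi>. \<psi> \<in> dual W \<Longrightarrow> \<psi> ?f = - (\<Sum>p\<leftarrow>zs. c p * \<psi> (snd p))"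
          "sg x ?f 1 + (\<Sum>p\<leftarrow>zs. sg x (snd p) (c p)) \<in> S"
          using Cons by auto
        have sc: "vs_scale W (- c q) (snd q) \<in> vs_carrier W" using q by (rule W.closed)
        have "\<psi> (vs_add W (vs_scale W (- c q) (snd q)) ?f) = - (c q * \<psi> (snd q)) - (\<Sum>p\<leftarrow>zs. c p * \<psi> (snd p))"
          if "\<psi> \<in> dual W" for \<psi>
          by (simp add: dual_add[OF that sc IH(1)] dual_scale[OF that q] IH(2)[OF that])
        moreover have "sg x (vs_add W (vs_scale W (- c q) (snd q)) ?f) 1 + (sg x (snd q) (c q) + (\<Sum>p\<leftarrow>zs. sg x (snd p) (c p))) \<in> S"
        proof -
          have "(sg x (vs_add W (vs_scale W (- c q) (snd q)) ?f) 1 - sg x (vs_scale W (- c q) (snd q)) 1 - sg x ?f 1)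
            + (sg x (vs_scale W (- c q) (snd q)) 1 - sg x (snd q) (- c q))
            + (sg x ?f 1 + (\<Sum>p\<leftarrow>zs. sg x (snd p) (c p))) \<in> S"
            by (intro free.span_add rel_add_right rel_scale_right IH x sc q)
          then show ?thesis by (simp add: single_uminus algebra_simps)
        qed
        ultimately show ?case using IH(1) sc by (simp add: W.closed)
      qed
      note y' = y'_gen[OF ys, folded y'_def]
      have yy': "y = y'"
      proof (rule dual_separates[OF y])
        show "y' \<in> vs_carrier W" using y' by blast
        fix \<psi> assume \<psi>: "\<psi> \<in> dual W"
        have "(\<Sum>p\<leftarrow>ys. \<phi>0 (fst p) * \<psi> (snd p)) = \<phi>0 x * (\<Sum>p\<leftarrow>ys. c p * \<psi> (snd p))"
          using \<phi>0(2) by (simp add: c_def flip: sum_list_const_mult)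
        then have "\<phi>0 x * (\<psi> y + (\<Sum>p\<leftarrow>ys. c p * \<psi> (snd p))) = 0"
          using zero[OF \<phi>0(1) \<psi>] by (simp add: distrib_left)
        then have "\<psi> y = - (\<Sum>p\<leftarrow>ys. c p * \<psi> (snd p))"
          using \<phi>0(2) by (simp add: add_eq_0_iff2)
        then show "\<psi> y = \<psi> y'" using y' \<psi> by simp
      qed
      \<comment> \<open>Since x \<otimes> y is congruent to minus the sum of c p \<cdot> (x
        \<otimes> snd p), it disappears when c p \<cdot> x is subtracted from each left factor. The
        new list is shorter and still satisfies the hypothesis.\<close>
      define g where "g p = (vs_diff V (fst p) (vs_scale V (c p) x), snd p)" for p
      have g: "g p \<in> pairs" if "p \<in> pairs" for p using that x by (auto simp: g_def V.closed)
      have IH: "tsum (map g ys) \<in> S"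
      proof (rule less.hyps)
        show "length (map g ys) < length xs" by (simp add: Cons)
        show "set (map g ys) \<subseteq> pairs" unfolding set_map by (intro image_subsetI g) (use ys in blast)
        fix \<phi> \<psi> assume \<phi>: "\<phi> \<in> dual V" and \<psi>: "\<psi> \<in> dual W"
        have "\<phi> (fst (g p)) * \<psi> (snd (g p)) = \<phi> (fst p) * \<psi> (snd p) - \<phi> x * (c p * \<psi> (snd p))" if "p \<in> set ys" for p
        proof -
          have "fst p \<in> vs_carrier V" using that ys by auto
          then show ?thesis
            using x by (simp add: g_def dual_diff[OF V.normed_space_axioms \<phi>] dual_scale[OF \<phi>] V.closed algebra_simps)
        qed
        then have "(\<Sum>p\<leftarrow>map g ys. \<phi> (fst p) * \<psi> (snd p))
            = (\<Sum>p\<leftarrow>ys. \<phi> (fst p) * \<psi> (snd p) - \<phi> x * (c p * \<psi> (snd p)))"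
          by (simp add: o_def cong: map_cong)
        also have "\<dots> = (\<Sum>p\<leftarrow>ys. \<phi> (fst p) * \<psi> (snd p)) - \<phi> x * (\<Sum>p\<leftarrow>ys. c p * \<psi> (snd p))"
          by (simp add: sum_list_subtractf sum_list_const_mult)
        also have "(\<Sum>p\<leftarrow>ys. c p * \<psi> (snd p)) = - \<psi> y"
        proof -
          have "\<psi> y' = - (\<Sum>p\<leftarrow>ys. c p * \<psi> (snd p))" using y' \<psi> by blast
          then show ?thesis by (simp add: yy')
        qed
        finally show "(\<Sum>p\<leftarrow>map g ys. \<phi> (fst p) * \<psi> (snd p)) = 0"
          using zero[OF \<phi> \<psi>] by (simp add: algebra_simps)
      qed
      \<comment> \<open>The same absorption carried out among formal sums: replacing the left
        factors costs precisely the terms x \<otimes> snd p with coefficient c p, modulo the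
        relations.\<close>
      have D: "tsum zs - tsum (map g zs) - (\<Sum>p\<leftarrow>zs. sg x (snd p) (c p)) \<in> S" if "set zs \<subseteq> pairs" for zs
        using that
      proof (induction zs)
        case Nil
        then show ?case by (simp add: free.span_zero)
      next
        case (Cons q zs)
        obtain u v where q: "q = (u, v)" by fastforce
        have u: "u \<in> vs_carrier V" and v: "v \<in> vs_carrier W" using Cons q by auto
        have "g q = (vs_add V u (vs_scale V (- c q) x), v)"
          using x by (simp add: g_def q vs_diff_def V.scale_scale)
        then have "Poly_Mapping.single (g q) 1 - sg u v 1 - sg (vs_scale V (- c q) x) v 1 \<in> S"
          using rel_add_left[OF u _ v, of "vs_scale V (- c q) x"] x by (simp add: V.closed)
        then have "(Poly_Mapping.single (g q) 1 - sg u v 1 - sg (vs_scale V (- c q) x) v 1)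
            + (sg (vs_scale V (- c q) x) v 1 - sg x v (- c q)) \<in> S"
          by (intro free.span_add rel_scale_left x v)
        then have "- (Poly_Mapping.single (g q) 1 - sg u v 1 - sg x v (- c q)) \<in> S"
          by (intro free.span_neg) simp
        moreover have "tsum zs - tsum (map g zs) - (\<Sum>p\<leftarrow>zs. sg x (snd p) (c p)) \<in> S" using Cons by simp
        ultimately have "- (Poly_Mapping.single (g q) 1 - sg u v 1 - sg x v (- c q)) +
            (tsum zs - tsum (map g zs) - (\<Sum>p\<leftarrow>zs. sg x (snd p) (c p))) \<in> S"
          by (rule free.span_add)
        then show ?case by (simp add: q single_uminus algebra_simps)
      qed
      have "sg x y 1 + (\<Sum>p\<leftarrow>ys. sg x (snd p) (c p)) \<in> S" using y' yy' by blast
      from free.span_add[OF free.span_add[OF D[OF ys] IH] this]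
      show ?thesis by (simp add: Cons p algebra_simps)
    qed
  qed
qed

end

section \<open>The projective norm on the algebraic tensor product\<close>

definition tweight :: "('k::real_normed_field, 'e) nspace \<Rightarrow> ('k, 'f) nspace \<Rightarrow> ('e \<times> 'f) list \<Rightarrow> real" where
  "tweight V W xs = (\<Sum>p\<leftarrow>xs. vs_norm V (fst p) * vs_norm W (snd p))"

lemma tweight_simps [simp]:
  "tweight V W [] = 0" "tweight V W (p # xs) = vs_norm V (fst p) * vs_norm W (snd p) + tweight V W xs"
  "tweight V W (xs @ ys) = tweight V W xs + tweight V W ys"
  by (simp_all add: tweight_def)

text \<open>Lists instead of indexed families make the triangle inequality a matter of appending
  representations.\<close>

lemma projective_norm_eq:
  "projective_norm V W B =
    Inf {tweight V W xs | xs. set xs \<subseteq> vs_carrier V \<times> vs_carrier W \<and> tsum xs \<in> B}"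
proof -
  have "{(\<Sum>i<n. vs_norm V (x i) * vs_norm W (y i)) | (n::nat) x y.
       (\<forall>i<n. x i \<in> vs_carrier V \<and> y i \<in> vs_carrier W) \<and> (\<Sum>i<n. Poly_Mapping.single (x i, y i) 1) \<in> B}
    = {tweight V W xs | xs. set xs \<subseteq> vs_carrier V \<times> vs_carrier W \<and> tsum xs \<in> B}" (is "?L = ?R")
  proof (intro equalityI subsetI)
    fix r assume "r \<in> ?L"
    then obtain n :: nat and x y where *: "r = (\<Sum>i<n. vs_norm V (x i) * vs_norm W (y i))"
      "\<forall>i<n. x i \<in> vs_carrier V \<and> y i \<in> vs_carrier W" "(\<Sum>i<n. Poly_Mapping.single (x i, y i) 1) \<in> B"
      by blast
    let ?xs = "map (\<lambda>i. (x i, y i)) [0..<n]"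
    have "tweight V W ?xs = r"
      by (simp add: tweight_def o_def * interv_sum_list_conv_sum_set_nat atLeast0LessThan)
    moreover have "tsum ?xs \<in> B"
      using *(3) by (simp add: tsum_def o_def interv_sum_list_conv_sum_set_nat atLeast0LessThan)
    moreover have "set ?xs \<subseteq> vs_carrier V \<times> vs_carrier W" using * by auto
    ultimately show "r \<in> ?R" by blast
  next
    fix r assume "r \<in> ?R"
    then obtain xs where *: "r = tweight V W xs" "set xs \<subseteq> vs_carrier V \<times> vs_carrier W" "tsum xs \<in> B" by blast
    have "r = (\<Sum>i<length xs. vs_norm V (fst (xs ! i)) * vs_norm W (snd (xs ! i)))"
      by (simp add: * tweight_def sum_list_sum_nth atLeast0LessThan)
    moreover have "(\<Sum>i<length xs. Poly_Mapping.single (fst (xs ! i), snd (xs ! i)) 1) \<in> B"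
      using *(3) by (simp add: tsum_def sum_list_sum_nth atLeast0LessThan)
    moreover have "\<forall>i<length xs. fst (xs ! i) \<in> vs_carrier V \<and> snd (xs ! i) \<in> vs_carrier W"
      using *(2) nth_mem by fastforce
    ultimately show "r \<in> ?L"
      by (intro CollectI exI[of _ "length xs"] exI[of _ "\<lambda>i. fst (xs ! i)"] exI[of _ "\<lambda>i. snd (xs ! i)"]) simp
  qed
  then show ?thesis by (simp add: projective_norm_def)
qed

context tensor_product
begin

definition FC :: "(('e \<times> 'f) \<Rightarrow>\<^sub>0 'k) set" where "FC = free_carrier V W"

lemma FC_closed:
  "0 \<in> FC" "u \<in> FC \<Longrightarrow> v \<in> FC \<Longrightarrow> u + v \<in> FC" "u \<in> FC \<Longrightarrow> free_scale c u \<in> FC"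
  "p \<in> pairs \<Longrightarrow> Poly_Mapping.single p a \<in> FC" "u \<in> FC \<Longrightarrow> - u \<in> FC"
  unfolding FC_def free_carrier_def mem_Collect_eq
  using Poly_Mapping.keys_add[of u v]
  by (auto simp: in_keys_iff lookup_free_scale lookup_single when_def split: if_splits)

lemma tsum_FC: "set xs \<subseteq> pairs \<Longrightarrow> tsum xs \<in> FC"
  by (induction xs) (auto intro!: FC_closed)

definition cls :: "(('e \<times> 'f) \<Rightarrow>\<^sub>0 'k) \<Rightarrow> (('e \<times> 'f) \<Rightarrow>\<^sub>0 'k) set" where
  "cls u = tensor_rel V W `` {u}"

lemma tensor_rel_iff: "(u, v) \<in> tensor_rel V W \<longleftrightarrow> u \<in> FC \<and> v \<in> FC \<and> u - v \<in> S"
  by (simp add: tensor_rel_def FC_def)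

lemma equiv_tensor_rel: "equiv FC (tensor_rel V W)"
proof (rule equivI)
  show "tensor_rel V W \<subseteq> FC \<times> FC" by (auto simp: tensor_rel_iff)
  show "refl_on FC (tensor_rel V W)" by (auto simp: refl_on_def tensor_rel_iff free.span_zero)
  show "sym (tensor_rel V W)" by (auto simp: sym_def tensor_rel_iff intro: span_sym)
  show "trans (tensor_rel V W)" by (auto simp: trans_def tensor_rel_iff intro: span_trans)
qed

lemma cls_eq: "u \<in> FC \<Longrightarrow> v \<in> FC \<Longrightarrow> cls u = cls v \<longleftrightarrow> u - v \<in> S"
  unfolding cls_def by (simp add: eq_equiv_class_iff[OF equiv_tensor_rel] tensor_rel_iff)

lemma mem_cls: "u \<in> FC \<Longrightarrow> v \<in> cls u \<longleftrightarrow> v \<in> FC \<and> u - v \<in> S"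
  by (simp add: cls_def tensor_rel_iff)

lemma A_carrier: "vs_carrier A = cls ` FC"
  by (auto simp: algebraic_tensor_def cls_def quotient_def FC_def)

lemma A_zero: "vs_zero A = cls 0"
  by (simp add: algebraic_tensor_def cls_def)

lemma A_norm: "vs_norm A = projective_norm V W"
  by (simp add: algebraic_tensor_def)

lemma A_add:
  assumes "u \<in> FC" "v \<in> FC"
  shows "vs_add A (cls u) (cls v) = cls (u + v)"
proof -
  have "congruent2 (tensor_rel V W) (tensor_rel V W) (\<lambda>u v. tensor_rel V W `` {u + v})"
  proof (rule congruent2I')
    fix u u' v v' assume u: "(u, u') \<in> tensor_rel V W" and v: "(v, v') \<in> tensor_rel V W"
    have "(u - u') + (v - v') \<in> S" using u v by (intro free.span_add) (auto simp: tensor_rel_iff)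
    then have "(u + v, u' + v') \<in> tensor_rel V W"
      using u v by (simp add: tensor_rel_iff FC_closed algebra_simps)
    then show "tensor_rel V W `` {u + v} = tensor_rel V W `` {u' + v'}"
      by (rule equiv_class_eq[OF equiv_tensor_rel])
  qed
  from UN_equiv_class2[OF equiv_tensor_rel equiv_tensor_rel this assms]
  show ?thesis by (simp add: algebraic_tensor_def cls_def)
qed

lemma A_scale:
  assumes "u \<in> FC"
  shows "vs_scale A c (cls u) = cls (free_scale c u)"
proof -
  have "congruent (tensor_rel V W) (\<lambda>u. tensor_rel V W `` {free_scale c u})"
  proof (rule congruentI)
    fix u u' assume u: "(u, u') \<in> tensor_rel V W"
    then have "free_scale c (u - u') \<in> S" by (intro free.span_scale) (auto simp: tensor_rel_iff)
    then have "(free_scale c u, free_scale c u') \<in> tensor_rel V W"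
      using u by (simp add: tensor_rel_iff FC_closed free.scale_right_diff_distrib)
    then show "tensor_rel V W `` {free_scale c u} = tensor_rel V W `` {free_scale c u'}"
      by (rule equiv_class_eq[OF equiv_tensor_rel])
  qed
  from UN_equiv_class[OF equiv_tensor_rel this assms]
  show ?thesis by (simp add: algebraic_tensor_def cls_def)
qed

text \<open>Every coefficient can be moved into the left factor modulo the relations. This
  guarantees that the infimum in the projective norm is over a nonempty set.\<close>

lemma ex_tsum:
  assumes "u \<in> FC"
  shows "\<exists>xs. set xs \<subseteq> pairs \<and> tsum xs - u \<in> S"
proof -
  have *: "\<exists>xs. set xs \<subseteq> pairs \<and> tsum xs - (\<Sum>p\<in>K. Poly_Mapping.single p (f p)) \<in> S"
    if "finite K" "K \<subseteq> pairs" for K and f :: "'e \<times> 'f \<Rightarrow> 'k"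
    using that
  proof (induction K)
    case empty
    then show ?case by (intro exI[of _ "[]"]) (simp add: free.span_zero)
  next
    case (insert p K)
    then obtain xs where xs: "set xs \<subseteq> pairs" "tsum xs - (\<Sum>p\<in>K. Poly_Mapping.single p (f p)) \<in> S" by auto
    obtain x y where p: "p = (x, y)" by fastforce
    have xy: "x \<in> vs_carrier V" "y \<in> vs_carrier W" using insert by (auto simp: p)
    have "(sg (vs_scale V (f p) x) y 1 - sg x y (f p)) + (tsum xs - (\<Sum>p\<in>K. Poly_Mapping.single p (f p))) \<in> S"
      by (intro free.span_add rel_scale_left xy xs)
    then show ?case using insert xs xy
      by (intro exI[of _ "(vs_scale V (f p) x, y) # xs"]) (auto simp: p V.closed algebra_simps)
  qed
  have "u = (\<Sum>p\<in>Poly_Mapping.keys u. Poly_Mapping.single p (Poly_Mapping.lookup u p))"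
    by (rule poly_mapping_eqI) (simp add: lookup_sum lookup_single when_def in_keys_iff)
  moreover have "Poly_Mapping.keys u \<subseteq> pairs"
    using assms unfolding FC_def free_carrier_def by simp
  ultimately show ?thesis
    using *[OF finite_keys, of u "Poly_Mapping.lookup u"] by simp
qed

lemma tweight_nonneg: "set xs \<subseteq> pairs \<Longrightarrow> 0 \<le> tweight V W xs"
  by (induction xs) (auto simp: V.norm_nonneg W.norm_nonneg)

lemma pnorm_le:
  assumes "u \<in> FC" "set xs \<subseteq> pairs" "tsum xs - u \<in> S"
  shows "vs_norm A (cls u) \<le> tweight V W xs"
  unfolding A_norm projective_norm_eq
proof (rule cInf_lower)
  show "tweight V W xs \<in> {tweight V W xs |xs. set xs \<subseteq> pairs \<and> tsum xs \<in> cls u}"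
    using assms by (auto simp: mem_cls tsum_FC intro: span_sym)
  show "bdd_below {tweight V W xs |xs. set xs \<subseteq> pairs \<and> tsum xs \<in> cls u}"
    using tweight_nonneg by (intro bdd_belowI[of _ 0]) auto
qed

lemma pnorm_ge:
  assumes "u \<in> FC" and le: "\<And>xs. set xs \<subseteq> pairs \<Longrightarrow> tsum xs - u \<in> S \<Longrightarrow> r \<le> tweight V W xs"
  shows "r \<le> vs_norm A (cls u)"
  unfolding A_norm projective_norm_eq
proof (rule cInf_greatest)
  show "{tweight V W xs |xs. set xs \<subseteq> pairs \<and> tsum xs \<in> cls u} \<noteq> {}"
  proof -
    obtain xs where "set xs \<subseteq> pairs" "tsum xs - u \<in> S" using ex_tsum[OF assms(1)] by blast
    then have "tweight V W xs \<in> {tweight V W xs |xs. set xs \<subseteq> pairs \<and> tsum xs \<in> cls u}"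
      using span_sym[of "tsum xs" u] by (auto simp: mem_cls assms(1) tsum_FC)
    then show ?thesis by blast
  qed
  show "r \<le> t" if "t \<in> {tweight V W xs |xs. set xs \<subseteq> pairs \<and> tsum xs \<in> cls u}" for t
    using that le assms(1) by (auto simp: mem_cls intro: span_sym)
qed

lemma pnorm_approx:
  assumes "u \<in> FC" "e > 0"
  shows "\<exists>xs. set xs \<subseteq> pairs \<and> tsum xs - u \<in> S \<and> tweight V W xs < vs_norm A (cls u) + e"
  using pnorm_ge[OF assms(1), of "vs_norm A (cls u) + e"] assms(2) by force

text \<open>The value of the form can be computed from any representation of the coset, in
  particular from one that is nearly optimal for the norm. Dividing the tolerance by C + 1 also
  covers C = 0.\<close>

lemma bform_le_pnorm:
  assumes b: "\<And>x x' y. \<lbrakk>x \<in> vs_carrier V; x' \<in> vs_carrier V; y \<in> vs_carrier W\<rbrakk> \<Longrightarrow> b (vs_add V x x') y = b x y + b x' y"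
    "\<And>x y y'. \<lbrakk>x \<in> vs_carrier V; y \<in> vs_carrier W; y' \<in> vs_carrier W\<rbrakk> \<Longrightarrow> b x (vs_add W y y') = b x y + b x y'"
    "\<And>c x y. \<lbrakk>x \<in> vs_carrier V; y \<in> vs_carrier W\<rbrakk> \<Longrightarrow> b (vs_scale V c x) y = c * b x y"
    "\<And>c x y. \<lbrakk>x \<in> vs_carrier V; y \<in> vs_carrier W\<rbrakk> \<Longrightarrow> b x (vs_scale W c y) = c * b x y"
    and bound: "\<And>x y. \<lbrakk>x \<in> vs_carrier V; y \<in> vs_carrier W\<rbrakk> \<Longrightarrow> norm (b x y) \<le> C * (vs_norm V x * vs_norm W y)"
    and C: "C \<ge> 0" and u: "u \<in> FC"
  shows "norm (bform b u) \<le> C * vs_norm A (cls u)"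
proof (rule field_le_epsilon)
  fix e :: real assume e: "e > 0"
  obtain xs where xs: "set xs \<subseteq> pairs" "tsum xs - u \<in> S" "tweight V W xs < vs_norm A (cls u) + e / (C + 1)"
    using pnorm_approx[OF u, of "e / (C + 1)"] e C by auto
  have "bform b (tsum xs - u) = 0" using b xs(2) by (rule bform_span)
  then have "bform b u = (\<Sum>p\<leftarrow>xs. b (fst p) (snd p))" by (simp add: bform_diff bform_tsum)
  also have "norm \<dots> \<le> C * tweight V W xs"
    using xs(1)
  proof (induction xs)
    case (Cons p xs)
    have "norm (b (fst p) (snd p)) \<le> C * (vs_norm V (fst p) * vs_norm W (snd p))"
      using Cons.prems by (intro bound) auto
    moreover have "norm (\<Sum>p\<leftarrow>xs. b (fst p) (snd p)) \<le> C * tweight V W xs" using Cons by simp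
    ultimately show ?case
      using norm_triangle_ineq[of "b (fst p) (snd p)" "\<Sum>p\<leftarrow>xs. b (fst p) (snd p)"]
      by (simp add: distrib_left)
  qed simp
  also have "\<dots> \<le> C * (vs_norm A (cls u) + e / (C + 1))"
    using xs(3) C by (intro mult_left_mono) auto
  also have "\<dots> \<le> C * vs_norm A (cls u) + e"
    using C e by (simp add: field_simps)
  finally show "norm (bform b u) \<le> C * vs_norm A (cls u) + e" .
qed

lemma pnorm_scale_le:
  assumes u: "u \<in> FC"
  shows "vs_norm A (cls (free_scale c u)) \<le> norm c * vs_norm A (cls u)"
proof (rule field_le_epsilon)
  fix e :: real assume e: "e > 0"
  obtain xs where xs: "set xs \<subseteq> pairs" "tsum xs - u \<in> S" "tweight V W xs < vs_norm A (cls u) + e / (norm c + 1)"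
    using pnorm_approx[OF u, of "e / (norm c + 1)"] e by (auto simp: add_nonneg_pos)
  define g where "g p = (vs_scale V c (fst p), snd p)" for p :: "'e \<times> 'f"
  have g: "set (map g ys) \<subseteq> pairs \<and> tsum (map g ys) - free_scale c (tsum ys) \<in> S \<and> tweight V W (map g ys) = norm c * tweight V W ys"
    if "set ys \<subseteq> pairs" for ys
    using that
  proof (induction ys)
    case Nil
    then show ?case by (simp add: free.span_zero)
  next
    case (Cons p ys)
    obtain x y where p: "p = (x, y)" by fastforce
    have xy: "x \<in> vs_carrier V" "y \<in> vs_carrier W" using Cons by (auto simp: p)
    have "(sg (vs_scale V c x) y 1 - sg x y c) + (tsum (map g ys) - free_scale c (tsum ys)) \<in> S"
      using Cons by (intro free.span_add rel_scale_left xy) auto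
    moreover have "g p = (vs_scale V c x, y)" by (simp add: g_def p)
    ultimately show ?case using Cons xy
      by (auto simp: p V.closed V.norm_scale free.scale_right_distrib free_scale_single algebra_simps)
  qed
  have "free_scale c (tsum xs - u) \<in> S" using xs(2) by (rule free.span_scale)
  then have "tsum (map g xs) - free_scale c u \<in> S"
    using g[OF xs(1)] span_trans[of "tsum (map g xs)" "free_scale c (tsum xs)" "free_scale c u"]
    by (simp add: free.scale_right_diff_distrib)
  then have "vs_norm A (cls (free_scale c u)) \<le> tweight V W (map g xs)"
    using g[OF xs(1)] u by (intro pnorm_le FC_closed) auto
  also have "\<dots> = norm c * tweight V W xs" using g[OF xs(1)] by blast
  also have "\<dots> \<le> norm c * (vs_norm A (cls u) + e / (norm c + 1))"
    using xs(3) by (intro mult_left_mono) auto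
  also have "\<dots> \<le> norm c * vs_norm A (cls u) + e"
  proof -
    have "norm c * (e / (norm c + 1)) \<le> e"
      using e add_nonneg_pos[OF norm_ge_zero[of c], of 1] by (simp add: field_simps)
    then show ?thesis by (simp add: distrib_left)
  qed
  finally show "vs_norm A (cls (free_scale c u)) \<le> norm c * vs_norm A (cls u) + e" .
qed

lemma pnorm_nonneg: "u \<in> FC \<Longrightarrow> 0 \<le> vs_norm A (cls u)"
  by (rule pnorm_ge) (auto simp: tweight_nonneg)

lemma normed_space_A: "normed_space A"
proof
  note [simp] = A_carrier A_zero A_add A_scale FC_closed
  show "vs_zero A \<in> vs_carrier A" by auto
  show "vs_add A x y \<in> vs_carrier A" if "x \<in> vs_carrier A" "y \<in> vs_carrier A" for x y
    using that by auto
  show "vs_scale A c x \<in> vs_carrier A" if "x \<in> vs_carrier A" for x c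
    using that by auto
  show "vs_add A (vs_add A x y) z = vs_add A x (vs_add A y z)"
    if "x \<in> vs_carrier A" "y \<in> vs_carrier A" "z \<in> vs_carrier A" for x y z
    using that by (auto simp: add.assoc)
  show "vs_add A x y = vs_add A y x" if "x \<in> vs_carrier A" "y \<in> vs_carrier A" for x y
    using that by (auto simp: add.commute)
  show "vs_add A x (vs_zero A) = x" if "x \<in> vs_carrier A" for x
    using that by auto
  show "vs_diff A x x = vs_zero A" if "x \<in> vs_carrier A" for x
    using that by (auto simp: vs_diff_def free.scale_minus_left)
  show "vs_scale A 1 x = x" if "x \<in> vs_carrier A" for x
    using that by auto
  show "vs_scale A a (vs_scale A b x) = vs_scale A (a * b) x" if "x \<in> vs_carrier A" for x a b
    using that by auto
  show "vs_scale A (a + b) x = vs_add A (vs_scale A a x) (vs_scale A b x)" if "x \<in> vs_carrier A" for x a b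
    using that by (auto simp: free.scale_left_distrib)
  show "vs_scale A a (vs_add A x y) = vs_add A (vs_scale A a x) (vs_scale A a y)"
    if "x \<in> vs_carrier A" "y \<in> vs_carrier A" for x y a
    using that by (auto simp: free.scale_right_distrib)
  show "0 \<le> vs_norm A x" if "x \<in> vs_carrier A" for x
    using that pnorm_nonneg by auto
  show "vs_norm A x = 0 \<longleftrightarrow> x = vs_zero A" if x: "x \<in> vs_carrier A" for x
  proof
    obtain u where u: "u \<in> FC" "x = cls u" using x by auto
    show "vs_norm A x = 0" if "x = vs_zero A"
      using pnorm_le[of 0 "[]"] pnorm_nonneg[of 0] that by (simp add: free.span_zero)
    assume zero: "vs_norm A x = 0"
    obtain xs where xs: "set xs \<subseteq> pairs" "tsum xs - u \<in> S" using ex_tsum[OF u(1)] by blast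
    then have eq: "cls (tsum xs) = x" using u by (simp add: cls_eq tsum_FC)
    \<comment> \<open>Definiteness of the projective norm: products \<phi> \<otimes> \<psi> of
      functionals are bounded forms, so norm zero makes all of them vanish on the list, and
      \<open>tsum_in_span\<close> concludes that the tensor is zero.\<close>
    have "tsum xs \<in> S"
    proof (rule tsum_in_span[OF xs(1)])
      fix \<phi> \<psi> assume \<phi>: "\<phi> \<in> dual V" and \<psi>: "\<psi> \<in> dual W"
      obtain C where C: "C > 0" "\<forall>x\<in>vs_carrier V. norm (\<phi> x) \<le> C * vs_norm V x"
        using dual_bound[OF V.normed_space_axioms \<phi>] by blast
      obtain D where D: "D > 0" "\<forall>x\<in>vs_carrier W. norm (\<psi> x) \<le> D * vs_norm W x"
        using dual_bound[OF W.normed_space_axioms \<psi>] by blast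
      have "norm (bform (\<lambda>x y. \<phi> x * \<psi> y) (tsum xs)) \<le> (C * D) * vs_norm A (cls (tsum xs))"
      proof (rule bform_le_pnorm)
        fix x y assume "x \<in> vs_carrier V" "y \<in> vs_carrier W"
        then have "norm (\<phi> x) * norm (\<psi> y) \<le> (C * vs_norm V x) * (D * vs_norm W y)"
          using C D by (intro mult_mono) (auto simp: V.norm_nonneg)
        then show "norm (\<phi> x * \<psi> y) \<le> C * D * (vs_norm V x * vs_norm W y)"
          by (simp add: norm_mult mult_ac)
      qed (use C D xs in \<open>auto simp: dual_add[OF \<phi>] dual_add[OF \<psi>] dual_scale[OF \<phi>] dual_scale[OF \<psi>] algebra_simps tsum_FC\<close>)
      then show "(\<Sum>p\<leftarrow>xs. \<phi> (fst p) * \<psi> (snd p)) = 0"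
        using zero by (simp add: eq bform_tsum)
    qed
    then show "x = vs_zero A"
      using cls_eq[of "tsum xs" 0] eq xs by (simp add: tsum_FC)
  qed
  show "vs_norm A (vs_scale A a x) = norm a * vs_norm A x" if x: "x \<in> vs_carrier A" for x a
  proof -
    obtain u where u: "u \<in> FC" "x = cls u" using x by auto
    show ?thesis
    proof (cases "a = 0")
      case True
      then show ?thesis using u pnorm_le[of 0 "[]"] pnorm_nonneg[of 0] by (simp add: free.span_zero)
    next
      case False
      have "vs_norm A (cls (free_scale (inverse a) (free_scale a u))) \<le> norm (inverse a) * vs_norm A (cls (free_scale a u))"
        using u by (intro pnorm_scale_le) simp
      then have "norm a * vs_norm A (cls u) \<le> vs_norm A (cls (free_scale a u))"
        using False by (simp add: norm_divide field_simps)
      then show ?thesis using pnorm_scale_le[OF u(1), of a] u by simp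
    qed
  qed
  show "vs_norm A (vs_add A x y) \<le> vs_norm A x + vs_norm A y" if x: "x \<in> vs_carrier A" "y \<in> vs_carrier A" for x y
  proof (rule field_le_epsilon)
    fix e :: real assume e: "e > 0"
    obtain u v where u: "u \<in> FC" "x = cls u" and v: "v \<in> FC" "y = cls v" using x by auto
    obtain xs where xs: "set xs \<subseteq> pairs" "tsum xs - u \<in> S" "tweight V W xs < vs_norm A (cls u) + e / 2"
      using pnorm_approx[OF u(1), of "e / 2"] e by auto
    obtain ys where ys: "set ys \<subseteq> pairs" "tsum ys - v \<in> S" "tweight V W ys < vs_norm A (cls v) + e / 2"
      using pnorm_approx[OF v(1), of "e / 2"] e by auto
    have "(tsum xs - u) + (tsum ys - v) \<in> S" using xs ys by (intro free.span_add)
    then have "vs_norm A (cls (u + v)) \<le> tweight V W (xs @ ys)"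
      using xs ys u v by (intro pnorm_le) (auto simp: algebra_simps)
    then show "vs_norm A (vs_add A x y) \<le> vs_norm A x + vs_norm A y + e"
      using xs ys u v by simp
  qed
qed

section \<open>The completed product and its universal property\<close>

abbreviation E :: "('k, (nat \<Rightarrow> (('e \<times> 'f) \<Rightarrow>\<^sub>0 'k) set) set) nspace" where
  "E \<equiv> projective_tensor V W"

definition tens :: "'e \<Rightarrow> 'f \<Rightarrow> (nat \<Rightarrow> (('e \<times> 'f) \<Rightarrow>\<^sub>0 'k) set) set" where
  "tens x y = normed_space.embed A (cls (sg x y 1))"

lemma normed_space_E: "normed_space E"
  unfolding projective_tensor_def by (rule normed_space.normed_space_completion[OF normed_space_A])

lemmas embed_A = normed_space.embed[OF normed_space_A, folded projective_tensor_def]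

lemma tens_closed: "x \<in> vs_carrier V \<Longrightarrow> y \<in> vs_carrier W \<Longrightarrow> tens x y \<in> vs_carrier E"
  unfolding tens_def by (rule embed_A) (simp add: A_carrier FC_closed)

lemma tens_add_left:
  assumes "x \<in> vs_carrier V" "x' \<in> vs_carrier V" "y \<in> vs_carrier W"
  shows "tens (vs_add V x x') y = vs_add E (tens x y) (tens x' y)"
proof -
  have "cls (sg (vs_add V x x') y 1) = cls (sg x y 1 + sg x' y 1)"
    using rel_add_left[OF assms] assms by (subst cls_eq) (auto simp: FC_closed V.closed diff_diff_add)
  then show ?thesis
    using assms unfolding tens_def by (subst embed_A(4)) (auto simp: A_carrier A_add FC_closed)
qed

lemma tens_add_right:
  assumes "x \<in> vs_carrier V" "y \<in> vs_carrier W" "y' \<in> vs_carrier W"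
  shows "tens x (vs_add W y y') = vs_add E (tens x y) (tens x y')"
proof -
  have "cls (sg x (vs_add W y y') 1) = cls (sg x y 1 + sg x y' 1)"
    using rel_add_right[OF assms] assms by (subst cls_eq) (auto simp: FC_closed W.closed diff_diff_add)
  then show ?thesis
    using assms unfolding tens_def by (subst embed_A(4)) (auto simp: A_carrier A_add FC_closed)
qed

lemma tens_scale_left:
  assumes "x \<in> vs_carrier V" "y \<in> vs_carrier W"
  shows "tens (vs_scale V c x) y = vs_scale E c (tens x y)"
proof -
  have "cls (sg (vs_scale V c x) y 1) = cls (free_scale c (sg x y 1))"
    using rel_scale_left[OF assms] assms by (subst cls_eq) (auto simp: FC_closed V.closed free_scale_single)
  then show ?thesis
    using assms unfolding tens_def by (subst embed_A(3)) (auto simp: A_carrier A_scale FC_closed)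
qed

lemma tens_scale_right:
  assumes "x \<in> vs_carrier V" "y \<in> vs_carrier W"
  shows "tens x (vs_scale W c y) = vs_scale E c (tens x y)"
proof -
  have "cls (sg x (vs_scale W c y) 1) = cls (free_scale c (sg x y 1))"
    using rel_scale_right[OF assms] assms by (subst cls_eq) (auto simp: FC_closed W.closed free_scale_single)
  then show ?thesis
    using assms unfolding tens_def by (subst embed_A(3)) (auto simp: A_carrier A_scale FC_closed)
qed

lemma norm_tens_le:
  assumes "x \<in> vs_carrier V" "y \<in> vs_carrier W"
  shows "vs_norm E (tens x y) \<le> vs_norm V x * vs_norm W y"
proof -
  have "vs_norm E (tens x y) = vs_norm A (cls (sg x y 1))"
    unfolding tens_def by (rule embed_A(2)) (use assms in \<open>simp add: A_carrier FC_closed\<close>)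
  also have "\<dots> \<le> vs_norm V x * vs_norm W y"
    using pnorm_le[of "sg x y 1" "[(x, y)]"] assms by (simp add: FC_closed free.span_zero)
  finally show ?thesis .
qed

text \<open>The universal property for scalar forms: the value on a coset is read off from a chosen
  representative, is independent of the choice by \<open>bform_span\<close>, and extends to the
  completion by continuity.\<close>

lemma bilinear_extends:
  assumes b: "\<And>x x' y. \<lbrakk>x \<in> vs_carrier V; x' \<in> vs_carrier V; y \<in> vs_carrier W\<rbrakk> \<Longrightarrow> b (vs_add V x x') y = b x y + b x' y"
    "\<And>x y y'. \<lbrakk>x \<in> vs_carrier V; y \<in> vs_carrier W; y' \<in> vs_carrier W\<rbrakk> \<Longrightarrow> b x (vs_add W y y') = b x y + b x y'"
    "\<And>c x y. \<lbrakk>x \<in> vs_carrier V; y \<in> vs_carrier W\<rbrakk> \<Longrightarrow> b (vs_scale V c x) y = c * b x y"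
    "\<And>c x y. \<lbrakk>x \<in> vs_carrier V; y \<in> vs_carrier W\<rbrakk> \<Longrightarrow> b x (vs_scale W c y) = c * b x y"
    and bound: "\<And>x y. \<lbrakk>x \<in> vs_carrier V; y \<in> vs_carrier W\<rbrakk> \<Longrightarrow> norm (b x y) \<le> C * (vs_norm V x * vs_norm W y)"
    and C: "C \<ge> 0"
  shows "\<exists>\<Phi>\<in>dual E. \<forall>x\<in>vs_carrier V. \<forall>y\<in>vs_carrier W. \<Phi> (tens x y) = b x y"
proof -
  define \<phi> where "\<phi> B = bform b (SOME u. u \<in> FC \<and> cls u = B)" for B
  have \<phi>: "\<phi> (cls u) = bform b u" if u: "u \<in> FC" for u
  proof -
    let ?v = "SOME v. v \<in> FC \<and> cls v = cls u"
    have v: "?v \<in> FC \<and> cls ?v = cls u" by (rule someI[of _ u]) (simp add: u)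
    then have "?v - u \<in> S" using u cls_eq[of ?v u] by blast
    with b have "bform b (?v - u) = 0" by (rule bform_span)
    then show ?thesis by (simp add: \<phi>_def bform_diff)
  qed
  have "\<phi> \<in> dual A"
  proof (rule dualI[OF normed_space_A])
    fix x y assume "x \<in> vs_carrier A" "y \<in> vs_carrier A"
    then obtain u v where "u \<in> FC" "x = cls u" "v \<in> FC" "y = cls v" by (auto simp: A_carrier)
    then show "\<phi> (vs_add A x y) = \<phi> x + \<phi> y" by (simp add: A_add \<phi> FC_closed bform_add)
  next
    fix c x assume "x \<in> vs_carrier A"
    then obtain u where "u \<in> FC" "x = cls u" by (auto simp: A_carrier)
    then show "\<phi> (vs_scale A c x) = c * \<phi> x" by (simp add: A_scale \<phi> FC_closed bform_scale)
  next
    fix x assume "x \<in> vs_carrier A"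
    then obtain u where u: "u \<in> FC" "x = cls u" by (auto simp: A_carrier)
    from b bound C u(1) have "norm (bform b u) \<le> C * vs_norm A (cls u)" by (rule bform_le_pnorm)
    then show "norm (\<phi> x) \<le> C * vs_norm A x" using u by (simp add: \<phi>)
  qed
  from dual_extend_completion[OF normed_space_A this]
  obtain \<Phi> where \<Phi>: "\<Phi> \<in> dual E" "\<forall>v\<in>vs_carrier A. \<Phi> (normed_space.embed A v) = \<phi> v"
    unfolding projective_tensor_def by blast
  have "\<Phi> (tens x y) = b x y" if "x \<in> vs_carrier V" "y \<in> vs_carrier W" for x y
    using bspec[OF \<Phi>(2), of "cls (sg x y 1)"] that by (simp add: tens_def A_carrier FC_closed \<phi>)
  then show ?thesis using \<Phi>(1) by blast
qed

text \<open>The unit ball of the projective norm is essentially the closed convex hull of elementary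
  tensors, so a constant valid on these is valid everywhere. The possibly much larger
  \<open>M\<close> only provides the continuity needed to leave the dense subspace. The lemma speaks
  of a subadditive \<open>p\<close> so as to cover single functionals and finite l2 combinations of
  them alike.\<close>

lemma seminorm_bound:
  assumes sub: "\<And>z w. \<lbrakk>z \<in> vs_carrier E; w \<in> vs_carrier E\<rbrakk> \<Longrightarrow> p (vs_add E z w) \<le> p z + p w"
    and M: "\<And>z. z \<in> vs_carrier E \<Longrightarrow> p z \<le> M * vs_norm E z"
    and C: "C \<ge> 0" "\<And>x y. \<lbrakk>x \<in> vs_carrier V; y \<in> vs_carrier W\<rbrakk> \<Longrightarrow> p (tens x y) \<le> C * (vs_norm V x * vs_norm W y)"
    and z: "z \<in> vs_carrier E"
  shows "p z \<le> C * vs_norm E z"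
proof -
  interpret E: normed_space E by (rule normed_space_E)
  let ?i = "normed_space.embed A"
  have iE: "?i (cls u) \<in> vs_carrier E" if "u \<in> FC" for u
    by (rule embed_A) (use that in \<open>simp add: A_carrier\<close>)
  have list: "p (?i (cls (tsum xs))) \<le> C * tweight V W xs" if "set xs \<subseteq> pairs" for xs
    using that
  proof (induction xs)
    case Nil
    have "vs_norm E (?i (cls 0)) = vs_norm A (cls 0)"
      by (rule embed_A(2)) (simp add: A_carrier FC_closed)
    also have "\<dots> = 0" using normed_space.norm_zero[OF normed_space_A] by (simp add: A_zero)
    finally show ?case using M[of "?i (cls 0)"] iE[of 0] by (simp add: FC_closed)
  next
    case (Cons q xs)
    obtain x y where q: "q = (x, y)" by fastforce
    have xy: "x \<in> vs_carrier V" "y \<in> vs_carrier W" using Cons by (auto simp: q)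
    have xs: "tsum xs \<in> FC" using Cons by (intro tsum_FC) auto
    have "?i (cls (tsum (q # xs))) = vs_add E (tens x y) (?i (cls (tsum xs)))"
      unfolding tens_def using xs xy by (subst embed_A(4)) (auto simp: A_carrier A_add FC_closed q)
    moreover have "p (vs_add E (tens x y) (?i (cls (tsum xs)))) \<le> p (tens x y) + p (?i (cls (tsum xs)))"
      by (intro sub tens_closed xy iE xs)
    ultimately show ?case using C(2)[OF xy] Cons by (simp add: q distrib_left)
  qed
  have i_le: "p (?i (cls u)) \<le> C * vs_norm A (cls u)" if u: "u \<in> FC" for u
  proof (rule field_le_epsilon)
    fix e :: real assume e: "e > 0"
    obtain xs where xs: "set xs \<subseteq> pairs" "tsum xs - u \<in> S" "tweight V W xs < vs_norm A (cls u) + e / (C + 1)"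
      using pnorm_approx[OF u, of "e / (C + 1)"] e C by auto
    have "cls u = cls (tsum xs)" using xs u by (simp add: cls_eq tsum_FC span_sym)
    then have "p (?i (cls u)) \<le> C * tweight V W xs" using list[OF xs(1)] by simp
    also have "\<dots> \<le> C * (vs_norm A (cls u) + e / (C + 1))"
      using xs(3) C by (intro mult_left_mono) auto
    also have "\<dots> \<le> C * vs_norm A (cls u) + e" using C e by (simp add: field_simps)
    finally show "p (?i (cls u)) \<le> C * vs_norm A (cls u) + e" .
  qed
  show ?thesis
  proof (rule field_le_epsilon)
    fix e :: real assume e: "e > 0"
    \<comment> \<open>The approximation error enters twice: through \<open>p\<close> of the
      difference, with factor \<bar>M\<bar>, and through the norm of the approximant, with factor
      C.\<close>
    define d where "d = e / (\<bar>M\<bar> + C + 1)"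
    have d: "d > 0" "(\<bar>M\<bar> + C) * d \<le> e" using e C by (auto simp: d_def field_simps)
    obtain v where v: "v \<in> vs_carrier A" "vs_norm E (vs_diff E z (?i v)) < d"
      using normed_space.embed_dense[OF normed_space_A, folded projective_tensor_def, OF z d(1)] by blast
    then obtain u where u: "u \<in> FC" "v = cls u" by (auto simp: A_carrier)
    have iv: "?i v \<in> vs_carrier E" using iE u by simp
    have zd: "vs_diff E z (?i v) \<in> vs_carrier E" using z iv by (rule E.diff_closed)
    have "p z = p (vs_add E (vs_diff E z (?i v)) (?i v))" using z iv by (simp add: E.diff_add_cancel)
    also have "\<dots> \<le> p (vs_diff E z (?i v)) + p (?i v)" by (rule sub[OF zd iv])
    also have "p (vs_diff E z (?i v)) \<le> \<bar>M\<bar> * d"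
    proof -
      have "p (vs_diff E z (?i v)) \<le> M * vs_norm E (vs_diff E z (?i v))" by (rule M[OF zd])
      also have "\<dots> \<le> \<bar>M\<bar> * vs_norm E (vs_diff E z (?i v))"
        by (intro mult_right_mono E.norm_nonneg zd) simp
      also have "\<dots> \<le> \<bar>M\<bar> * d" using v by (intro mult_left_mono) auto
      finally show ?thesis .
    qed
    also have "p (?i v) \<le> C * (vs_norm E z + d)"
    proof -
      have "vs_norm A v = vs_norm E (?i v)" using v(1) by (rule embed_A(2)[symmetric])
      also have "\<dots> \<le> vs_norm E (vs_diff E (?i v) z) + vs_norm E z" by (rule E.norm_le_diff[OF iv z])
      also have "\<dots> \<le> vs_norm E z + d" using v(2) E.norm_diff_commute[OF iv z] by simp
      finally have "C * vs_norm A v \<le> C * (vs_norm E z + d)" using C by (intro mult_left_mono) auto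
      then show ?thesis using i_le[OF u(1)] u by simp
    qed
    finally show "p z \<le> C * vs_norm E z + e" using d by (simp add: algebra_simps)
  qed
qed

end

section \<open>Continuous functions on a compact space\<close>

abbreviation cont :: "'a topology \<Rightarrow> ('a \<Rightarrow> 'b::topological_space) \<Rightarrow> bool" where
  "cont K f \<equiv> continuous_map K euclidean f"

text \<open>With continuity expressed by limits at points, closure under the algebraic operations is
  inherited from the limit rules for real and complex values.\<close>

lemma cont_iff: "cont K f \<longleftrightarrow> (\<forall>a\<in>topspace K. (f \<longlongrightarrow> f a) (atin K a))"
  by (simp add: continuous_map_atin)

lemma cont_const: "cont K (\<lambda>_. c)" by simp

lemma cont_add:
  fixes f g :: "'a \<Rightarrow> 'b::real_normed_vector"
  shows "cont K f \<Longrightarrow> cont K g \<Longrightarrow> cont K (\<lambda>x. f x + g x)"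
  unfolding cont_iff by (blast intro: tendsto_add)

lemma cont_diff:
  fixes f g :: "'a \<Rightarrow> 'b::real_normed_vector"
  shows "cont K f \<Longrightarrow> cont K g \<Longrightarrow> cont K (\<lambda>x. f x - g x)"
  unfolding cont_iff by (blast intro: tendsto_diff)

lemma cont_mult:
  fixes f g :: "'a \<Rightarrow> 'b::real_normed_algebra"
  shows "cont K f \<Longrightarrow> cont K g \<Longrightarrow> cont K (\<lambda>x. f x * g x)"
  unfolding cont_iff by (blast intro: tendsto_mult)

lemma cont_sum:
  fixes f :: "'i \<Rightarrow> 'a \<Rightarrow> 'b::real_normed_vector"
  shows "(\<And>i. i \<in> I \<Longrightarrow> cont K (f i)) \<Longrightarrow> cont K (\<lambda>x. \<Sum>i\<in>I. f i x)"
  unfolding cont_iff by (blast intro: tendsto_sum)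

lemma cont_prod:
  fixes f :: "'i \<Rightarrow> 'a \<Rightarrow> real"
  shows "(\<And>i. i \<in> I \<Longrightarrow> cont K (f i)) \<Longrightarrow> cont K (\<lambda>x. \<Prod>i\<in>I. f i x)"
  unfolding cont_iff by (blast intro: tendsto_prod)

lemma cont_divide:
  fixes f g :: "'a \<Rightarrow> real"
  shows "cont K f \<Longrightarrow> cont K g \<Longrightarrow> (\<And>x. x \<in> topspace K \<Longrightarrow> g x \<noteq> 0) \<Longrightarrow> cont K (\<lambda>x. f x / g x)"
  unfolding cont_iff by (blast intro: tendsto_divide)

lemma cont_of_real:
  fixes f :: "'a \<Rightarrow> real"
  shows "cont K f \<Longrightarrow> cont K (\<lambda>x. of_real (f x) :: 'b::real_normed_algebra_1)"
  unfolding cont_iff by (blast intro: tendsto_of_real)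

lemma cont_norm:
  fixes f :: "'a \<Rightarrow> 'b::real_normed_vector"
  shows "cont K f \<Longrightarrow> cont K (\<lambda>x. norm (f x))"
  unfolding cont_iff by (blast intro: tendsto_norm)

lemma cont_minmax:
  fixes f g :: "'a \<Rightarrow> real"
  shows "cont K f \<Longrightarrow> cont K g \<Longrightarrow> cont K (\<lambda>x. min (f x) (g x))"
    and "cont K f \<Longrightarrow> cont K g \<Longrightarrow> cont K (\<lambda>x. max (f x) (g x))"
  unfolding cont_iff by (blast intro: tendsto_min tendsto_max)+

lemmas cont_intros = cont_const cont_add cont_diff cont_mult cont_sum cont_prod cont_divide cont_of_real cont_norm cont_minmax

lemma openin_preimage:
  assumes "cont K f" "open U" shows "openin K {x \<in> topspace K. f x \<in> U}"
  using assms openin_continuous_map_preimage[of K euclidean f U] by simp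

lemma closedin_preimage:
  assumes "cont K f" "closed U" shows "closedin K {x \<in> topspace K. f x \<in> U}"
  using assms closedin_continuous_map_preimage[of K euclidean f U] by simp

locale compact_Hausdorff =
  fixes K :: "'a topology"
  assumes compact: "compact_space K" and Hausdorff: "Hausdorff_space K" and nonempty: "topspace K \<noteq> {}"
begin

lemma cont_bounded:
  fixes f :: "'a \<Rightarrow> 'b::real_normed_vector"
  assumes "cont K f" shows "\<exists>B>0. \<forall>x\<in>topspace K. norm (f x) \<le> B"
proof -
  have "compactin euclidean (f ` topspace K)"
    using image_compactin[of K "topspace K" euclidean f] compact assms by (simp add: compact_space_def)
  then have "bounded (f ` topspace K)" by (simp add: compact_imp_bounded)
  then obtain B where "B > 0" "\<forall>y\<in>f ` topspace K. norm y \<le> B" unfolding bounded_pos by blast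
  then show ?thesis by (intro exI[of _ B]) auto
qed

lemma Urysohn:
  assumes "closedin K S" "closedin K T" "S \<inter> T = {}"
  shows "\<exists>f :: 'a \<Rightarrow> real. cont K f \<and> (\<forall>x\<in>topspace K. 0 \<le> f x \<and> f x \<le> 1) \<and>
    (\<forall>x\<in>S. f x = 0) \<and> (\<forall>x\<in>T. f x = 1)"
proof -
  have "normal_space K" using compact Hausdorff by (simp add: compact_Hausdorff_or_regular_imp_normal_space)
  then obtain f where f: "continuous_map K (top_of_set {0..1::real}) f" "f ` S \<subseteq> {0}" "f ` T \<subseteq> {1}"
    by (rule Urysohn_lemma[of K S T 0 1]) (use assms in \<open>auto simp: disjnt_def\<close>)
  then have "cont K f" "\<forall>x\<in>topspace K. 0 \<le> f x \<and> f x \<le> 1"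
    by (auto simp: continuous_map_in_subtopology)
  then show ?thesis using f by (intro exI[of _ f]) auto
qed

lemma closedin_finite: "finite S \<Longrightarrow> S \<subseteq> topspace K \<Longrightarrow> closedin K S"
  using Hausdorff Hausdorff_imp_t1_space t1_space_closedin_finite by blast

end

section \<open>Tails of seminorms on scattered spaces\<close>

text \<open>The functions \<open>h\<close> whose multiplication makes the tails small form a closed ideal; an isolated
  point of its zero set is impossible because of the condition on disjoint sequences.\<close>

locale disjoint_null_seminorm = compact_Hausdorff K for K :: "'a topology" +
  fixes P :: "('a \<Rightarrow> 'k::{real_normed_field, euclidean_space}) \<Rightarrow> real" and M :: real
  assumes P_add: "cont K f \<Longrightarrow> cont K g \<Longrightarrow> P (\<lambda>x. f x + g x) \<le> P f + P g"
    and P_scale: "cont K f \<Longrightarrow> c > 0 \<Longrightarrow> P (\<lambda>x. of_real c * f x) \<le> c * P f"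
    and P_bound: "cont K f \<Longrightarrow> (\<And>x. x \<in> topspace K \<Longrightarrow> norm (f x) \<le> b) \<Longrightarrow> P f \<le> M * b"
    and M_nonneg: "M \<ge> 0"
    and P_null: "(\<And>n :: nat. cont K (F n)) \<Longrightarrow> (\<And>n x. x \<in> topspace K \<Longrightarrow> norm (F n x) \<le> 1) \<Longrightarrow>
      (\<And>m n x. m \<noteq> n \<Longrightarrow> x \<in> topspace K \<Longrightarrow> F m x = 0 \<or> F n x = 0) \<Longrightarrow> (\<lambda>n. P (F n)) \<longlonglongrightarrow> 0"
begin

definition ball1 :: "('a \<Rightarrow> 'k) \<Rightarrow> bool" where
  "ball1 f \<longleftrightarrow> cont K f \<and> (\<forall>x\<in>topspace K. norm (f x) \<le> 1)"

definition J :: "('a \<Rightarrow> real) \<Rightarrow> bool" where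
  "J h \<longleftrightarrow> cont K h \<and> (\<forall>e>0. \<exists>S. finite S \<and> S \<subseteq> topspace K \<and>
    (\<forall>f. ball1 f \<and> (\<forall>x\<in>S. f x = 0) \<longrightarrow> P (\<lambda>x. f x * of_real (h x)) \<le> e))"

lemma P_split:
  assumes "cont K f" "cont K g" "\<And>x. x \<in> topspace K \<Longrightarrow> norm (f x - g x) \<le> b"
  shows "P f \<le> P g + M * b"
proof -
  have "P (\<lambda>x. g x + (f x - g x)) \<le> P g + P (\<lambda>x. f x - g x)"
    using assms by (intro P_add cont_intros)
  also have "P (\<lambda>x. f x - g x) \<le> M * b"
    using assms by (intro P_bound cont_intros)
  finally show ?thesis by simp
qed

lemma J_tail:
  assumes "J h" "e > 0"
  shows "\<exists>S. finite S \<and> S \<subseteq> topspace K \<and>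
    (\<forall>f. ball1 f \<and> (\<forall>x\<in>S. f x = 0) \<longrightarrow> P (\<lambda>x. f x * of_real (h x)) \<le> e)"
  using assms by (simp add: J_def)

lemma J_cont: "J h \<Longrightarrow> cont K h"
  by (simp add: J_def)

lemma J_zero: "J (\<lambda>_. 0)"
  using P_bound[of "\<lambda>_. 0" 0] unfolding J_def by (auto intro!: exI[of _ "{}"])

lemma J_add:
  assumes "J h" "J k" shows "J (\<lambda>x. h x + k x)"
  unfolding J_def
proof (intro conjI allI impI)
  have c: "cont K h" "cont K k" using assms by (auto simp: J_def)
  then show "cont K (\<lambda>x. h x + k x)" by (intro cont_intros)
  fix e :: real assume e: "e > 0"
  obtain S where S: "finite S" "S \<subseteq> topspace K" "\<And>f. ball1 f \<Longrightarrow> \<forall>x\<in>S. f x = 0 \<Longrightarrow> P (\<lambda>x. f x * of_real (h x)) \<le> e / 2"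
    using J_tail[OF assms(1), of "e / 2"] e by auto
  obtain T where T: "finite T" "T \<subseteq> topspace K" "\<And>f. ball1 f \<Longrightarrow> \<forall>x\<in>T. f x = 0 \<Longrightarrow> P (\<lambda>x. f x * of_real (k x)) \<le> e / 2"
    using J_tail[OF assms(2), of "e / 2"] e by auto
  show "\<exists>S. finite S \<and> S \<subseteq> topspace K \<and>
      (\<forall>f. ball1 f \<and> (\<forall>x\<in>S. f x = 0) \<longrightarrow> P (\<lambda>x. f x * of_real (h x + k x)) \<le> e)"
  proof (intro exI[of _ "S \<union> T"] conjI allI impI)
    fix f assume f: "ball1 f \<and> (\<forall>x\<in>S \<union> T. f x = 0)"
    have "P (\<lambda>x. f x * of_real (h x) + f x * of_real (k x)) \<le> P (\<lambda>x. f x * of_real (h x)) + P (\<lambda>x. f x * of_real (k x))"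
      using c f by (intro P_add cont_intros) (auto simp: ball1_def)
    also have "\<dots> \<le> e" using S(3)[of f] T(3)[of f] f by simp
    finally show "P (\<lambda>x. f x * of_real (h x + k x)) \<le> e" by (simp add: distrib_left)
  qed (use S T in auto)
qed

lemma J_sum: "finite I \<Longrightarrow> (\<And>i. i \<in> I \<Longrightarrow> J (h i)) \<Longrightarrow> J (\<lambda>x. \<Sum>i\<in>I. h i x)"
  by (induction I rule: finite_induct) (auto intro: J_zero J_add)

lemma J_mult:
  assumes h: "J h" and m: "cont K m" shows "J (\<lambda>x. h x * m x)"
  unfolding J_def
proof (intro conjI allI impI)
  have c: "cont K h" using h by (auto simp: J_def)
  show "cont K (\<lambda>x. h x * m x)" using c m by (intro cont_intros)
  obtain B where B: "B > 0" "\<forall>x\<in>topspace K. norm (m x) \<le> B" using cont_bounded[OF m] by blast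
  fix e :: real assume e: "e > 0"
  obtain S where S: "finite S" "S \<subseteq> topspace K" "\<And>f. ball1 f \<Longrightarrow> \<forall>x\<in>S. f x = 0 \<Longrightarrow> P (\<lambda>x. f x * of_real (h x)) \<le> e / B"
    using J_tail[OF h, of "e / B"] e B by auto
  show "\<exists>S. finite S \<and> S \<subseteq> topspace K \<and>
      (\<forall>f. ball1 f \<and> (\<forall>x\<in>S. f x = 0) \<longrightarrow> P (\<lambda>x. f x * of_real (h x * m x)) \<le> e)"
  proof (intro exI[of _ S] conjI allI impI)
    fix f assume f: "ball1 f \<and> (\<forall>x\<in>S. f x = 0)"
    let ?g = "\<lambda>x. f x * of_real (1 / B * m x)"
    have g: "ball1 ?g" unfolding ball1_def
    proof (intro conjI ballI)
      show "cont K ?g" using f m by (intro cont_intros) (auto simp: ball1_def)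
      fix x assume x: "x \<in> topspace K"
      have "norm (f x) * (\<bar>m x\<bar> / B) \<le> 1 * 1"
        using f x B by (intro mult_mono) (auto simp: ball1_def)
      then show "norm (?g x) \<le> 1" using B by (simp add: norm_mult norm_divide)
    qed
    have "P (\<lambda>x. of_real B * (?g x * of_real (h x))) \<le> B * P (\<lambda>x. ?g x * of_real (h x))"
      by (intro P_scale cont_mult[OF _ cont_of_real[OF c]] B(1)) (use g in \<open>simp add: ball1_def\<close>)
    also have "\<dots> \<le> B * (e / B)"
      using S(3)[OF g] f B by (intro mult_left_mono) auto
    also have "(\<lambda>x. of_real B * (?g x * of_real (h x))) = (\<lambda>x. f x * of_real (h x * m x))"
      using B by (auto simp: fun_eq_iff)
    finally show "P (\<lambda>x. f x * of_real (h x * m x)) \<le> e" using B by simp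
  qed (use S in auto)
qed

lemma J_closed:
  assumes h: "cont K h" and approx: "\<And>d. d > 0 \<Longrightarrow> \<exists>k. J k \<and> (\<forall>x\<in>topspace K. \<bar>h x - k x\<bar> \<le> d)"
  shows "J h"
  unfolding J_def
proof (intro conjI allI impI h)
  fix e :: real assume e: "e > 0"
  define d where "d = e / (2 * (M + 1))"
  have d: "d > 0" "M * d \<le> e / 2" using e M_nonneg by (auto simp: d_def field_simps)
  obtain k where k: "J k" "\<forall>x\<in>topspace K. \<bar>h x - k x\<bar> \<le> d" using approx[OF d(1)] by blast
  then have ck: "cont K k" by (simp add: J_def)
  obtain S where S: "finite S" "S \<subseteq> topspace K" "\<And>f. ball1 f \<Longrightarrow> \<forall>x\<in>S. f x = 0 \<Longrightarrow> P (\<lambda>x. f x * of_real (k x)) \<le> e / 2"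
    using J_tail[OF k(1), of "e / 2"] e by auto
  show "\<exists>S. finite S \<and> S \<subseteq> topspace K \<and>
      (\<forall>f. ball1 f \<and> (\<forall>x\<in>S. f x = 0) \<longrightarrow> P (\<lambda>x. f x * of_real (h x)) \<le> e)"
  proof (intro exI[of _ S] conjI allI impI)
    fix f assume f: "ball1 f \<and> (\<forall>x\<in>S. f x = 0)"
    have "P (\<lambda>x. f x * of_real (h x)) \<le> P (\<lambda>x. f x * of_real (k x)) + M * d"
    proof (rule P_split)
      show "norm (f x * of_real (h x) - f x * of_real (k x)) \<le> d" if x: "x \<in> topspace K" for x
      proof -
        have "norm (f x) * \<bar>h x - k x\<bar> \<le> 1 * d" using f k x by (intro mult_mono) (auto simp: ball1_def)
        moreover have "f x * of_real (h x) - f x * of_real (k x) = f x * of_real (h x - k x)"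
          by (simp add: right_diff_distrib)
        ultimately show ?thesis by (simp only: norm_mult norm_of_real mult_1)
      qed
    qed (use f h ck in \<open>auto simp: ball1_def intro!: cont_intros\<close>)
    also have "\<dots> \<le> e" using S(3)[of f] f d by simp
    finally show "P (\<lambda>x. f x * of_real (h x)) \<le> e" .
  qed (use S in auto)
qed

definition H :: "'a set" where "H = {x \<in> topspace K. \<forall>h. J h \<longrightarrow> h x = 0}"

lemma closedin_H: "closedin K H"
proof -
  have "H = topspace K \<inter> \<Inter>{{x \<in> topspace K. h x \<in> {0}} | h. J h}" by (auto simp: H_def)
  moreover have "closedin K (topspace K \<inter> \<Inter>{{x \<in> topspace K. h x \<in> {0}} | h. J h})"
  proof (cases "{{x \<in> topspace K. h x \<in> {0}} | h. J h} = {}")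
    case False
    then show ?thesis
      by (intro closedin_Int closedin_Inter) (auto intro!: closedin_preimage[where U = "{0::real}", simplified] simp: J_def)
  qed simp
  ultimately show ?thesis by simp
qed

text \<open>The closed ideal contains everything that vanishes on its common zero set
  \<open>H\<close>. On the compact set where |g| \<ge> d the ideal has no common zero, so finitely
  many members combine to a \<open>k\<close> in the ideal that is bounded below there, and g \<cdot>
  n k / (1 + n k) is close to g.\<close>

lemma J_vanish:
  assumes g: "cont K g" and gH: "\<And>x. x \<in> H \<Longrightarrow> g x = 0"
  shows "J g"
proof (rule J_closed[OF g])
  fix d :: real assume d: "d > 0"
  define C where "C = {x \<in> topspace K. g x \<in> {y. d \<le> \<bar>y\<bar>}}"
  have "closedin K C" unfolding C_def
    by (intro closedin_preimage g closed_Collect_le continuous_intros)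
  then have C: "compactin K C" using compact closedin_compact_space by blast
  have "\<exists>h. J h \<and> h y \<noteq> 0" if "y \<in> C" for y
    using that gH d by (force simp: C_def H_def)
  then obtain h where h: "\<And>y. y \<in> C \<Longrightarrow> J (h y)" "\<And>y. y \<in> C \<Longrightarrow> h y y \<noteq> 0" by metis
  define V where "V y = {x \<in> topspace K. h y x \<in> - {0}}" for y
  have "\<exists>\<F>. finite \<F> \<and> \<F> \<subseteq> V ` C \<and> C \<subseteq> \<Union>\<F>"
  proof (rule compactinD[OF C])
    show "openin K U" if "U \<in> V ` C" for U
      using that h(1) unfolding V_def by (auto intro!: openin_preimage[where U = "- {0::real}", simplified] simp: J_def)
    show "C \<subseteq> \<Union> (V ` C)" using h(2) by (auto simp: V_def C_def)
  qed
  then obtain \<F> where \<F>: "finite \<F>" "\<F> \<subseteq> V ` C" "C \<subseteq> \<Union>\<F>" by blast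
  obtain L where L: "L \<subseteq> C" "finite L" "\<F> = V ` L" using finite_subset_image[OF \<F>(1,2)] by blast
  \<comment> \<open>Squares are nonnegative, so the sum can vanish only where all chosen members of
    the ideal vanish, which happens nowhere on \<open>C\<close>.\<close>
  define k where "k x = (\<Sum>y\<in>L. h y x * h y x)" for x
  have Jk: "J k" unfolding k_def
  proof (rule J_sum[OF L(2)])
    fix y assume "y \<in> L"
    then have "J (h y)" using h(1) L(1) by blast
    then show "J (\<lambda>x. h y x * h y x)" using J_cont by (intro J_mult)
  qed
  then have ck: "cont K k" by (rule J_cont)
  have k0: "k x \<ge> 0" for x by (auto simp: k_def intro: sum_nonneg)
  have kC: "k x > 0" if x: "x \<in> C" for x
  proof -
    obtain y where y: "y \<in> L" "h y x \<noteq> 0" using \<F>(3) L x by (auto simp: V_def)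
    have "0 < h y x * h y x" using y(2) by (metis not_real_square_gt_zero)
    also have "\<dots> \<le> k x" unfolding k_def by (rule member_le_sum) (use y L in auto)
    finally show ?thesis .
  qed
  have "\<exists>c>0. \<forall>x\<in>C. c \<le> k x"
  proof (cases "C = {}")
    case True
    then show ?thesis by (intro exI[of _ 1]) simp
  next
    case False
    have "compactin euclidean (k ` C)" using image_compactin[OF C ck] .
    then have "compact (k ` C)" by simp
    then obtain t where "t \<in> k ` C" "\<forall>s\<in>k ` C. t \<le> s"
      using compact_attains_inf[of "k ` C"] False by blast
    then show ?thesis using kC by (intro exI[of _ t]) auto
  qed
  then obtain c where c: "c > 0" "\<forall>x\<in>C. c \<le> k x" by blast
  obtain B where B: "B > 0" "\<forall>x\<in>topspace K. norm (g x) \<le> B" using cont_bounded[OF g] by blast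
  \<comment> \<open>With this choice the error |g| / (1 + n k) is at most B / (1 + B/d) \<le> d on
    \<open>C\<close>; off \<open>C\<close> it is at most |g| < d.\<close>
  define n where "n = B / (c * d)"
  have n: "n > 0" "B / (1 + n * c) \<le> d" using B c d by (auto simp: n_def field_simps)
  have pos: "1 + n * k x > 0" for x using n(1) k0[of x] by (simp add: add_pos_nonneg)
  let ?k = "\<lambda>x. k x * (g x * n / (1 + n * k x))"
  have "J ?k" using pos by (intro J_mult Jk cont_intros g ck) (auto simp: less_le)
  moreover have "\<bar>g x - ?k x\<bar> \<le> d" if x: "x \<in> topspace K" for x
  proof -
    have "g x - ?k x = g x / (1 + n * k x)" using pos[of x] by (simp add: field_simps)
    then have eq: "\<bar>g x - ?k x\<bar> = \<bar>g x\<bar> / (1 + n * k x)" using pos[of x] by (simp add: abs_of_pos)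
    show ?thesis
    proof (cases "x \<in> C")
      case True
      have "\<bar>g x\<bar> / (1 + n * k x) \<le> B / (1 + n * c)"
        using True c n B x by (intro frac_le) (auto simp: add_pos_pos)
      then show ?thesis using eq n by simp
    next
      case False
      then have "\<bar>g x\<bar> \<le> d" using x by (simp add: C_def)
      moreover have "\<bar>g x\<bar> / (1 + n * k x) \<le> \<bar>g x\<bar> / 1"
        using n(1) k0[of x] pos[of x] by (intro divide_left_mono) auto
      ultimately show ?thesis using eq by simp
    qed
  qed
  ultimately show "\<exists>k. J k \<and> (\<forall>x\<in>topspace K. \<bar>g x - k x\<bar> \<le> d)" by blast
qed

text \<open>Otherwise every neighbourhood of \<open>x\<close> supports a function of the unit ball
  that vanishes at \<open>x\<close> and has P above e. Cut off to vanish near \<open>x\<close> at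
  little cost, it leaves a smaller neighbourhood for the next one. The resulting functions are
  disjoint with P at least e/2, against \<open>P_null\<close>.\<close>

lemma small_near_point:
  assumes x: "x \<in> topspace K" and e: "e > 0"
  shows "\<exists>W. openin K W \<and> x \<in> W \<and> (\<forall>f. ball1 f \<and> f x = 0 \<and> (\<forall>y\<in>topspace K - W. f y = 0) \<longrightarrow> P f \<le> e)"
proof (rule ccontr)
  assume neg: "\<not> ?thesis"
  define d where "d = e / (4 * (M + 1))"
  have d: "d > 0" "M * (2 * d) \<le> e / 2" using e M_nonneg by (auto simp: d_def field_simps)
  have step: "\<exists>f W'. openin K W' \<and> x \<in> W' \<and> W' \<subseteq> W \<and> ball1 f \<and> (\<forall>y\<in>topspace K - W. f y = 0) \<and>
      (\<forall>y\<in>W'. f y = 0) \<and> P f \<ge> e / 2" if W: "openin K W" "x \<in> W" for W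
  proof -
    obtain f where f: "ball1 f" "f x = 0" "\<forall>y\<in>topspace K - W. f y = 0" "P f > e"
      using neg W by (meson not_le)
    then have cf: "cont K f" by (simp add: ball1_def)
    \<comment> \<open>The factor is 0 where norm (f y) \<le> d and 1 where norm (f y) \<ge> 2 d, so
      \<open>f\<close> changes by at most 2 d, while the new function vanishes on the open set norm
      (f y) < d, which contains \<open>x\<close> because f x = 0.\<close>
    define t where "t y = min 1 (max 0 (norm (f y) / d - 1))" for y
    define f' where "f' y = f y * of_real (t y)" for y
    have t01: "0 \<le> t y" "t y \<le> 1" for y by (auto simp: t_def)
    have cf': "cont K f'" unfolding f'_def t_def using d by (intro cont_intros cf) auto
    have norm_f': "norm (f' y) \<le> norm (f y)" for y
      using mult_left_le[of "t y" "norm (f y)"] t01 by (simp add: f'_def norm_mult)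
    have "norm (f y - f' y) \<le> 2 * d" for y
    proof (cases "norm (f y) \<ge> 2 * d")
      case True
      then have "t y = 1" using d(1) by (simp add: t_def field_simps)
      then show ?thesis using d(1) by (simp add: f'_def)
    next
      case False
      have "f y - f' y = f y * of_real (1 - t y)" by (simp add: f'_def right_diff_distrib)
      then have "norm (f y - f' y) = norm (f y) * (1 - t y)"
        using t01[of y] by (simp only: norm_mult norm_of_real)
      also have "\<dots> \<le> norm (f y)" using mult_left_le[of "1 - t y" "norm (f y)"] t01[of y] by simp
      finally show ?thesis using False by simp
    qed
    then have "P f \<le> P f' + M * (2 * d)" by (intro P_split cf cf')
    then have "P f' \<ge> e / 2" using f(4) d(2) by simp
    moreover have "ball1 f'"
      using f(1) cf' norm_f' unfolding ball1_def by (meson order_trans)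
    moreover have "openin K (W \<inter> {y \<in> topspace K. f y \<in> {v. norm v < d}})"
      by (intro openin_Int W openin_preimage cf open_Collect_less continuous_intros)
    moreover have "f' y = 0" if "norm (f y) < d" for y
    proof -
      have "t y = 0" using that d(1) by (simp add: t_def field_simps)
      then show ?thesis by (simp add: f'_def)
    qed
    moreover have "\<forall>y\<in>topspace K - W. f' y = 0" using f(3) by (simp add: f'_def)
    ultimately show ?thesis using W x f(2) d(1)
      by (intro exI[of _ f'] exI[of _ "W \<inter> {y \<in> topspace K. f y \<in> {v. norm v < d}}"]) auto
  qed
  then obtain F G where FG: "\<And>W. openin K W \<Longrightarrow> x \<in> W \<Longrightarrow> openin K (G W) \<and> x \<in> G W \<and> G W \<subseteq> W \<and>
      ball1 (F W) \<and> (\<forall>y\<in>topspace K - W. F W y = 0) \<and> (\<forall>y\<in>G W. F W y = 0) \<and> P (F W) \<ge> e / 2"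
    by metis
  \<comment> \<open>The n-th function lives on \<open>W n\<close> and vanishes on
    \<open>W (Suc n)\<close>, where all later functions live.\<close>
  define W where "W n = (G ^^ n) (topspace K)" for n
  have W: "openin K (W n) \<and> x \<in> W n" for n
    by (induction n) (use FG x in \<open>auto simp: W_def\<close>)
  have W_Suc: "W (Suc n) = G (W n)" for n by (simp add: W_def)
  have "W (Suc n) \<subseteq> W n" for n using FG W by (simp add: W_Suc)
  then have anti: "W n \<subseteq> W m" if "m \<le> n" for m n using lift_Suc_antimono_le[of W] that by blast
  define f where "f n = F (W n)" for n
  have f: "ball1 (f n)" "\<forall>y\<in>topspace K - W n. f n y = 0" "\<forall>y\<in>W (Suc n). f n y = 0" "P (f n) \<ge> e / 2" for n
    using FG[of "W n"] W[of n] by (auto simp: f_def W_Suc)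
  have disj: "f m y = 0 \<or> f n y = 0" if "m < n" "y \<in> topspace K" for m n y
    using f(2)[of n] f(3)[of m] anti[of "Suc m" n] that by (cases "y \<in> W n") auto
  have "(\<lambda>n. P (f n)) \<longlonglongrightarrow> 0"
  proof (rule P_null)
    show "f m y = 0 \<or> f n y = 0" if "m \<noteq> n" "y \<in> topspace K" for m n y
      using disj[of m n y] disj[of n m y] that by (cases "m < n") auto
  qed (use f(1) in \<open>auto simp: ball1_def\<close>)
  then have "e / 2 \<le> 0" by (rule LIMSEQ_le_const) (use f(4) in auto)
  then show False using e by simp
qed

text \<open>At an isolated point \<open>x\<close> of \<open>H\<close> choose u with u x = 1 that
  vanishes on the rest of \<open>H\<close>, and v concentrated near \<open>x\<close> with v x = 1.
  Then u (1 - v) vanishes on all of \<open>H\<close>, so it lies in the ideal, while the part u v is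
  controlled by \<open>small_near_point\<close>. So u lies in the ideal although u x \<noteq> 0.
  Hence \<open>H\<close> is empty and the constant 1 is in the ideal.\<close>

theorem scattered_tail:
  assumes scattered: "scattered_space K" and e: "e > 0"
  shows "\<exists>S. finite S \<and> S \<subseteq> topspace K \<and>
    (\<forall>f. cont K f \<and> (\<forall>x\<in>topspace K. norm (f x) \<le> 1) \<and> (\<forall>x\<in>S. f x = 0) \<longrightarrow> P f \<le> e)"
proof -
  have "H = {}"
  proof (rule ccontr)
    assume "H \<noteq> {}"
    moreover have HK: "H \<subseteq> topspace K" by (auto simp: H_def)
    ultimately obtain x where x: "x \<in> H" "openin (subtopology K H) {x}"
      using scattered unfolding scattered_space_def by blast
    then obtain U where U: "openin K U" "{x} = U \<inter> H" by (auto simp: openin_subtopology)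
    have "closedin K (H - U)" by (intro closedin_diff closedin_H U)
    moreover have xK: "x \<in> topspace K" using x HK by blast
    moreover have "closedin K {x}" by (rule closedin_finite) (use xK in auto)
    moreover have "(H - U) \<inter> {x} = {}" using U by auto
    ultimately obtain u :: "'a \<Rightarrow> real" where u: "cont K u" "\<forall>y\<in>topspace K. 0 \<le> u y \<and> u y \<le> 1" "\<forall>y\<in>H - U. u y = 0" "u x = 1"
      using Urysohn[of "H - U" "{x}"] by blast
    have "J u"
      unfolding J_def
    proof (intro conjI allI impI u(1))
      fix e :: real assume e: "e > 0"
      obtain W where W: "openin K W" "x \<in> W"
        and small: "\<And>f. ball1 f \<Longrightarrow> f x = 0 \<Longrightarrow> (\<forall>y\<in>topspace K - W. f y = 0) \<Longrightarrow> P f \<le> e / 2"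
        using small_near_point[OF xK, of "e / 2"] e by auto
      have "closedin K (topspace K - W)" "(topspace K - W) \<inter> {x} = {}" using W by auto
      then obtain v :: "'a \<Rightarrow> real" where v: "cont K v" "\<forall>y\<in>topspace K. 0 \<le> v y \<and> v y \<le> 1" "\<forall>y\<in>topspace K - W. v y = 0" "v x = 1"
        using Urysohn[of "topspace K - W" "{x}"] \<open>closedin K {x}\<close> by blast
      have "J (\<lambda>y. u y * (1 - v y))"
      proof (rule J_vanish)
        show "cont K (\<lambda>y. u y * (1 - v y))" using u v by (intro cont_intros)
        show "u y * (1 - v y) = 0" if "y \<in> H" for y
          using that u v U(2) by (cases "y \<in> U") auto
      qed
      from J_tail[OF this, of "e / 2"] e obtain S where S: "finite S" "S \<subseteq> topspace K"
        "\<And>f. ball1 f \<Longrightarrow> \<forall>x\<in>S. f x = 0 \<Longrightarrow> P (\<lambda>y. f y * of_real (u y * (1 - v y))) \<le> e / 2"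
        by auto
      show "\<exists>S. finite S \<and> S \<subseteq> topspace K \<and>
          (\<forall>f. ball1 f \<and> (\<forall>x\<in>S. f x = 0) \<longrightarrow> P (\<lambda>x. f x * of_real (u x)) \<le> e)"
      \<comment> \<open>Adding \<open>x\<close> to the finite set makes f x = 0, as the estimate
        near \<open>x\<close> demands for the part f u v.\<close>
      proof (intro exI[of _ "insert x S"] conjI allI impI)
        fix f assume f: "ball1 f \<and> (\<forall>y\<in>insert x S. f y = 0)"
        let ?g = "\<lambda>y. f y * of_real (u y * v y)"
        have g: "ball1 ?g" unfolding ball1_def
        proof (intro conjI ballI)
          show "cont K ?g" using f u v by (intro cont_intros) (auto simp: ball1_def)
          fix y assume y: "y \<in> topspace K"
          have "norm (f y) * \<bar>u y * v y\<bar> \<le> 1 * 1"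
            using f y u(2) v(2) by (intro mult_mono) (auto simp: ball1_def abs_mult mult_le_one)
          then show "norm (?g y) \<le> 1" by (simp only: norm_mult norm_of_real mult_1)
        qed
        have "P (\<lambda>y. ?g y + f y * of_real (u y * (1 - v y))) \<le> P ?g + P (\<lambda>y. f y * of_real (u y * (1 - v y)))"
          using f u v by (intro P_add cont_intros) (auto simp: ball1_def)
        also have "P ?g \<le> e / 2" using f v by (intro small g) auto
        also have "P (\<lambda>y. f y * of_real (u y * (1 - v y))) \<le> e / 2" using f by (intro S) auto
        also have "(\<lambda>y. ?g y + f y * of_real (u y * (1 - v y))) = (\<lambda>y. f y * of_real (u y))"
          by (auto simp: algebra_simps)
        finally show "P (\<lambda>x. f x * of_real (u x)) \<le> e" by simp
      qed (use S xK in auto)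
    qed
    then have "u x = 0" using x(1) by (simp add: H_def)
    then show False using u(4) by simp
  qed
  then have "J (\<lambda>_. 1)" by (intro J_vanish) auto
  then show ?thesis using e unfolding J_def ball1_def by auto
qed

end

section \<open>The normed space C(K), interpolation at finite sets, and suprema of seminorms\<close>

context compact_Hausdorff
begin

definition in_ball :: "('a \<Rightarrow> 'b::real_normed_vector) \<Rightarrow> bool" where
  "in_ball f \<longleftrightarrow> cont K f \<and> (\<forall>x\<in>topspace K. norm (f x) \<le> 1)"

text \<open>Elements of \<open>C_space K\<close> are extensional. Arguments are carried out with
  arbitrary functions that are continuous on \<open>K\<close>, and \<open>rs\<close> is applied only
  when a vector is required.\<close>

definition rs :: "('a \<Rightarrow> 'b) \<Rightarrow> 'a \<Rightarrow> 'b" where "rs f = restrict f (topspace K)"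

lemma C_carrier: "f \<in> vs_carrier (C_space K) \<longleftrightarrow> f \<in> extensional (topspace K) \<and> cont K f"
  by (simp add: C_space_def)

lemma rs_carrier: "cont K f \<Longrightarrow> rs f \<in> vs_carrier (C_space K)"
  by (auto simp: C_carrier rs_def intro: continuous_map_eq)

lemma rs_id: "f \<in> vs_carrier (C_space K) \<Longrightarrow> rs f = f"
  by (simp add: C_carrier rs_def extensional_restrict)

lemma rs_apply [simp]: "x \<in> topspace K \<Longrightarrow> rs f x = f x"
  by (simp add: rs_def)

lemma rs_add: "rs (\<lambda>x. f x + g x) = vs_add (C_space K) (rs f) (rs g)"
  by (auto simp: C_space_def rs_def)

lemma rs_scale: "rs (\<lambda>x. c * f x) = vs_scale (C_space K) c (rs f)"
  by (auto simp: C_space_def rs_def)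

lemma C_norm: "vs_norm (C_space K) f = (SUP x\<in>topspace K. norm (f x))"
  by (simp add: C_space_def)

lemma C_norm_le: "(\<And>x. x \<in> topspace K \<Longrightarrow> norm (f x) \<le> b) \<Longrightarrow> vs_norm (C_space K) f \<le> b"
  unfolding C_norm by (intro cSUP_least nonempty)

lemma C_norm_ge:
  assumes "cont K f" "x \<in> topspace K"
  shows "norm (f x) \<le> vs_norm (C_space K) f"
proof -
  obtain B where "\<forall>x\<in>topspace K. norm (f x) \<le> B" using cont_bounded[OF assms(1)] by blast
  then show ?thesis unfolding C_norm using assms(2) by (intro cSUP_upper bdd_aboveI2[of _ _ B]) auto
qed

lemma normed_space_C: "normed_space (C_space K :: ('k::real_normed_field, 'a \<Rightarrow> 'k) nspace)"
proof
  let ?C = "C_space K :: ('k, 'a \<Rightarrow> 'k) nspace"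
  have ops: "vs_add ?C f g = rs (\<lambda>x. f x + g x)" "vs_scale ?C c f = rs (\<lambda>x. c * f x)" "vs_zero ?C = rs (\<lambda>_. 0)" for f g c
    by (simp_all add: C_space_def rs_def)
  have ext: "f = g" if "f \<in> extensional (topspace K)" "g \<in> extensional (topspace K)" "\<And>x. x \<in> topspace K \<Longrightarrow> f x = g x"
    for f g :: "'a \<Rightarrow> 'k"
    using that by (rule extensionalityI)
  have rs_ext: "rs f \<in> extensional (topspace K)" for f :: "'a \<Rightarrow> 'k" by (simp add: rs_def)
  note C = C_carrier ops rs_ext
  show "vs_zero ?C \<in> vs_carrier ?C" unfolding ops by (rule rs_carrier) simp
  show add_cl: "vs_add ?C f g \<in> vs_carrier ?C" if "f \<in> vs_carrier ?C" "g \<in> vs_carrier ?C" for f g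
    unfolding ops using that by (intro rs_carrier cont_intros) (auto simp: C_carrier)
  show scale_cl: "vs_scale ?C c f \<in> vs_carrier ?C" if "f \<in> vs_carrier ?C" for f c
    unfolding ops using that by (intro rs_carrier cont_intros) (auto simp: C_carrier)
  show "vs_add ?C (vs_add ?C x y) z = vs_add ?C x (vs_add ?C y z)" for x y z
    unfolding ops by (auto intro!: ext simp: C)
  show "vs_add ?C x y = vs_add ?C y x" for x y
    unfolding ops by (auto intro!: ext simp: C add.commute)
  show "vs_add ?C x (vs_zero ?C) = x" if "x \<in> vs_carrier ?C" for x
    unfolding ops using that by (auto intro!: ext simp: C)
  show "vs_diff ?C x x = vs_zero ?C" for x
    unfolding vs_diff_def ops by (auto intro!: ext simp: C)
  show "vs_scale ?C 1 x = x" if "x \<in> vs_carrier ?C" for x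
    unfolding ops using that by (auto intro!: ext simp: C)
  show "vs_scale ?C a (vs_scale ?C b x) = vs_scale ?C (a * b) x" for x a b
    unfolding ops by (auto intro!: ext simp: C)
  show "vs_scale ?C (a + b) x = vs_add ?C (vs_scale ?C a x) (vs_scale ?C b x)" for x a b
    unfolding ops by (auto intro!: ext simp: C distrib_right)
  show "vs_scale ?C a (vs_add ?C x y) = vs_add ?C (vs_scale ?C a x) (vs_scale ?C a y)" for x y a
    unfolding ops by (auto intro!: ext simp: C distrib_left)
  show nonneg: "0 \<le> vs_norm ?C x" if "x \<in> vs_carrier ?C" for x
  proof -
    obtain a where "a \<in> topspace K" using nonempty by blast
    then show ?thesis
      by (intro order_trans[OF norm_ge_zero[of "x a"] C_norm_ge[of x a]]) (use that in \<open>simp_all add: C_carrier\<close>)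
  qed
  show "vs_norm ?C x = 0 \<longleftrightarrow> x = vs_zero ?C" if x: "x \<in> vs_carrier ?C" for x
  proof
    assume "vs_norm ?C x = 0"
    then have "x a = 0" if "a \<in> topspace K" for a
      using C_norm_ge[of x a] x that by (simp add: C_carrier)
    then show "x = vs_zero ?C" unfolding ops using x by (auto intro!: ext simp: C)
  next
    assume "x = vs_zero ?C"
    then have "vs_norm ?C x \<le> 0" unfolding ops by (intro C_norm_le) simp
    then show "vs_norm ?C x = 0" using nonneg[OF x] by simp
  qed
  show "vs_norm ?C (vs_scale ?C a x) = norm a * vs_norm ?C x" if x: "x \<in> vs_carrier ?C" for x a
  proof (rule antisym)
    have cx: "cont K x" using x by (simp add: C_carrier)
    show "vs_norm ?C (vs_scale ?C a x) \<le> norm a * vs_norm ?C x"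
      unfolding ops by (intro C_norm_le) (simp add: norm_mult C_norm_ge[OF cx] mult_left_mono)
    show "norm a * vs_norm ?C x \<le> vs_norm ?C (vs_scale ?C a x)"
    proof (cases "a = 0")
      case True
      then show ?thesis using nonneg[OF scale_cl[OF x]] by simp
    next
      case False
      have "vs_norm ?C x \<le> vs_norm ?C (vs_scale ?C a x) / norm a"
      proof (rule C_norm_le)
        fix b assume b: "b \<in> topspace K"
        have "norm (vs_scale ?C a x b) \<le> vs_norm ?C (vs_scale ?C a x)"
          using scale_cl[OF x] b by (intro C_norm_ge) (simp_all add: C_carrier)
        then show "norm (x b) \<le> vs_norm ?C (vs_scale ?C a x) / norm a"
          using False b by (simp add: ops norm_mult field_simps)
      qed
      then show ?thesis using False by (simp add: field_simps)
    qed
  qed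
  show "vs_norm ?C (vs_add ?C x y) \<le> vs_norm ?C x + vs_norm ?C y" if "x \<in> vs_carrier ?C" "y \<in> vs_carrier ?C" for x y
  proof (rule C_norm_le)
    fix b assume b: "b \<in> topspace K"
    have "norm (x b + y b) \<le> norm (x b) + norm (y b)" by (rule norm_triangle_ineq)
    also have "\<dots> \<le> vs_norm ?C x + vs_norm ?C y"
      using that b by (intro add_mono C_norm_ge) (auto simp: C_carrier)
    finally show "norm (vs_add ?C x y b) \<le> vs_norm ?C x + vs_norm ?C y" using b by (simp add: ops)
  qed
qed

text \<open>Urysohn functions for the single points are divided by max 1 of their sum. This forces
  the sum below 1 everywhere and changes nothing on \<open>S\<close>, where the sum is already
  1.\<close>

lemma finite_partition:
  assumes S: "finite S" "S \<subseteq> topspace K"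
  shows "\<exists>e :: 'a \<Rightarrow> 'a \<Rightarrow> real. (\<forall>t\<in>S. cont K (e t)) \<and> (\<forall>t\<in>S. \<forall>x\<in>topspace K. 0 \<le> e t x) \<and>
    (\<forall>x\<in>topspace K. (\<Sum>t\<in>S. e t x) \<le> 1) \<and> (\<forall>t\<in>S. \<forall>s\<in>S. e t s = (if t = s then 1 else 0))"
proof -
  have "\<exists>f :: 'a \<Rightarrow> real. cont K f \<and> (\<forall>x\<in>topspace K. 0 \<le> f x \<and> f x \<le> 1) \<and>
      (\<forall>x\<in>S - {t}. f x = 0) \<and> (\<forall>x\<in>{t}. f x = 1)" if "t \<in> S" for t
    by (rule Urysohn) (use S that in \<open>auto intro!: closedin_finite\<close>)
  then obtain a :: "'a \<Rightarrow> 'a \<Rightarrow> real" where a: "\<And>t. t \<in> S \<Longrightarrow> cont K (a t)"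
    "\<And>t x. t \<in> S \<Longrightarrow> x \<in> topspace K \<Longrightarrow> 0 \<le> a t x" "\<And>t s. t \<in> S \<Longrightarrow> s \<in> S \<Longrightarrow> a t s = (if t = s then 1 else 0)"
    by (metis Diff_iff empty_iff insert_iff)
  define m where "m x = max 1 (\<Sum>t\<in>S. a t x)" for x
  have m: "m x \<ge> 1" "m x \<ge> (\<Sum>t\<in>S. a t x)" for x by (auto simp: m_def)
  have m0: "m x > 0" for x using m(1)[of x] by linarith
  have cm: "cont K m" unfolding m_def by (intro cont_intros a(1))
  have ms: "m s = 1" if "s \<in> S" for s
  proof -
    have "(\<Sum>t\<in>S. a t s) = (\<Sum>t\<in>S. if t = s then 1 else 0)" using a(3) that by (intro sum.cong) auto
    then show ?thesis using S that by (simp add: m_def)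
  qed
  show ?thesis
  proof (intro exI[of _ "\<lambda>t x. a t x / m x"] conjI ballI)
    show "cont K (\<lambda>x. a t x / m x)" if "t \<in> S" for t
      using that m0 by (intro cont_intros a cm) (auto simp: less_le)
    show "0 \<le> a t x / m x" if "t \<in> S" "x \<in> topspace K" for t x
      using a(2)[OF that] m0[of x] by simp
    show "(\<Sum>t\<in>S. a t x / m x) \<le> 1" for x
      using m(2)[of x] m0[of x] by (simp flip: sum_divide_distrib)
    show "a t s / m s = (if t = s then 1 else 0)" if "t \<in> S" "s \<in> S" for t s
      using a(3) ms that by simp
  qed
qed

definition partition_on_points :: "'a set \<Rightarrow> ('a \<Rightarrow> 'a \<Rightarrow> real) \<Rightarrow> bool" where
  "partition_on_points S e \<longleftrightarrow> finite S \<and> S \<subseteq> topspace K \<and> (\<forall>t\<in>S. cont K (e t)) \<and> (\<forall>t\<in>S. \<forall>x\<in>topspace K. 0 \<le> e t x) \<and>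
    (\<forall>x\<in>topspace K. (\<Sum>t\<in>S. e t x) \<le> 1) \<and> (\<forall>t\<in>S. \<forall>s\<in>S. e t s = (if t = s then 1 else 0))"

text \<open>Interpolating \<open>f\<close> on \<open>S\<close> leaves a remainder that vanishes on
  \<open>S\<close>. Its norm is at most 2, and the factor 1/2 returns it to the unit ball, where the
  tail estimates apply.\<close>

lemma interpolation:
  fixes f :: "'a \<Rightarrow> 'k::{real_normed_field, euclidean_space}"
  assumes e: "partition_on_points S e" and f: "in_ball f"
  shows "t \<in> S \<Longrightarrow> in_ball (\<lambda>x. of_real (e t x) :: 'k)"
    and "in_ball (\<lambda>x. \<Sum>t\<in>S. f t * of_real (e t x))"
    and "in_ball (\<lambda>x. of_real (1/2) * (f x - (\<Sum>t\<in>S. f t * of_real (e t x))))"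
    and "s \<in> S \<Longrightarrow> of_real (1/2) * (f s - (\<Sum>t\<in>S. f t * of_real (e t s))) = 0"
proof -
  have e': "finite S" "S \<subseteq> topspace K" "\<And>t. t \<in> S \<Longrightarrow> cont K (e t)" "\<And>t x. t \<in> S \<Longrightarrow> x \<in> topspace K \<Longrightarrow> 0 \<le> e t x"
    "\<And>x. x \<in> topspace K \<Longrightarrow> (\<Sum>t\<in>S. e t x) \<le> 1" "\<And>t s. t \<in> S \<Longrightarrow> s \<in> S \<Longrightarrow> e t s = (if t = s then 1 else 0)"
    using e by (auto simp: partition_on_points_def)
  have le1: "e t x \<le> 1" if "t \<in> S" "x \<in> topspace K" for t x
    using member_le_sum[of t S "\<lambda>t. e t x"] e' that by force
  show "in_ball (\<lambda>x. of_real (e t x) :: 'k)" if "t \<in> S"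
    using that e' le1 by (auto simp: in_ball_def intro!: cont_of_real)
  have cf: "cont K f" "\<And>x. x \<in> topspace K \<Longrightarrow> norm (f x) \<le> 1" using f by (auto simp: in_ball_def)
  have c: "cont K (\<lambda>x. \<Sum>t\<in>S. f t * of_real (e t x))" by (intro cont_intros e')
  have b: "norm (\<Sum>t\<in>S. f t * of_real (e t x)) \<le> 1" if x: "x \<in> topspace K" for x
  proof -
    have "norm (\<Sum>t\<in>S. f t * of_real (e t x)) \<le> (\<Sum>t\<in>S. e t x)"
    proof (rule sum_norm_le)
      fix t assume t: "t \<in> S"
      then have "norm (f t) * e t x \<le> 1 * e t x" using cf e' x by (intro mult_right_mono) auto
      then show "norm (f t * of_real (e t x)) \<le> e t x" using e'(4)[OF t x] by (simp add: norm_mult)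
    qed
    then show ?thesis using e'(5)[OF x] by simp
  qed
  show "in_ball (\<lambda>x. \<Sum>t\<in>S. f t * of_real (e t x))" using b c by (simp add: in_ball_def)
  show "in_ball (\<lambda>x. of_real (1/2) * (f x - (\<Sum>t\<in>S. f t * of_real (e t x))))"
    unfolding in_ball_def
  proof (intro conjI ballI cont_mult cont_diff cont_const cf c)
    fix x assume x: "x \<in> topspace K"
    have "norm (f x - (\<Sum>t\<in>S. f t * of_real (e t x))) \<le> norm (f x) + norm (\<Sum>t\<in>S. f t * of_real (e t x))"
      by (rule norm_triangle_ineq4)
    also have "\<dots> \<le> 2" using cf(2)[OF x] b[OF x] by simp
    finally show "norm (of_real (1/2) * (f x - (\<Sum>t\<in>S. f t * of_real (e t x)))) \<le> 1"
      unfolding norm_mult norm_of_real by simp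
  qed
  show "of_real (1/2) * (f s - (\<Sum>t\<in>S. f t * of_real (e t s))) = 0" if s: "s \<in> S"
  proof -
    have "(\<Sum>t\<in>S. f t * of_real (e t s)) = (\<Sum>t\<in>S. if t = s then f s else 0)"
      using e'(6)[OF _ s] by (intro sum.cong) auto
    then show ?thesis using e'(1) s by simp
  qed
qed

text \<open>Assumption \<open>null\<close> allows the index to vary with n. Applied to indices that
  come within 1 / (n + 1) of the supremum, it shows that the supremum itself is null on disjoint
  sequences, so the result for one seminorm becomes uniform in the index.\<close>

lemma sup_disjoint_null_seminorm:
  fixes N :: "'i \<Rightarrow> ('a \<Rightarrow> 'k::{real_normed_field, euclidean_space}) \<Rightarrow> real"
  assumes I: "I \<noteq> {}" and M: "M \<ge> 0"
    and add: "\<And>i f g. i \<in> I \<Longrightarrow> cont K f \<Longrightarrow> cont K g \<Longrightarrow> N i (\<lambda>x. f x + g x) \<le> N i f + N i g"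
    and scale: "\<And>i f c. i \<in> I \<Longrightarrow> cont K f \<Longrightarrow> N i (\<lambda>x. c * f x) \<le> norm c * N i f"
    and bound: "\<And>i f b. i \<in> I \<Longrightarrow> cont K f \<Longrightarrow> (\<And>x. x \<in> topspace K \<Longrightarrow> norm (f x) \<le> b) \<Longrightarrow> N i f \<le> M * b"
    and nonneg: "\<And>i f. i \<in> I \<Longrightarrow> cont K f \<Longrightarrow> 0 \<le> N i f"
    and null: "\<And>F i. (\<And>n :: nat. in_ball (F n)) \<Longrightarrow> (\<And>m n x. m \<noteq> n \<Longrightarrow> x \<in> topspace K \<Longrightarrow> F m x = 0 \<or> F n x = 0) \<Longrightarrow>
      (\<And>n. i n \<in> I) \<Longrightarrow> (\<lambda>n. N (i n) (F n)) \<longlonglongrightarrow> 0"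
  shows "disjoint_null_seminorm K (\<lambda>f. SUP i\<in>I. N i f) M \<and>
    (\<forall>i\<in>I. \<forall>f. cont K f \<longrightarrow> N i f \<le> (SUP i\<in>I. N i f))"
proof -
  have ub: "N i f \<le> (SUP i\<in>I. N i f)" if i: "i \<in> I" and f: "cont K f" for i f
  proof (rule cSUP_upper[OF i])
    obtain B where "\<forall>x\<in>topspace K. norm (f x) \<le> B" using cont_bounded[OF f] by blast
    then show "bdd_above ((\<lambda>i. N i f) ` I)" using f by (intro bdd_aboveI2[of _ _ "M * B"] bound) auto
  qed
  have "disjoint_null_seminorm K (\<lambda>f. SUP i\<in>I. N i f) M"
  proof
    fix f g :: "'a \<Rightarrow> 'k" assume f: "cont K f" and g: "cont K g"
    show "(SUP i\<in>I. N i (\<lambda>x. f x + g x)) \<le> (SUP i\<in>I. N i f) + (SUP i\<in>I. N i g)"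
    proof (rule cSUP_least[OF I])
      fix i assume i: "i \<in> I"
      show "N i (\<lambda>x. f x + g x) \<le> (SUP i\<in>I. N i f) + (SUP i\<in>I. N i g)"
        using add[OF i f g] ub[OF i f] ub[OF i g] by linarith
    qed
  next
    fix f :: "'a \<Rightarrow> 'k" and c :: real assume f: "cont K f" and c: "c > 0"
    show "(SUP i\<in>I. N i (\<lambda>x. of_real c * f x)) \<le> c * (SUP i\<in>I. N i f)"
    proof (rule cSUP_least[OF I])
      fix i assume i: "i \<in> I"
      have "N i (\<lambda>x. of_real c * f x) \<le> c * N i f" using scale[OF i f, of "of_real c"] c by simp
      also have "\<dots> \<le> c * (SUP i\<in>I. N i f)" using ub[OF i f] c by simp
      finally show "N i (\<lambda>x. of_real c * f x) \<le> c * (SUP i\<in>I. N i f)" .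
    qed
  next
    fix f :: "'a \<Rightarrow> 'k" and b :: real
    assume "cont K f" "\<And>x. x \<in> topspace K \<Longrightarrow> norm (f x) \<le> b"
    then show "(SUP i\<in>I. N i f) \<le> M * b" by (intro cSUP_least[OF I] bound)
  next
    show "M \<ge> 0" by (rule M)
  next
    fix F :: "nat \<Rightarrow> 'a \<Rightarrow> 'k"
    assume F: "\<And>n. cont K (F n)" "\<And>n x. x \<in> topspace K \<Longrightarrow> norm (F n x) \<le> 1"
      "\<And>m n x. m \<noteq> n \<Longrightarrow> x \<in> topspace K \<Longrightarrow> F m x = 0 \<or> F n x = 0"
    have "\<exists>i\<in>I. (SUP i\<in>I. N i (F n)) - 1 / real (Suc n) < N i (F n)" for n
    proof (rule ccontr)
      assume "\<not> ?thesis"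
      then have "(SUP i\<in>I. N i (F n)) \<le> (SUP i\<in>I. N i (F n)) - 1 / real (Suc n)"
        by (intro cSUP_least[OF I]) (auto simp: not_less)
      then show False by simp
    qed
    then obtain i where i: "\<And>n. i n \<in> I" "\<And>n. (SUP i\<in>I. N i (F n)) - 1 / real (Suc n) < N (i n) (F n)" by metis
    have "(\<lambda>n. N (i n) (F n)) \<longlonglongrightarrow> 0"
      by (rule null) (use F i in \<open>auto simp: in_ball_def\<close>)
    moreover have "(\<lambda>n. 1 / real (Suc n)) \<longlonglongrightarrow> 0" by (rule LIMSEQ_Suc[OF lim_1_over_n])
    ultimately have lim: "(\<lambda>n. N (i n) (F n) + 1 / real (Suc n)) \<longlonglongrightarrow> 0"
      using tendsto_add[of "\<lambda>n. N (i n) (F n)" 0 sequentially "\<lambda>n. 1 / real (Suc n)" 0] by simp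
    show "(\<lambda>n. SUP i\<in>I. N i (F n)) \<longlonglongrightarrow> 0"
    proof (rule Lim_null_comparison[OF always_eventually lim], rule allI)
      fix n
      have "0 \<le> N (i n) (F n)" by (rule nonneg[OF i(1) F(1)])
      also have "\<dots> \<le> (SUP i\<in>I. N i (F n))" by (rule ub[OF i(1) F(1)])
      finally show "norm (SUP i\<in>I. N i (F n)) \<le> N (i n) (F n) + 1 / real (Suc n)"
        using i(2)[of n] by simp
    qed
  qed
  then show ?thesis using ub by blast
qed

end

text \<open>If no value is taken infinitely often, any bounded range of values is left for good, so
  strictly larger values can be chosen again and again.\<close>

lemma constant_or_strict_subsequence:
  fixes s :: "nat \<Rightarrow> nat"
  shows "\<exists>r :: nat \<Rightarrow> nat. strict_mono r \<and> ((\<exists>v. \<forall>n. s (r n) = v) \<or> strict_mono (s \<circ> r))"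
proof (cases "\<exists>v. infinite {n. s n = v}")
  case True
  then obtain v where v: "infinite {n. s n = v}" by blast
  show ?thesis
    using strict_mono_enumerate[OF v] enumerate_in_set[OF v]
    by (intro exI[of _ "wellorder_class.enumerate {n. s n = v}"]) auto
next
  case False
  have ex: "\<exists>m. N < m \<and> b < s m" for N b
  proof -
    have "{n. s n \<le> b} = (\<Union>v\<le>b. {n. s n = v})" by auto
    then have "finite ({n. s n \<le> b} \<union> {..N})" using False by auto
    then obtain m where "m \<notin> {n. s n \<le> b} \<union> {..N}" using ex_new_if_finite[OF infinite_UNIV_nat] by blast
    then show ?thesis by (intro exI[of _ m]) auto
  qed
  have "\<exists>r. \<forall>n. True \<and> (r n < r (Suc n) \<and> s (r n) < s (r (Suc n)))"
    by (rule dependent_nat_choice) (use ex in auto)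
  then obtain r where "\<And>n. r n < r (Suc n)" "\<And>n. s (r n) < s (r (Suc n))" by blast
  then show ?thesis by (intro exI[of _ r]) (auto simp: strict_mono_Suc_iff)
qed

section \<open>Two variables\<close>

text \<open>What is retained of the function |T (f \<otimes> g)|. The conditions
  \<open>null_both\<close>, \<open>null_left\<close> and \<open>null_right\<close> are those that
  follow from unconditional summability. Disjoint f_n with arbitrary g_n are not among them: there
  the conclusion can fail if the second space is not scattered.\<close>

locale disjoint_null_biseminorm = K1: compact_Hausdorff K1 + K2: compact_Hausdorff K2
  for K1 :: "'a topology" and K2 :: "'b topology" +
  fixes N :: "('a \<Rightarrow> 'k::{real_normed_field, euclidean_space}) \<Rightarrow> ('b \<Rightarrow> 'k) \<Rightarrow> real" and M :: real
  assumes N_add1: "cont K1 f \<Longrightarrow> cont K1 f' \<Longrightarrow> cont K2 g \<Longrightarrow> N (\<lambda>x. f x + f' x) g \<le> N f g + N f' g"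
    and N_add2: "cont K1 f \<Longrightarrow> cont K2 g \<Longrightarrow> cont K2 g' \<Longrightarrow> N f (\<lambda>x. g x + g' x) \<le> N f g + N f g'"
    and N_scale1: "cont K1 f \<Longrightarrow> cont K2 g \<Longrightarrow> N (\<lambda>x. c * f x) g \<le> norm c * N f g"
    and N_scale2: "cont K1 f \<Longrightarrow> cont K2 g \<Longrightarrow> N f (\<lambda>x. c * g x) \<le> norm c * N f g"
    and N_bound: "cont K1 f \<Longrightarrow> cont K2 g \<Longrightarrow> (\<And>x. x \<in> topspace K1 \<Longrightarrow> norm (f x) \<le> a) \<Longrightarrow>
      (\<And>x. x \<in> topspace K2 \<Longrightarrow> norm (g x) \<le> b) \<Longrightarrow> N f g \<le> M * (a * b)"
    and N_nonneg: "cont K1 f \<Longrightarrow> cont K2 g \<Longrightarrow> 0 \<le> N f g"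
    and M_nonneg: "M \<ge> 0"
    and null_both: "(\<And>n :: nat. K1.in_ball (F n)) \<Longrightarrow> (\<And>n. K2.in_ball (G n)) \<Longrightarrow>
      (\<And>m n x. m \<noteq> n \<Longrightarrow> x \<in> topspace K1 \<Longrightarrow> F m x = 0 \<or> F n x = 0) \<Longrightarrow>
      (\<And>m n x. m \<noteq> n \<Longrightarrow> x \<in> topspace K2 \<Longrightarrow> G m x = 0 \<or> G n x = 0) \<Longrightarrow> (\<lambda>n. N (F n) (G n)) \<longlonglongrightarrow> 0"
    and null_left: "(\<And>n :: nat. K1.in_ball (F n)) \<Longrightarrow> K2.in_ball g \<Longrightarrow>
      (\<And>m n x. m \<noteq> n \<Longrightarrow> x \<in> topspace K1 \<Longrightarrow> F m x = 0 \<or> F n x = 0) \<Longrightarrow> (\<lambda>n. N (F n) g) \<longlonglongrightarrow> 0"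
    and null_right: "K1.in_ball f \<Longrightarrow> (\<And>n :: nat. K2.in_ball (G n)) \<Longrightarrow>
      (\<And>m n x. m \<noteq> n \<Longrightarrow> x \<in> topspace K2 \<Longrightarrow> G m x = 0 \<or> G n x = 0) \<Longrightarrow> (\<lambda>n. N f (G n)) \<longlonglongrightarrow> 0"
begin

lemma N_sum2:
  assumes "finite S" "cont K1 f" "\<And>t. t \<in> S \<Longrightarrow> cont K2 (g t)"
  shows "N f (\<lambda>x. \<Sum>t\<in>S. c t * g t x) \<le> (\<Sum>t\<in>S. norm (c t) * N f (g t))"
  using assms
proof (induction S)
  case empty
  then show ?case using N_scale2[of f "\<lambda>_. 0" 0] by simp
next
  case (insert t S)
  have "N f (\<lambda>x. c t * g t x + (\<Sum>t\<in>S. c t * g t x)) \<le> N f (\<lambda>x. c t * g t x) + N f (\<lambda>x. \<Sum>t\<in>S. c t * g t x)"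
    using insert by (intro N_add2 cont_intros) auto
  also have "N f (\<lambda>x. c t * g t x) \<le> norm (c t) * N f (g t)" using insert by (intro N_scale2) auto
  also have "N f (\<lambda>x. \<Sum>t\<in>S. c t * g t x) \<le> (\<Sum>t\<in>S. norm (c t) * N f (g t))" using insert by simp
  finally show ?case using insert by simp
qed

text \<open>Scatteredness of \<open>K2\<close> is applied to the supremum of the seminorms N (F i).
  Outside a finite set S the G n then contribute little, uniformly in n, and on S they are finite
  combinations of fixed functions, for which \<open>null_left\<close> suffices.\<close>

lemma null_disjoint_left:
  assumes scattered: "scattered_space K2"
    and F: "\<And>n :: nat. K1.in_ball (F n)"
    and disj: "\<And>m n x. m \<noteq> n \<Longrightarrow> x \<in> topspace K1 \<Longrightarrow> F m x = 0 \<or> F n x = 0"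
    and G: "\<And>n. K2.in_ball (G n)"
  shows "(\<lambda>n. N (F n) (G n)) \<longlonglongrightarrow> 0"
proof -
  have cF: "cont K1 (F n)" "\<And>x. x \<in> topspace K1 \<Longrightarrow> norm (F n x) \<le> 1" for n
    using F by (auto simp: K1.in_ball_def)
  have cG: "cont K2 (G n)" "\<And>x. x \<in> topspace K2 \<Longrightarrow> norm (G n x) \<le> 1" for n
    using G by (auto simp: K2.in_ball_def)
  \<comment> \<open>The index sequence is arbitrary and may repeat itself. Along a subsequence it is
    either constant, and \<open>null_right\<close> applies, or strictly increasing, so that both
    factors are disjoint and \<open>null_both\<close> applies.\<close>
  have null: "(\<lambda>n. N (F (i n)) (H n)) \<longlonglongrightarrow> 0"
    if H: "\<And>n :: nat. K2.in_ball (H n)" "\<And>m n x. m \<noteq> n \<Longrightarrow> x \<in> topspace K2 \<Longrightarrow> H m x = 0 \<or> H n x = 0" for H i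
  proof (rule ccontr)
    have cH: "cont K2 (H n)" for n using H by (auto simp: K2.in_ball_def)
    assume "\<not> (\<lambda>n. N (F (i n)) (H n)) \<longlonglongrightarrow> 0"
    from not_tendsto_zero_subsequence[OF this] N_nonneg[OF cF(1) cH]
    obtain d and r :: "nat \<Rightarrow> nat" where d: "d > 0" "strict_mono r" "\<And>n. N (F (i (r n))) (H (r n)) \<ge> d" by blast
    obtain \<rho> :: "nat \<Rightarrow> nat" where \<rho>: "strict_mono \<rho>" "(\<exists>v. \<forall>n. i (r (\<rho> n)) = v) \<or> strict_mono ((i \<circ> r) \<circ> \<rho>)"
      using constant_or_strict_subsequence[of "i \<circ> r"] unfolding o_apply by blast
    have inj_r: "r (\<rho> m) \<noteq> r (\<rho> n)" if "m \<noteq> n" for m n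
      using that d(2) \<rho>(1) by (simp add: strict_mono_eq)
    have "(\<lambda>n. N (F (i (r (\<rho> n)))) (H (r (\<rho> n)))) \<longlonglongrightarrow> 0"
      using \<rho>(2)
    proof
      assume "\<exists>v. \<forall>n. i (r (\<rho> n)) = v"
      then obtain v where v: "\<And>n. i (r (\<rho> n)) = v" by blast
      have "(\<lambda>n. N (F v) (H (r (\<rho> n)))) \<longlonglongrightarrow> 0"
        by (rule null_right[OF F H(1)]) (rule H(2)[OF inj_r])
      then show ?thesis by (simp add: v)
    next
      assume s: "strict_mono ((i \<circ> r) \<circ> \<rho>)"
      have inj_i: "i (r (\<rho> m)) \<noteq> i (r (\<rho> n))" if "m \<noteq> n" for m n
        using that strict_mono_eq[OF s, of m n] by simp
      show ?thesis
      proof (rule null_both[OF F H(1)])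
        show "F (i (r (\<rho> m))) x = 0 \<or> F (i (r (\<rho> n))) x = 0" if "m \<noteq> n" "x \<in> topspace K1" for m n x
          by (rule disj[OF inj_i[OF that(1)] that(2)])
        show "H (r (\<rho> m)) x = 0 \<or> H (r (\<rho> n)) x = 0" if "m \<noteq> n" "x \<in> topspace K2" for m n x
          by (rule H(2)[OF inj_r[OF that(1)] that(2)])
      qed
    qed
    then have "d \<le> 0" by (rule LIMSEQ_le_const) (use d(3) in auto)
    then show False using d(1) by simp
  qed
  have "disjoint_null_seminorm K2 (\<lambda>g. SUP i\<in>UNIV. N (F i) g) M \<and>
    (\<forall>i\<in>UNIV. \<forall>g. cont K2 g \<longrightarrow> N (F i) g \<le> (SUP i\<in>UNIV. N (F i) g))"
  proof (rule K2.sup_disjoint_null_seminorm)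
    show "N (F i) g \<le> M * b" if "cont K2 g" "\<And>x. x \<in> topspace K2 \<Longrightarrow> norm (g x) \<le> b" for i g b
      using N_bound[OF cF(1) that(1) cF(2) that(2)] by simp
    show "(\<lambda>n. N (F (i n)) (H n)) \<longlonglongrightarrow> 0"
      if "\<And>n :: nat. K2.in_ball (H n)" "\<And>m n x. m \<noteq> n \<Longrightarrow> x \<in> topspace K2 \<Longrightarrow> H m x = 0 \<or> H n x = 0" for H i
      using that by (rule null)
  qed (auto intro: M_nonneg N_add2 N_scale2 cF N_nonneg)
  then have sup: "disjoint_null_seminorm K2 (\<lambda>g. SUP i\<in>UNIV. N (F i) g) M"
    "\<And>i g. cont K2 g \<Longrightarrow> N (F i) g \<le> (SUP i\<in>UNIV. N (F i) g)" by blast+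
  show ?thesis
  proof (rule LIMSEQ_I)
    fix e :: real assume e: "e > 0"
    obtain S where S: "finite S" "S \<subseteq> topspace K2" and tail: "\<And>g. cont K2 g \<Longrightarrow> \<forall>x\<in>topspace K2. norm (g x) \<le> 1 \<Longrightarrow>
        \<forall>x\<in>S. g x = 0 \<Longrightarrow> (SUP i\<in>UNIV. N (F i) g) \<le> e / 4"
      using disjoint_null_seminorm.scattered_tail[OF sup(1) scattered, of "e / 4"] e by auto
    obtain p :: "'b \<Rightarrow> 'b \<Rightarrow> real" where p: "K2.partition_on_points S p"
      using K2.finite_partition[OF S] S unfolding K2.partition_on_points_def by blast
    note ip = K2.interpolation[OF p G]
    have cp: "cont K2 (\<lambda>x. of_real (p t x) :: 'k)" if "t \<in> S" for t
      using ip(1)[OF that] by (simp add: K2.in_ball_def)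
    have "(\<lambda>n. \<Sum>t\<in>S. N (F n) (\<lambda>x. of_real (p t x))) \<longlonglongrightarrow> (\<Sum>t\<in>S. 0)"
      by (intro tendsto_sum null_left F ip(1) disj) auto
    then obtain n0 where n0: "\<And>n. n \<ge> n0 \<Longrightarrow> \<bar>\<Sum>t\<in>S. N (F n) (\<lambda>x. of_real (p t x))\<bar> < e / 2"
      using LIMSEQ_D[of _ 0 "e / 2"] e by fastforce
    have "N (F n) (G n) < e" if n: "n \<ge> n0" for n
    proof -
      \<comment> \<open>G n = ?P + 2 ?R. The interpolating part contributes less than e/2 for large
        n, and the remainder at most 2 times e/4.\<close>
      let ?P = "\<lambda>x. \<Sum>t\<in>S. G n t * of_real (p t x)" and ?R = "\<lambda>x. of_real (1/2) * (G n x - (\<Sum>t\<in>S. G n t * of_real (p t x)))"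
      have cP: "cont K2 ?P" and cR: "cont K2 ?R" using ip(2,3)[of n] by (auto simp: K2.in_ball_def)
      have half: "2 * (of_real (1/2) * y) = y" for y :: 'k by simp
      have eq: "(\<lambda>x. ?P x + 2 * ?R x) = G n" unfolding half by simp
      have "N (F n) (G n) \<le> N (F n) ?P + N (F n) (\<lambda>x. 2 * ?R x)"
        using N_add2[OF cF(1)[of n] cP cont_mult[OF cont_const cR, of 2]] unfolding eq .
      moreover have "N (F n) ?P \<le> (\<Sum>t\<in>S. N (F n) (\<lambda>x. of_real (p t x)))"
      proof -
        have "N (F n) ?P \<le> (\<Sum>t\<in>S. norm (G n t) * N (F n) (\<lambda>x. of_real (p t x)))"
          by (rule N_sum2[OF S(1) cF(1) cp])
        also have "\<dots> \<le> (\<Sum>t\<in>S. N (F n) (\<lambda>x. of_real (p t x)))"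
        proof (rule sum_mono)
          fix t assume t: "t \<in> S"
          have "norm (G n t) \<le> 1" using cG(2) S t by auto
          then show "norm (G n t) * N (F n) (\<lambda>x. of_real (p t x)) \<le> N (F n) (\<lambda>x. of_real (p t x))"
            using N_nonneg[OF cF(1) cp[OF t], of n] by (rule mult_left_le_one_le[OF _ norm_ge_zero, rotated])
        qed
        finally show ?thesis .
      qed
      moreover have "N (F n) (\<lambda>x. 2 * ?R x) \<le> 2 * (e / 4)"
      proof -
        have "N (F n) (\<lambda>x. 2 * ?R x) \<le> 2 * N (F n) ?R" using N_scale2[OF cF(1) cR, of n 2] by simp
        moreover have "N (F n) ?R \<le> (SUP i\<in>UNIV. N (F i) ?R)" by (rule sup(2)[OF cR])
        moreover have "(SUP i\<in>UNIV. N (F i) ?R) \<le> e / 4"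
        proof (rule tail[OF cR])
          show "\<forall>x\<in>topspace K2. norm (?R x) \<le> 1" using ip(3)[of n] unfolding K2.in_ball_def by blast
          show "\<forall>x\<in>S. ?R x = 0" using ip(4)[of _ n] by blast
        qed
        ultimately show ?thesis by linarith
      qed
      ultimately show ?thesis using n0[OF n] by linarith
    qed
    then show "\<exists>n0. \<forall>n\<ge>n0. norm (N (F n) (G n) - 0) < e"
      using N_nonneg[OF cF(1) cG(1)] by (intro exI[of _ n0]) auto
  qed
qed

text \<open>The supremum over all g in the unit ball is null on disjoint sequences in the first
  variable, by scatteredness of the second space; scatteredness of the first space then yields a
  finite set that serves all g at once.\<close>

lemma tail_left:
  assumes s1: "scattered_space K1" and s2: "scattered_space K2" and e: "e > 0"
  shows "\<exists>S. finite S \<and> S \<subseteq> topspace K1 \<and> (\<forall>f g. K1.in_ball f \<and> K2.in_ball g \<and> (\<forall>x\<in>S. f x = 0) \<longrightarrow> N f g \<le> e)"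
proof -
  have ne: "{g :: 'b \<Rightarrow> 'k. K2.in_ball g} \<noteq> {}"
    by (auto simp: K2.in_ball_def intro!: exI[of _ "\<lambda>_. 0"])
  have cb: "cont K2 g" "\<And>x. x \<in> topspace K2 \<Longrightarrow> norm (g x) \<le> 1" if "g \<in> {g :: 'b \<Rightarrow> 'k. K2.in_ball g}" for g
    using that by (auto simp: K2.in_ball_def)
  have "disjoint_null_seminorm K1 (\<lambda>f. SUP g\<in>{g. K2.in_ball g}. N f g) M \<and>
    (\<forall>g\<in>{g. K2.in_ball g}. \<forall>f. cont K1 f \<longrightarrow> N f g \<le> (SUP g\<in>{g. K2.in_ball g}. N f g))"
  proof (rule K1.sup_disjoint_null_seminorm[OF ne M_nonneg])
    show "N f g \<le> M * b"
      if "g \<in> {g. K2.in_ball g}" "cont K1 f" "\<And>x. x \<in> topspace K1 \<Longrightarrow> norm (f x) \<le> b" for f g b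
      using N_bound[OF that(2) cb(1)[OF that(1)] that(3) cb(2)[OF that(1)]] by simp
    show "(\<lambda>n. N (F n) (G n)) \<longlonglongrightarrow> 0"
      if "\<And>n :: nat. K1.in_ball (F n)" "\<And>m n x. m \<noteq> n \<Longrightarrow> x \<in> topspace K1 \<Longrightarrow> F m x = 0 \<or> F n x = 0"
        "\<And>n. G n \<in> {g. K2.in_ball g}" for F G
      by (rule null_disjoint_left[OF s2]) (use that in auto)
  qed (auto intro: N_add1 N_scale1 cb N_nonneg)
  then have sup: "disjoint_null_seminorm K1 (\<lambda>f. SUP g\<in>{g. K2.in_ball g}. N f g) M"
    and ub: "\<And>f g. cont K1 f \<Longrightarrow> K2.in_ball g \<Longrightarrow> N f g \<le> (SUP g\<in>{g. K2.in_ball g}. N f g)" by blast+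
  obtain S where S: "finite S" "S \<subseteq> topspace K1" "\<And>f. cont K1 f \<Longrightarrow> \<forall>x\<in>topspace K1. norm (f x) \<le> 1 \<Longrightarrow>
      \<forall>x\<in>S. f x = 0 \<Longrightarrow> (SUP g\<in>{g. K2.in_ball g}. N f g) \<le> e"
    using disjoint_null_seminorm.scattered_tail[OF sup s1 e] by blast
  have "N f g \<le> e" if "K1.in_ball f" "K2.in_ball g" "\<forall>x\<in>S. f x = 0" for f g
    using ub[of f g] S(3)[of f] that by (auto simp: K1.in_ball_def)
  then show ?thesis using S(1,2) by blast
qed

lemma swap: "disjoint_null_biseminorm K2 K1 (\<lambda>g f. N f g) M"
proof unfold_locales
  show "N g f \<le> M * (a * b)" if "cont K2 f" "cont K1 g" "\<And>x. x \<in> topspace K2 \<Longrightarrow> norm (f x) \<le> a"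
    "\<And>x. x \<in> topspace K1 \<Longrightarrow> norm (g x) \<le> b" for f g a b
    using N_bound[OF that(2) that(1) that(4) that(3)] by (simp add: mult.commute[of a])
  show "(\<lambda>n. N (G n) (F n)) \<longlonglongrightarrow> 0"
    if "\<And>n :: nat. K2.in_ball (F n)" "\<And>n. K1.in_ball (G n)"
      "\<And>m n x. m \<noteq> n \<Longrightarrow> x \<in> topspace K2 \<Longrightarrow> F m x = 0 \<or> F n x = 0"
      "\<And>m n x. m \<noteq> n \<Longrightarrow> x \<in> topspace K1 \<Longrightarrow> G m x = 0 \<or> G n x = 0" for F G
    by (rule null_both[OF that(2) that(1) that(4) that(3)])
  show "(\<lambda>n. N g (F n)) \<longlonglongrightarrow> 0"
    if "\<And>n :: nat. K2.in_ball (F n)" "K1.in_ball g"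
      "\<And>m n x. m \<noteq> n \<Longrightarrow> x \<in> topspace K2 \<Longrightarrow> F m x = 0 \<or> F n x = 0" for F g
    by (rule null_right[OF that(2) that(1) that(3)])
  show "(\<lambda>n. N (G n) f) \<longlonglongrightarrow> 0"
    if "K2.in_ball f" "\<And>n :: nat. K1.in_ball (G n)"
      "\<And>m n x. m \<noteq> n \<Longrightarrow> x \<in> topspace K1 \<Longrightarrow> G m x = 0 \<or> G n x = 0" for f G
    by (rule null_left[OF that(2) that(1) that(3)])
qed (auto intro: N_add1 N_add2 N_scale1 N_scale2 N_nonneg M_nonneg)

end

section \<open>Bounded bilinear forms on disjoint functions\<close>

locale bilinear_form = K1: compact_Hausdorff K1 + K2: compact_Hausdorff K2
  for K1 :: "'a topology" and K2 :: "'b topology" +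
  fixes b :: "('a \<Rightarrow> 'k::{real_normed_field, euclidean_space}) \<Rightarrow> ('b \<Rightarrow> 'k) \<Rightarrow> 'k" and M :: real
  assumes add1: "cont K1 f \<Longrightarrow> cont K1 f' \<Longrightarrow> cont K2 g \<Longrightarrow> b (\<lambda>x. f x + f' x) g = b f g + b f' g"
    and add2: "cont K1 f \<Longrightarrow> cont K2 g \<Longrightarrow> cont K2 g' \<Longrightarrow> b f (\<lambda>x. g x + g' x) = b f g + b f g'"
    and scale1: "cont K1 f \<Longrightarrow> cont K2 g \<Longrightarrow> b (\<lambda>x. c * f x) g = c * b f g"
    and scale2: "cont K1 f \<Longrightarrow> cont K2 g \<Longrightarrow> b f (\<lambda>x. c * g x) = c * b f g"
    and bound: "K1.in_ball f \<Longrightarrow> K2.in_ball g \<Longrightarrow> norm (b f g) \<le> M"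
begin

lemma diff1: "cont K1 f \<Longrightarrow> cont K1 f' \<Longrightarrow> cont K2 g \<Longrightarrow> b (\<lambda>x. f x - f' x) g = b f g - b f' g"
  using add1[of f "\<lambda>x. (-1) * f' x" g] scale1[of f' g "-1"] cont_mult[OF cont_const, of K1 f' "-1"] by simp

lemma diff2: "cont K1 f \<Longrightarrow> cont K2 g \<Longrightarrow> cont K2 g' \<Longrightarrow> b f (\<lambda>x. g x - g' x) = b f g - b f g'"
  using add2[of f g "\<lambda>x. (-1) * g' x"] scale2[of f g' "-1"] cont_mult[OF cont_const, of K2 g' "-1"] by simp

lemma sum1:
  assumes "finite S" "\<And>t. t \<in> S \<Longrightarrow> cont K1 (f t)" "cont K2 g"
  shows "b (\<lambda>x. \<Sum>t\<in>S. c t * f t x) g = (\<Sum>t\<in>S. c t * b (f t) g)"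
  using assms
proof (induction S)
  case empty
  then show ?case using scale1[of "\<lambda>_. 0" g 0] by simp
next
  case (insert t S)
  have "b (\<lambda>x. c t * f t x + (\<Sum>t\<in>S. c t * f t x)) g = b (\<lambda>x. c t * f t x) g + b (\<lambda>x. \<Sum>t\<in>S. c t * f t x) g"
    using insert by (intro add1 cont_intros) auto
  moreover have "b (\<lambda>x. c t * f t x) g = c t * b (f t) g" using insert by (intro scale1) auto
  ultimately show ?case using insert by simp
qed

lemma sum2:
  assumes "finite S" "cont K1 f" "\<And>t. t \<in> S \<Longrightarrow> cont K2 (g t)"
  shows "b f (\<lambda>x. \<Sum>t\<in>S. c t * g t x) = (\<Sum>t\<in>S. c t * b f (g t))"
  using assms
proof (induction S)
  case empty
  then show ?case using scale2[of f "\<lambda>_. 0" 0] by simp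
next
  case (insert t S)
  have "b f (\<lambda>x. c t * g t x + (\<Sum>t\<in>S. c t * g t x)) = b f (\<lambda>x. c t * g t x) + b f (\<lambda>x. \<Sum>t\<in>S. c t * g t x)"
    using insert by (intro add2 cont_intros) auto
  moreover have "b f (\<lambda>x. c t * g t x) = c t * b f (g t)" using insert by (intro scale2) auto
  ultimately show ?case using insert by simp
qed

lemma in_ball_plus_minus1:
  assumes "K1.in_ball f" "K1.in_ball f'" "\<And>x. x \<in> topspace K1 \<Longrightarrow> f x = 0 \<or> f' x = 0"
  shows "K1.in_ball (\<lambda>x. f x + f' x)" "K1.in_ball (\<lambda>x. f x - f' x)"
  unfolding K1.in_ball_def using assms by (fastforce simp: K1.in_ball_def intro!: cont_intros)+

lemma in_ball_plus_minus2:
  assumes "K2.in_ball f" "K2.in_ball f'" "\<And>x. x \<in> topspace K2 \<Longrightarrow> f x = 0 \<or> f' x = 0"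
  shows "K2.in_ball (\<lambda>x. f x + f' x)" "K2.in_ball (\<lambda>x. f x - f' x)"
  unfolding K2.in_ball_def using assms by (fastforce simp: K2.in_ball_def intro!: cont_intros)+

text \<open>The extra term \<open>b f g\<close> makes the induction work: it is split as the average of
  \<open>b (f \<plusminus> F n) (g \<plusminus> G n)\<close> minus \<open>b (F n) (G n)\<close>.\<close>

lemma disjoint_diagonal_aux:
  assumes F: "\<And>l :: nat. K1.in_ball (F l)" "\<And>l m x. l \<noteq> m \<Longrightarrow> x \<in> topspace K1 \<Longrightarrow> F l x = 0 \<or> F m x = 0"
    and G: "\<And>l. K2.in_ball (G l)" "\<And>l m x. l \<noteq> m \<Longrightarrow> x \<in> topspace K2 \<Longrightarrow> G l x = 0 \<or> G m x = 0"
    and f: "K1.in_ball f" "\<And>l x. l < n \<Longrightarrow> x \<in> topspace K1 \<Longrightarrow> f x = 0 \<or> F l x = 0"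
    and g: "K2.in_ball g" "\<And>l x. l < n \<Longrightarrow> x \<in> topspace K2 \<Longrightarrow> g x = 0 \<or> G l x = 0"
  shows "norm ((\<Sum>l<n. b (F l) (G l)) + b f g) \<le> M"
  using f g
proof (induction n arbitrary: f g)
  case 0
  then show ?case by (simp add: bound)
next
  case (Suc n)
  let ?s = "\<Sum>l<n. b (F l) (G l)"
  let ?p = "b (\<lambda>x. f x + F n x) (\<lambda>x. g x + G n x)" and ?m = "b (\<lambda>x. f x - F n x) (\<lambda>x. g x - G n x)"
  note pm1 = in_ball_plus_minus1[OF Suc.prems(1) F(1)[of n] Suc.prems(2)[OF lessI]]
  note pm2 = in_ball_plus_minus2[OF Suc.prems(3) G(1)[of n] Suc.prems(4)[OF lessI]]
  have P: "norm (?s + ?p) \<le> M"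
  proof (rule Suc.IH[OF pm1(1) _ pm2(1)])
    show "f x + F n x = 0 \<or> F l x = 0" if "l < n" "x \<in> topspace K1" for l x
      using Suc.prems(2)[of l x] F(2)[of n l x] that by auto
    show "g x + G n x = 0 \<or> G l x = 0" if "l < n" "x \<in> topspace K2" for l x
      using Suc.prems(4)[of l x] G(2)[of n l x] that by auto
  qed
  have Q: "norm (?s + ?m) \<le> M"
  proof (rule Suc.IH[OF pm1(2) _ pm2(2)])
    show "f x - F n x = 0 \<or> F l x = 0" if "l < n" "x \<in> topspace K1" for l x
      using Suc.prems(2)[of l x] F(2)[of n l x] that by auto
    show "g x - G n x = 0 \<or> G l x = 0" if "l < n" "x \<in> topspace K2" for l x
      using Suc.prems(4)[of l x] G(2)[of n l x] that by auto
  qed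
  have c: "cont K1 f" "cont K1 (F n)" "cont K2 g" "cont K2 (G n)"
    using Suc.prems F G by (auto simp: K1.in_ball_def K2.in_ball_def)
  \<comment> \<open>The mixed terms b f (G n) and b (F n) g have opposite signs in the two products
    and cancel.\<close>
  have "?p + ?m = 2 * (b (F n) (G n) + b f g)"
    using c by (simp add: add1 add2 diff1 diff2 cont_add cont_diff algebra_simps)
  then have eq: "2 * ((\<Sum>l<Suc n. b (F l) (G l)) + b f g) = (?s + ?p) + (?s + ?m)"
    by (simp add: algebra_simps)
  have "norm (2 * ((\<Sum>l<Suc n. b (F l) (G l)) + b f g)) \<le> M + M"
    unfolding eq by (rule norm_triangle_mono[OF P Q])
  then show ?case unfolding norm_mult by simp
qed

lemma disjoint_diagonal:
  assumes "\<And>l :: nat. K1.in_ball (F l)" "\<And>l m x. l \<noteq> m \<Longrightarrow> x \<in> topspace K1 \<Longrightarrow> F l x = 0 \<or> F m x = 0"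
    and "\<And>l. K2.in_ball (G l)" "\<And>l m x. l \<noteq> m \<Longrightarrow> x \<in> topspace K2 \<Longrightarrow> G l x = 0 \<or> G m x = 0"
  shows "norm (\<Sum>l<n. b (F l) (G l)) \<le> M"
proof -
  have "norm ((\<Sum>l<n. b (F l) (G l)) + b (\<lambda>_. 0) (\<lambda>_. 0)) \<le> M"
    by (rule disjoint_diagonal_aux[OF assms]) (auto simp: K1.in_ball_def K2.in_ball_def)
  moreover have "b (\<lambda>_. 0) (\<lambda>_. 0) = 0" using scale1[of "\<lambda>_. 0" "\<lambda>_. 0" 0] by simp
  ultimately show ?thesis by simp
qed

end

context compact_Hausdorff
begin

lemma in_ball_scale: "norm c \<le> 1 \<Longrightarrow> in_ball f \<Longrightarrow> in_ball (\<lambda>x. c * f x)" for c :: "'k::real_normed_field"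
  unfolding in_ball_def by (auto intro!: cont_mult cont_const mult_le_one simp: norm_mult)

lemma in_ball_disjoint_sum:
  fixes F :: "nat \<Rightarrow> 'a \<Rightarrow> 'k::real_normed_field"
  assumes F: "\<And>l :: nat. in_ball (F l)" "\<And>l m x. l \<noteq> m \<Longrightarrow> x \<in> topspace K \<Longrightarrow> F l x = 0 \<or> F m x = 0"
  shows "in_ball (\<lambda>x. \<Sum>l<n. F l x)"
  unfolding in_ball_def
proof (intro conjI ballI cont_sum)
  fix x assume x: "x \<in> topspace K"
  show "norm (\<Sum>l<n. F l x) \<le> 1"
  proof (cases "\<exists>l<n. F l x \<noteq> 0")
    case True
    then obtain l where l: "l < n" "F l x \<noteq> 0" by blast
    have "(\<Sum>m<n. F m x) = (\<Sum>m<n. if m = l then F l x else 0)"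
      using F(2)[OF _ x] l(2) by (intro sum.cong) auto
    then show ?thesis using l(1) F(1) x by (simp add: in_ball_def)
  qed simp
qed (use F(1) in \<open>simp add: in_ball_def\<close>)

end

lemma dual_lincomb:
  assumes V: "normed_space V" and \<phi>: "\<phi> \<in> dual V" and I: "finite I" and \<psi>: "\<And>i. i \<in> I \<Longrightarrow> \<psi> i \<in> dual V"
  shows "(\<lambda>z. \<phi> z - (\<Sum>i\<in>I. a i * \<psi> i z)) \<in> dual V"
proof -
  obtain C where C: "\<forall>x\<in>vs_carrier V. norm (\<phi> x) \<le> C * vs_norm V x" using dual_bound[OF V \<phi>] by blast
  have "\<forall>i\<in>I. \<exists>D. \<forall>x\<in>vs_carrier V. norm (\<psi> i x) \<le> D * vs_norm V x" using dual_bound[OF V \<psi>] by blast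
  then obtain D where D: "\<forall>i\<in>I. \<forall>x\<in>vs_carrier V. norm (\<psi> i x) \<le> D i * vs_norm V x" by metis
  show ?thesis
  proof (rule dualI[OF V])
    fix x y assume x: "x \<in> vs_carrier V" "y \<in> vs_carrier V"
    have "(\<Sum>i\<in>I. a i * \<psi> i (vs_add V x y)) = (\<Sum>i\<in>I. a i * \<psi> i x + a i * \<psi> i y)"
      by (intro sum.cong refl) (simp add: dual_add[OF \<psi> x] distrib_left)
    then show "\<phi> (vs_add V x y) - (\<Sum>i\<in>I. a i * \<psi> i (vs_add V x y)) =
        \<phi> x - (\<Sum>i\<in>I. a i * \<psi> i x) + (\<phi> y - (\<Sum>i\<in>I. a i * \<psi> i y))"
      by (simp add: dual_add[OF \<phi> x] sum.distrib)
  next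
    fix c x assume x: "x \<in> vs_carrier V"
    have "(\<Sum>i\<in>I. a i * \<psi> i (vs_scale V c x)) = (\<Sum>i\<in>I. c * (a i * \<psi> i x))"
      by (intro sum.cong refl) (simp add: dual_scale[OF \<psi> x])
    then show "\<phi> (vs_scale V c x) - (\<Sum>i\<in>I. a i * \<psi> i (vs_scale V c x)) = c * (\<phi> x - (\<Sum>i\<in>I. a i * \<psi> i x))"
      by (simp add: dual_scale[OF \<phi> x] sum_distrib_left right_diff_distrib)
  next
    fix x assume x: "x \<in> vs_carrier V"
    have "norm (\<phi> x - (\<Sum>i\<in>I. a i * \<psi> i x)) \<le> norm (\<phi> x) + norm (\<Sum>i\<in>I. a i * \<psi> i x)"
      by (rule norm_triangle_ineq4)
    also have "norm (\<Sum>i\<in>I. a i * \<psi> i x) \<le> (\<Sum>i\<in>I. norm (a i) * D i * vs_norm V x)"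
    proof (rule sum_norm_le)
      fix i assume i: "i \<in> I"
      have "norm (a i) * norm (\<psi> i x) \<le> norm (a i) * (D i * vs_norm V x)"
        using D i x by (intro mult_left_mono) auto
      then show "norm (a i * \<psi> i x) \<le> norm (a i) * D i * vs_norm V x" by (simp add: norm_mult mult.assoc)
    qed
    finally show "norm (\<phi> x - (\<Sum>i\<in>I. a i * \<psi> i x)) \<le> (C + (\<Sum>i\<in>I. norm (a i) * D i)) * vs_norm V x"
      using bspec[OF C x] by (simp add: distrib_right sum_distrib_right)
  qed
qed

section \<open>Scattered spaces give the Dunford-Pettis property\<close>

text \<open>The \<open>itself\<close> parameter pins down the scalar type, so that the locale can be
  interpreted once for real and once for complex scalars.\<close>

locale C_tensor = K1: compact_Hausdorff K1 + K2: compact_Hausdorff K2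
  for K1 :: "'a topology" and K2 :: "'b topology" +
  fixes scalars :: "'k::{real_normed_field, euclidean_space} itself"
begin

sublocale tensor_product "C_space K1 :: ('k, 'a \<Rightarrow> 'k) nspace" "C_space K2 :: ('k, 'b \<Rightarrow> 'k) nspace"
  by (intro tensor_product.intro K1.normed_space_C K2.normed_space_C)

definition tn :: "('a \<Rightarrow> 'k) \<Rightarrow> ('b \<Rightarrow> 'k) \<Rightarrow> (nat \<Rightarrow> ((('a \<Rightarrow> 'k) \<times> ('b \<Rightarrow> 'k)) \<Rightarrow>\<^sub>0 'k) set) set" where
  "tn f g = tens (K1.rs f) (K2.rs g)"

lemma tn_closed: "cont K1 f \<Longrightarrow> cont K2 g \<Longrightarrow> tn f g \<in> vs_carrier E"
  unfolding tn_def by (intro tens_closed K1.rs_carrier K2.rs_carrier)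

lemma tn_add1: "cont K1 f \<Longrightarrow> cont K1 f' \<Longrightarrow> cont K2 g \<Longrightarrow> tn (\<lambda>x. f x + f' x) g = vs_add E (tn f g) (tn f' g)"
  unfolding tn_def K1.rs_add by (intro tens_add_left K1.rs_carrier K2.rs_carrier)

lemma tn_add2: "cont K1 f \<Longrightarrow> cont K2 g \<Longrightarrow> cont K2 g' \<Longrightarrow> tn f (\<lambda>x. g x + g' x) = vs_add E (tn f g) (tn f g')"
  unfolding tn_def K2.rs_add by (intro tens_add_right K1.rs_carrier K2.rs_carrier)

lemma tn_scale1: "cont K1 f \<Longrightarrow> cont K2 g \<Longrightarrow> tn (\<lambda>x. c * f x) g = vs_scale E c (tn f g)"
  unfolding tn_def K1.rs_scale by (intro tens_scale_left K1.rs_carrier K2.rs_carrier)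

lemma tn_scale2: "cont K1 f \<Longrightarrow> cont K2 g \<Longrightarrow> tn f (\<lambda>x. c * g x) = vs_scale E c (tn f g)"
  unfolding tn_def K2.rs_scale by (intro tens_scale_right K1.rs_carrier K2.rs_carrier)

lemma norm_tn_le:
  assumes f: "cont K1 f" and g: "cont K2 g"
    and a: "\<And>x. x \<in> topspace K1 \<Longrightarrow> norm (f x) \<le> a" and b: "\<And>x. x \<in> topspace K2 \<Longrightarrow> norm (g x) \<le> b"
  shows "vs_norm E (tn f g) \<le> a * b"
proof -
  have "vs_norm E (tn f g) \<le> vs_norm (C_space K1) (K1.rs f) * vs_norm (C_space K2) (K2.rs g)"
    unfolding tn_def by (intro norm_tens_le K1.rs_carrier K2.rs_carrier f g)
  also have "\<dots> \<le> a * b"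
  proof (rule mult_mono')
    show "vs_norm (C_space K1) (K1.rs f) \<le> a" by (rule K1.C_norm_le) (simp add: a)
    show "vs_norm (C_space K2) (K2.rs g) \<le> b" by (rule K2.C_norm_le) (simp add: b)
  qed (intro V.norm_nonneg W.norm_nonneg K1.rs_carrier K2.rs_carrier f g)+
  finally show ?thesis .
qed

lemma dual_bilinear_form:
  assumes \<phi>: "\<phi> \<in> dual E" and C: "C \<ge> 0" "\<And>z. z \<in> vs_carrier E \<Longrightarrow> norm (\<phi> z) \<le> C * vs_norm E z"
  shows "bilinear_form K1 K2 (\<lambda>f g. \<phi> (tn f g)) C"
proof unfold_locales
  fix f f' :: "'a \<Rightarrow> 'k" and g g' :: "'b \<Rightarrow> 'k" and c
  show "\<phi> (tn (\<lambda>x. f x + f' x) g) = \<phi> (tn f g) + \<phi> (tn f' g)" if "cont K1 f" "cont K1 f'" "cont K2 g"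
    using that by (simp add: tn_add1 dual_add[OF \<phi>] tn_closed)
  show "\<phi> (tn f (\<lambda>x. g x + g' x)) = \<phi> (tn f g) + \<phi> (tn f g')" if "cont K1 f" "cont K2 g" "cont K2 g'"
    using that by (simp add: tn_add2 dual_add[OF \<phi>] tn_closed)
  show "\<phi> (tn (\<lambda>x. c * f x) g) = c * \<phi> (tn f g)" if "cont K1 f" "cont K2 g"
    using that by (simp add: tn_scale1 dual_scale[OF \<phi>] tn_closed)
  show "\<phi> (tn f (\<lambda>x. c * g x)) = c * \<phi> (tn f g)" if "cont K1 f" "cont K2 g"
    using that by (simp add: tn_scale2 dual_scale[OF \<phi>] tn_closed)
  show "norm (\<phi> (tn f g)) \<le> C" if "K1.in_ball f" "K2.in_ball g"
  proof -
    have c: "cont K1 f" "cont K2 g" using that by (auto simp: K1.in_ball_def K2.in_ball_def)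
    have "norm (\<phi> (tn f g)) \<le> C * vs_norm E (tn f g)" by (intro C tn_closed c)
    also have "\<dots> \<le> C * (1 * 1)"
      using that by (intro mult_left_mono norm_tn_le C c) (auto simp: K1.in_ball_def K2.in_ball_def)
    finally show ?thesis by simp
  qed
qed

text \<open>By Hahn-Banach it suffices to bound the scalar sums \<open>\<Sum>\<^sub>l \<phi> (c\<^sub>l F\<^sub>l \<otimes> G\<^sub>l)\<close>.\<close>

lemma weakly_compact_null:
  fixes W :: "('k, 'w) nspace"
  assumes W: "normed_space W" and T: "weakly_compact_operator E W T"
    and F: "\<And>n :: nat. cont K1 (F n)" and G: "\<And>n. cont K2 (G n)"
    and bnd: "\<And>b (r :: nat \<Rightarrow> nat) c n. bilinear_form K1 K2 b 1 \<Longrightarrow> strict_mono r \<Longrightarrow> (\<And>l. norm (c l) \<le> 1) \<Longrightarrow>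
      norm (\<Sum>l<n. c l * b (F (r l)) (G (r l))) \<le> 1"
  shows "(\<lambda>n. vs_norm W (T (tn (F n) (G n)))) \<longlonglongrightarrow> 0"
proof (rule weakly_compact_operator_wuc[OF normed_space_E W T])
  show x: "tn (F n) (G n) \<in> vs_carrier E" for n by (intro tn_closed F G)
  fix r :: "nat \<Rightarrow> nat" and c :: "nat \<Rightarrow> 'k" and n
  assume r: "strict_mono r" and c: "\<And>l. norm (c l) \<le> 1"
  let ?t = "\<lambda>l. vs_scale E (c l) (tn (F (r l)) (G (r l)))"
  have t: "?t l \<in> vs_carrier E" for l
    by (rule normed_space.scale_closed[OF normed_space_E x])
  have z: "vsum E ?t n \<in> vs_carrier E" by (rule vsum_closed[OF normed_space_E t])
  have "\<exists>\<phi>\<in>dual E. (\<forall>x\<in>vs_carrier E. norm (\<phi> x) \<le> vs_norm E x) \<and> norm (\<phi> (vsum E ?t n)) = vs_norm E (vsum E ?t n)"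
    by (rule norming_functional[OF normed_space_E z]) blast
  then obtain \<phi> where \<phi>: "\<phi> \<in> dual E" "\<And>x. x \<in> vs_carrier E \<Longrightarrow> norm (\<phi> x) \<le> 1 * vs_norm E x"
    "norm (\<phi> (vsum E ?t n)) = vs_norm E (vsum E ?t n)" by auto
  have form: "bilinear_form K1 K2 (\<lambda>f g. \<phi> (tn f g)) 1"
    by (rule dual_bilinear_form[OF \<phi>(1) _ \<phi>(2)]) auto
  have "\<phi> (vsum E ?t n) = (\<Sum>l<n. \<phi> (?t l))" by (rule dual_vsum[OF normed_space_E \<phi>(1) t])
  also have "\<dots> = (\<Sum>l<n. c l * \<phi> (tn (F (r l)) (G (r l))))" by (intro sum.cong refl dual_scale[OF \<phi>(1) x])
  finally have "norm (\<phi> (vsum E ?t n)) \<le> 1" using bnd[OF form r c] by simp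
  then show "vs_norm E (vsum E ?t n) \<le> 1" using \<phi>(3) by simp
qed

text \<open>With coefficients absorbed into one factor, each null condition is a bound on sums of
  values of a form of norm at most 1. If both factors are disjoint this is
  \<open>disjoint_diagonal\<close>; if one is fixed, the sum of the disjoint functions is itself in
  the unit ball.\<close>

lemma weakly_compact_biseminorm:
  fixes W :: "('k, 'w) nspace"
  assumes W: "normed_space W" and T: "weakly_compact_operator E W T"
  shows "\<exists>M. disjoint_null_biseminorm K1 K2 (\<lambda>f g. vs_norm W (T (tn f g))) M"
proof -
  interpret E: normed_space E by (rule normed_space_E)
  interpret W': normed_space W by (rule W)
  have Top: "T \<in> operators E W" using T by (simp add: weakly_compact_operator_def)
  note Tn = operators_simps[OF Top]
  obtain M where M: "M > 0" "\<forall>z\<in>vs_carrier E. vs_norm W (T z) \<le> M * vs_norm E z"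
    using operators_bound[OF normed_space_E W Top] by blast
  have "disjoint_null_biseminorm K1 K2 (\<lambda>f g. vs_norm W (T (tn f g))) M"
  proof unfold_locales
    fix f f' :: "'a \<Rightarrow> 'k" and g g' :: "'b \<Rightarrow> 'k" and c
    show "vs_norm W (T (tn (\<lambda>x. f x + f' x) g)) \<le> vs_norm W (T (tn f g)) + vs_norm W (T (tn f' g))"
      if "cont K1 f" "cont K1 f'" "cont K2 g"
      using that by (simp add: tn_add1 Tn(2) tn_closed W'.norm_triangle Tn(1)[OF tn_closed])
    show "vs_norm W (T (tn f (\<lambda>x. g x + g' x))) \<le> vs_norm W (T (tn f g)) + vs_norm W (T (tn f g'))"
      if "cont K1 f" "cont K2 g" "cont K2 g'"
      using that by (simp add: tn_add2 Tn(2) tn_closed W'.norm_triangle Tn(1)[OF tn_closed])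
    show "vs_norm W (T (tn (\<lambda>x. c * f x) g)) \<le> norm c * vs_norm W (T (tn f g))" if "cont K1 f" "cont K2 g"
      using that by (simp add: tn_scale1 Tn(3) tn_closed W'.norm_scale Tn(1)[OF tn_closed])
    show "vs_norm W (T (tn f (\<lambda>x. c * g x))) \<le> norm c * vs_norm W (T (tn f g))" if "cont K1 f" "cont K2 g"
      using that by (simp add: tn_scale2 Tn(3) tn_closed W'.norm_scale Tn(1)[OF tn_closed])
    show "vs_norm W (T (tn f g)) \<le> M * (a * b)" if "cont K1 f" "cont K2 g"
      "\<And>x. x \<in> topspace K1 \<Longrightarrow> norm (f x) \<le> a" "\<And>x. x \<in> topspace K2 \<Longrightarrow> norm (g x) \<le> b" for a b
    proof -
      have "vs_norm W (T (tn f g)) \<le> M * vs_norm E (tn f g)" using M(2) tn_closed[OF that(1,2)] by blast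
      also have "\<dots> \<le> M * (a * b)" using M(1) that by (intro mult_left_mono norm_tn_le) auto
      finally show ?thesis .
    qed
    show "0 \<le> vs_norm W (T (tn f g))" if "cont K1 f" "cont K2 g"
      by (intro W'.norm_nonneg Tn(1) tn_closed that)
    show "0 \<le> M" using M(1) by simp
  next
    fix F :: "nat \<Rightarrow> 'a \<Rightarrow> 'k" and G :: "nat \<Rightarrow> 'b \<Rightarrow> 'k"
    assume F: "\<And>n. K1.in_ball (F n)" "\<And>m n x. m \<noteq> n \<Longrightarrow> x \<in> topspace K1 \<Longrightarrow> F m x = 0 \<or> F n x = 0"
      and G: "\<And>n. K2.in_ball (G n)" "\<And>m n x. m \<noteq> n \<Longrightarrow> x \<in> topspace K2 \<Longrightarrow> G m x = 0 \<or> G n x = 0"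
    have c: "cont K1 (F n)" "cont K2 (G n)" for n using F(1) G(1) by (auto simp: K1.in_ball_def K2.in_ball_def)
    show "(\<lambda>n. vs_norm W (T (tn (F n) (G n)))) \<longlonglongrightarrow> 0"
    proof (rule weakly_compact_null[OF W T c])
      fix b :: "('a \<Rightarrow> 'k) \<Rightarrow> ('b \<Rightarrow> 'k) \<Rightarrow> 'k" and r :: "nat \<Rightarrow> nat" and d :: "nat \<Rightarrow> 'k" and n
      assume b: "bilinear_form K1 K2 b 1" and r: "strict_mono r" and d: "\<And>l. norm (d l) \<le> 1"
      interpret bilinear_form K1 K2 b 1 by (rule b)
      have ne: "r l \<noteq> r m" if "l \<noteq> m" for l m using that r by (simp add: strict_mono_eq)
      have "norm (\<Sum>l<n. b (\<lambda>x. d l * F (r l) x) (G (r l))) \<le> 1"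
      proof (rule disjoint_diagonal)
        show "d l * F (r l) x = 0 \<or> d m * F (r m) x = 0" if "l \<noteq> m" "x \<in> topspace K1" for l m x
          using F(2)[OF ne[OF that(1)] that(2)] by auto
        show "G (r l) x = 0 \<or> G (r m) x = 0" if "l \<noteq> m" "x \<in> topspace K2" for l m x
          using G(2)[OF ne[OF that(1)] that(2)] .
      qed (intro K1.in_ball_scale d F G)+
      then show "norm (\<Sum>l<n. d l * b (F (r l)) (G (r l))) \<le> 1" by (simp add: scale1 c)
    qed
  next
    fix F :: "nat \<Rightarrow> 'a \<Rightarrow> 'k" and g :: "'b \<Rightarrow> 'k"
    assume F: "\<And>n. K1.in_ball (F n)" "\<And>m n x. m \<noteq> n \<Longrightarrow> x \<in> topspace K1 \<Longrightarrow> F m x = 0 \<or> F n x = 0"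
      and g: "K2.in_ball g"
    have c: "cont K1 (F n)" "cont K2 g" for n using F(1) g by (auto simp: K1.in_ball_def K2.in_ball_def)
    show "(\<lambda>n. vs_norm W (T (tn (F n) g))) \<longlonglongrightarrow> 0"
    proof (rule weakly_compact_null[OF W T c])
      fix b :: "('a \<Rightarrow> 'k) \<Rightarrow> ('b \<Rightarrow> 'k) \<Rightarrow> 'k" and r :: "nat \<Rightarrow> nat" and d :: "nat \<Rightarrow> 'k" and n
      assume b: "bilinear_form K1 K2 b 1" and r: "strict_mono r" and d: "\<And>l. norm (d l) \<le> 1"
      interpret bilinear_form K1 K2 b 1 by (rule b)
      have ne: "r l \<noteq> r m" if "l \<noteq> m" for l m using that r by (simp add: strict_mono_eq)
      have "K1.in_ball (\<lambda>x. \<Sum>l<n. d l * F (r l) x)"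
      proof (rule K1.in_ball_disjoint_sum)
        show "d l * F (r l) x = 0 \<or> d m * F (r m) x = 0" if "l \<noteq> m" "x \<in> topspace K1" for l m x
          using F(2)[OF ne[OF that(1)] that(2)] by auto
      qed (intro K1.in_ball_scale d F)
      from bound[OF this g] show "norm (\<Sum>l<n. d l * b (F (r l)) g) \<le> 1" by (simp add: sum1 c)
    qed
  next
    fix f :: "'a \<Rightarrow> 'k" and G :: "nat \<Rightarrow> 'b \<Rightarrow> 'k"
    assume f: "K1.in_ball f"
      and G: "\<And>n. K2.in_ball (G n)" "\<And>m n x. m \<noteq> n \<Longrightarrow> x \<in> topspace K2 \<Longrightarrow> G m x = 0 \<or> G n x = 0"
    have c: "cont K1 f" "cont K2 (G n)" for n using f G(1) by (auto simp: K1.in_ball_def K2.in_ball_def)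
    show "(\<lambda>n. vs_norm W (T (tn f (G n)))) \<longlonglongrightarrow> 0"
    proof (rule weakly_compact_null[OF W T c])
      fix b :: "('a \<Rightarrow> 'k) \<Rightarrow> ('b \<Rightarrow> 'k) \<Rightarrow> 'k" and r :: "nat \<Rightarrow> nat" and d :: "nat \<Rightarrow> 'k" and n
      assume b: "bilinear_form K1 K2 b 1" and r: "strict_mono r" and d: "\<And>l. norm (d l) \<le> 1"
      interpret bilinear_form K1 K2 b 1 by (rule b)
      have ne: "r l \<noteq> r m" if "l \<noteq> m" for l m using that r by (simp add: strict_mono_eq)
      have "K2.in_ball (\<lambda>x. \<Sum>l<n. d l * G (r l) x)"
      proof (rule K2.in_ball_disjoint_sum)
        show "d l * G (r l) x = 0 \<or> d m * G (r m) x = 0" if "l \<noteq> m" "x \<in> topspace K2" for l m x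
          using G(2)[OF ne[OF that(1)] that(2)] by auto
      qed (intro K2.in_ball_scale d G)
      from bound[OF f this] show "norm (\<Sum>l<n. d l * b f (G (r l))) \<le> 1" by (simp add: sum2 c)
    qed
  qed
  then show ?thesis by blast
qed

lemma evaluation_dual:
  assumes s: "s \<in> topspace K1" and t: "t \<in> topspace K2"
  shows "\<exists>\<Phi>\<in>dual E. \<forall>x\<in>vs_carrier (C_space K1). \<forall>y\<in>vs_carrier (C_space K2). \<Phi> (tens x y) = x s * y t"
proof (rule bilinear_extends)
  show "norm (x s * y t) \<le> 1 * (vs_norm (C_space K1) x * vs_norm (C_space K2) y)"
    if "x \<in> vs_carrier (C_space K1)" "y \<in> vs_carrier (C_space K2)" for x :: "'a \<Rightarrow> 'k" and y :: "'b \<Rightarrow> 'k"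
    unfolding norm_mult mult_1
    using that s t by (intro mult_mono' K1.C_norm_ge K2.C_norm_ge norm_ge_zero) (auto simp: K1.C_carrier K2.C_carrier)
qed (use s t in \<open>auto simp: C_space_def algebra_simps\<close>)

text \<open>Up to \<open>\<epsilon>\<close>, \<open>T\<close> factors through finitely many point evaluations.\<close>

lemma weakly_compact_estimate:
  fixes W :: "('k, 'w) nspace"
  assumes s1: "scattered_space K1" and s2: "scattered_space K2"
    and W: "normed_space W" and T: "weakly_compact_operator E W T" and e: "e > 0"
  shows "\<exists>(I :: ('a \<times> 'b) set) \<Phi> C. finite I \<and> (\<forall>i\<in>I. \<Phi> i \<in> dual E) \<and>
    (\<forall>z\<in>vs_carrier E. vs_norm W (T z) \<le> 4 * e * vs_norm E z + C * (\<Sum>i\<in>I. norm (\<Phi> i z)))"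
proof -
  interpret E: normed_space E by (rule normed_space_E)
  interpret W': normed_space W by (rule W)
  let ?N = "\<lambda>f g. vs_norm W (T (tn f g))"
  have Top: "T \<in> operators E W" using T by (simp add: weakly_compact_operator_def)
  note Tn = operators_simps[OF Top]
  obtain M where M: "disjoint_null_biseminorm K1 K2 ?N M" using weakly_compact_biseminorm[OF W T] by blast
  interpret N: disjoint_null_biseminorm K1 K2 ?N M by (rule M)
  interpret N': disjoint_null_biseminorm K2 K1 "\<lambda>g f. vs_norm W (T (tn f g))" M by (rule N.swap)
  obtain S where S: "finite S" "S \<subseteq> topspace K1"
    "\<And>f g. K1.in_ball f \<Longrightarrow> K2.in_ball g \<Longrightarrow> \<forall>x\<in>S. f x = 0 \<Longrightarrow> ?N f g \<le> e"
    using N.tail_left[OF s1 s2 e] by blast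
  obtain S' where S': "finite S'" "S' \<subseteq> topspace K2"
    "\<And>f g. K1.in_ball f \<Longrightarrow> K2.in_ball g \<Longrightarrow> \<forall>x\<in>S'. g x = 0 \<Longrightarrow> ?N f g \<le> e"
    using N'.tail_left[OF s2 s1 e] by blast
  obtain p where p: "K1.partition_on_points S p"
    using K1.finite_partition[OF S(1,2)] S(1,2) unfolding K1.partition_on_points_def by blast
  obtain p' where p': "K2.partition_on_points S' p'"
    using K2.finite_partition[OF S'(1,2)] S'(1,2) unfolding K2.partition_on_points_def by blast
  note ip = K1.interpolation[OF p] and ip' = K2.interpolation[OF p']
  define u where "u s = (\<lambda>x. of_real (p s x) :: 'k)" for s
  define v where "v t = (\<lambda>x. of_real (p' t x) :: 'k)" for t
  have zero_ball: "K1.in_ball (\<lambda>_. 0 :: 'k)" "K2.in_ball (\<lambda>_. 0 :: 'k)" by (auto simp: K1.in_ball_def K2.in_ball_def)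
  have cu: "cont K1 (u s)" if "s \<in> S" for s using ip(1)[OF zero_ball(1) that] by (simp add: u_def K1.in_ball_def)
  have cv: "cont K2 (v t)" if "t \<in> S'" for t using ip'(1)[OF zero_ball(2) that] by (simp add: v_def K2.in_ball_def)
  let ?I = "S \<times> S'"
  have fin: "finite ?I" using S(1,2) S'(1,2) by simp
  have "\<forall>i\<in>?I. \<exists>\<Phi>. \<Phi> \<in> dual E \<and> (\<forall>x\<in>vs_carrier (C_space K1). \<forall>y\<in>vs_carrier (C_space K2). \<Phi> (tens x y) = x (fst i) * y (snd i))"
  proof
    fix i assume "i \<in> ?I"
    then have "fst i \<in> topspace K1" "snd i \<in> topspace K2" using S(1,2) S'(1,2) by auto
    then show "\<exists>\<Phi>. \<Phi> \<in> dual E \<and>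
      (\<forall>x\<in>vs_carrier (C_space K1). \<forall>y\<in>vs_carrier (C_space K2). \<Phi> (tens x y) = x (fst i) * y (snd i))"
      using evaluation_dual unfolding Bex_def by simp
  qed
  from bchoice[OF this] obtain \<Phi> where \<Phi>': "\<forall>i\<in>?I. \<Phi> i \<in> dual E \<and>
      (\<forall>x\<in>vs_carrier (C_space K1). \<forall>y\<in>vs_carrier (C_space K2). \<Phi> i (tens x y) = x (fst i) * y (snd i))"
    by (rule exE)
  have \<Phi>: "\<Phi> i \<in> dual E" "x \<in> vs_carrier (C_space K1) \<Longrightarrow> y \<in> vs_carrier (C_space K2) \<Longrightarrow>
      \<Phi> i (tens x y) = x (fst i) * y (snd i)" if "i \<in> ?I" for i x y
    using bspec[OF \<Phi>' that] by simp_all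
  \<comment> \<open>A crude bound for T on the finitely many tensors u s \<otimes> v t. It depends
    neither on \<open>z\<close> nor on the functional chosen below, so the final estimate holds for
    all \<open>z\<close> with the same constant.\<close>
  define C where "C = (\<Sum>i\<in>?I. ?N (u (fst i)) (v (snd i)))"
  have N_uv: "0 \<le> ?N (u (fst i)) (v (snd i))" "?N (u (fst i)) (v (snd i)) \<le> C" if i: "i \<in> ?I" for i
  proof -
    have pos: "0 \<le> ?N (u (fst i)) (v (snd i))" if "i \<in> ?I" for i
      using that by (intro N.N_nonneg cu cv) auto
    then show "0 \<le> ?N (u (fst i)) (v (snd i))" using i by blast
    show "?N (u (fst i)) (v (snd i)) \<le> C"
      unfolding C_def by (rule member_le_sum[OF i _ fin]) (rule pos, simp)
  qed
  have "vs_norm W (T z) \<le> 4 * e * vs_norm E z + C * (\<Sum>i\<in>?I. norm (\<Phi> i z))" if z: "z \<in> vs_carrier E" for z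
  proof -
    have "\<exists>h\<in>dual W. (\<forall>w\<in>vs_carrier W. norm (h w) \<le> vs_norm W w) \<and> norm (h (T z)) = vs_norm W (T z)"
      by (rule norming_functional[OF W Tn(1)[OF z]]) blast
    then obtain h where h: "h \<in> dual W" "\<And>w. w \<in> vs_carrier W \<Longrightarrow> norm (h w) \<le> vs_norm W w"
      "norm (h (T z)) = vs_norm W (T z)" by blast
    define b where "b f g = h (T (tn f g))" for f g
    have hT: "(\<lambda>z. h (T z)) \<in> dual E" by (rule dual_comp[OF normed_space_E W Top h(1)])
    obtain D where D: "D > 0" "\<forall>z\<in>vs_carrier E. norm (h (T z)) \<le> D * vs_norm E z"
      using dual_bound[OF normed_space_E hT] by blast
    interpret b: bilinear_form K1 K2 b D
      unfolding b_def by (rule dual_bilinear_form[OF hT]) (use D in auto)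
    have bN: "norm (b f g) \<le> ?N f g" if "cont K1 f" "cont K2 g" for f g
      unfolding b_def by (intro h Tn(1) tn_closed that)
    \<comment> \<open>The subtracted sum is h \<circ> T applied to interpolated tensors, written by
      means of point evaluations so that it makes sense on all of E. Thus \<theta> measures the
      interpolation error, and its small bound on elementary tensors spreads to E by
      \<open>seminorm_bound\<close>.\<close>
    define \<theta> where "\<theta> z = h (T z) - (\<Sum>i\<in>?I. b (u (fst i)) (v (snd i)) * \<Phi> i z)" for z
    have \<theta>: "\<theta> \<in> dual E"
      unfolding \<theta>_def by (rule dual_lincomb[OF normed_space_E hT fin \<Phi>(1)])
    obtain L where L: "L > 0" "\<forall>z\<in>vs_carrier E. norm (\<theta> z) \<le> L * vs_norm E z"
      using dual_bound[OF normed_space_E \<theta>] by blast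
    have ball: "norm (\<theta> (tn f g)) \<le> 4 * e" if f: "K1.in_ball f" and g: "K2.in_ball g" for f g
    proof -
      let ?P = "\<lambda>x. \<Sum>s\<in>S. f s * u s x" and ?Q = "\<lambda>x. \<Sum>t\<in>S'. g t * v t x"
      let ?R = "\<lambda>x. of_real (1/2) * (f x - ?P x)" and ?R' = "\<lambda>x. of_real (1/2) * (g x - ?Q x)"
      have P: "K1.in_ball ?P" "K1.in_ball ?R" "\<forall>s\<in>S. ?R s = 0" using ip(2-4)[OF f] unfolding u_def by blast+
      have Q: "K2.in_ball ?Q" "K2.in_ball ?R'" "\<forall>s\<in>S'. ?R' s = 0" using ip'(2-4)[OF g] unfolding v_def by blast+
      have cP: "cont K1 f" "cont K1 ?P" "cont K1 ?R" using P(1,2) f by (auto simp: K1.in_ball_def)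
      have cQ: "cont K2 g" "cont K2 ?Q" "cont K2 ?R'" using Q(1,2) g by (auto simp: K2.in_ball_def)
      have "\<Phi> i (tn f g) = f (fst i) * g (snd i)" if "i \<in> ?I" for i
      proof -
        have "fst i \<in> topspace K1" "snd i \<in> topspace K2" using that S(2) S'(2) by auto
        then show ?thesis
          using \<Phi>(2)[OF that K1.rs_carrier[OF cP(1)] K2.rs_carrier[OF cQ(1)]] by (simp add: tn_def)
      qed
      then have "(\<Sum>i\<in>?I. b (u (fst i)) (v (snd i)) * \<Phi> i (tn f g)) =
          (\<Sum>i\<in>?I. f (fst i) * (g (snd i) * b (u (fst i)) (v (snd i))))"
        by (intro sum.cong refl) simp
      also have "\<dots> = (\<Sum>s\<in>S. f s * (\<Sum>t\<in>S'. g t * b (u s) (v t)))"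
        by (simp add: sum.cartesian_product case_prod_beta sum_distrib_left)
      also have "\<dots> = (\<Sum>s\<in>S. f s * b (u s) ?Q)"
        by (intro sum.cong refl) (simp add: b.sum2[OF S'(1) cu cv])
      also have "\<dots> = b ?P ?Q" by (rule b.sum1[OF S(1) cu cQ(2), symmetric])
      finally have "\<theta> (tn f g) = b f g - b ?P ?Q" by (simp add: \<theta>_def b_def)
      also have "\<dots> = (b f g - b ?P g) + (b ?P g - b ?P ?Q)" by simp
      \<comment> \<open>The factors are replaced one at a time, each step with a remainder vanishing
        on its finite set. Each remainder was halved to lie in the unit ball, so each step costs 2
        e, altogether 4 e.\<close>
      also have "b f g - b ?P g = 2 * b ?R g"
        using b.scale1[OF cont_diff[OF cP(1,2)] cQ(1), of "of_real (1/2)"] b.diff1[OF cP(1,2) cQ(1)] by (simp add: mult.commute[of 2])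
      also have "b ?P g - b ?P ?Q = 2 * b ?P ?R'"
        using b.scale2[OF cP(2) cont_diff[OF cQ(1,2)], of "of_real (1/2)"] b.diff2[OF cP(2) cQ(1,2)] by (simp add: mult.commute[of 2])
      finally have "norm (\<theta> (tn f g)) \<le> norm (2 * b ?R g) + norm (2 * b ?P ?R')"
        by (simp only: norm_triangle_ineq)
      also have "\<dots> = 2 * norm (b ?R g) + 2 * norm (b ?P ?R')" unfolding norm_mult by simp
      also have "norm (b ?R g) \<le> e" by (rule order_trans[OF bN[OF cP(3) cQ(1)] S(3)[OF P(2) g P(3)]])
      also have "norm (b ?P ?R') \<le> e" by (rule order_trans[OF bN[OF cP(2) cQ(3)] S'(3)[OF P(1) Q(2) Q(3)]])
      finally show ?thesis by simp
    qed
    have tens_le: "norm (\<theta> (tens x y)) \<le> 4 * e * (vs_norm (C_space K1) x * vs_norm (C_space K2) y)"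
      if x: "x \<in> vs_carrier (C_space K1)" and y: "y \<in> vs_carrier (C_space K2)" for x y
    proof (cases "vs_norm (C_space K1) x = 0 \<or> vs_norm (C_space K2) y = 0")
      case True
      \<comment> \<open>A factor of norm zero cannot be normalised; the crude bound for \<theta>
        already gives zero here.\<close>
      have "norm (\<theta> (tens x y)) \<le> L * vs_norm E (tens x y)" using L(2) tens_closed[OF x y] by blast
      also have "\<dots> \<le> L * (vs_norm (C_space K1) x * vs_norm (C_space K2) y)"
        using L(1) by (intro mult_left_mono norm_tens_le x y) simp
      finally show ?thesis using True by auto
    next
      case False
      define a where "a = vs_norm (C_space K1) x"
      define c where "c = vs_norm (C_space K2) y"
      have ac: "a > 0" "c > 0" using False V.norm_nonneg[OF x] W.norm_nonneg[OF y] by (auto simp: a_def c_def)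
      define f where "f = (\<lambda>s. of_real (1 / a) * x s)"
      define g where "g = (\<lambda>s. of_real (1 / c) * y s)"
      have cx: "cont K1 x" "cont K2 y" using x y by (auto simp: K1.C_carrier K2.C_carrier)
      have f: "K1.in_ball f" unfolding K1.in_ball_def f_def
      proof (intro conjI ballI cont_mult cont_const cx)
        fix s assume "s \<in> topspace K1"
        then have "norm (x s) \<le> a" using K1.C_norm_ge[OF cx(1)] by (simp add: a_def)
        then show "norm (of_real (1 / a) * x s) \<le> 1" using ac by (simp add: norm_mult norm_divide)
      qed
      have g: "K2.in_ball g" unfolding K2.in_ball_def g_def
      proof (intro conjI ballI cont_mult cont_const cx)
        fix s assume "s \<in> topspace K2"
        then have "norm (y s) \<le> c" using K2.C_norm_ge[OF cx(2)] by (simp add: c_def)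
        then show "norm (of_real (1 / c) * y s) \<le> 1" using ac by (simp add: norm_mult norm_divide)
      qed
      have cf: "cont K1 f" "cont K2 g" using f g by (auto simp: K1.in_ball_def K2.in_ball_def)
      have "tens x y = tn (\<lambda>s. of_real a * f s) (\<lambda>s. of_real c * g s)"
        using ac x y by (simp add: tn_def f_def g_def K1.rs_id K2.rs_id)
      also have "\<dots> = vs_scale E (of_real a) (vs_scale E (of_real c) (tn f g))"
        using cf by (simp add: tn_scale1 tn_scale2 cont_mult)
      finally have "\<theta> (tens x y) = of_real a * (of_real c * \<theta> (tn f g))"
        using cf by (simp add: dual_scale[OF \<theta>] tn_closed E.scale_closed)
      then have "norm (\<theta> (tens x y)) = a * (c * norm (\<theta> (tn f g)))" using ac by (simp add: norm_mult)
      also have "\<dots> \<le> a * (c * (4 * e))" using ac ball[OF f g] by (intro mult_left_mono) auto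
      finally show ?thesis by (simp add: a_def c_def mult_ac)
    qed
    have "norm (\<theta> z) \<le> 4 * e * vs_norm E z"
    proof (rule seminorm_bound[where M = L])
      show "norm (\<theta> (vs_add E z w)) \<le> norm (\<theta> z) + norm (\<theta> w)" if "z \<in> vs_carrier E" "w \<in> vs_carrier E" for z w
        using norm_triangle_ineq by (simp add: dual_add[OF \<theta> that])
    qed (use e z tens_le L in auto)
    moreover have "norm (\<Sum>i\<in>?I. b (u (fst i)) (v (snd i)) * \<Phi> i z) \<le> (\<Sum>i\<in>?I. C * norm (\<Phi> i z))"
    proof (rule sum_norm_le)
      fix i assume i: "i \<in> ?I"
      have "norm (b (u (fst i)) (v (snd i))) \<le> ?N (u (fst i)) (v (snd i))"
        using i by (intro bN cu cv) auto
      also have "\<dots> \<le> C" by (rule N_uv(2)[OF i])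
      finally show "norm (b (u (fst i)) (v (snd i)) * \<Phi> i z) \<le> C * norm (\<Phi> i z)"
        by (simp add: norm_mult mult_right_mono)
    qed
    moreover have "norm (h (T z)) \<le> norm (\<theta> z) + norm (\<Sum>i\<in>?I. b (u (fst i)) (v (snd i)) * \<Phi> i z)"
      using norm_triangle_ineq[of "\<theta> z" "\<Sum>i\<in>?I. b (u (fst i)) (v (snd i)) * \<Phi> i z"] by (simp add: \<theta>_def)
    ultimately show ?thesis using h(3) by (simp add: sum_distrib_left)
  qed
  then show ?thesis using fin \<Phi>(1) by blast
qed

theorem scattered_imp_completely_continuous:
  fixes W :: "('k, 'w) nspace"
  assumes s1: "scattered_space K1" and s2: "scattered_space K2"
    and W: "normed_space W" and T: "weakly_compact_operator E W T"
  shows "completely_continuous_operator E W T"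
  unfolding completely_continuous_operator_def
proof (intro conjI allI impI)
  interpret E: normed_space E by (rule normed_space_E)
  interpret W': normed_space W by (rule W)
  show Top: "T \<in> operators E W" using T by (simp add: weakly_compact_operator_def)
  fix s assume "range s \<subseteq> vs_carrier E \<and> (\<exists>l. limitin (weak_topology E) s l sequentially)"
  then obtain l where s: "\<And>n. s n \<in> vs_carrier E" and "limitin (weak_topology E) s l sequentially" by blast
  then have l: "l \<in> vs_carrier E" "\<And>\<phi>. \<phi> \<in> dual E \<Longrightarrow> (\<lambda>n. \<phi> (s n)) \<longlonglongrightarrow> \<phi> l"
    using limitin_weak_iff[OF normed_space_E, of s l sequentially] by auto
  define w where "w n = vs_diff E (s n) l" for n
  have w: "w n \<in> vs_carrier E" for n using s l by (simp add: w_def E.closed)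
  have w_null: "(\<lambda>n. \<phi> (w n)) \<longlonglongrightarrow> 0" if "\<phi> \<in> dual E" for \<phi>
    using LIM_zero[OF l(2)[OF that]] by (simp add: w_def dual_diff[OF normed_space_E that s l(1)])
  \<comment> \<open>The estimate for T contains the norm of w n with a small coefficient, so a
    uniform bound on these norms has to be extracted from weak convergence.\<close>
  have "\<exists>B. \<forall>n. vs_norm E (w n) \<le> B"
  proof (rule weakly_bounded_imp_bounded[OF normed_space_E w])
    fix \<phi> assume "\<phi> \<in> dual E"
    from convergent_imp_bounded[OF w_null[OF this]] show "\<exists>C. \<forall>n. norm (\<phi> (w n)) \<le> C"
      by (auto simp: bounded_iff)
  qed
  then obtain B where B: "\<And>n. vs_norm E (w n) \<le> B" by blast
  have B0: "B \<ge> 0" using B[of 0] E.norm_nonneg[OF w[of 0]] by simp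
  have "(\<lambda>n. vs_norm W (T (w n))) \<longlonglongrightarrow> 0"
  proof (rule LIMSEQ_I)
    fix r :: real assume r: "r > 0"
    define e where "e = r / (8 * (B + 1))"
    have e: "e > 0" "4 * e * B \<le> r / 2" using r B0 by (auto simp: e_def field_simps)
    obtain I :: "('a \<times> 'b) set" and \<Phi> C where I: "finite I" "\<forall>i\<in>I. \<Phi> i \<in> dual E"
      "\<forall>z\<in>vs_carrier E. vs_norm W (T z) \<le> 4 * e * vs_norm E z + C * (\<Sum>i\<in>I. norm (\<Phi> i z))"
      using weakly_compact_estimate[OF s1 s2 W T e(1)] by blast
    have "(\<lambda>n. C * (\<Sum>i\<in>I. norm (\<Phi> i (w n)))) \<longlonglongrightarrow> C * (\<Sum>i\<in>I. 0)"
      using I(2) by (intro tendsto_mult_left tendsto_sum tendsto_norm_zero w_null) auto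
    then obtain n0 where n0: "\<And>n. n \<ge> n0 \<Longrightarrow> \<bar>C * (\<Sum>i\<in>I. norm (\<Phi> i (w n)))\<bar> < r / 2"
      using LIMSEQ_D[of _ 0 "r / 2"] r by fastforce
    have "vs_norm W (T (w n)) < r" if n: "n \<ge> n0" for n
    proof -
      have "vs_norm W (T (w n)) \<le> 4 * e * vs_norm E (w n) + C * (\<Sum>i\<in>I. norm (\<Phi> i (w n)))" using I(3) w by blast
      moreover have "4 * e * vs_norm E (w n) \<le> 4 * e * B" using B e by (intro mult_left_mono) auto
      ultimately show ?thesis using n0[OF n] e(2) by linarith
    qed
    then show "\<exists>n0. \<forall>n\<ge>n0. norm (vs_norm W (T (w n)) - 0) < r"
      using W'.norm_nonneg[OF operators_simps(1)[OF Top w]] by (intro exI[of _ n0]) auto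
  qed
  then have "(\<lambda>n. vs_norm W (vs_diff W (T (s n)) (T l))) \<longlonglongrightarrow> 0"
    by (simp add: w_def operators_diff[OF Top normed_space_E s l(1)])
  then have "limitin (norm_topology W) (T \<circ> s) (T l) sequentially"
    using operators_simps(1)[OF Top s] operators_simps(1)[OF Top l(1)]
    by (subst W'.limitin_norm) (auto simp: o_def)
  then show "\<exists>m. limitin (norm_topology W) (T \<circ> s) m sequentially" by blast
qed

end

section \<open>Weak compactness in the Hilbert sequence space\<close>

lemma openin_weak:
  assumes "\<phi> \<in> dual V" "open G"
  shows "openin (weak_topology V) {x \<in> vs_carrier V. \<phi> x \<in> G}"
  unfolding weak_topology_def by (rule topology_generated_by_Basis) (use assms in auto)

lemma Hausdorff_weak:
  fixes V :: "('k::{real_normed_field, euclidean_space}, 'e) nspace"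
  assumes V: "normed_space V"
  shows "Hausdorff_space (weak_topology V)"
  unfolding Hausdorff_space_def topspace_weak[OF V]
proof (intro allI impI)
  interpret normed_space V by fact
  fix x y assume xy: "x \<in> vs_carrier V \<and> y \<in> vs_carrier V \<and> x \<noteq> y"
  then have d: "vs_diff V x y \<in> vs_carrier V" "vs_diff V x y \<noteq> vs_zero V" by (auto simp: closed diff_eq_zero)
  have "\<exists>\<phi>\<in>dual V. norm (\<phi> (vs_diff V x y)) = vs_norm V (vs_diff V x y)"
    by (rule norming_functional[OF V d(1)]) blast
  then obtain \<phi> where \<phi>: "\<phi> \<in> dual V" "norm (\<phi> (vs_diff V x y)) = vs_norm V (vs_diff V x y)" by blast
  have "vs_norm V (vs_diff V x y) \<noteq> 0" using d norm_eq_zero by simp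
  then have "norm (\<phi> x - \<phi> y) \<noteq> 0" using \<phi>(2) dual_diff[OF V \<phi>(1), of x y] xy by simp
  then have "\<phi> x \<noteq> \<phi> y" by simp
  then obtain U U' where U: "open U" "open U'" "\<phi> x \<in> U" "\<phi> y \<in> U'" "U \<inter> U' = {}"
    by (metis hausdorff)
  note o = openin_weak[OF \<phi>(1)]
  show "\<exists>U V'. openin (weak_topology V) U \<and> openin (weak_topology V) V' \<and> x \<in> U \<and> y \<in> V' \<and> disjnt U V'"
    by (rule exI[of _ "{x \<in> vs_carrier V. \<phi> x \<in> U}"], rule exI[of _ "{x \<in> vs_carrier V. \<phi> x \<in> U'}"])
      (use o U xy in \<open>auto simp: disjnt_def\<close>)
qed

text \<open>The weak topology is Hausdorff, so a compact set containing the image is closed and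
  contains the closure of the image as well.\<close>

lemma weakly_compact_operatorI:
  fixes W :: "('k::{real_normed_field, euclidean_space}, 'w) nspace"
  assumes W: "normed_space W" and T: "T \<in> operators V W"
    and D: "\<And>B. norm_bounded V B \<Longrightarrow> \<exists>D. compactin (weak_topology W) D \<and> T ` B \<subseteq> D"
  shows "weakly_compact_operator V W T"
  unfolding weakly_compact_operator_def
proof (intro conjI allI impI T)
  fix B assume "norm_bounded V B"
  then obtain D where D: "compactin (weak_topology W) D" "T ` B \<subseteq> D" using D by blast
  have "closedin (weak_topology W) D" by (rule compactin_imp_closedin[OF Hausdorff_weak[OF W] D(1)])
  then have sub: "weak_topology W closure_of (T ` B) \<subseteq> D" by (rule closure_of_minimal[OF D(2)])
  show "compactin (weak_topology W) (weak_topology W closure_of (T ` B))"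
    by (rule closed_compactin[OF D(1) sub closedin_closure_of])
qed

lemma operators_weak_continuous:
  assumes V: "normed_space V" and W: "normed_space W" and T: "T \<in> operators V W"
  shows "continuous_map (weak_topology V) (weak_topology W) T"
  unfolding weak_topology_def[of W]
proof (rule continuous_on_generated_topo)
  fix U assume "U \<in> {{x \<in> vs_carrier W. \<phi> x \<in> U} |\<phi> U. \<phi> \<in> dual W \<and> open U}"
  then obtain \<phi> G where G: "\<phi> \<in> dual W" "open G" "U = {x \<in> vs_carrier W. \<phi> x \<in> G}" by blast
  have TW: "T x \<in> vs_carrier W" if "x \<in> vs_carrier V" for x
    by (rule operators_simps(1)[OF T that])
  have top: "topspace (weak_topology V) = vs_carrier V" by (rule topspace_weak[OF V])
  have "T -` U \<inter> topspace (weak_topology V) = {x \<in> vs_carrier V. \<phi> (T x) \<in> G}"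
    unfolding top using TW G(3) by auto
  moreover have "openin (weak_topology V) {x \<in> vs_carrier V. \<phi> (T x) \<in> G}"
    by (rule openin_weak[OF dual_comp[OF V W T G(1)] G(2)])
  ultimately show "openin (weak_topology V) (T -` U \<inter> topspace (weak_topology V))" by simp
next
  have "T ` topspace (weak_topology V) \<subseteq> topspace (weak_topology W)"
    unfolding topspace_weak[OF V] topspace_weak[OF W] using operators_simps(1)[OF T] by blast
  then show "T ` topspace (weak_topology V) \<subseteq> \<Union> {{x \<in> vs_carrier W. \<phi> x \<in> U} |\<phi> U. \<phi> \<in> dual W \<and> open U}"
    by (simp add: weak_topology_def)
qed

section \<open>The Hilbert sequence space l2 and its dual\<close>

definition l2n :: "nat \<Rightarrow> (nat \<Rightarrow> 'k::real_normed_field) \<Rightarrow> real" where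
  "l2n N a = L2_set (\<lambda>n. norm (a n)) {..<N}"

text \<open>Membership and norm are expressed through finite sections. Each section is a continuous
  function of finitely many coordinates, so limits and closedness need no manipulation of infinite
  series.\<close>

definition l2 :: "('k::real_normed_field, nat \<Rightarrow> 'k) nspace" where
  "l2 = \<lparr>vs_carrier = {a. \<exists>C. \<forall>N. l2n N a \<le> C}, vs_add = (\<lambda>a b n. a n + b n), vs_zero = (\<lambda>_. 0),
    vs_scale = (\<lambda>c a n. c * a n), vs_norm = (\<lambda>a. SUP N. l2n N a)\<rparr>"

lemma l2_simps [simp]:
  "vs_add l2 a b = (\<lambda>n. a n + b n)" "vs_zero l2 = (\<lambda>_. 0)" "vs_scale l2 c a = (\<lambda>n. c * a n)"
  "vs_diff l2 a b = (\<lambda>n. a n - b n)"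
  by (simp_all add: l2_def vs_diff_def)

lemma l2_carrier: "a \<in> vs_carrier l2 \<longleftrightarrow> (\<exists>C. \<forall>N. l2n N a \<le> C)"
  by (simp add: l2_def)

lemma l2n_nonneg: "0 \<le> l2n N a"
  by (simp add: l2n_def)

lemma l2n_le_norm: "a \<in> vs_carrier l2 \<Longrightarrow> l2n N a \<le> vs_norm l2 a"
  unfolding l2_def by (auto intro!: cSUP_upper bdd_aboveI2)

lemma l2_norm_le: "(\<And>N. l2n N a \<le> C) \<Longrightarrow> vs_norm l2 a \<le> C"
  unfolding l2_def by (auto intro!: cSUP_least)

lemma l2_coord: "a \<in> vs_carrier l2 \<Longrightarrow> norm (a n) \<le> vs_norm l2 a"
  using member_le_L2_set[of "{..<Suc n}" n "\<lambda>n. norm (a n)"] l2n_le_norm[of a "Suc n"] by (simp add: l2n_def)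

lemma l2n_add: "l2n N (\<lambda>n. a n + b n) \<le> l2n N a + l2n N b"
proof -
  have "l2n N (\<lambda>n. a n + b n) \<le> L2_set (\<lambda>n. norm (a n) + norm (b n)) {..<N}"
    unfolding l2n_def by (rule L2_set_mono) (auto simp: norm_triangle_ineq)
  also have "\<dots> \<le> l2n N a + l2n N b" unfolding l2n_def by (rule L2_set_triangle_ineq)
  finally show ?thesis .
qed

lemma l2n_scale: "l2n N (\<lambda>n. c * a n) = norm c * l2n N a"
  unfolding l2n_def by (simp add: norm_mult L2_set_right_distrib)

lemma normed_space_l2: "normed_space (l2 :: ('k::real_normed_field, nat \<Rightarrow> 'k) nspace)"
proof
  let ?V = "l2 :: ('k, nat \<Rightarrow> 'k) nspace"
  have zero: "l2n N (\<lambda>_. 0 :: 'k) = 0" for N by (simp add: l2n_def L2_set_def)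
  show "vs_zero ?V \<in> vs_carrier ?V" by (auto simp: l2_carrier zero)
  show "vs_add ?V a b \<in> vs_carrier ?V" if "a \<in> vs_carrier ?V" "b \<in> vs_carrier ?V" for a b
    unfolding l2_carrier
    using order_trans[OF l2n_add add_mono[OF l2n_le_norm[OF that(1)] l2n_le_norm[OF that(2)]]] by auto
  show "vs_scale ?V c a \<in> vs_carrier ?V" if "a \<in> vs_carrier ?V" for a c
    unfolding l2_carrier using mult_left_mono[OF l2n_le_norm[OF that] norm_ge_zero[of c]] by (auto simp: l2n_scale)
  show nonneg: "0 \<le> vs_norm ?V a" if "a \<in> vs_carrier ?V" for a
    using l2n_le_norm[OF that, of 0] l2n_nonneg[of 0 a] by simp
  show "vs_norm ?V a = 0 \<longleftrightarrow> a = vs_zero ?V" if a: "a \<in> vs_carrier ?V" for a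
  proof
    show "a = vs_zero ?V" if "vs_norm ?V a = 0"
      using l2_coord[OF a] that by (auto simp: fun_eq_iff)
    assume "a = vs_zero ?V"
    then have "vs_norm ?V a \<le> 0" by (intro l2_norm_le) (simp add: zero)
    then show "vs_norm ?V a = 0" using nonneg[OF a] by simp
  qed
  show "vs_norm ?V (vs_scale ?V c a) = norm c * vs_norm ?V a" if a: "a \<in> vs_carrier ?V" for a c
  proof -
    have le: "vs_norm ?V (vs_scale ?V c b) \<le> norm c * vs_norm ?V b" if "b \<in> vs_carrier ?V" for b c
      by (rule l2_norm_le) (simp add: l2n_scale mult_left_mono l2n_le_norm that)
    show ?thesis
    proof (cases "c = 0")
      case True
      have "vs_norm ?V (\<lambda>_. 0) \<le> 0" by (rule l2_norm_le) (simp add: zero)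
      moreover have "0 \<le> vs_norm ?V (\<lambda>_. 0)" by (rule nonneg) (auto simp: l2_carrier zero)
      ultimately show ?thesis using True by simp
    next
      case False
      have "vs_scale ?V c a \<in> vs_carrier ?V"
        unfolding l2_carrier using mult_left_mono[OF l2n_le_norm[OF a] norm_ge_zero[of c]] by (auto simp: l2n_scale)
      from le[OF this, of "1 / c"] have "vs_norm ?V a \<le> norm (1 / c) * vs_norm ?V (vs_scale ?V c a)"
        using False by simp
      then have "norm c * vs_norm ?V a \<le> vs_norm ?V (vs_scale ?V c a)"
        using False by (simp add: norm_divide field_simps)
      then show ?thesis using le[OF a, of c] by simp
    qed
  qed
  show "vs_norm ?V (vs_add ?V a b) \<le> vs_norm ?V a + vs_norm ?V b" if "a \<in> vs_carrier ?V" "b \<in> vs_carrier ?V" for a b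
    by (rule l2_norm_le) (use order_trans[OF l2n_add add_mono[OF l2n_le_norm[OF that(1)] l2n_le_norm[OF that(2)]]] in simp)
qed (auto simp: fun_eq_iff algebra_simps)

lemma tendsto_l2n:
  assumes "\<And>n. (\<lambda>i. s i n) \<longlonglongrightarrow> a n"
  shows "(\<lambda>i. l2n N (s i)) \<longlonglongrightarrow> l2n N a"
  unfolding l2n_def L2_set_def by (intro tendsto_intros assms)

lemma banach_space_l2: "banach_space (l2 :: ('k::{real_normed_field, banach}, nat \<Rightarrow> 'k) nspace)"
  unfolding banach_space_def normed_space.mcomplete_iff[OF normed_space_l2]
proof (intro conjI normed_space_l2 allI impI)
  interpret normed_space "l2 :: ('k, nat \<Rightarrow> 'k) nspace" by (rule normed_space_l2)
  let ?V = "l2 :: ('k, nat \<Rightarrow> 'k) nspace"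
  fix s :: "nat \<Rightarrow> nat \<Rightarrow> 'k"
  assume "range s \<subseteq> vs_carrier l2 \<and> (\<forall>e>0. \<exists>N. \<forall>m\<ge>N. \<forall>n\<ge>N. vs_norm l2 (vs_diff l2 (s m) (s n)) < e)"
  then have s: "s n \<in> vs_carrier l2" and cauchy: "e > 0 \<Longrightarrow> \<exists>N. \<forall>m\<ge>N. \<forall>n\<ge>N. vs_norm l2 (vs_diff l2 (s m) (s n)) < e" for n e
    by auto
  have d: "vs_diff l2 (s m) (s n) \<in> vs_carrier l2" for m n by (intro diff_closed s)
  have "Cauchy (\<lambda>i. s i k)" for k
    unfolding Cauchy_iff
  proof (intro allI impI)
    fix e :: real assume "e > 0"
    from cauchy[OF this] obtain N where N: "\<forall>m\<ge>N. \<forall>n\<ge>N. vs_norm ?V (vs_diff l2 (s m) (s n)) < e" by blast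
    have "norm (s m k - s n k) < e" if "m \<ge> N" "n \<ge> N" for m n
      using l2_coord[OF d, of m n k] N that by fastforce
    then show "\<exists>M. \<forall>m\<ge>M. \<forall>n\<ge>M. norm (s m k - s n k) < e" by blast
  qed
  then have "\<forall>k. \<exists>l. (\<lambda>i. s i k) \<longlonglongrightarrow> l" using Cauchy_convergent_iff convergent_def by blast
  then obtain a where a: "\<And>k. (\<lambda>i. s i k) \<longlonglongrightarrow> a k" by metis
  have close: "\<exists>N. \<forall>m\<ge>N. \<forall>k. l2n k (\<lambda>n. s m n - a n) \<le> e" if e: "e > 0" for e
  proof -
    obtain N where N: "\<forall>m\<ge>N. \<forall>n\<ge>N. vs_norm ?V (vs_diff l2 (s m) (s n)) < e" using cauchy[OF e] by blast
    have "l2n k (\<lambda>n. s m n - a n) \<le> e" if m: "m \<ge> N" for m k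
    proof (rule LIMSEQ_le_const2)
      show "(\<lambda>j. l2n k (\<lambda>n. s m n - s j n)) \<longlonglongrightarrow> l2n k (\<lambda>n. s m n - a n)"
        by (intro tendsto_l2n tendsto_diff tendsto_const a)
      have "l2n k (\<lambda>n. s m n - s j n) \<le> e" if "j \<ge> N" for j
        using l2n_le_norm[OF d, of k m j] N m that by fastforce
      then show "\<exists>N. \<forall>j\<ge>N. l2n k (\<lambda>n. s m n - s j n) \<le> e" by blast
    qed
    then show ?thesis by blast
  qed
  have a_in: "a \<in> vs_carrier ?V"
  proof -
    obtain N where N: "\<forall>m\<ge>N. \<forall>k. l2n k (\<lambda>n. s m n - a n) \<le> 1" using close[of 1] by auto
    have "(\<lambda>n. s N n - a n) \<in> vs_carrier ?V" unfolding l2_carrier using N by blast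
    from diff_closed[OF s[of N] this] show ?thesis by simp
  qed
  have "(\<lambda>n. vs_norm ?V (vs_diff l2 (s n) a)) \<longlonglongrightarrow> 0"
  proof (rule LIMSEQ_I)
    fix e :: real assume "e > 0"
    then obtain N where N: "\<forall>m\<ge>N. \<forall>k. l2n k (\<lambda>n. s m n - a n) \<le> e / 2" using close[of "e / 2"] by auto
    have "vs_norm ?V (vs_diff l2 (s m) a) < e" if "m \<ge> N" for m
    proof -
      have "vs_norm ?V (vs_diff l2 (s m) a) \<le> e / 2" by (rule l2_norm_le) (use N that in simp)
      then show ?thesis using \<open>e > 0\<close> by simp
    qed
    then show "\<exists>n0. \<forall>n\<ge>n0. norm (vs_norm ?V (vs_diff l2 (s n) a) - 0) < e"
      using norm_nonneg[OF diff_closed[OF s a_in]] by (intro exI[of _ N]) auto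
  qed
  then show "\<exists>l\<in>vs_carrier l2. (\<lambda>n. vs_norm l2 (vs_diff l2 (s n) l)) \<longlonglongrightarrow> 0" using a_in by blast
qed

definition cut :: "nat \<Rightarrow> (nat \<Rightarrow> 'k::real_normed_field) \<Rightarrow> nat \<Rightarrow> 'k" where
  "cut m a n = (if n < m then a n else 0)"

definition unit_seq :: "nat \<Rightarrow> nat \<Rightarrow> 'k::real_normed_field" where
  "unit_seq m n = (if n = m then 1 else 0)"

lemma l2n_cut_le: "l2n N (cut m a) \<le> l2n m a"
proof -
  have "l2n N (cut m a) = sqrt (\<Sum>n\<in>{..<N} \<inter> {..<m}. (norm (a n))\<^sup>2)"
    unfolding l2n_def L2_set_def by (rule arg_cong[where f = sqrt], rule sum.mono_neutral_cong_right) (auto simp: cut_def)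
  also have "\<dots> \<le> l2n m a"
    unfolding l2n_def L2_set_def by (intro real_sqrt_le_mono sum_mono2) auto
  finally show ?thesis .
qed

lemma cut_in_l2: "cut m a \<in> vs_carrier l2"
  unfolding l2_carrier using l2n_cut_le by blast

lemma unit_seq_in_l2: "unit_seq m \<in> vs_carrier l2"
proof -
  have "cut (Suc m) (unit_seq m) = unit_seq m" by (auto simp: fun_eq_iff cut_def unit_seq_def)
  then show ?thesis using cut_in_l2 by metis
qed

lemma dual_l2_cut:
  assumes \<phi>: "\<phi> \<in> dual l2"
  shows "\<phi> (cut m a) = (\<Sum>n<m. a n * \<phi> (unit_seq n))"
proof (induction m)
  case 0
  have "\<phi> (vs_scale l2 0 (cut 0 a)) = 0 * \<phi> (cut 0 a)" by (rule dual_scale[OF \<phi> cut_in_l2])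
  moreover have "vs_scale l2 0 (cut 0 a) = cut 0 a" by (simp add: cut_def[abs_def])
  ultimately show ?case by simp
next
  case (Suc m)
  have "cut (Suc m) a = vs_add l2 (cut m a) (vs_scale l2 (a m) (unit_seq m))"
    by (auto simp: cut_def unit_seq_def fun_eq_iff less_Suc_eq)
  then have "\<phi> (cut (Suc m) a) = \<phi> (cut m a) + \<phi> (vs_scale l2 (a m) (unit_seq m))"
    using dual_add[OF \<phi> cut_in_l2 normed_space.scale_closed[OF normed_space_l2 unit_seq_in_l2]] by metis
  then show ?case using Suc dual_scale[OF \<phi> unit_seq_in_l2, of "a m" m] by simp
qed

text \<open>Testing \<open>\<phi>\<close> on the sequence \<open>|c\<^sub>n|\<^sup>2 / c\<^sub>n\<close>, where \<open>c\<^sub>n = \<phi> (unit_seq n)\<close>, shows that \<open>c\<close> is in \<open>l2\<close>.\<close>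

lemma dual_l2_square_summable:
  assumes \<phi>: "\<phi> \<in> dual l2"
  shows "summable (\<lambda>n. (norm (\<phi> (unit_seq n)))\<^sup>2)"
proof -
  obtain D where D: "D > 0" "\<forall>x\<in>vs_carrier l2. norm (\<phi> x) \<le> D * vs_norm l2 x"
    using dual_bound[OF normed_space_l2 \<phi>] by blast
  define c where "c n = \<phi> (unit_seq n)" for n
  define a where "a n = (if c n = 0 then 0 else of_real ((norm (c n))\<^sup>2) / c n)" for n
  have a: "norm (a n) = norm (c n)" "a n * c n = of_real ((norm (c n))\<^sup>2)" for n
    by (auto simp: a_def norm_divide norm_mult power2_eq_square)
  have la: "l2n m a = l2n m c" for m by (simp add: l2n_def a)
  have "(\<Sum>n<m. (norm (c n))\<^sup>2) \<le> D\<^sup>2" for m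
  proof -
    have sq: "(\<Sum>n<m. (norm (c n))\<^sup>2) = (l2n m c)\<^sup>2"
      unfolding l2n_def L2_set_def by (simp add: sum_nonneg)
    have "\<phi> (cut m a) = of_real (\<Sum>n<m. (norm (c n))\<^sup>2)"
      unfolding dual_l2_cut[OF \<phi>] of_real_sum by (simp add: a(2) flip: c_def)
    then have "norm (\<phi> (cut m a)) = (l2n m c)\<^sup>2" unfolding sq by (simp add: norm_power)
    moreover have "norm (\<phi> (cut m a)) \<le> D * vs_norm l2 (cut m a)" using D(2) cut_in_l2 by blast
    moreover have "vs_norm l2 (cut m a) \<le> l2n m c" unfolding la[symmetric] by (rule l2_norm_le[OF l2n_cut_le])
    ultimately have "(l2n m c)\<^sup>2 \<le> D * l2n m c" using D(1) by (smt (verit) mult_left_mono)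
    then have "l2n m c \<le> D" using l2n_nonneg[of m c] D(1)
      by (cases "l2n m c = 0") (auto simp: power2_eq_square)
    then show ?thesis unfolding sq using l2n_nonneg by (intro power_mono)
  qed
  then have "\<And>n. (\<Sum>i\<le>n. (norm (c i))\<^sup>2) \<le> D\<^sup>2" by (metis lessThan_Suc_atMost)
  then show ?thesis unfolding c_def by (intro bounded_imp_summable) auto
qed

lemma l2_square_summable:
  assumes "a \<in> vs_carrier l2" shows "summable (\<lambda>n. (norm (a n))\<^sup>2)"
proof -
  have "(\<Sum>n<m. (norm (a n))\<^sup>2) \<le> (vs_norm l2 a)\<^sup>2" for m
  proof -
    have "(\<Sum>n<m. (norm (a n))\<^sup>2) = (l2n m a)\<^sup>2"
      unfolding l2n_def L2_set_def by (simp add: sum_nonneg)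
    then show ?thesis using power_mono[OF l2n_le_norm[OF assms, of m] l2n_nonneg, of 2] by simp
  qed
  then have "\<And>n. (\<Sum>i\<le>n. (norm (a i))\<^sup>2) \<le> (vs_norm l2 a)\<^sup>2" by (metis lessThan_Suc_atMost)
  then show ?thesis by (intro bounded_imp_summable) auto
qed

lemma tail_sum_le:
  fixes f :: "nat \<Rightarrow> real"
  assumes f: "summable f" "\<And>n. 0 \<le> f n"
  shows "sum f {m..<n} \<le> suminf f - sum f {..<m}"
proof (cases "m \<le> n")
  case True
  have "sum f {m..<n} = sum f {..<n} - sum f {..<m}"
    using sum_diff_nat_ivl[of 0 m n f] True by (simp add: atLeast0LessThan)
  also have "\<dots> \<le> suminf f - sum f {..<m}" using sum_le_suminf[OF f(1), of "{..<n}"] f(2) by simp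
  finally show ?thesis .
next
  case False
  then show ?thesis using sum_le_suminf[OF f(1), of "{..<m}"] f(2) by simp
qed

lemma tail_tendsto_zero:
  fixes f :: "nat \<Rightarrow> real"
  assumes "summable f"
  shows "(\<lambda>m. suminf f - sum f {..<m}) \<longlonglongrightarrow> 0"
  using tendsto_diff[OF tendsto_const summable_LIMSEQ[OF assms], of "suminf f"] by simp

lemma cut_tendsto:
  assumes a: "a \<in> vs_carrier l2" and \<phi>: "\<phi> \<in> dual l2"
  shows "(\<lambda>m. \<phi> (cut m a)) \<longlonglongrightarrow> \<phi> a"
proof -
  interpret normed_space l2 by (rule normed_space_l2)
  obtain D where D: "D > 0" "\<forall>x\<in>vs_carrier l2. norm (\<phi> x) \<le> D * vs_norm l2 x"
    using dual_bound[OF normed_space_l2 \<phi>] by blast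
  let ?f = "\<lambda>n. (norm (a n))\<^sup>2"
  note sm = l2_square_summable[OF a]
  let ?t = "\<lambda>m. suminf ?f - sum ?f {..<m}"
  have le: "norm (\<phi> (cut m a) - \<phi> a) \<le> D * sqrt (?t m)" for m
  proof -
    have d: "vs_diff l2 (cut m a) a \<in> vs_carrier l2" by (intro diff_closed cut_in_l2 a)
    have "l2n N (vs_diff l2 (cut m a) a) \<le> sqrt (?t m)" for N
    proof -
      have "l2n N (vs_diff l2 (cut m a) a) = sqrt (sum ?f {m..<N})"
        unfolding l2n_def L2_set_def
        by (rule arg_cong[where f = sqrt], rule sum.mono_neutral_cong_right) (auto simp: cut_def)
      also have "\<dots> \<le> sqrt (?t m)" by (intro real_sqrt_le_mono tail_sum_le sm) simp
      finally show ?thesis .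
    qed
    then have "vs_norm l2 (vs_diff l2 (cut m a) a) \<le> sqrt (?t m)" by (rule l2_norm_le)
    then have "D * vs_norm l2 (vs_diff l2 (cut m a) a) \<le> D * sqrt (?t m)" using D(1) by simp
    moreover have "norm (\<phi> (vs_diff l2 (cut m a) a)) \<le> D * vs_norm l2 (vs_diff l2 (cut m a) a)" using D(2) d by blast
    ultimately show ?thesis by (simp only: dual_diff[OF normed_space_l2 \<phi> cut_in_l2 a])
  qed
  have "(\<lambda>m. D * sqrt (?t m)) \<longlonglongrightarrow> D * sqrt 0"
    by (intro tendsto_mult_left tendsto_real_sqrt tail_tendsto_zero sm)
  then have "(\<lambda>m. D * sqrt (?t m)) \<longlonglongrightarrow> 0" by simp
  then have "(\<lambda>m. \<phi> (cut m a) - \<phi> a) \<longlonglongrightarrow> 0"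
    by (rule Lim_null_comparison[OF always_eventually, rotated]) (use le in blast)
  then show ?thesis by (rule LIM_zero_cancel)
qed

text \<open>By Cauchy-Schwarz on the tail the error is at most C times the l2 tail of the
  coefficients of \<phi>. It is uniform over the ball, which is the point.\<close>

lemma dual_l2_tail:
  assumes a: "a \<in> vs_carrier l2" "vs_norm l2 a \<le> C" and \<phi>: "\<phi> \<in> dual l2"
  shows "norm ((\<Sum>n<m. a n * \<phi> (unit_seq n)) - \<phi> a)
    \<le> C * sqrt (suminf (\<lambda>n. (norm (\<phi> (unit_seq n)))\<^sup>2) - (\<Sum>n<m. (norm (\<phi> (unit_seq n)))\<^sup>2))"
proof -
  let ?c = "\<lambda>n. \<phi> (unit_seq n)"
  let ?t = "suminf (\<lambda>n. (norm (?c n))\<^sup>2) - (\<Sum>n<m. (norm (?c n))\<^sup>2)"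
  have C: "C \<ge> 0" using a normed_space.norm_nonneg[OF normed_space_l2 a(1)] by simp
  have le: "norm ((\<Sum>n<m. a n * ?c n) - \<phi> (cut k a)) \<le> C * sqrt ?t" if k: "k \<ge> m" for k
  proof -
    have "\<phi> (cut k a) = (\<Sum>n<m. a n * ?c n) + (\<Sum>n\<in>{m..<k}. a n * ?c n)"
      unfolding dual_l2_cut[OF \<phi>] using sum.atLeastLessThan_concat[of 0 m k "\<lambda>n. a n * ?c n"] k
      by (simp add: atLeast0LessThan)
    then have "norm ((\<Sum>n<m. a n * ?c n) - \<phi> (cut k a)) = norm (\<Sum>n\<in>{m..<k}. a n * ?c n)"
      by (simp add: norm_minus_cancel)
    also have "\<dots> \<le> (\<Sum>n\<in>{m..<k}. norm (a n * ?c n))" by (rule norm_sum)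
    also have "\<dots> = (\<Sum>n\<in>{m..<k}. \<bar>norm (a n)\<bar> * \<bar>norm (?c n)\<bar>)"
      by (simp add: norm_mult)
    also have "\<dots> \<le> L2_set (\<lambda>n. norm (a n)) {m..<k} * L2_set (\<lambda>n. norm (?c n)) {m..<k}"
      by (rule L2_set_mult_ineq)
    also have "\<dots> \<le> C * sqrt ?t"
    proof (rule mult_mono)
      have "L2_set (\<lambda>n. norm (a n)) {m..<k} \<le> l2n k a"
        unfolding l2n_def L2_set_def by (intro real_sqrt_le_mono sum_mono2) auto
      also have "\<dots> \<le> C" using l2n_le_norm[OF a(1), of k] a(2) by simp
      finally show "L2_set (\<lambda>n. norm (a n)) {m..<k} \<le> C" .
      show "L2_set (\<lambda>n. norm (?c n)) {m..<k} \<le> sqrt ?t"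
        unfolding L2_set_def by (intro real_sqrt_le_mono tail_sum_le dual_l2_square_summable[OF \<phi>]) simp
    qed (use C in auto)
    finally show ?thesis .
  qed
  have "(\<lambda>k. norm ((\<Sum>n<m. a n * ?c n) - \<phi> (cut k a))) \<longlonglongrightarrow> norm ((\<Sum>n<m. a n * ?c n) - \<phi> a)"
    by (intro tendsto_norm tendsto_diff tendsto_const cut_tendsto a \<phi>)
  then show ?thesis by (rule LIMSEQ_le_const2) (use le in blast)
qed

text \<open>Coordinatewise, the ball is a closed subset of a product of compact balls, so
  Tychonoff's theorem applies. On the ball every functional is a uniform limit of finite coordinate
  sums, so the topology of coordinatewise convergence is at least as fine as the weak one
  there.\<close>

theorem l2_ball_weakly_compact:
  "compactin (weak_topology (l2 :: ('k::{real_normed_field, euclidean_space}, nat \<Rightarrow> 'k) nspace))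
    {a \<in> vs_carrier l2. vs_norm l2 a \<le> C}"
proof -
  let ?V = "l2 :: ('k, nat \<Rightarrow> 'k) nspace"
  define D where "D = {a \<in> vs_carrier ?V. vs_norm ?V a \<le> C}"
  have D_iff: "a \<in> D \<longleftrightarrow> (\<forall>N. l2n N a \<le> C)" for a
    unfolding D_def using l2_norm_le l2_carrier order_trans[OF l2n_le_norm] by blast
  have "compactin (product_topology (\<lambda>_. euclidean) UNIV) (PiE UNIV (\<lambda>_ :: nat. cball 0 C :: 'k set))"
    unfolding compactin_PiE by simp
  then have "compact (PiE UNIV (\<lambda>_ :: nat. cball 0 C :: 'k set))"
    by (simp add: euclidean_product_topology)
  moreover have "closed {a :: nat \<Rightarrow> 'k. l2n N a \<le> C}" for N
    unfolding l2n_def L2_set_def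
    by (intro closed_Collect_le continuous_intros continuous_on_product_coordinates)
  then have "closed (\<Inter>N. {a :: nat \<Rightarrow> 'k. l2n N a \<le> C})" by blast
  ultimately have "compact (PiE UNIV (\<lambda>_ :: nat. cball 0 C :: 'k set) \<inter> (\<Inter>N. {a. l2n N a \<le> C}))"
    by (rule compact_Int_closed)
  moreover have "PiE UNIV (\<lambda>_ :: nat. cball 0 C :: 'k set) \<inter> (\<Inter>N. {a. l2n N a \<le> C}) = D"
  proof (rule set_eqI)
    fix a :: "nat \<Rightarrow> 'k"
    have "norm (a n) \<le> C" if "\<forall>N. l2n N a \<le> C" for n
      using member_le_L2_set[of "{..<Suc n}" n "\<lambda>n. norm (a n)"] that[rule_format, of "Suc n"] by (simp add: l2n_def)
    then show "a \<in> PiE UNIV (\<lambda>_ :: nat. cball 0 C :: 'k set) \<inter> (\<Inter>N. {a. l2n N a \<le> C}) \<longleftrightarrow> a \<in> D"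
      unfolding D_iff by auto
  qed
  ultimately have cD: "compact D" by simp
  have cont: "continuous_on D \<phi>" if \<phi>: "\<phi> \<in> dual ?V" for \<phi>
  proof (rule uniform_limit_theorem[where F = sequentially])
    let ?S = "\<lambda>m (a :: nat \<Rightarrow> 'k). \<Sum>n<m. a n * \<phi> (unit_seq n)"
    show "\<forall>\<^sub>F m in sequentially. continuous_on D (?S m)"
      by (intro always_eventually allI continuous_intros continuous_on_subset[OF continuous_on_product_coordinates]) auto
    let ?t = "\<lambda>m. C * sqrt (suminf (\<lambda>n. (norm (\<phi> (unit_seq n)))\<^sup>2) - (\<Sum>n<m. (norm (\<phi> (unit_seq n)))\<^sup>2))"
    have "?t \<longlonglongrightarrow> C * sqrt 0"
      by (intro tendsto_mult_left tendsto_real_sqrt tail_tendsto_zero dual_l2_square_summable \<phi>)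
    then have lim: "?t \<longlonglongrightarrow> 0" by simp
    show "uniform_limit D ?S \<phi> sequentially"
    proof (rule uniform_limitI)
      fix e :: real assume "e > 0"
      then have "\<forall>\<^sub>F m in sequentially. ?t m < e" using order_tendstoD(2)[OF lim] by blast
      then show "\<forall>\<^sub>F m in sequentially. \<forall>a\<in>D. dist (?S m a) (\<phi> a) < e"
      proof (rule eventually_mono, intro ballI)
        fix m a assume "?t m < e" "a \<in> D"
        then show "dist (?S m a) (\<phi> a) < e"
          using dual_l2_tail[of a C \<phi> m] \<phi> by (simp add: D_def dist_norm)
      qed
    qed
  qed simp
  \<comment> \<open>The identity carries compactness from the product topology to the weak
    topology.\<close>
  have "continuous_map (top_of_set D) (weak_topology ?V) (\<lambda>a. a)"
    unfolding weak_topology_def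
  proof (rule continuous_on_generated_topo)
    fix U assume "U \<in> {{x \<in> vs_carrier ?V. \<phi> x \<in> U} |\<phi> U. \<phi> \<in> dual ?V \<and> open U}"
    then obtain \<phi> G where G: "\<phi> \<in> dual ?V" "open G" "U = {x \<in> vs_carrier ?V. \<phi> x \<in> G}" by blast
    have "(\<lambda>a. a) -` U \<inter> topspace (top_of_set D) = D \<inter> \<phi> -` G" unfolding G(3) by (auto simp: D_def)
    moreover have "openin (top_of_set D) (D \<inter> \<phi> -` G)"
      by (rule continuous_openin_preimage_gen[OF cont[OF G(1)] G(2)])
    ultimately show "openin (top_of_set D) ((\<lambda>a. a) -` U \<inter> topspace (top_of_set D))" by simp
  next
    show "(\<lambda>a. a) ` topspace (top_of_set D) \<subseteq> \<Union> {{x \<in> vs_carrier ?V. \<phi> x \<in> U} |\<phi> U. \<phi> \<in> dual ?V \<and> open U}"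
      using topspace_weak[OF normed_space_l2, where ?'a = 'k] unfolding weak_topology_def topology_generated_by_topspace
      by (simp add: D_def)
  qed
  then have "compactin (weak_topology ?V) ((\<lambda>a. a) ` D)"
    by (rule image_compactin[rotated]) (simp add: compactin_subtopology cD)
  then show ?thesis by (simp add: D_def)
qed

section \<open>A Riesz product estimate\<close>

context bilinear_form
begin

lemma swap: "bilinear_form K2 K1 (\<lambda>g f. b f g) M"
  by unfold_locales (auto simp: add1 add2 scale1 scale2 bound)

lemma bound_scaled:
  assumes f: "cont K1 f" "\<And>x. x \<in> topspace K1 \<Longrightarrow> norm (f x) \<le> R" and R: "R > 0" and g: "K2.in_ball g"
  shows "norm (b f g) \<le> M * R"
proof -
  have "K1.in_ball (\<lambda>x. of_real (1 / R) * f x)"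
    unfolding K1.in_ball_def
  proof (intro conjI ballI cont_mult cont_const f(1))
    show "norm (of_real (1 / R) * f x) \<le> 1" if "x \<in> topspace K1" for x
      using f(2)[OF that] R by (simp add: norm_mult norm_divide)
  qed
  from bound[OF this g] have "norm (b (\<lambda>x. of_real (1 / R) * f x) g) \<le> M" .
  moreover have "b (\<lambda>x. of_real (1 / R) * f x) g = of_real (1 / R) * b f g"
    by (rule scale1[OF f(1)]) (use g in \<open>simp add: K2.in_ball_def\<close>)
  ultimately have "norm (of_real (1 / R) * b f g) \<le> M" by (simp only:)
  then show ?thesis using R by (simp add: norm_mult norm_divide field_simps)
qed

text \<open>With \<open>P + iQ = \<Prod>\<^sub>l (1 \<plusminus> i a x\<^sub>l)\<close> and \<open>g = \<Sum>\<^sub>l \<plusminus> y\<^sub>l\<close>, averaging \<open>b Q g\<close> over all signs gives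
  \<open>a \<Sum>\<^sub>l b x\<^sub>l y\<^sub>l\<close>. The induction performs the averaging one sign at a time.\<close>

lemma Riesz_product:
  fixes x :: "nat \<Rightarrow> 'a \<Rightarrow> real" and y :: "nat \<Rightarrow> 'b \<Rightarrow> 'k"
  assumes x: "\<And>l. K1.in_ball (x l)"
    and y: "\<And>l. K2.in_ball (y l)" "\<And>l m t. l \<noteq> m \<Longrightarrow> t \<in> topspace K2 \<Longrightarrow> y l t = 0 \<or> y m t = 0"
    and P: "cont K1 P" and Q: "cont K1 Q" and R: "R > 0" "\<And>s. s \<in> topspace K1 \<Longrightarrow> (P s)\<^sup>2 + (Q s)\<^sup>2 \<le> R\<^sup>2"
    and g: "K2.in_ball g" "\<And>l t. l < n \<Longrightarrow> t \<in> topspace K2 \<Longrightarrow> g t = 0 \<or> y l t = 0"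
  shows "norm (b (\<lambda>s. of_real (Q s)) g + of_real a * (\<Sum>l<n. b (\<lambda>s. of_real (x l s * P s)) (y l)))
    \<le> M * (R * sqrt (1 + a\<^sup>2) ^ n)"
  using P Q R g
proof (induction n arbitrary: P Q R g)
  case 0
  have "norm (b (\<lambda>s. of_real (Q s)) g) \<le> M * R"
  proof (rule bound_scaled[OF cont_of_real[OF 0(2)] _ 0(3,5)])
    fix s assume "s \<in> topspace K1"
    then have "(Q s)\<^sup>2 \<le> R\<^sup>2" using 0(4)[of s] zero_le_power2[of "P s"] by linarith
    then show "norm (of_real (Q s) :: 'k) \<le> R" using 0(3) abs_le_square_iff[of "Q s" R] by simp
  qed
  then show ?case by simp
next
  case (Suc n)
  let ?q = "sqrt (1 + a\<^sup>2)"
  have cx: "cont K1 (x l)" and cy: "cont K2 (y l)" for l using x y by (auto simp: K1.in_ball_def K2.in_ball_def)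
  have cg: "cont K2 g" using Suc.prems(5) by (simp add: K2.in_ball_def)
  note cP = Suc.prems(1) and cQ = Suc.prems(2)
  note pm = in_ball_plus_minus2[OF Suc.prems(5) y(1)[of n] Suc.prems(6)[OF lessI]]
  \<comment> \<open>For a sign e the pair (P, Q) turns into the real and imaginary parts of (P + i
    Q) (1 + i e a x_n). The modulus grows by at most sqrt (1 + a^2). Writing out both parts keeps
    the argument inside an arbitrary scalar field.\<close>
  have IH: "norm (b (\<lambda>s. of_real (Q s + e * (a * (x n s * P s)))) h + of_real a * (\<Sum>l<n. b (\<lambda>s. of_real (x l s * (P s - e * (a * (x n s * Q s))))) (y l)))
      \<le> M * (R * ?q * ?q ^ n)" if e: "e\<^sup>2 = 1" and h: "K2.in_ball h" "\<And>l t. l < n \<Longrightarrow> t \<in> topspace K2 \<Longrightarrow> h t = 0 \<or> y l t = 0" for e h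
  proof (rule Suc.IH[OF _ _ _ _ h])
    show "cont K1 (\<lambda>s. P s - e * (a * (x n s * Q s)))" "cont K1 (\<lambda>s. Q s + e * (a * (x n s * P s)))"
      by (intro cont_intros cP cQ cx)+
    show "0 < R * ?q" using Suc.prems(3) by (simp add: add_pos_nonneg)
    fix s assume s: "s \<in> topspace K1"
    have "\<bar>x n s\<bar> \<le> 1" using x[of n] s by (simp add: K1.in_ball_def)
    then have "(x n s)\<^sup>2 \<le> 1" by (simp add: abs_square_le_1)
    then have xs: "a\<^sup>2 * (x n s)\<^sup>2 \<le> a\<^sup>2 * 1" by (intro mult_left_mono) auto
    have "(P s - e * (a * (x n s * Q s)))\<^sup>2 + (Q s + e * (a * (x n s * P s)))\<^sup>2
        = ((P s)\<^sup>2 + (Q s)\<^sup>2) * (1 + e\<^sup>2 * (a\<^sup>2 * (x n s)\<^sup>2))"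
      by (simp add: power2_eq_square algebra_simps)
    also have "\<dots> \<le> R\<^sup>2 * (1 + a\<^sup>2)"
      using Suc.prems(4)[OF s] xs by (intro mult_mono) (auto simp: e)
    also have "\<dots> = (R * ?q)\<^sup>2" by (simp add: power_mult_distrib)
    finally show "(P s - e * (a * (x n s * Q s)))\<^sup>2 + (Q s + e * (a * (x n s * P s)))\<^sup>2 \<le> (R * ?q)\<^sup>2" .
  qed
  define B where "B f h = b (\<lambda>s. of_real (f s)) h" for f :: "'a \<Rightarrow> real" and h
  have B_add1: "B (\<lambda>s. f s + f' s) h = B f h + B f' h" if "cont K1 f" "cont K1 f'" "cont K2 h" for f f' h
    using add1[OF cont_of_real[OF that(1)] cont_of_real[OF that(2)] that(3)] by (simp add: B_def)
  have B_diff1: "B (\<lambda>s. f s - f' s) h = B f h - B f' h" if "cont K1 f" "cont K1 f'" "cont K2 h" for f f' h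
    using diff1[OF cont_of_real[OF that(1)] cont_of_real[OF that(2)] that(3)] by (simp add: B_def)
  have B_scale1: "B (\<lambda>s. c * f s) h = of_real c * B f h" if "cont K1 f" "cont K2 h" for f c h
    using scale1[OF cont_of_real[OF that(1)] that(2), of "of_real c"] by (simp add: B_def)
  have B_add2: "B f (\<lambda>t. h t + h' t) = B f h + B f h'" "B f (\<lambda>t. h t - h' t) = B f h - B f h'"
    if "cont K1 f" "cont K2 h" "cont K2 h'" for f h h'
    using add2[OF cont_of_real[OF that(1)] that(2,3)] diff2[OF cont_of_real[OF that(1)] that(2,3)] by (simp_all add: B_def)
  let ?U = "\<lambda>s. a * (x n s * P s)" and ?V = "\<lambda>s. a * (x n s * Q s)"
  let ?p = "B (\<lambda>s. Q s + ?U s) (\<lambda>t. g t + y n t) + of_real a * (\<Sum>l<n. B (\<lambda>s. x l s * (P s - ?V s)) (y l))"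
  let ?m = "B (\<lambda>s. Q s - ?U s) (\<lambda>t. g t - y n t) + of_real a * (\<Sum>l<n. B (\<lambda>s. x l s * (P s + ?V s)) (y l))"
  have p: "norm ?p \<le> M * (R * ?q * ?q ^ n)"
  proof -
    have "g t + y n t = 0 \<or> y l t = 0" if "l < n" "t \<in> topspace K2" for l t
      using Suc.prems(6)[of l t] y(2)[of n l t] that by auto
    from IH[of 1, OF _ pm(1) this] show ?thesis by (simp add: B_def)
  qed
  have m: "norm ?m \<le> M * (R * ?q * ?q ^ n)"
  proof -
    have "g t - y n t = 0 \<or> y l t = 0" if "l < n" "t \<in> topspace K2" for l t
      using Suc.prems(6)[of l t] y(2)[of n l t] that by auto
    from IH[of "-1", OF _ pm(2) this] show ?thesis by (simp add: B_def)
  qed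
  have cU: "cont K1 ?U" "cont K1 ?V" by (intro cont_intros cx cP cQ)+
  \<comment> \<open>The sign is used twice, in front of x_n and of y_n. Averaging therefore keeps
    the product of the two increments and cancels the terms in which the sign occurs once.\<close>
  have s1: "B (\<lambda>s. Q s + ?U s) (\<lambda>t. g t + y n t) + B (\<lambda>s. Q s - ?U s) (\<lambda>t. g t - y n t) = 2 * (B Q g + B ?U (y n))"
  proof -
    have ring: "(p + q + (r + t)) + ((p - q) - (r - t)) = 2 * (p + t)" for p q r t :: 'k by (simp add: algebra_simps)
    show ?thesis
      unfolding B_add1[OF cQ cU(1) cont_add[OF cg cy]] B_diff1[OF cQ cU(1) cont_diff[OF cg cy]]
        B_add2[OF cQ cg cy] B_add2[OF cU(1) cg cy] by (rule ring)
  qed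
  have s2: "B (\<lambda>s. x l s * (P s - ?V s)) (y l) + B (\<lambda>s. x l s * (P s + ?V s)) (y l) = 2 * B (\<lambda>s. x l s * P s) (y l)" for l
    unfolding distrib_left[of "x l _"] right_diff_distrib[of "x l _"] B_add1[OF cont_mult[OF cx cP] cont_mult[OF cx cU(2)] cy]
      B_diff1[OF cont_mult[OF cx cP] cont_mult[OF cx cU(2)] cy] by simp
  have "?p + ?m = (B (\<lambda>s. Q s + ?U s) (\<lambda>t. g t + y n t) + B (\<lambda>s. Q s - ?U s) (\<lambda>t. g t - y n t))
      + of_real a * (\<Sum>l<n. B (\<lambda>s. x l s * (P s - ?V s)) (y l) + B (\<lambda>s. x l s * (P s + ?V s)) (y l))"
    by (simp only: sum.distrib distrib_left add_ac)
  also have "\<dots> = 2 * (B Q g + B ?U (y n)) + of_real a * (\<Sum>l<n. 2 * B (\<lambda>s. x l s * P s) (y l))"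
    unfolding s1 s2 ..
  also have "\<dots> = 2 * (B Q g + of_real a * (\<Sum>l<Suc n. B (\<lambda>s. x l s * P s) (y l)))"
  proof -
    have ring: "2 * (p + r * q) + r * (2 * t) = 2 * (p + r * (t + q))" for p q r t :: 'k by (simp add: algebra_simps)
    show ?thesis
      unfolding B_scale1[OF cont_mult[OF cx cP] cy] sum.lessThan_Suc sum_distrib_left[symmetric] by (rule ring)
  qed
  finally have "2 * (B Q g + of_real a * (\<Sum>l<Suc n. B (\<lambda>s. x l s * P s) (y l))) = ?p + ?m" ..
  then have "norm (2 * (B Q g + of_real a * (\<Sum>l<Suc n. B (\<lambda>s. x l s * P s) (y l)))) \<le> M * (R * ?q * ?q ^ n) + M * (R * ?q * ?q ^ n)"
    using norm_triangle_mono[OF p m] by (simp only:)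
  then have "norm (B Q g + of_real a * (\<Sum>l<Suc n. B (\<lambda>s. x l s * P s) (y l))) \<le> M * (R * ?q * ?q ^ n)"
    unfolding norm_mult by simp
  then show ?case by (simp add: B_def mult.assoc)
qed

text \<open>The Riesz product is started at P = 1, Q = 0 and g = 0, after phases have been absorbed
  into the y_l. The choice a = 1 / sqrt n keeps the growth (1 + 1/n)^(n/2) below sqrt (exp 1) \<le>
  2, and dividing by a leaves the factor sqrt n.\<close>

lemma diagonal_sqrt_bound:
  fixes x :: "nat \<Rightarrow> 'a \<Rightarrow> real" and y :: "nat \<Rightarrow> 'b \<Rightarrow> 'k"
  assumes x: "\<And>l. K1.in_ball (x l)"
    and y: "\<And>l. K2.in_ball (y l)" "\<And>l m t. l \<noteq> m \<Longrightarrow> t \<in> topspace K2 \<Longrightarrow> y l t = 0 \<or> y m t = 0"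
    and n: "n > 0"
  shows "(\<Sum>l<n. norm (b (\<lambda>s. of_real (x l s)) (y l))) \<le> 2 * M * sqrt n"
proof -
  define B where "B l = b (\<lambda>s. of_real (x l s)) (y l)" for l
  define c where "c l = (if B l = 0 then 0 else of_real (norm (B l)) / B l)" for l
  have c: "norm (c l) \<le> 1" "c l * B l = of_real (norm (B l))" for l by (auto simp: c_def norm_divide)
  have cx: "cont K1 (\<lambda>s. of_real (x l s) :: 'k)" and cy: "cont K2 (y l)" for l
    using x y by (auto simp: K1.in_ball_def K2.in_ball_def intro: cont_of_real)
  define a where "a = 1 / sqrt (real n)"
  have a: "a > 0" "a\<^sup>2 = 1 / real n" using n by (auto simp: a_def power_divide)
  have M: "M \<ge> 0"
    using order_trans[OF norm_ge_zero bound[of "\<lambda>_. 0" "\<lambda>_. 0"]] by (simp add: K1.in_ball_def K2.in_ball_def)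
  have zero: "b (\<lambda>s. of_real 0) (\<lambda>_. 0) = 0" using scale1[of "\<lambda>_. 0" "\<lambda>_. 0" 0] by simp
  have "norm (b (\<lambda>s. of_real 0) (\<lambda>_. 0) + of_real a * (\<Sum>l<n. b (\<lambda>s. of_real (x l s * 1)) (\<lambda>t. c l * y l t)))
      \<le> M * (1 * sqrt (1 + a\<^sup>2) ^ n)"
  proof (rule Riesz_product[OF x])
    show "K2.in_ball (\<lambda>t. c l * y l t)" for l by (rule K2.in_ball_scale[OF c(1) y(1)])
    show "c l * y l t = 0 \<or> c m * y m t = 0" if "l \<noteq> m" "t \<in> topspace K2" for l m t
      using y(2)[OF that] by auto
  qed (auto simp: K2.in_ball_def)
  also have "(\<Sum>l<n. b (\<lambda>s. of_real (x l s * 1)) (\<lambda>t. c l * y l t)) = of_real (\<Sum>l<n. norm (B l))"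
    unfolding of_real_sum c(2)[symmetric] using scale2[OF cx cy] by (simp add: B_def)
  finally have "a * (\<Sum>l<n. norm (B l)) \<le> M * sqrt (1 + a\<^sup>2) ^ n"
    unfolding zero add_0 norm_mult norm_of_real using a(1) by (simp add: sum_nonneg)
  also have "\<dots> \<le> M * 2"
  proof (rule mult_left_mono[OF _ M])
    have "(sqrt (1 + a\<^sup>2) ^ n)\<^sup>2 = (1 + 1 / real n) ^ n"
      by (simp add: power_mult[symmetric] mult.commute[of n] power_mult a(2))
    also have "\<dots> \<le> exp (1 / real n) ^ n"
      using exp_ge_add_one_self[of "1 / real n"] by (intro power_mono) auto
    also have "\<dots> = exp 1" using n by (simp flip: exp_of_nat_mult)
    also have "\<dots> \<le> 2\<^sup>2" using exp_le by simp
    finally show "sqrt (1 + a\<^sup>2) ^ n \<le> 2" by (rule power2_le_imp_le) simp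
  qed
  finally show ?thesis using n by (simp add: a_def B_def field_simps)
qed

text \<open>If the values stayed above d on a subsequence, the sum of n of them would be at least n
  d, whereas it is at most 2 M sqrt n.\<close>

theorem diagonal_null:
  fixes x :: "nat \<Rightarrow> 'a \<Rightarrow> real" and y :: "nat \<Rightarrow> 'b \<Rightarrow> 'k"
  assumes x: "\<And>l. K1.in_ball (x l)"
    and y: "\<And>l. K2.in_ball (y l)" "\<And>l m t. l \<noteq> m \<Longrightarrow> t \<in> topspace K2 \<Longrightarrow> y l t = 0 \<or> y m t = 0"
  shows "(\<lambda>l. b (\<lambda>s. of_real (x l s)) (y l)) \<longlonglongrightarrow> 0"
proof (rule ccontr)
  assume "\<not> ?thesis"
  then have "\<not> (\<lambda>l. norm (b (\<lambda>s. of_real (x l s)) (y l))) \<longlonglongrightarrow> 0" by (simp add: tendsto_norm_zero_iff)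
  from not_tendsto_zero_subsequence[OF this norm_ge_zero]
  obtain d and r :: "nat \<Rightarrow> nat" where d: "d > 0" and r: "strict_mono r"
    and big: "\<And>l. d \<le> norm (b (\<lambda>s. of_real (x (r l) s)) (y (r l)))" by blast
  have ne: "r l \<noteq> r m" if "l \<noteq> m" for l m using that r by (simp add: strict_mono_eq)
  have le: "real n * d \<le> 2 * M * sqrt n" if n: "n > 0" for n
  proof -
    have "real n * d = (\<Sum>l<n. d)" by simp
    also have "\<dots> \<le> (\<Sum>l<n. norm (b (\<lambda>s. of_real (x (r l) s)) (y (r l))))" by (rule sum_mono) (rule big)
    also have "\<dots> \<le> 2 * M * sqrt n"
      by (rule diagonal_sqrt_bound[OF x y(1) _ n]) (rule y(2)[OF ne])
    finally show ?thesis .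
  qed
  \<comment> \<open>Taking n to be the square of k + 1 makes the square root an integer.\<close>
  obtain k :: nat where k: "2 * M / d < real k" using reals_Archimedean2 by blast
  have "real ((Suc k)\<^sup>2) * d \<le> 2 * M * sqrt (real ((Suc k)\<^sup>2))" by (rule le) simp
  also have "sqrt (real ((Suc k)\<^sup>2)) = real (Suc k)" by (simp only: of_nat_power real_sqrt_abs abs_of_nat)
  finally have "real (Suc k) * (real (Suc k) * d) \<le> real (Suc k) * (2 * M)"
    by (simp only: of_nat_power of_nat_mult power2_eq_square mult_ac)
  then have "real (Suc k) * d \<le> 2 * M" by (simp only: mult_le_cancel_left_pos of_nat_0_less_iff zero_less_Suc)
  then have "real (Suc k) \<le> 2 * M / d" using d by (simp add: field_simps)
  then show False using k by simp
qed

end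

section \<open>Sequences in infinite and in non-scattered spaces\<close>

context compact_Hausdorff
begin

text \<open>Two points of U have disjoint neighbourhoods A and B inside U. If U minus the closure of
  A is infinite, it is what remains. If not, B is finite, being disjoint from that closure; then B
  is split off and U - B, open and still infinite, remains.\<close>

lemma split_infinite_open:
  assumes U: "openin K U" "infinite U"
  shows "\<exists>A U'. openin K A \<and> A \<noteq> {} \<and> A \<subseteq> U \<and> openin K U' \<and> infinite U' \<and> U' \<subseteq> U \<and> A \<inter> U' = {}"
proof -
  obtain x y where xy: "x \<in> U" "y \<in> U" "x \<noteq> y" using U(2) by (metis finite.emptyI finite_insert finite_subset insertCI subsetI)
  have UK: "U \<subseteq> topspace K" using U(1) by (rule openin_subset)
  obtain A0 B0 where AB: "openin K A0" "openin K B0" "x \<in> A0" "y \<in> B0" "disjnt A0 B0"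
    using Hausdorff xy UK unfolding Hausdorff_space_def by (metis subsetD)
  define A where "A = A0 \<inter> U"
  define B where "B = B0 \<inter> U"
  have A: "openin K A" "x \<in> A" "A \<subseteq> U" and B: "openin K B" "y \<in> B" "B \<subseteq> U" and dis: "A \<inter> B = {}"
    using AB U xy by (auto simp: A_def B_def disjnt_def)
  show ?thesis
  proof (cases "infinite (U - K closure_of A)")
    case True
    moreover have "openin K (U - K closure_of A)" by (intro openin_diff U closedin_closure_of)
    moreover have "A \<subseteq> K closure_of A" using A UK by (intro closure_of_subset) auto
    ultimately show ?thesis using A by (intro exI[of _ A] exI[of _ "U - K closure_of A"]) auto
  next
    case False
    have "B \<inter> K closure_of A = {}" using openin_Int_closure_of_eq_empty[OF B(1)] dis by blast
    then have "B \<subseteq> U - K closure_of A" using B by auto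
    then have fB: "finite B" using False finite_subset by blast
    have "openin K (U - B)" using fB B UK by (intro openin_diff U closedin_finite) auto
    moreover have "infinite (U - B)" using fB U(2) by simp
    ultimately show ?thesis using B by (intro exI[of _ B] exI[of _ "U - B"]) auto
  qed
qed

theorem disjoint_bumps:
  assumes inf: "infinite (topspace K)"
  shows "\<exists>(Y :: nat \<Rightarrow> 'a \<Rightarrow> real) t. (\<forall>n. in_ball (Y n)) \<and> (\<forall>n. t n \<in> topspace K \<and> Y n (t n) = 1) \<and>
    (\<forall>m n x. m \<noteq> n \<longrightarrow> x \<in> topspace K \<longrightarrow> Y m x = 0 \<or> Y n x = 0)"
proof -
  have "\<exists>A U'. (openin K U \<and> infinite U \<longrightarrow> openin K A \<and> A \<noteq> {} \<and> A \<subseteq> U \<and> openin K U' \<and> infinite U' \<and> U' \<subseteq> U \<and> A \<inter> U' = {})" for U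
    using split_infinite_open[of U] by blast
  then obtain A G where AG: "\<And>U. openin K U \<Longrightarrow> infinite U \<Longrightarrow>
      openin K (A U) \<and> A U \<noteq> {} \<and> A U \<subseteq> U \<and> openin K (G U) \<and> infinite (G U) \<and> G U \<subseteq> U \<and> A U \<inter> G U = {}"
    by metis
  define U where "U n = (G ^^ n) (topspace K)" for n
  have U: "openin K (U n) \<and> infinite (U n)" for n
    by (induction n) (use AG inf in \<open>auto simp: U_def\<close>)
  have Suc: "U (Suc n) = G (U n)" for n by (simp add: U_def)
  have "U (Suc n) \<subseteq> U n" for n using AG U by (simp add: Suc)
  then have anti: "U n \<subseteq> U m" if "m \<le> n" for m n using lift_Suc_antimono_le[of U] that by blast
  define B where "B n = A (U n)" for n
  have B: "openin K (B n)" "B n \<noteq> {}" "B n \<subseteq> U n" "B n \<inter> U (Suc n) = {}" for n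
    using AG[of "U n"] U[of n] by (auto simp: B_def Suc)
  have disj: "B m \<inter> B n = {}" if "m < n" for m n
    using B(4)[of m] B(3)[of n] anti[of "Suc m" n] that by fastforce
  have "\<forall>n. \<exists>t. t \<in> B n" using B(2) by blast
  then obtain t where t: "\<And>n. t n \<in> B n" by metis
  have tK: "t n \<in> topspace K" for n using t B(1) openin_subset by blast
  have "\<exists>f :: 'a \<Rightarrow> real. cont K f \<and> (\<forall>x\<in>topspace K. 0 \<le> f x \<and> f x \<le> 1) \<and>
      (\<forall>x\<in>topspace K - B n. f x = 0) \<and> (\<forall>x\<in>{t n}. f x = 1)" for n
    by (rule Urysohn[OF closedin_diff[OF closedin_topspace B(1)] closedin_finite]) (use t tK in auto)
  then obtain Y :: "nat \<Rightarrow> 'a \<Rightarrow> real" where Y: "\<And>n. cont K (Y n)"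
    "\<And>n x. x \<in> topspace K \<Longrightarrow> 0 \<le> Y n x \<and> Y n x \<le> 1" "\<And>n x. x \<in> topspace K \<Longrightarrow> x \<notin> B n \<Longrightarrow> Y n x = 0" "\<And>n. Y n (t n) = 1"
    by (metis DiffI singletonI)
  have "Y m x = 0 \<or> Y n x = 0" if "m \<noteq> n" "x \<in> topspace K" for m n x
    using disj[of m n] disj[of n m] Y(3)[OF that(2)] that(1) by (metis disjoint_iff nat_neq_iff)
  moreover have "in_ball (Y n)" for n using Y(1,2) by (auto simp: in_ball_def)
  ultimately show ?thesis using Y(4) tK by blast
qed

end

section \<open>Rademacher functionals on non-scattered spaces\<close>

definition sgn_of :: "bool \<Rightarrow> real" where "sgn_of e = (if e then 1 else -1)"

primrec avg :: "nat \<Rightarrow> (bool list \<Rightarrow> 'v::real_vector) \<Rightarrow> 'v" where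
  "avg 0 G = G []"
| "avg (Suc m) G = (1/2) *\<^sub>R (avg m (\<lambda>l. G (True # l)) + avg m (\<lambda>l. G (False # l)))"

lemma avg_add: "avg m (\<lambda>l. G l + H l) = avg m G + avg m H"
  by (induction m arbitrary: G H) (simp_all add: scaleR_right_distrib)

lemma avg_scaleR: "avg m (\<lambda>l. c *\<^sub>R G l) = c *\<^sub>R avg m G"
  by (induction m arbitrary: G) (simp_all add: scaleR_right_distrib mult.commute)

lemma avg_mult: "avg m (\<lambda>l. c * G l) = c * avg m G" for c :: "'k::real_normed_field"
  by (induction m arbitrary: G) (simp_all add: distrib_left)

lemma avg_le: "(\<And>l. length l = m \<Longrightarrow> G l \<le> c) \<Longrightarrow> avg m G \<le> (c::real)"
proof (induction m arbitrary: G)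
  case (Suc m)
  have "avg m (\<lambda>l. G (True # l)) \<le> c" "avg m (\<lambda>l. G (False # l)) \<le> c"
    by (rule Suc.IH, rule Suc.prems, simp)+
  then show ?case by simp
qed simp

lemma avg_cong_const: "(\<And>l. length l = m \<Longrightarrow> G l = c) \<Longrightarrow> avg m G = c"
proof (induction m arbitrary: G)
  case (Suc m)
  have "avg m (\<lambda>l. G (True # l)) = c" "avg m (\<lambda>l. G (False # l)) = c"
    by (rule Suc.IH, rule Suc.prems, simp)+
  then show ?case by (simp flip: scaleR_2)
qed simp

text \<open>The n-th Rademacher coefficient of a function \<open>G\<close> on the cube of sign lists
  of length m, with normalised counting measure. It is meaningful for n < m.\<close>

definition rademacher :: "nat \<Rightarrow> nat \<Rightarrow> (bool list \<Rightarrow> 'v::real_vector) \<Rightarrow> 'v" where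
  "rademacher m n G = avg m (\<lambda>l. sgn_of (l ! n) *\<^sub>R G l)"

lemma parallelogram_half:
  fixes p q :: "'v::real_inner"
  shows "(norm ((1/2) *\<^sub>R (p + q)))\<^sup>2 + (norm ((1/2) *\<^sub>R (p - q)))\<^sup>2 = ((norm p)\<^sup>2 + (norm q)\<^sup>2) / 2"
  by (simp add: power2_norm_eq_inner inner_add_left inner_add_right inner_diff_left inner_diff_right inner_commute field_simps)

text \<open>Induction over the first sign, which splits the cube into two halves. The mean and the
  coefficient 0 are half the sum and half the difference of the two means, so the parallelogram law
  handles them exactly; later coefficients are averages of those on the halves, and convexity of the
  square suffices. Keeping the mean in the statement closes the induction.\<close>

lemma Bessel:
  fixes G :: "bool list \<Rightarrow> 'v::real_inner"
  shows "(\<Sum>n<m. (norm (rademacher m n G))\<^sup>2) + (norm (avg m G))\<^sup>2 \<le> avg m (\<lambda>l. (norm (G l))\<^sup>2)"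
proof (induction m arbitrary: G)
  case 0
  then show ?case by simp
next
  case (Suc m)
  let ?P = "\<lambda>l. G (True # l)" and ?Q = "\<lambda>l. G (False # l)"
  have r0: "rademacher (Suc m) 0 G = (1/2) *\<^sub>R (avg m ?P - avg m ?Q)"
    using avg_scaleR[of m "-1" ?Q] by (simp add: rademacher_def sgn_of_def)
  have rS: "rademacher (Suc m) (Suc n) G = (1/2) *\<^sub>R (rademacher m n ?P + rademacher m n ?Q)" for n
    by (simp add: rademacher_def)
  have half: "(norm ((1/2) *\<^sub>R (p + q)))\<^sup>2 \<le> ((norm p)\<^sup>2 + (norm q)\<^sup>2) / 2" for p q :: 'v
    using parallelogram_half[of p q] zero_le_power2[of "norm ((1/2) *\<^sub>R (p - q))"] by linarith
  have "(\<Sum>n<Suc m. (norm (rademacher (Suc m) n G))\<^sup>2) + (norm (avg (Suc m) G))\<^sup>2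
      = (\<Sum>n<m. (norm (rademacher (Suc m) (Suc n) G))\<^sup>2) + ((norm (avg m ?P))\<^sup>2 + (norm (avg m ?Q))\<^sup>2) / 2"
    unfolding sum.lessThan_Suc_shift r0 avg.simps parallelogram_half[symmetric] by simp
  also have "\<dots> \<le> (\<Sum>n<m. ((norm (rademacher m n ?P))\<^sup>2 + (norm (rademacher m n ?Q))\<^sup>2) / 2)
      + ((norm (avg m ?P))\<^sup>2 + (norm (avg m ?Q))\<^sup>2) / 2"
    unfolding rS by (intro add_right_mono sum_mono half)
  also have "\<dots> = ((\<Sum>n<m. (norm (rademacher m n ?P))\<^sup>2) + (norm (avg m ?P))\<^sup>2) / 2
      + ((\<Sum>n<m. (norm (rademacher m n ?Q))\<^sup>2) + (norm (avg m ?Q))\<^sup>2) / 2"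
    by (simp add: sum.distrib add_divide_distrib flip: sum_divide_distrib)
  also have "\<dots> \<le> avg m (\<lambda>l. (norm (?P l))\<^sup>2) / 2 + avg m (\<lambda>l. (norm (?Q l))\<^sup>2) / 2"
    by (intro add_mono divide_right_mono Suc.IH) auto
  also have "\<dots> = avg (Suc m) (\<lambda>l. (norm (G l))\<^sup>2)" by simp
  finally show ?case .
qed

context compact_Hausdorff
begin

text \<open>Every sign pattern is attained on a whole open set meeting \<open>S\<close>. A single
  point would leave no room for splitting by the next function.\<close>

definition independent_on :: "'a set \<Rightarrow> ('a \<Rightarrow> real) list \<Rightarrow> bool" where
  "independent_on S xs \<longleftrightarrow> (\<forall>x\<in>set xs. in_ball x) \<and>
    (\<forall>es. length es = length xs \<longrightarrow> (\<exists>U. openin K U \<and> U \<inter> S \<noteq> {} \<and>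
      (\<forall>n<length xs. \<forall>y\<in>U. (xs ! n) y = sgn_of (es ! n))))"

text \<open>As \<open>S\<close> has no isolated points, each open piece holds two distinct points of
  \<open>S\<close>. A Urysohn function that separates all first points from all second points,
  stretched and clipped, takes both signs on every piece.\<close>

lemma independent_on_extend:
  assumes S: "S \<subseteq> topspace K" "\<And>x. x \<in> S \<Longrightarrow> \<not> openin (subtopology K S) {x}" and xs: "independent_on S xs"
  shows "\<exists>x. independent_on S (xs @ [x])"
proof -
  define L where "L = {es :: bool list. length es = length xs}"
  have finL: "finite L" unfolding L_def using finite_lists_length_eq[of "UNIV :: bool set"] by simp
  have "\<forall>es\<in>L. \<exists>U. openin K U \<and> U \<inter> S \<noteq> {} \<and> (\<forall>n<length xs. \<forall>y\<in>U. (xs ! n) y = sgn_of (es ! n))"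
    using xs unfolding independent_on_def L_def by blast
  then obtain U where U: "\<And>es. es \<in> L \<Longrightarrow> openin K (U es)" "\<And>es. es \<in> L \<Longrightarrow> U es \<inter> S \<noteq> {}"
    "\<And>es n y. es \<in> L \<Longrightarrow> n < length xs \<Longrightarrow> y \<in> U es \<Longrightarrow> (xs ! n) y = sgn_of (es ! n)"
    by metis
  have two: "\<exists>p. fst p \<in> U es \<inter> S \<and> snd p \<in> U es \<inter> S \<and> fst p \<noteq> snd p" if es: "es \<in> L" for es
  proof -
    obtain a where a: "a \<in> U es \<inter> S" using U(2)[OF es] by blast
    have "openin (subtopology K S) (U es \<inter> S)" using U(1)[OF es] by (rule openin_subtopology_Int)
    then have "U es \<inter> S \<noteq> {a}" using S(2)[of a] a by auto
    then obtain b where "b \<in> U es \<inter> S" "a \<noteq> b" using a by blast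
    then show ?thesis using a by (intro exI[of _ "(a, b)"]) simp
  qed
  have "\<forall>es\<in>L. \<exists>p. fst p \<in> U es \<inter> S \<and> snd p \<in> U es \<inter> S \<and> fst p \<noteq> snd p"
    by (rule ballI) (rule two)
  from bchoice[OF this] obtain p where p: "\<forall>es\<in>L. fst (p es) \<in> U es \<inter> S \<and> snd (p es) \<in> U es \<inter> S \<and> fst (p es) \<noteq> snd (p es)"
    by (rule exE)
  define a where "a es = fst (p es)" for es
  define b where "b es = snd (p es)" for es
  have ab: "a es \<in> U es \<inter> S" "b es \<in> U es \<inter> S" "a es \<noteq> b es" if "es \<in> L" for es
    using bspec[OF p that] by (simp_all add: a_def b_def)
  \<comment> \<open>A common point would lie in pieces for two patterns; the earlier functions have
    prescribed signs on each piece, so the patterns agree, and then the two points of that piece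
    would coincide.\<close>
  have disj: "b ` L \<inter> a ` L = {}"
  proof (rule ccontr)
    assume "b ` L \<inter> a ` L \<noteq> {}"
    then obtain v where "v \<in> b ` L" "v \<in> a ` L" by blast
    then obtain es es' where es: "es \<in> L" "es' \<in> L" "a es = b es'" by (elim imageE) simp
    have "es = es'"
    proof (rule nth_equalityI)
      show "length es = length es'" using es by (simp add: L_def)
      fix n assume "n < length es"
      then have n: "n < length xs" using es by (simp add: L_def)
      have "a es \<in> U es" "a es \<in> U es'" using ab(1)[OF es(1)] ab(2)[OF es(2)] es(3) by auto
      then have "sgn_of (es ! n) = sgn_of (es' ! n)" using U(3)[OF es(1) n] U(3)[OF es(2) n] by metis
      then show "es ! n = es' ! n" by (simp add: sgn_of_def split: if_splits)
    qed
    then show False using ab(3) es by auto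
  qed
  have "closedin K (a ` L)" "closedin K (b ` L)"
    using ab(1,2) S(1) finL by (auto intro!: closedin_finite)
  from Urysohn[OF this(2,1) disj] obtain g :: "'a \<Rightarrow> real" where g: "cont K g" "\<forall>x\<in>b ` L. g x = 0" "\<forall>x\<in>a ` L. g x = 1"
    by blast
  \<comment> \<open>The new function is exactly 1 where g \<ge> 3/4 and exactly -1 where g \<le>
    1/4, so both values are attained on open sets around the chosen points.\<close>
  define x where "x y = max (-1) (min 1 (4 * g y - 2))" for y
  have x: "in_ball x" unfolding in_ball_def x_def
    by (intro conjI cont_intros g) auto
  have "\<exists>V. openin K V \<and> V \<inter> S \<noteq> {} \<and> (\<forall>n<length (xs @ [x]). \<forall>y\<in>V. ((xs @ [x]) ! n) y = sgn_of (fs ! n))"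
    if fs: "length fs = length (xs @ [x])" for fs
  proof -
    obtain es e where fse: "fs = es @ [e]" using fs by (cases fs rule: rev_cases) auto
    have es: "es \<in> L" using fs by (simp add: fse L_def)
    have len: "length es = length xs" using es by (simp add: L_def)
    define I :: "real set" where "I = (if e then {3/4<..} else {..<1/4})"
    have "open I" by (simp add: I_def)
    define V where "V = U es \<inter> {y \<in> topspace K. g y \<in> I}"
    have "openin K V" unfolding V_def by (intro openin_Int U(1)[OF es] openin_preimage g \<open>open I\<close>)
    moreover have "V \<inter> S \<noteq> {}"
    proof -
      have "(if e then a es else b es) \<in> V \<inter> S"
        using ab(1,2)[OF es] g(2,3) es S(1) by (auto simp: V_def I_def)
      then show ?thesis by blast
    qed
    moreover have "((xs @ [x]) ! n) y = sgn_of (fs ! n)" if n: "n < length (xs @ [x])" and y: "y \<in> V" for n y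
    proof (cases "n < length xs")
      case True
      then show ?thesis using U(3)[OF es True, of y] y len by (simp add: nth_append fse V_def)
    next
      case False
      then have "n = length xs" using n by simp
      moreover have "x y = sgn_of e" using y by (cases e) (auto simp: V_def I_def x_def sgn_of_def)
      ultimately show ?thesis using len by (simp add: nth_append fse)
    qed
    ultimately show ?thesis by blast
  qed
  then have "independent_on S (xs @ [x])" using xs x unfolding independent_on_def by auto
  then show ?thesis by blast
qed

lemma independent_sequence:
  assumes "\<not> scattered_space K"
  shows "\<exists>X :: nat \<Rightarrow> 'a \<Rightarrow> real. (\<forall>n. in_ball (X n)) \<and>
    (\<forall>m es. length es = m \<longrightarrow> (\<exists>t\<in>topspace K. \<forall>n<m. X n t = sgn_of (es ! n)))"
proof -
  obtain S where S: "S \<subseteq> topspace K" "S \<noteq> {}" "\<And>x. x \<in> S \<Longrightarrow> \<not> openin (subtopology K S) {x}"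
    using assms unfolding scattered_space_def by blast
  have base: "independent_on S []" unfolding independent_on_def using S(1,2) by (auto intro!: exI[of _ "topspace K"])
  define F where "F xs = (SOME x. independent_on S (xs @ [x]))" for xs
  have F: "independent_on S (xs @ [F xs])" if "independent_on S xs" for xs
    unfolding F_def by (rule someI_ex[OF independent_on_extend[OF S(1,3) that]])
  define ls where "ls = rec_nat [] (\<lambda>_ xs. xs @ [F xs])"
  have ls_0: "ls 0 = []" and ls_Suc: "ls (Suc m) = ls m @ [F (ls m)]" for m by (simp_all add: ls_def)
  have ind: "independent_on S (ls m)" for m by (induction m) (auto simp: ls_0 ls_Suc base F)
  define X where "X n = F (ls n)" for n
  have ls: "ls m = map X [0..<m]" for m by (induction m) (auto simp: ls_0 ls_Suc X_def)
  have "in_ball (X n)" for n using ind[of "Suc n"] unfolding independent_on_def ls by auto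
  moreover have "\<exists>t\<in>topspace K. \<forall>n<m. X n t = sgn_of (es ! n)" if "length es = m" for m es
  proof -
    have "length es = length (ls m)" using that by (simp add: ls)
    then obtain U where U: "openin K U" "U \<inter> S \<noteq> {}" "\<forall>n<length (ls m). \<forall>y\<in>U. (ls m ! n) y = sgn_of (es ! n)"
      using ind[of m] unfolding independent_on_def by blast
    then obtain t where "t \<in> U" "t \<in> S" by blast
    then show ?thesis using U(3) S(1) by (intro bexI[of _ t]) (auto simp: ls)
  qed
  ultimately show ?thesis by blast
qed

text \<open>The functionals are limits along the ultrafilter of Rademacher coefficients of \<open>f\<close> on finite
  cubes of points.\<close>

definition rademacher_functionals ::
    "(nat \<Rightarrow> 'a \<Rightarrow> real) \<Rightarrow> (nat \<Rightarrow> ('a \<Rightarrow> 'k::real_normed_field) \<Rightarrow> 'k) \<Rightarrow> bool" where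
  "rademacher_functionals X \<phi> \<longleftrightarrow>
    (\<forall>n. in_ball (X n)) \<and> (\<forall>n. \<phi> n (\<lambda>s. of_real (X n s)) = 1) \<and>
    (\<forall>n f g. cont K f \<longrightarrow> cont K g \<longrightarrow> \<phi> n (\<lambda>s. f s + g s) = \<phi> n f + \<phi> n g) \<and>
    (\<forall>n c f. cont K f \<longrightarrow> \<phi> n (\<lambda>s. c * f s) = c * \<phi> n f) \<and>
    (\<forall>n f g. (\<forall>s\<in>topspace K. f s = g s) \<longrightarrow> \<phi> n f = \<phi> n g) \<and>
    (\<forall>N f B. cont K f \<longrightarrow> (\<forall>s\<in>topspace K. norm (f s) \<le> B) \<longrightarrow> L2_set (\<lambda>n. norm (\<phi> n f)) {..<N} \<le> B)"

lemma rademacher_functionalsD: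
  assumes "rademacher_functionals X \<phi>"
  shows "in_ball (X n)" "\<phi> n (\<lambda>s. of_real (X n s)) = 1"
    "cont K f \<Longrightarrow> cont K g \<Longrightarrow> \<phi> n (\<lambda>s. f s + g s) = \<phi> n f + \<phi> n g"
    "cont K f \<Longrightarrow> \<phi> n (\<lambda>s. c * f s) = c * \<phi> n f"
    "\<forall>s\<in>topspace K. f s = g s \<Longrightarrow> \<phi> n f = \<phi> n g"
    "cont K f \<Longrightarrow> \<forall>s\<in>topspace K. norm (f s) \<le> B \<Longrightarrow> L2_set (\<lambda>n. norm (\<phi> n f)) {..<N} \<le> B"
  using assms unfolding rademacher_functionals_def by simp_all

text \<open>On the m-th cube of points the first m functions are exactly the coordinate signs, so
  the coefficients are biorthogonal to them and satisfy Bessel's inequality. Both properties pass to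
  the limit along \<open>\<U>\<close>, the inequality because it concerns finitely many indices at a
  time.\<close>

theorem rademacher_functionals_exist:
  assumes "\<not> scattered_space K"
  shows "\<exists>X (\<phi> :: nat \<Rightarrow> ('a \<Rightarrow> 'k::{real_normed_field, euclidean_space}) \<Rightarrow> 'k). rademacher_functionals X \<phi>"
proof -
  obtain X :: "nat \<Rightarrow> 'a \<Rightarrow> real" where X: "\<And>n. in_ball (X n)"
    "\<And>es. \<exists>t\<in>topspace K. \<forall>n<length es. X n t = sgn_of (es ! n)"
    using independent_sequence[OF assms] by blast
  from X(2) obtain t where t: "\<And>es. t es \<in> topspace K" "\<And>es n. n < length es \<Longrightarrow> X n (t es) = sgn_of (es ! n)"
    by metis
  define \<rho> where "\<rho> m n f = rademacher m n (\<lambda>l. f (t l))" for m n and f :: "'a \<Rightarrow> 'k"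
  define \<phi> where "\<phi> n f = Lim \<U> (\<lambda>m. \<rho> m n f)" for n and f :: "'a \<Rightarrow> 'k"
  have bess: "(\<Sum>n<m. (norm (\<rho> m n f))\<^sup>2) \<le> B\<^sup>2" if B: "\<forall>s\<in>topspace K. norm (f s) \<le> B" for m f B
  proof -
    have "(\<Sum>n<m. (norm (\<rho> m n f))\<^sup>2) \<le> avg m (\<lambda>l. (norm (f (t l)))\<^sup>2)"
      using Bessel[of m "\<lambda>l. f (t l)"] zero_le_power2[of "norm (avg m (\<lambda>l. f (t l)))"] unfolding \<rho>_def by linarith
    also have "\<dots> \<le> B\<^sup>2" using B t(1) by (intro avg_le power_mono) auto
    finally show ?thesis .
  qed
  have \<rho>_le: "norm (\<rho> m n f) \<le> B" if B: "\<forall>s\<in>topspace K. norm (f s) \<le> B" and n: "n < m" for m n f B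
  proof -
    have "(norm (\<rho> m n f))\<^sup>2 \<le> (\<Sum>n<m. (norm (\<rho> m n f))\<^sup>2)" by (rule member_le_sum) (use n in auto)
    also have "\<dots> \<le> B\<^sup>2" by (rule bess[OF B])
    finally show ?thesis
      by (rule power2_le_imp_le) (rule order_trans[OF norm_ge_zero bspec[OF B t(1)[of "[]"]]])
  qed
  have lim: "((\<lambda>m. \<rho> m n f) \<longlongrightarrow> \<phi> n f) \<U>" if f: "cont K f" for n f
  proof -
    obtain B where B: "B > 0" "\<forall>s\<in>topspace K. norm (f s) \<le> B" using cont_bounded[OF f] by blast
    \<comment> \<open>For m \<le> n the expression \<open>l ! n\<close> reads beyond the list, and
      the bound on the coefficient is available only for n < m. Setting these values to 0 does not
      affect the limit.\<close>
    let ?g = "\<lambda>m. if n < m then \<rho> m n f else 0"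
    have "norm (?g m) \<le> B" for m using \<rho>_le[OF B(2)] B(1) by simp
    then have "(?g \<longlongrightarrow> Lim \<U> ?g) \<U>" by (rule \<U>_convergent)
    moreover have "eventually (\<lambda>m. ?g m = \<rho> m n f) \<U>"
      by (rule eventually_mono[OF eventually_\<U>[OF eventually_gt_at_top[of n]]]) simp
    ultimately have "((\<lambda>m. \<rho> m n f) \<longlongrightarrow> Lim \<U> ?g) \<U>" using tendsto_cong by fastforce
    then show ?thesis unfolding \<phi>_def using tendsto_Lim[OF \<U>_nontrivial] by metis
  qed
  show ?thesis
    unfolding rademacher_functionals_def
  proof (intro exI[of _ X] exI[of _ \<phi>] conjI allI impI X(1))
    fix n
    have cX: "cont K (\<lambda>s. of_real (X n s) :: 'k)" using X(1) by (intro cont_of_real) (auto simp: in_ball_def)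
    have "\<rho> m n (\<lambda>s. of_real (X n s)) = 1" if "n < m" for m
      unfolding \<rho>_def rademacher_def
      by (rule avg_cong_const) (use that t(2) in \<open>auto simp: scaleR_conv_of_real sgn_of_def\<close>)
    then have "eventually (\<lambda>m. \<rho> m n (\<lambda>s. of_real (X n s)) = 1) \<U>"
      by (intro eventually_mono[OF eventually_\<U>[OF eventually_gt_at_top[of n]]]) auto
    then have "((\<lambda>m. \<rho> m n (\<lambda>s. of_real (X n s))) \<longlongrightarrow> 1) \<U>" by (rule tendsto_eventually)
    then show "\<phi> n (\<lambda>s. of_real (X n s)) = 1" using lim[OF cX] tendsto_unique[OF \<U>_nontrivial] by blast
  next
    fix n and f g :: "'a \<Rightarrow> 'k" assume fg: "cont K f" "cont K g"
    have "\<rho> m n (\<lambda>s. f s + g s) = \<rho> m n f + \<rho> m n g" for m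
      by (simp add: \<rho>_def rademacher_def scaleR_right_distrib avg_add)
    then have "((\<lambda>m. \<rho> m n f + \<rho> m n g) \<longlongrightarrow> \<phi> n (\<lambda>s. f s + g s)) \<U>"
      using lim[OF cont_add[OF fg], of n] by simp
    then show "\<phi> n (\<lambda>s. f s + g s) = \<phi> n f + \<phi> n g"
      by (rule tendsto_unique[OF \<U>_nontrivial]) (intro tendsto_add lim fg)
  next
    fix n c and f :: "'a \<Rightarrow> 'k" assume f: "cont K f"
    have "\<rho> m n (\<lambda>s. c * f s) = c * \<rho> m n f" for m
      by (simp add: \<rho>_def rademacher_def flip: avg_mult)
    then have "((\<lambda>m. c * \<rho> m n f) \<longlongrightarrow> \<phi> n (\<lambda>s. c * f s)) \<U>"
      using lim[OF cont_mult[OF cont_const f], of n c] by simp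
    then show "\<phi> n (\<lambda>s. c * f s) = c * \<phi> n f"
      by (rule tendsto_unique[OF \<U>_nontrivial]) (intro tendsto_mult_left lim f)
  next
    fix n and f g :: "'a \<Rightarrow> 'k" assume "\<forall>s\<in>topspace K. f s = g s"
    then have "(\<lambda>l. f (t l)) = (\<lambda>l. g (t l))" using t(1) by auto
    then show "\<phi> n f = \<phi> n g" by (simp add: \<phi>_def \<rho>_def)
  next
    fix N B and f :: "'a \<Rightarrow> 'k" assume f: "cont K f" and B: "\<forall>s\<in>topspace K. norm (f s) \<le> B"
    have B0: "B \<ge> 0" by (rule order_trans[OF norm_ge_zero bspec[OF B t(1)[of "[]"]]])
    have "((\<lambda>m. \<Sum>n<N. (norm (\<rho> m n f))\<^sup>2) \<longlongrightarrow> (\<Sum>n<N. (norm (\<phi> n f))\<^sup>2)) \<U>"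
      by (intro tendsto_sum tendsto_power tendsto_norm lim f)
    moreover have "eventually (\<lambda>m. (\<Sum>n<N. (norm (\<rho> m n f))\<^sup>2) \<le> B\<^sup>2) \<U>"
    proof (rule eventually_mono[OF eventually_\<U>[OF eventually_ge_at_top[of N]]])
      fix m assume "N \<le> m"
      then have "(\<Sum>n<N. (norm (\<rho> m n f))\<^sup>2) \<le> (\<Sum>n<m. (norm (\<rho> m n f))\<^sup>2)" by (intro sum_mono2) auto
      also have "\<dots> \<le> B\<^sup>2" by (rule bess[OF B])
      finally show "(\<Sum>n<N. (norm (\<rho> m n f))\<^sup>2) \<le> B\<^sup>2" .
    qed
    ultimately have "(\<Sum>n<N. (norm (\<phi> n f))\<^sup>2) \<le> B\<^sup>2" by (rule tendsto_upperbound) simp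
    then show "L2_set (\<lambda>n. norm (\<phi> n f)) {..<N} \<le> B"
      unfolding L2_set_def using B0 by (intro real_le_lsqrt sum_nonneg) auto
  qed
qed

end

section \<open>Failure of the Dunford-Pettis property\<close>

text \<open>The property quantifies over spaces on one fixed type, so l2 has to be copied
  isometrically into that type along an injection before it can serve as a target.\<close>

definition transport :: "('e \<Rightarrow> 'd) \<Rightarrow> ('k, 'e) nspace \<Rightarrow> ('k, 'd) nspace" where
  "transport \<iota> V = \<lparr>vs_carrier = \<iota> ` vs_carrier V, vs_add = (\<lambda>x y. \<iota> (vs_add V (inv \<iota> x) (inv \<iota> y))),
    vs_zero = \<iota> (vs_zero V), vs_scale = (\<lambda>c x. \<iota> (vs_scale V c (inv \<iota> x))), vs_norm = (\<lambda>x. vs_norm V (inv \<iota> x))\<rparr>"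

lemma transport_simps:
  assumes "inj \<iota>"
  shows "vs_carrier (transport \<iota> V) = \<iota> ` vs_carrier V" "vs_add (transport \<iota> V) (\<iota> x) (\<iota> y) = \<iota> (vs_add V x y)"
    "vs_zero (transport \<iota> V) = \<iota> (vs_zero V)" "vs_scale (transport \<iota> V) c (\<iota> x) = \<iota> (vs_scale V c x)"
    "vs_norm (transport \<iota> V) (\<iota> x) = vs_norm V x" "vs_diff (transport \<iota> V) (\<iota> x) (\<iota> y) = \<iota> (vs_diff V x y)"
  using assms by (simp_all add: transport_def vs_diff_def)

lemma normed_space_transport:
  assumes V: "normed_space V" and i: "inj \<iota>"
  shows "normed_space (transport \<iota> V)"
proof -
  interpret normed_space V by (rule V)
  show ?thesis
    by unfold_locales
      (auto simp: transport_simps[OF i] closed add_assoc add_zero diff_self scale_one scale_scale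
        scale_left_distrib scale_right_distrib norm_nonneg norm_eq_zero norm_scale norm_triangle inj_eq[OF i]
        intro: add_commute)
qed

lemma banach_space_transport:
  assumes V: "banach_space V" and i: "inj \<iota>"
  shows "banach_space (transport \<iota> V)"
proof -
  have n: "normed_space V" "normed_space (transport \<iota> V)" using V normed_space_transport[OF _ i] by (auto simp: banach_space_def)
  show ?thesis
    unfolding banach_space_def normed_space.mcomplete_iff[OF n(2)]
  proof (intro conjI n allI impI)
    fix s :: "nat \<Rightarrow> _" assume s: "range s \<subseteq> vs_carrier (transport \<iota> V) \<and>
      (\<forall>e>0. \<exists>N. \<forall>m\<ge>N. \<forall>n\<ge>N. vs_norm (transport \<iota> V) (vs_diff (transport \<iota> V) (s m) (s n)) < e)"
    then have "s n \<in> \<iota> ` vs_carrier V" for n unfolding transport_simps[OF i] by blast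
    then have "\<forall>n :: nat. \<exists>x\<in>vs_carrier V. s n = \<iota> x" by blast
    then obtain u :: "nat \<Rightarrow> _" where u: "\<And>n. u n \<in> vs_carrier V" "\<And>n. s n = \<iota> (u n)" by metis
    have "\<exists>l\<in>vs_carrier V. (\<lambda>n. vs_norm V (vs_diff V (u n) l)) \<longlonglongrightarrow> 0"
      using V s u(1) unfolding banach_space_def normed_space.mcomplete_iff[OF n(1)] u(2) transport_simps[OF i] by blast
    then show "\<exists>l\<in>vs_carrier (transport \<iota> V). (\<lambda>n. vs_norm (transport \<iota> V) (vs_diff (transport \<iota> V) (s n) l)) \<longlonglongrightarrow> 0"
      unfolding u(2) transport_simps[OF i] by (auto simp: transport_simps[OF i])
  qed
qed

lemma transport_operator:
  assumes V: "normed_space V" and i: "inj \<iota>"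
  shows "\<iota> \<in> operators V (transport \<iota> V)"
  by (rule operatorsI[OF V normed_space_transport[OF V i], of _ 1]) (auto simp: transport_simps[OF i])

text \<open>Square summable families of functionals define weakly compact operators into \<open>l2\<close>.\<close>

lemma not_dunford_pettis:
  fixes V :: "('k::{real_normed_field, euclidean_space}, 'e) nspace" and \<iota> :: "(nat \<Rightarrow> 'k) \<Rightarrow> 'e + 'u"
  assumes V: "normed_space V" and i: "inj \<iota>"
    and L: "\<And>n. L n \<in> dual V" "\<And>N z. z \<in> vs_carrier V \<Longrightarrow> L2_set (\<lambda>n. norm (L n z)) {..<N} \<le> vs_norm V z"
    and z: "\<And>n. z n \<in> vs_carrier V" "\<And>\<phi>. \<phi> \<in> dual V \<Longrightarrow> (\<lambda>n. \<phi> (z n)) \<longlonglongrightarrow> 0" "\<And>n. L n (z n) = 1"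
  shows "\<not> dunford_pettis_property TYPE('u) V"
proof
  assume dpp: "dunford_pettis_property TYPE('u) V"
  interpret normed_space V by (rule V)
  let ?F = "transport \<iota> (l2 :: ('k, nat \<Rightarrow> 'k) nspace)"
  define T where "T x = \<iota> (\<lambda>n. L n x)" for x
  have F: "normed_space ?F" by (rule normed_space_transport[OF normed_space_l2 i])
  have Lx: "l2n N (\<lambda>n. L n x) \<le> vs_norm V x" if "x \<in> vs_carrier V" for N x
    using L(2)[OF that] by (simp add: l2n_def)
  have l2: "(\<lambda>n. L n x) \<in> vs_carrier l2" "vs_norm l2 (\<lambda>n. L n x) \<le> vs_norm V x" if "x \<in> vs_carrier V" for x
    using Lx[OF that] l2_norm_le by (auto simp: l2_carrier)
  have T: "T \<in> operators V ?F"
    by (rule operatorsI[OF V F, of _ 1])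
      (auto simp: T_def transport_simps[OF i] l2 dual_add[OF L(1)] dual_scale[OF L(1)])
  have "weakly_compact_operator V ?F T"
  proof (rule weakly_compact_operatorI[OF F T])
    fix B assume "norm_bounded V B"
    then obtain C where C: "B \<subseteq> vs_carrier V" "\<forall>x\<in>B. vs_norm V x \<le> C" by (auto simp: norm_bounded_def)
    let ?D = "{a \<in> vs_carrier (l2 :: ('k, nat \<Rightarrow> 'k) nspace). vs_norm l2 a \<le> C}"
    have "compactin (weak_topology ?F) (\<iota> ` ?D)"
      by (rule image_compactin[OF l2_ball_weakly_compact
            operators_weak_continuous[OF normed_space_l2 F transport_operator[OF normed_space_l2 i]]])
    moreover have "T ` B \<subseteq> \<iota> ` ?D"
    proof
      fix w assume "w \<in> T ` B"
      then obtain x where x: "x \<in> B" "w = T x" by blast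
      then have "(\<lambda>n. L n x) \<in> ?D" using C l2[of x] by force
      then show "w \<in> \<iota> ` ?D" using x(2) by (simp add: T_def)
    qed
    ultimately show "\<exists>D. compactin (weak_topology ?F) D \<and> T ` B \<subseteq> D" by blast
  qed
  moreover have "banach_space ?F" by (rule banach_space_transport[OF banach_space_l2 i])
  ultimately have "completely_continuous_operator V ?F T"
    using dpp unfolding dunford_pettis_property_def by blast
  moreover have "limitin (weak_topology V) z (vs_zero V) sequentially"
    unfolding limitin_weak_iff[OF V z(1)]
  proof (intro conjI ballI zero_closed)
    fix \<phi> assume \<phi>: "\<phi> \<in> dual V"
    have "\<phi> (vs_zero V) = 0"
      using dual_scale[OF \<phi> zero_closed, of 0] by simp
    then show "(\<lambda>n. \<phi> (z n)) \<longlonglongrightarrow> \<phi> (vs_zero V)" using z(2)[OF \<phi>] by metis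
  qed
  ultimately obtain m where "limitin (norm_topology ?F) (T \<circ> z) m sequentially"
    using z(1) unfolding completely_continuous_operator_def by blast
  moreover have "range (T \<circ> z) \<subseteq> vs_carrier ?F"
    using operators_simps(1)[OF T z(1)] by auto
  ultimately have m: "m \<in> vs_carrier ?F" "(\<lambda>n. vs_norm ?F (vs_diff ?F ((T \<circ> z) n) m)) \<longlonglongrightarrow> 0"
    using normed_space.limitin_norm[OF F] by blast+
  then obtain a where a: "a \<in> vs_carrier l2" "m = \<iota> a" by (auto simp: transport_simps[OF i])
  have d: "vs_diff l2 (\<lambda>k. L k (z n)) a \<in> vs_carrier l2" for n
    by (intro normed_space.diff_closed[OF normed_space_l2] l2 z a)
  have lim: "(\<lambda>n. vs_norm l2 (vs_diff l2 (\<lambda>k. L k (z n)) a)) \<longlonglongrightarrow> 0"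
    using m(2) unfolding o_def T_def a(2) transport_simps[OF i] .
  have coord: "norm (L k (z n) - a k) \<le> vs_norm l2 (vs_diff l2 (\<lambda>k. L k (z n)) a)" for k n
    using l2_coord[OF d, of n k] by simp
  \<comment> \<open>A norm limit of the images is determined by its coordinates, and these tend to 0
    by weak nullness. But the n-th image has n-th coordinate 1, so it stays at distance at least 1
    from zero.\<close>
  have a0: "a k = 0" for k
  proof -
    have "(\<lambda>n. L k (z n) - a k) \<longlonglongrightarrow> 0"
      by (rule Lim_null_comparison[OF always_eventually lim]) (use coord in blast)
    from LIM_zero_cancel[OF this] show ?thesis using z(2)[OF L(1), of k] LIMSEQ_unique by blast
  qed
  have "1 \<le> vs_norm l2 (vs_diff l2 (\<lambda>k. L k (z n)) a)" for n
    using coord[of n n] by (simp add: z(3) a0)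
  then have "1 \<le> (0::real)" by (intro LIMSEQ_le_const[OF lim]) blast
  then show False by simp
qed

context C_tensor
begin

text \<open>A purely set-theoretic embedding: the n-th scalar is stored as the coefficient of one
  fixed pair, and singletons supply the two levels of sets in the type. It ignores the tensor
  structure.\<close>

lemma l2_injection: "\<exists>\<iota> :: (nat \<Rightarrow> 'k) \<Rightarrow> (nat \<Rightarrow> ((('a \<Rightarrow> 'k) \<times> ('b \<Rightarrow> 'k)) \<Rightarrow>\<^sub>0 'k) set) set + 'u. inj \<iota>"
proof -
  define h :: "(nat \<Rightarrow> 'k) \<Rightarrow> nat \<Rightarrow> ((('a \<Rightarrow> 'k) \<times> ('b \<Rightarrow> 'k)) \<Rightarrow>\<^sub>0 'k) set" where
    "h s n = {Poly_Mapping.single undefined (s n)}" for s n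
  have "inj h"
  proof (rule injI)
    fix s t assume "h s = h t"
    then have "Poly_Mapping.single undefined (s n) = (Poly_Mapping.single undefined (t n) :: (('a \<Rightarrow> 'k) \<times> ('b \<Rightarrow> 'k)) \<Rightarrow>\<^sub>0 'k)" for n
      unfolding h_def fun_eq_iff by auto
    then show "s = t" by (metis ext lookup_single_eq)
  qed
  then have "inj (\<lambda>s. Inl {h s} :: _ + 'u)" by (auto simp: inj_def)
  then show ?thesis by blast
qed

text \<open>Each form extends separately to E by the universal property. The joint l2 bound is
  proved only on elementary tensors and reaches all of E because the l2 norm of finitely many
  functionals is again subadditive.\<close>

lemma square_summable_functionals:
  fixes b :: "nat \<Rightarrow> ('a \<Rightarrow> 'k) \<Rightarrow> ('b \<Rightarrow> 'k) \<Rightarrow> 'k"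
  assumes add1: "\<And>n f f' g. cont K1 f \<Longrightarrow> cont K1 f' \<Longrightarrow> cont K2 g \<Longrightarrow> b n (\<lambda>x. f x + f' x) g = b n f g + b n f' g"
    and add2: "\<And>n f g g'. cont K1 f \<Longrightarrow> cont K2 g \<Longrightarrow> cont K2 g' \<Longrightarrow> b n f (\<lambda>x. g x + g' x) = b n f g + b n f g'"
    and scale1: "\<And>n c f g. cont K1 f \<Longrightarrow> cont K2 g \<Longrightarrow> b n (\<lambda>x. c * f x) g = c * b n f g"
    and scale2: "\<And>n c f g. cont K1 f \<Longrightarrow> cont K2 g \<Longrightarrow> b n f (\<lambda>x. c * g x) = c * b n f g"
    and ext: "\<And>n f f' g g'. (\<forall>s\<in>topspace K1. f s = f' s) \<Longrightarrow> (\<forall>s\<in>topspace K2. g s = g' s) \<Longrightarrow> b n f g = b n f' g'"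
    and bound: "\<And>N f g A B. cont K1 f \<Longrightarrow> cont K2 g \<Longrightarrow> (\<forall>s\<in>topspace K1. norm (f s) \<le> A) \<Longrightarrow>
      (\<forall>s\<in>topspace K2. norm (g s) \<le> B) \<Longrightarrow> L2_set (\<lambda>n. norm (b n f g)) {..<N} \<le> A * B"
  shows "\<exists>L. (\<forall>n. L n \<in> dual E) \<and> (\<forall>N. \<forall>z\<in>vs_carrier E. L2_set (\<lambda>n. norm (L n z)) {..<N} \<le> vs_norm E z) \<and>
    (\<forall>n f g. cont K1 f \<longrightarrow> cont K2 g \<longrightarrow> L n (tn f g) = b n f g)"
proof -
  have c: "cont K1 x" "\<forall>s\<in>topspace K1. norm (x s) \<le> vs_norm (C_space K1) x" if "x \<in> vs_carrier (C_space K1)" for x :: "'a \<Rightarrow> 'k"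
    using that K1.C_norm_ge[of x] by (auto simp: K1.C_carrier)
  have d: "cont K2 y" "\<forall>s\<in>topspace K2. norm (y s) \<le> vs_norm (C_space K2) y" if "y \<in> vs_carrier (C_space K2)" for y :: "'b \<Rightarrow> 'k"
    using that K2.C_norm_ge[of y] by (auto simp: K2.C_carrier)
  have bd: "L2_set (\<lambda>n. norm (b n x y)) {..<N} \<le> vs_norm (C_space K1) x * vs_norm (C_space K2) y"
    if "x \<in> vs_carrier (C_space K1)" "y \<in> vs_carrier (C_space K2)" for x y N
    by (rule bound[OF c(1)[OF that(1)] d(1)[OF that(2)] c(2)[OF that(1)] d(2)[OF that(2)]])
  have "\<exists>\<Phi>\<in>dual E. \<forall>x\<in>vs_carrier (C_space K1). \<forall>y\<in>vs_carrier (C_space K2). \<Phi> (tens x y) = b n x y" for n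
  proof (rule bilinear_extends)
    fix x x' :: "'a \<Rightarrow> 'k" and y y' :: "'b \<Rightarrow> 'k" and a
    show "b n (vs_add (C_space K1) x x') y = b n x y + b n x' y"
      if x: "x \<in> vs_carrier (C_space K1)" "x' \<in> vs_carrier (C_space K1)" "y \<in> vs_carrier (C_space K2)"
    proof -
      have "b n (vs_add (C_space K1) x x') y = b n (\<lambda>s. x s + x' s) y" by (rule ext) (auto simp: C_space_def)
      then show ?thesis using add1[OF c(1)[OF x(1)] c(1)[OF x(2)] d(1)[OF x(3)]] by simp
    qed
    show "b n x (vs_add (C_space K2) y y') = b n x y + b n x y'"
      if x: "x \<in> vs_carrier (C_space K1)" "y \<in> vs_carrier (C_space K2)" "y' \<in> vs_carrier (C_space K2)"
    proof -
      have "b n x (vs_add (C_space K2) y y') = b n x (\<lambda>s. y s + y' s)" by (rule ext) (auto simp: C_space_def)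
      then show ?thesis using add2[OF c(1)[OF x(1)] d(1)[OF x(2)] d(1)[OF x(3)]] by simp
    qed
    show "b n (vs_scale (C_space K1) a x) y = a * b n x y"
      if x: "x \<in> vs_carrier (C_space K1)" "y \<in> vs_carrier (C_space K2)"
    proof -
      have "b n (vs_scale (C_space K1) a x) y = b n (\<lambda>s. a * x s) y" by (rule ext) (auto simp: C_space_def)
      then show ?thesis using scale1[OF c(1)[OF x(1)] d(1)[OF x(2)]] by simp
    qed
    show "b n x (vs_scale (C_space K2) a y) = a * b n x y"
      if x: "x \<in> vs_carrier (C_space K1)" "y \<in> vs_carrier (C_space K2)"
    proof -
      have "b n x (vs_scale (C_space K2) a y) = b n x (\<lambda>s. a * y s)" by (rule ext) (auto simp: C_space_def)
      then show ?thesis using scale2[OF c(1)[OF x(1)] d(1)[OF x(2)]] by simp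
    qed
    show "norm (b n x y) \<le> 1 * (vs_norm (C_space K1) x * vs_norm (C_space K2) y)"
      if x: "x \<in> vs_carrier (C_space K1)" "y \<in> vs_carrier (C_space K2)"
      using member_le_L2_set[of "{..<Suc n}" n "\<lambda>n. norm (b n x y)"] bd[OF x, of "Suc n"] by simp
  qed simp
  then obtain L where L: "\<And>n. L n \<in> dual E"
    "\<And>n. \<forall>x\<in>vs_carrier (C_space K1). \<forall>y\<in>vs_carrier (C_space K2). L n (tens x y) = b n x y"
    by metis
  have Ltn: "L n (tn f g) = b n f g" if "cont K1 f" "cont K2 g" for n f g
  proof -
    have "L n (tn f g) = b n (K1.rs f) (K2.rs g)"
      using L(2)[of n] K1.rs_carrier[OF that(1)] K2.rs_carrier[OF that(2)] by (simp add: tn_def)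
    also have "\<dots> = b n f g" by (rule ext) auto
    finally show ?thesis .
  qed
  have "L2_set (\<lambda>n. norm (L n z)) {..<N} \<le> 1 * vs_norm E z" if z: "z \<in> vs_carrier E" for N z
  proof -
    \<comment> \<open>The sum of the individual bounds depends on N; it serves as the crude constant
      in \<open>seminorm_bound\<close>, whose conclusion has the constant 1 for every N.\<close>
    have "\<forall>n. \<exists>D. D > 0 \<and> (\<forall>z\<in>vs_carrier E. norm (L n z) \<le> D * vs_norm E z)"
      using dual_bound[OF normed_space_E L(1)] by blast
    then obtain D where D: "\<And>n. D n > 0" "\<And>n z. z \<in> vs_carrier E \<Longrightarrow> norm (L n z) \<le> D n * vs_norm E z" by metis
    show ?thesis
    proof (rule seminorm_bound[where M = "\<Sum>n<N. D n"])
      fix z w assume zw: "z \<in> vs_carrier E" "w \<in> vs_carrier E"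
      have "L2_set (\<lambda>n. norm (L n (vs_add E z w))) {..<N} \<le> L2_set (\<lambda>n. norm (L n z) + norm (L n w)) {..<N}"
        by (rule L2_set_mono) (auto simp: dual_add[OF L(1) zw] norm_triangle_ineq)
      also have "\<dots> \<le> L2_set (\<lambda>n. norm (L n z)) {..<N} + L2_set (\<lambda>n. norm (L n w)) {..<N}" by (rule L2_set_triangle_ineq)
      finally show "L2_set (\<lambda>n. norm (L n (vs_add E z w))) {..<N} \<le> L2_set (\<lambda>n. norm (L n z)) {..<N} + L2_set (\<lambda>n. norm (L n w)) {..<N}" .
    next
      fix z assume z: "z \<in> vs_carrier E"
      have "L2_set (\<lambda>n. norm (L n z)) {..<N} \<le> (\<Sum>n<N. norm (L n z))" by (rule L2_set_le_sum) auto
      also have "\<dots> \<le> (\<Sum>n<N. D n) * vs_norm E z" unfolding sum_distrib_right by (intro sum_mono D(2) z)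
      finally show "L2_set (\<lambda>n. norm (L n z)) {..<N} \<le> (\<Sum>n<N. D n) * vs_norm E z" .
    next
      fix x :: "'a \<Rightarrow> 'k" and y :: "'b \<Rightarrow> 'k" assume xy: "x \<in> vs_carrier (C_space K1)" "y \<in> vs_carrier (C_space K2)"
      then show "L2_set (\<lambda>n. norm (L n (tens x y))) {..<N} \<le> 1 * (vs_norm (C_space K1) x * vs_norm (C_space K2) y)"
        using bd[OF xy, of N] L(2) by simp
    qed (use z in auto)
  qed
  then show ?thesis using L(1) Ltn by (intro exI[of _ L]) auto
qed

theorem not_scattered_imp_not_dunford_pettis:
  assumes inf: "infinite (topspace K1)" "infinite (topspace K2)"
    and ns: "\<not> scattered_space K1 \<or> \<not> scattered_space K2"
  shows "\<not> dunford_pettis_property TYPE('u) E"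
proof -
  have form: "bilinear_form K1 K2 (\<lambda>f g. \<psi> (tn f g)) C"
    if "\<psi> \<in> dual E" "C > 0" "\<forall>z\<in>vs_carrier E. norm (\<psi> z) \<le> C * vs_norm E z" for \<psi> C
    by (rule dual_bilinear_form[OF that(1) less_imp_le[OF that(2)] bspec[OF that(3)]])
  have "\<exists>z L. (\<forall>n. L n \<in> dual E) \<and> (\<forall>N. \<forall>z\<in>vs_carrier E. L2_set (\<lambda>n. norm (L n z)) {..<N} \<le> vs_norm E z) \<and>
    (\<forall>n. z n \<in> vs_carrier E) \<and> (\<forall>\<psi>\<in>dual E. (\<lambda>n. \<psi> (z n)) \<longlonglongrightarrow> 0) \<and> (\<forall>n. L n (z n) = 1)"
    using ns
  proof
    assume "\<not> scattered_space K1"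
    from K1.rademacher_functionals_exist[OF this, where ?'k = 'k]
    obtain X and \<phi> :: "nat \<Rightarrow> ('a \<Rightarrow> 'k) \<Rightarrow> 'k" where R: "K1.rademacher_functionals X \<phi>" by blast
    note X = K1.rademacher_functionalsD(1,2)[OF R] and \<phi> = K1.rademacher_functionalsD(3-)[OF R]
    from K2.disjoint_bumps[OF inf(2)] obtain Y :: "nat \<Rightarrow> 'b \<Rightarrow> real" and t where bumps: "(\<forall>n. K2.in_ball (Y n)) \<and>
      (\<forall>n. t n \<in> topspace K2 \<and> Y n (t n) = 1) \<and> (\<forall>m n x. m \<noteq> n \<longrightarrow> x \<in> topspace K2 \<longrightarrow> Y m x = 0 \<or> Y n x = 0)"
      by (elim exE)
    have Y: "K2.in_ball (Y n)" "t n \<in> topspace K2" "Y n (t n) = 1"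
        "m \<noteq> n \<Longrightarrow> x \<in> topspace K2 \<Longrightarrow> Y m x = 0 \<or> Y n x = 0" for m n x
      using bumps by simp_all
    define x where "x n = (\<lambda>s. of_real (X n s) :: 'k)" for n
    define y where "y n = (\<lambda>s. of_real (Y n s) :: 'k)" for n
    have xb: "K1.in_ball (x n)" and yb: "K2.in_ball (y n)" for n
      using X(1) Y(1) by (auto simp: x_def y_def K1.in_ball_def K2.in_ball_def intro!: cont_of_real)
    then have c: "cont K1 (x n)" "cont K2 (y n)" for n by (auto simp: K1.in_ball_def K2.in_ball_def)
    \<comment> \<open>Bessel's inequality makes the values \<phi> n f square summable, and
      evaluation at t n only multiplies them by a factor of modulus at most the bound of g.\<close>
    have "\<exists>L. (\<forall>n. L n \<in> dual E) \<and> (\<forall>N. \<forall>z\<in>vs_carrier E. L2_set (\<lambda>n. norm (L n z)) {..<N} \<le> vs_norm E z) \<and>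
        (\<forall>n f g. cont K1 f \<longrightarrow> cont K2 g \<longrightarrow> L n (tn f g) = \<phi> n f * g (t n))"
    proof (rule square_summable_functionals)
      fix N A B and f :: "'a \<Rightarrow> 'k" and g :: "'b \<Rightarrow> 'k"
      assume f: "cont K1 f" "\<forall>s\<in>topspace K1. norm (f s) \<le> A" and g: "cont K2 g" "\<forall>s\<in>topspace K2. norm (g s) \<le> B"
      have B: "B \<ge> 0" by (rule order_trans[OF norm_ge_zero bspec[OF g(2) Y(2)[of 0]]])
      have "L2_set (\<lambda>n. norm (\<phi> n f * g (t n))) {..<N} \<le> L2_set (\<lambda>n. norm (\<phi> n f) * B) {..<N}"
        using g(2) Y(2) by (intro L2_set_mono) (auto simp: norm_mult intro!: mult_left_mono)
      also have "\<dots> = L2_set (\<lambda>n. norm (\<phi> n f)) {..<N} * B" by (rule L2_set_left_distrib[OF B, symmetric])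
      also have "\<dots> \<le> A * B" by (intro mult_right_mono \<phi>(4) f B)
      finally show "L2_set (\<lambda>n. norm (\<phi> n f * g (t n))) {..<N} \<le> A * B" .
    next
      show "\<phi> n f * g (t n) = \<phi> n f' * g' (t n)"
        if "\<forall>s\<in>topspace K1. f s = f' s" "\<forall>s\<in>topspace K2. g s = g' s" for n f f' g g'
        using \<phi>(3)[OF that(1), of n] that(2) Y(2)[of n] by simp
    qed (simp_all add: \<phi>(1,2) algebra_simps)
    then obtain L where L: "\<And>n. L n \<in> dual E" "\<And>N z. z \<in> vs_carrier E \<Longrightarrow> L2_set (\<lambda>n. norm (L n z)) {..<N} \<le> vs_norm E z"
      "\<And>n f g. cont K1 f \<Longrightarrow> cont K2 g \<Longrightarrow> L n (tn f g) = \<phi> n f * g (t n)" by blast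
    have "(\<lambda>n. \<psi> (tn (x n) (y n))) \<longlonglongrightarrow> 0" if \<psi>: "\<psi> \<in> dual E" for \<psi>
    proof -
      obtain C where C: "C > 0" "\<forall>z\<in>vs_carrier E. norm (\<psi> z) \<le> C * vs_norm E z" using dual_bound[OF normed_space_E \<psi>] by blast
      have "y m s = 0 \<or> y n s = 0" if "m \<noteq> n" "s \<in> topspace K2" for m n s
        using Y(4)[OF that] by (simp add: y_def)
      from bilinear_form.diagonal_null[OF form[OF \<psi> C] X(1) yb this] show ?thesis by (simp add: x_def)
    qed
    moreover have "L n (tn (x n) (y n)) = 1" for n
      using L(3)[OF c] X(2) Y(3) by (simp add: x_def y_def)
    ultimately show ?thesis using L(1,2) tn_closed[OF c]
      by (intro exI[of _ "\<lambda>n. tn (x n) (y n)"] exI[of _ L]) auto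
  next
    \<comment> \<open>The mirrored case. No flip isomorphism of the tensor product is set up: only
      the scalar form is swapped when weak nullness is derived.\<close>
    assume "\<not> scattered_space K2"
    from K2.rademacher_functionals_exist[OF this, where ?'k = 'k]
    obtain X and \<phi> :: "nat \<Rightarrow> ('b \<Rightarrow> 'k) \<Rightarrow> 'k" where R: "K2.rademacher_functionals X \<phi>" by blast
    note X = K2.rademacher_functionalsD(1,2)[OF R] and \<phi> = K2.rademacher_functionalsD(3-)[OF R]
    from K1.disjoint_bumps[OF inf(1)] obtain Y :: "nat \<Rightarrow> 'a \<Rightarrow> real" and t where bumps: "(\<forall>n. K1.in_ball (Y n)) \<and>
      (\<forall>n. t n \<in> topspace K1 \<and> Y n (t n) = 1) \<and> (\<forall>m n x. m \<noteq> n \<longrightarrow> x \<in> topspace K1 \<longrightarrow> Y m x = 0 \<or> Y n x = 0)"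
      by (elim exE)
    have Y: "K1.in_ball (Y n)" "t n \<in> topspace K1" "Y n (t n) = 1"
        "m \<noteq> n \<Longrightarrow> x \<in> topspace K1 \<Longrightarrow> Y m x = 0 \<or> Y n x = 0" for m n x
      using bumps by simp_all
    define x where "x n = (\<lambda>s. of_real (X n s) :: 'k)" for n
    define y where "y n = (\<lambda>s. of_real (Y n s) :: 'k)" for n
    have xb: "K2.in_ball (x n)" and yb: "K1.in_ball (y n)" for n
      using X(1) Y(1) by (auto simp: x_def y_def K1.in_ball_def K2.in_ball_def intro!: cont_of_real)
    then have c: "cont K1 (y n)" "cont K2 (x n)" for n by (auto simp: K1.in_ball_def K2.in_ball_def)
    have "\<exists>L. (\<forall>n. L n \<in> dual E) \<and> (\<forall>N. \<forall>z\<in>vs_carrier E. L2_set (\<lambda>n. norm (L n z)) {..<N} \<le> vs_norm E z) \<and>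
        (\<forall>n f g. cont K1 f \<longrightarrow> cont K2 g \<longrightarrow> L n (tn f g) = f (t n) * \<phi> n g)"
    proof (rule square_summable_functionals)
      fix N A B and f :: "'a \<Rightarrow> 'k" and g :: "'b \<Rightarrow> 'k"
      assume f: "cont K1 f" "\<forall>s\<in>topspace K1. norm (f s) \<le> A" and g: "cont K2 g" "\<forall>s\<in>topspace K2. norm (g s) \<le> B"
      have A: "A \<ge> 0" by (rule order_trans[OF norm_ge_zero bspec[OF f(2) Y(2)[of 0]]])
      have "L2_set (\<lambda>n. norm (f (t n) * \<phi> n g)) {..<N} \<le> L2_set (\<lambda>n. A * norm (\<phi> n g)) {..<N}"
        using f(2) Y(2) by (intro L2_set_mono) (auto simp: norm_mult intro!: mult_right_mono)
      also have "\<dots> = A * L2_set (\<lambda>n. norm (\<phi> n g)) {..<N}" by (rule L2_set_right_distrib[OF A, symmetric])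
      also have "\<dots> \<le> A * B" by (intro mult_left_mono \<phi>(4) g A)
      finally show "L2_set (\<lambda>n. norm (f (t n) * \<phi> n g)) {..<N} \<le> A * B" .
    next
      show "f (t n) * \<phi> n g = f' (t n) * \<phi> n g'"
        if "\<forall>s\<in>topspace K1. f s = f' s" "\<forall>s\<in>topspace K2. g s = g' s" for n f f' g g'
        using \<phi>(3)[OF that(2), of n] that(1) Y(2)[of n] by simp
    qed (simp_all add: \<phi>(1,2) algebra_simps)
    then obtain L where L: "\<And>n. L n \<in> dual E" "\<And>N z. z \<in> vs_carrier E \<Longrightarrow> L2_set (\<lambda>n. norm (L n z)) {..<N} \<le> vs_norm E z"
      "\<And>n f g. cont K1 f \<Longrightarrow> cont K2 g \<Longrightarrow> L n (tn f g) = f (t n) * \<phi> n g" by blast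
    have "(\<lambda>n. \<psi> (tn (y n) (x n))) \<longlonglongrightarrow> 0" if \<psi>: "\<psi> \<in> dual E" for \<psi>
    proof -
      obtain C where C: "C > 0" "\<forall>z\<in>vs_carrier E. norm (\<psi> z) \<le> C * vs_norm E z" using dual_bound[OF normed_space_E \<psi>] by blast
      have "y m s = 0 \<or> y n s = 0" if "m \<noteq> n" "s \<in> topspace K1" for m n s
        using Y(4)[OF that] by (simp add: y_def)
      from bilinear_form.diagonal_null[OF bilinear_form.swap[OF form[OF \<psi> C]] X(1) yb this] show ?thesis by (simp add: x_def)
    qed
    moreover have "L n (tn (y n) (x n)) = 1" for n
      using L(3)[OF c] X(2) Y(3) by (simp add: x_def y_def)
    ultimately show ?thesis using L(1,2) tn_closed[OF c]
      by (intro exI[of _ "\<lambda>n. tn (y n) (x n)"] exI[of _ L]) auto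
  qed
  then obtain z L where zL: "\<And>n. L n \<in> dual E" "\<And>N z. z \<in> vs_carrier E \<Longrightarrow> L2_set (\<lambda>n. norm (L n z)) {..<N} \<le> vs_norm E z"
    "\<And>n. z n \<in> vs_carrier E" "\<And>\<psi>. \<psi> \<in> dual E \<Longrightarrow> (\<lambda>n. \<psi> (z n)) \<longlonglongrightarrow> 0" "\<And>n. L n (z n) = 1" by blast
  obtain \<iota> :: "(nat \<Rightarrow> 'k) \<Rightarrow> (nat \<Rightarrow> ((('a \<Rightarrow> 'k) \<times> ('b \<Rightarrow> 'k)) \<Rightarrow>\<^sub>0 'k) set) set + 'u" where "inj \<iota>"
    using l2_injection by blast
  from not_dunford_pettis[OF normed_space_E this zL(1,2,3,4,5)] show ?thesis .
qed

theorem dunford_pettis_iff_scattered: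
  assumes "infinite (topspace K1)" "infinite (topspace K2)"
  shows "dunford_pettis_property TYPE('u) E \<longleftrightarrow> scattered_space K1 \<and> scattered_space K2"
proof
  show "scattered_space K1 \<and> scattered_space K2" if "dunford_pettis_property TYPE('u) E"
    using not_scattered_imp_not_dunford_pettis[OF assms] that by blast
  show "dunford_pettis_property TYPE('u) E" if "scattered_space K1 \<and> scattered_space K2"
    unfolding dunford_pettis_property_def banach_space_def
    using scattered_imp_completely_continuous that by blast
qed

end

theorem theorem2p2:
  fixes K1 :: "'a topology" and K2 :: "'b topology"
  assumes "compact_space K1" and "Hausdorff_space K1" and "infinite (topspace K1)"
    and "compact_space K2" and "Hausdorff_space K2" and "infinite (topspace K2)"
  shows
    "(dunford_pettis_property TYPE('u)
        (projective_tensor (C_space K1 :: (real, 'a \<Rightarrow> real) nspace)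
                           (C_space K2 :: (real, 'b \<Rightarrow> real) nspace))
      \<longleftrightarrow> scattered_space K1 \<and> scattered_space K2) \<and>
     (dunford_pettis_property TYPE('u)
        (projective_tensor (C_space K1 :: (complex, 'a \<Rightarrow> complex) nspace)
                           (C_space K2 :: (complex, 'b \<Rightarrow> complex) nspace))
      \<longleftrightarrow> scattered_space K1 \<and> scattered_space K2)"
proof -
  have K: "compact_Hausdorff K1" "compact_Hausdorff K2"
    using assms by (auto intro!: compact_Hausdorff.intro)
  interpret re: C_tensor K1 K2 "TYPE(real)" by (intro C_tensor.intro K)
  interpret co: C_tensor K1 K2 "TYPE(complex)" by (intro C_tensor.intro K)
  show ?thesis
    using re.dunford_pettis_iff_scattered[OF assms(3,6)] co.dunford_pettis_iff_scattered[OF assms(3,6)] by blast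
qed

end
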